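(* Let $\Gamma$ be a finitely generated group such that $\dim H_1(\Gamma,\mathbb{C})=2$. If one of the following conditions holds, then $X(\Gamma)$ is smooth at the trivial character. (1) $H^2(\Gamma,\mathbb{C})=0$. (2) $\Gamma$ admits a finite presentation with deficiency $2$. (3) There exists a surjective group morphism $\Gamma\to F_2$, where $F_2$ is the free group of rank $2$.
   Context: A finite presentation has deficiency $2$ if it has two more generators than relations. $R(\Gamma)=\mathrm{Hom}(\Gamma,\mathrm{SL}_2(\mathbb{C}))$, and $A(\Gamma)$ is its (possibly non-reduced) ring of regular functions: the $\mathbb{C}$-algebra generated by the entries of the matrices $\rho(\gamma_l)$, for $\gamma_1,\dots,\gamma_r$ generating $\Gamma$, modulo the relations coming from $\det\rho(\gamma_l)=1$ and from the relations of $\Gamma$. $\mathrm{SL}_2(\mathbb{C})$ acts by conjugation, and $X(\Gamma)$ is the algebraic quotient, the affine scheme with ring of regular functions $A(\Gamma)^{\mathrm{SL}_2(\mathbb{C})}$, which is generated by the functions $t_\gamma(\rho)=\mathrm{Tr}\,\rho(\gamma)$. The trivial character $\chi$ is the point with $t_\gamma=2$ for all $\gamma$, i.e. the maximal ideal $m$ generated by the $t_\gamma-2$. $X(\Gamma)$ is smooth at $\chi$ if its local dimension at $\chi$ equals the dimension of the Zariski-tangent space $(m/m^2)^*$; equivalently the local ring at $\chi$ is regular. *)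

theory Defs
  imports
    "HOL-Analysis.Determinants"
    "HOL-Library.Poly_Mapping"
    "HOL-Library.Extended_Nat"
    "HOL-Algebra.QuotRing"
    "HOL-Algebra.Ideal_Product"
    "HOL-Algebra.Generated_Groups"
    "Jordan_Normal_Form.Missing_VectorSpace"
begin

text \<open>A letter \<^term>\<open>(x, True)\<close> stands for \<open>x\<close> and \<^term>\<open>(x, False)\<close> for its inverse.\<close>

type_synonym 'x word = "('x \<times> bool) list"

definition words_over :: "'x set \<Rightarrow> 'x word set" where
  "words_over X = {w. fst ` set w \<subseteq> X}"

definition inv_letter :: "'x \<times> bool \<Rightarrow> 'x \<times> bool" where
  "inv_letter a = (fst a, \<not> snd a)"

definition reduced :: "'x word \<Rightarrow> bool" where
  "reduced w \<longleftrightarrow> successively (\<lambda>a b. b \<noteq> inv_letter a) w"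

fun push_letter :: "'x \<times> bool \<Rightarrow> 'x word \<Rightarrow> 'x word" where
  "push_letter a [] = [a]"
| "push_letter a (b # w) = (if b = inv_letter a then w else a # b # w)"

definition free_group :: "'x set \<Rightarrow> 'x word monoid" where
  "free_group X = \<lparr>carrier = {w \<in> words_over X. reduced w},
                   mult = (\<lambda>u v. foldr push_letter u v),
                   one = []\<rparr>"

definition normal_closure :: "('a, 'b) monoid_scheme \<Rightarrow> 'a set \<Rightarrow> 'a set" where
  "normal_closure G R = \<Inter>{N. N \<lhd> G \<and> R \<subseteq> N}"

definition has_finite_presentation_of_deficiency_2 :: "('g, 'b) monoid_scheme \<Rightarrow> bool" where
  "has_finite_presentation_of_deficiency_2 G \<longleftrightarrow>
     (\<exists>(n::nat) R. R \<subseteq> carrier (free_group {..<n}) \<and> finite R \<and> n = card R + 2 \<and>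
        G \<cong> free_group {..<n} Mod normal_closure (free_group {..<n}) R)"

definition complex_field :: "complex ring" where
  "complex_field = \<lparr>carrier = UNIV, mult = (*), one = 1, zero = 0, add = (+)\<rparr>"

text \<open>
  The fields \<open>mult\<close> and \<open>one\<close> of a module record play no role for its vector space structure
  and are left undefined.
\<close>

definition quot_space :: "(complex, 'v) module \<Rightarrow> 'v set \<Rightarrow> (complex, 'v set) module" where
  "quot_space V W = \<lparr>carrier = a_rcosets\<^bsub>V\<^esub> W, mult = undefined, one = undefined,
     zero = W, add = set_add V,
     smult = (\<lambda>c X. \<Union>x\<in>X. W +>\<^bsub>V\<^esub> (c \<odot>\<^bsub>V\<^esub> x))\<rparr>"

text \<open>Linear forms are normalised to be \<open>0\<close> outside the carrier.\<close>

definition dual_space :: "(complex, 'v) module \<Rightarrow> (complex, 'v \<Rightarrow> complex) module" where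
  "dual_space V = \<lparr>carrier = {f. (\<forall>x. x \<notin> carrier V \<longrightarrow> f x = 0) \<and>
       (\<forall>x\<in>carrier V. \<forall>y\<in>carrier V. f (x \<oplus>\<^bsub>V\<^esub> y) = f x + f y) \<and>
       (\<forall>c. \<forall>x\<in>carrier V. f (c \<odot>\<^bsub>V\<^esub> x) = c * f x)},
     mult = undefined, one = undefined,
     zero = (\<lambda>_. 0), add = (\<lambda>f g x. f x + g x), smult = (\<lambda>c f x. c * f x)\<rparr>"

text \<open>
  The dimension of a space that is not finite-dimensional is unspecified in the library, hence
  the first conjunct.
\<close>

definition has_dimension :: "(complex, 'v) module \<Rightarrow> nat \<Rightarrow> bool" where
  "has_dimension V n \<longleftrightarrow> vectorspace.fin_dim complex_field V \<and> vectorspace.dim complex_field V = n"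

text \<open>
  Homology and cohomology of \<open>G\<close> with trivial complex coefficients are computed from the
  inhomogeneous bar resolution. For trivial coefficients the boundary map from 1-chains to 0-chains vanishes, so every 1-chain is a cycle.
\<close>

definition chains1 :: "('g, 'b) monoid_scheme \<Rightarrow> (complex, 'g \<Rightarrow>\<^sub>0 complex) module" where
  "chains1 G = \<lparr>carrier = {c. Poly_Mapping.keys c \<subseteq> carrier G}, mult = undefined, one = undefined,
     zero = 0, add = (+), smult = (\<lambda>a c. Poly_Mapping.map (\<lambda>z. a * z) c)\<rparr>"

definition boundary2 :: "('g, 'b) monoid_scheme \<Rightarrow> ('g \<times> 'g \<Rightarrow>\<^sub>0 complex) \<Rightarrow> ('g \<Rightarrow>\<^sub>0 complex)" where
  "boundary2 G c = (\<Sum>(g, h)\<in>Poly_Mapping.keys c.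
       Poly_Mapping.single h (Poly_Mapping.lookup c (g, h))
     - Poly_Mapping.single (g \<otimes>\<^bsub>G\<^esub> h) (Poly_Mapping.lookup c (g, h))
     + Poly_Mapping.single g (Poly_Mapping.lookup c (g, h)))"

definition group_H1 :: "('g, 'b) monoid_scheme \<Rightarrow> (complex, ('g \<Rightarrow>\<^sub>0 complex) set) module" where
  "group_H1 G = quot_space (chains1 G)
     (boundary2 G ` {c. Poly_Mapping.keys c \<subseteq> carrier G \<times> carrier G})"

text \<open>Cochains are normalised to be \<open>0\<close> outside the carrier.\<close>

definition cocycles2 :: "('g, 'b) monoid_scheme \<Rightarrow> (complex, 'g \<times> 'g \<Rightarrow> complex) module" where
  "cocycles2 G = \<lparr>carrier = {f. (\<forall>x. x \<notin> carrier G \<times> carrier G \<longrightarrow> f x = 0) \<and>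
       (\<forall>g\<in>carrier G. \<forall>h\<in>carrier G. \<forall>k\<in>carrier G.
          f (h, k) - f (g \<otimes>\<^bsub>G\<^esub> h, k) + f (g, h \<otimes>\<^bsub>G\<^esub> k) - f (g, h) = 0)},
     mult = undefined, one = undefined,
     zero = (\<lambda>_. 0), add = (\<lambda>f f' x. f x + f' x), smult = (\<lambda>a f x. a * f x)\<rparr>"

definition coboundary1 :: "('g, 'b) monoid_scheme \<Rightarrow> ('g \<Rightarrow> complex) \<Rightarrow> ('g \<times> 'g \<Rightarrow> complex)" where
  "coboundary1 G u = (\<lambda>(g, h). if g \<in> carrier G \<and> h \<in> carrier G
     then u h - u (g \<otimes>\<^bsub>G\<^esub> h) + u g else 0)"

definition group_H2 :: "('g, 'b) monoid_scheme \<Rightarrow> (complex, ('g \<times> 'g \<Rightarrow> complex) set) module" where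
  "group_H2 G = quot_space (cocycles2 G) (range (coboundary1 G))"

text \<open>
  Throughout, \<open>gs\<close> is a list of generators of \<open>G\<close>. The variable \<open>(l, i, j)\<close> is the \<open>(i, j)\<close> entry
  of the generic matrix assigned to the generator \<open>gs ! l\<close>.
\<close>

type_synonym rep_var = "nat \<times> 2 \<times> 2"
type_synonym rep_poly = "(rep_var \<Rightarrow>\<^sub>0 nat) \<Rightarrow>\<^sub>0 complex"

definition poly_const :: "complex \<Rightarrow> rep_poly" where
  "poly_const c = Poly_Mapping.single 0 c"

definition poly_var :: "rep_var \<Rightarrow> rep_poly" where
  "poly_var v = Poly_Mapping.single (Poly_Mapping.single v 1) 1"

definition poly_subst :: "(rep_var \<Rightarrow> rep_poly) \<Rightarrow> rep_poly \<Rightarrow> rep_poly" where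
  "poly_subst s p = (\<Sum>m\<in>Poly_Mapping.keys p. poly_const (Poly_Mapping.lookup p m) *
     (\<Prod>v\<in>Poly_Mapping.keys m. s v ^ Poly_Mapping.lookup m v))"

definition rep_poly_ring :: "nat \<Rightarrow> rep_poly ring" where
  "rep_poly_ring r =
     \<lparr>carrier = {p. \<forall>m\<in>Poly_Mapping.keys p. \<forall>(l, i, j)\<in>Poly_Mapping.keys m. l < r},
      mult = (*), one = 1, zero = 0, add = (+)\<rparr>"

definition gen_matrix :: "nat \<Rightarrow> rep_poly^2^2" where
  "gen_matrix l = (\<chi> i j. poly_var (l, i, j))"

text \<open>The adjugate, which is the inverse of a matrix of determinant \<open>1\<close>.\<close>

definition adjugate2 :: "('a::comm_ring_1)^2^2 \<Rightarrow> 'a^2^2" where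
  "adjugate2 M = vector [vector [M$2$2, - (M$1$2)], vector [- (M$2$1), M$1$1]]"

definition word_matrix :: "nat word \<Rightarrow> rep_poly^2^2" where
  "word_matrix w = foldr (\<lambda>(l, b) M. (if b then gen_matrix l else adjugate2 (gen_matrix l)) ** M)
     w (mat 1)"

definition word_value :: "('g, 'b) monoid_scheme \<Rightarrow> 'g list \<Rightarrow> nat word \<Rightarrow> 'g" where
  "word_value G gs w = foldr (\<lambda>(l, b) x. (if b then gs ! l else inv\<^bsub>G\<^esub> (gs ! l)) \<otimes>\<^bsub>G\<^esub> x)
     w \<one>\<^bsub>G\<^esub>"

definition rep_ideal :: "('g, 'b) monoid_scheme \<Rightarrow> 'g list \<Rightarrow> rep_poly set" where
  "rep_ideal G gs = Idl\<^bsub>rep_poly_ring (length gs)\<^esub>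
     ({det (gen_matrix l) - 1 | l. l < length gs} \<union>
      {(word_matrix w - mat 1) $ i $ j | w i j.
         w \<in> words_over {..<length gs} \<and> word_value G gs w = \<one>\<^bsub>G\<^esub>})"

definition rep_ring :: "('g, 'b) monoid_scheme \<Rightarrow> 'g list \<Rightarrow> rep_poly set ring" where
  "rep_ring G gs = rep_poly_ring (length gs) Quot rep_ideal G gs"

definition rep_fun :: "('g, 'b) monoid_scheme \<Rightarrow> 'g list \<Rightarrow> rep_poly \<Rightarrow> rep_poly set" where
  "rep_fun G gs p = rep_ideal G gs +>\<^bsub>rep_poly_ring (length gs)\<^esub> p"

text \<open>
  The action of \<open>h\<close> on a function \<open>f\<close> of the representation \<open>\<rho>\<close> is
  \<open>(h \<cdot> f)(\<rho>) = f (h\<^sup>-\<^sup>1 \<rho> h)\<close>. On polynomials it is an automorphism preserving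
  the ideal of relations, so on the quotient ring it maps a residue class to its image.
\<close>

definition conj_subst :: "complex^2^2 \<Rightarrow> rep_var \<Rightarrow> rep_poly" where
  "conj_subst h = (\<lambda>(l, i, j).
     ((\<chi> a b. poly_const (matrix_inv h $ a $ b)) ** gen_matrix l ** (\<chi> a b. poly_const (h $ a $ b)))
       $ i $ j)"

definition conj_act :: "complex^2^2 \<Rightarrow> rep_poly set \<Rightarrow> rep_poly set" where
  "conj_act h a = poly_subst (conj_subst h) ` a"

definition char_ring :: "('g, 'b) monoid_scheme \<Rightarrow> 'g list \<Rightarrow> rep_poly set ring" where
  "char_ring G gs = (rep_ring G gs)
     \<lparr>carrier := {a \<in> carrier (rep_ring G gs). \<forall>h. det h = 1 \<longrightarrow> conj_act h a = a}\<rparr>"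

text \<open>The residue class below depends only on the value \<open>\<gamma>\<close> of the chosen word.\<close>

definition trace_fun :: "('g, 'b) monoid_scheme \<Rightarrow> 'g list \<Rightarrow> 'g \<Rightarrow> rep_poly set" where
  "trace_fun G gs \<gamma> = rep_fun G gs (trace (word_matrix
     (SOME w. w \<in> words_over {..<length gs} \<and> word_value G gs w = \<gamma>)))"

definition trivial_char :: "('g, 'b) monoid_scheme \<Rightarrow> 'g list \<Rightarrow> rep_poly set set" where
  "trivial_char G gs = Idl\<^bsub>char_ring G gs\<^esub>
     {trace_fun G gs \<gamma> \<ominus>\<^bsub>char_ring G gs\<^esub> rep_fun G gs 2 | \<gamma>. \<gamma> \<in> carrier G}"

text \<open>
  The local dimension of the affine scheme of \<open>R\<close> at a prime \<open>m\<close>, i.e. the Krull dimension of the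
  local ring at \<open>m\<close>: the supremum of the lengths of chains of prime ideals contained in \<open>m\<close>
  (chains of irreducible closed subsets passing through the point).
\<close>

definition local_dimension :: "('a, 'b) ring_scheme \<Rightarrow> 'a set \<Rightarrow> enat" where
  "local_dimension R m = Sup {enat n | n. \<exists>P. (\<forall>i\<le>n. primeideal (P i) R \<and> P i \<subseteq> m) \<and>
     (\<forall>i<n. P i \<subset> P (Suc i))}"

definition ideal_space :: "('g, 'b) monoid_scheme \<Rightarrow> 'g list \<Rightarrow> rep_poly set set \<Rightarrow>
    (complex, rep_poly set) module" where
  "ideal_space G gs J = \<lparr>carrier = J, mult = undefined, one = undefined,
     zero = \<zero>\<^bsub>char_ring G gs\<^esub>, add = add (char_ring G gs),
     smult = (\<lambda>c a. rep_fun G gs (poly_const c) \<otimes>\<^bsub>char_ring G gs\<^esub> a)\<rparr>"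

definition zariski_tangent_space :: "('g, 'b) monoid_scheme \<Rightarrow> 'g list \<Rightarrow> rep_poly set set \<Rightarrow>
    (complex, rep_poly set set \<Rightarrow> complex) module" where
  "zariski_tangent_space G gs m =
     dual_space (quot_space (ideal_space G gs m) (m \<cdot>\<^bsub>char_ring G gs\<^esub> m))"

definition char_scheme_smooth_at :: "('g, 'b) monoid_scheme \<Rightarrow> 'g list \<Rightarrow> rep_poly set set \<Rightarrow> bool"
  where
  "char_scheme_smooth_at G gs m \<longleftrightarrow>
     (\<exists>d. has_dimension (zariski_tangent_space G gs m) d \<and>
          local_dimension (char_ring G gs) m = enat d)"

end

theory Submission
  imports Defs "HOL-Computational_Algebra.Computational_Algebra"
begin

text \<open>Modulo the relations, the invariant functions are the polynomials in traces: Lie algebra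
  invariants modulo an ideal lift by projecting with the Casimir operator, and polynomials killed by
  \<open>sl\<^sub>2\<close> are polynomials in traces. The trace identities of \<open>2 \<times> 2\<close> matrices show that, modulo the
  square of the maximal ideal, \<open>\<gamma> \<mapsto> t\<^sub>\<gamma> - 2\<close> is a quadratic form on \<open>H\<^sub>1\<close>. For \<open>H\<^sub>1\<close> of dimension 2
  with basis \<open>a, b\<close> the cotangent space is thus spanned by the three functions \<open>t\<^sub>a - 2\<close>, \<open>t\<^sub>b - 2\<close>,
  \<open>t\<^sub>a\<^sub>b - 2\<close>.

  Each of the three conditions makes the trivial representation unobstructed: for (1) the obstructions
  lie in \<open>H\<^sup>2\<close>, (2) reduces to (1) by counting linear equations, one per relation, and for (3) one pulls
  back representations of \<open>F\<^sub>2\<close>. So for traceless \<open>X, Y\<close> there is a formal curve of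
  representations with linear term \<open>\<alpha> X + \<beta> Y\<close>, on which \<open>t\<^sub>\<gamma> - 2\<close> starts with
  \<open>- det (\<alpha> X + \<beta> Y) \<epsilon>\<^sup>2\<close>. These curves separate forms in the three functions, so the completed local
  ring is a power series ring in three variables. This gives tangent dimension 3 and, pulling back
  coordinate ideals, a chain of four primes; longer chains are excluded by comparing the growth of
  powers of the maximal ideal, using the Artin--Rees lemma.\<close>

text \<open>The ring of the scheme may have nilpotents, so counting characters is not enough: all
  estimates concern the ideal \<open>I\<close> itself, and an arc is a homomorphism to power series
  that kills all of \<open>I\<close>. The failure of \<open>t\<close> to be quadratic is, modulo the
  square of the maximal ideal, an alternating trilinear form on \<open>H_1\<close>, and such forms
  vanish in dimension 2; what remains are the three coefficients of a binary quadratic form. On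
  traceless pairs the values \<open>- det X\<close>, \<open>- det Y\<close>,
  \<open>- det (X + Y)\<close> are arbitrary, so arcs point in every direction of this 3-space. Arcs
  meet the coordinates only to order 2, so forms of degree \<open>n\<close> are read off at order
  \<open>2 n\<close>. The Casimir operator replaces averaging over the non-compact group: on
  products of \<open>d\<close> matrix entries it is multiplication by \<open>4 d (d + 1)\<close> up
  to products of fewer entries. For the dimension, a chain of five primes would give
  \<open>J ^ 4\<close> products independent modulo the \<open>k\<close>-th power of the maximal
  ideal with \<open>k\<close> linear in \<open>J\<close>, against at most \<open>k ^ 3\<close>
  dimensions.\<close>

no_notation fps_nth (infixl "$" 75)
notation fps_nth (infixl "$$$" 100)

section \<open>Subalgebras and the Hilbert basis theorem\<close>

text \<open>Scalars enter through an explicit homomorphism because several algebras occur: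
  \<open>rep_poly\<close>, polynomials over an algebra, power series, and the complex numbers
  themselves.\<close>

locale complex_algebra =
  fixes \<kappa> :: "complex \<Rightarrow> 'a::comm_ring_1"
  assumes scalar_add: "\<kappa> (a + b) = \<kappa> a + \<kappa> b"
    and scalar_mult: "\<kappa> (a * b) = \<kappa> a * \<kappa> b"
    and scalar_1 [simp]: "\<kappa> 1 = 1"
begin

lemma scalar_0 [simp]: "\<kappa> 0 = 0"
  using scalar_add[of 0 0] by simp

lemma scalar_minus: "\<kappa> (- a) = - \<kappa> a"
  using scalar_add[of a "- a"] by (simp add: eq_neg_iff_add_eq_0 add.commute)

lemma scalar_diff: "\<kappa> (a - b) = \<kappa> a - \<kappa> b"
  using scalar_add[of a "- b"] scalar_minus by simp

inductive_set alg :: "'a set \<Rightarrow> 'a set" for X where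
  const: "\<kappa> c \<in> alg X"
| gen: "x \<in> X \<Longrightarrow> x \<in> alg X"
| add: "a \<in> alg X \<Longrightarrow> b \<in> alg X \<Longrightarrow> a + b \<in> alg X"
| mult: "a \<in> alg X \<Longrightarrow> b \<in> alg X \<Longrightarrow> a * b \<in> alg X"

definition subalg :: "'a set \<Rightarrow> bool" where
  "subalg R \<longleftrightarrow> range \<kappa> \<subseteq> R \<and> (\<forall>a\<in>R. \<forall>b\<in>R. a + b \<in> R \<and> a * b \<in> R)"

lemma subalgD:
  assumes "subalg R"
  shows "\<kappa> c \<in> R" "a \<in> R \<Longrightarrow> b \<in> R \<Longrightarrow> a + b \<in> R" "a \<in> R \<Longrightarrow> b \<in> R \<Longrightarrow> a * b \<in> R"
    "0 \<in> R" "1 \<in> R" "a \<in> R \<Longrightarrow> - a \<in> R" "a \<in> R \<Longrightarrow> b \<in> R \<Longrightarrow> a - b \<in> R"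
    "a \<in> R \<Longrightarrow> a ^ n \<in> R"
proof -
  show 1: "\<kappa> c \<in> R" "a \<in> R \<Longrightarrow> b \<in> R \<Longrightarrow> a + b \<in> R" "a \<in> R \<Longrightarrow> b \<in> R \<Longrightarrow> a * b \<in> R" for a b c
    using assms by (auto simp: subalg_def)
  show "0 \<in> R" "1 \<in> R" using 1(1)[of 0] 1(1)[of 1] by auto
  then show "a \<in> R \<Longrightarrow> a ^ n \<in> R" by (induction n) (auto intro: 1)
  show 2: "a \<in> R \<Longrightarrow> - a \<in> R" for a
    using 1(3)[OF 1(1)[of "-1"], of a] by (simp add: scalar_minus)
  show "a \<in> R \<Longrightarrow> b \<in> R \<Longrightarrow> a - b \<in> R" using 1(2)[OF _ 2] by force
qed

lemma subalg_sum: "subalg R \<Longrightarrow> (\<And>i. i \<in> A \<Longrightarrow> f i \<in> R) \<Longrightarrow> sum f A \<in> R"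
  by (induction A rule: infinite_finite_induct) (auto intro: subalgD)

lemma subalg_prod: "subalg R \<Longrightarrow> (\<And>i. i \<in> A \<Longrightarrow> f i \<in> R) \<Longrightarrow> prod f A \<in> R"
  by (induction A rule: infinite_finite_induct) (auto intro: subalgD)

lemma subalg_alg: "subalg (alg X)"
  by (auto simp: subalg_def intro: alg.intros)

lemma alg_least: "subalg R \<Longrightarrow> X \<subseteq> R \<Longrightarrow> alg X \<subseteq> R"
proof
  fix x assume "subalg R" "X \<subseteq> R" "x \<in> alg X"
  from this(3,1,2) show "x \<in> R" by (induction rule: alg.induct) (auto intro: subalgD)
qed

lemma alg_mono: "X \<subseteq> Y \<Longrightarrow> alg X \<subseteq> alg Y"
  by (intro alg_least subalg_alg) (auto intro: alg.gen)

end

text \<open>Rings are subsets of a type, so that subalgebras such as \<open>alg Y\<close> need no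
  type of their own. Closure under negatives comes from the scalar \<open>-1\<close>.\<close>

definition ideal_of :: "'a::comm_ring_1 set \<Rightarrow> 'a set \<Rightarrow> bool" where
  "ideal_of R I \<longleftrightarrow> I \<subseteq> R \<and> 0 \<in> I \<and> (\<forall>a\<in>I. \<forall>b\<in>I. a + b \<in> I) \<and> (\<forall>r\<in>R. \<forall>a\<in>I. r * a \<in> I)"

definition prime_of :: "'a::comm_ring_1 set \<Rightarrow> 'a set \<Rightarrow> bool" where
  "prime_of R P \<longleftrightarrow> ideal_of R P \<and> 1 \<notin> P \<and> (\<forall>a\<in>R. \<forall>b\<in>R. a * b \<in> P \<longrightarrow> a \<in> P \<or> b \<in> P)"

lemma prime_ofD:
  assumes "prime_of R P"
  shows "ideal_of R P" "1 \<notin> P" "a \<in> R \<Longrightarrow> b \<in> R \<Longrightarrow> a * b \<in> P \<Longrightarrow> a \<notin> P \<Longrightarrow> b \<in> P"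
  using assms by (auto simp: prime_of_def)

lemma ideal_ofD:
  assumes "ideal_of R I"
  shows "a \<in> I \<Longrightarrow> a \<in> R" "0 \<in> I" "a \<in> I \<Longrightarrow> b \<in> I \<Longrightarrow> a + b \<in> I"
    "r \<in> R \<Longrightarrow> a \<in> I \<Longrightarrow> r * a \<in> I" "r \<in> R \<Longrightarrow> a \<in> I \<Longrightarrow> a * r \<in> I"
  using assms by (auto simp: ideal_of_def mult.commute)

lemma ideal_of_sum: "ideal_of R I \<Longrightarrow> (\<And>i. i \<in> A \<Longrightarrow> f i \<in> I) \<Longrightarrow> sum f A \<in> I"
  by (induction A rule: infinite_finite_induct) (auto intro: ideal_ofD)

lemma (in complex_algebra) ideal_of_minus:
  assumes "subalg R" "ideal_of R I"
  shows "a \<in> I \<Longrightarrow> - a \<in> I" "a \<in> I \<Longrightarrow> b \<in> I \<Longrightarrow> a - b \<in> I"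
proof -
  show 1: "a \<in> I \<Longrightarrow> - a \<in> I" for a
    using ideal_ofD(4)[OF assms(2) subalgD(1)[OF assms(1), of "-1"], of a] by (simp add: scalar_minus)
  show "a \<in> I \<Longrightarrow> b \<in> I \<Longrightarrow> a - b \<in> I"
    using ideal_ofD(3)[OF assms(2) _ 1, of a b] by simp
qed

definition combs :: "'a::comm_ring_1 set \<Rightarrow> (nat \<Rightarrow> 'a) \<Rightarrow> nat \<Rightarrow> 'a set" where
  "combs R f n = {(\<Sum>j<n. r j * f j) | r. \<forall>j. r j \<in> R}"

text \<open>The ascending chain condition in sequential form, ready to be contradicted by a sequence
  obtained from dependent choice.\<close>

definition noetherian :: "'a::comm_ring_1 set \<Rightarrow> bool" where
  "noetherian R \<longleftrightarrow> (\<forall>f. (\<forall>n. f n \<in> R) \<longrightarrow> (\<exists>n. f n \<in> combs R f n))"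

lemma combsI: "(\<And>j. r j \<in> R) \<Longrightarrow> (\<Sum>j<n. r j * f j) \<in> combs R f n"
  by (auto simp: combs_def)

lemma (in complex_algebra) combs_closed:
  assumes "subalg R" "r \<in> R" "a \<in> combs R f n" "b \<in> combs R f n"
  shows "a + b \<in> combs R f n" "r * a \<in> combs R f n" "0 \<in> combs R f n"
proof -
  obtain ra rb where *: "\<forall>j. ra j \<in> R" "a = (\<Sum>j<n. ra j * f j)" "\<forall>j. rb j \<in> R" "b = (\<Sum>j<n. rb j * f j)"
    using assms by (auto simp: combs_def)
  have "a + b = (\<Sum>j<n. (ra j + rb j) * f j)" by (simp add: * sum.distrib algebra_simps)
  then show "a + b \<in> combs R f n"
    unfolding combs_def using * subalgD[OF assms(1)] by (auto intro!: exI[of _ "\<lambda>j. ra j + rb j"])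
  have "r * a = (\<Sum>j<n. (r * ra j) * f j)" by (simp add: * sum_distrib_left algebra_simps)
  then show "r * a \<in> combs R f n"
    unfolding combs_def using * subalgD[OF assms(1)] assms by (auto intro!: exI[of _ "\<lambda>j. r * ra j"])
  show "0 \<in> combs R f n"
    unfolding combs_def using subalgD[OF assms(1)] by (auto intro!: exI[of _ "\<lambda>j. 0"])
qed

lemma (in complex_algebra) combs_mono:
  assumes "subalg R" "m \<le> n" shows "combs R f m \<subseteq> combs R f n"
proof
  fix x assume "x \<in> combs R f m"
  then obtain r where r: "\<forall>j. r j \<in> R" "x = (\<Sum>j<m. r j * f j)" by (auto simp: combs_def)
  have "x = (\<Sum>j<n. (if j < m then r j else 0) * f j)"
    unfolding r using assms(2) by (intro sum.mono_neutral_cong_left) auto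
  then show "x \<in> combs R f n"
    unfolding combs_def using r subalgD[OF assms(1)]
    by (auto intro!: exI[of _ "\<lambda>j. if j < m then r j else 0"])
qed

lemma (in complex_algebra) combs_gen:
  assumes "subalg R" "m < n" shows "f m \<in> combs R f n"
proof -
  have "f m = (\<Sum>j<n. (if j = m then 1 else 0) * f j)" using assms(2) by (simp add: if_distrib[of "\<lambda>x. x * _"] cong: if_cong)
  then show ?thesis unfolding combs_def using subalgD[OF assms(1)]
    by (auto intro!: exI[of _ "\<lambda>j. if j = m then 1 else 0"])
qed

lemma (in complex_algebra) combs_sum:
  assumes "subalg R" "\<And>i. i \<in> A \<Longrightarrow> g i \<in> combs R f n" shows "sum g A \<in> combs R f n"
  using assms(2)
proof (induction A rule: infinite_finite_induct)
  have z: "0 \<in> combs R f n"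
    unfolding combs_def using subalgD[OF assms(1)] by (auto intro!: exI[of _ "\<lambda>j. 0"])
  { case empty show ?case using z by simp next case infinite then show ?case using z by simp next
    case (insert x F) then show ?case using combs_closed(1)[OF assms(1) subalgD(4)[OF assms(1)]] by simp }
qed

text \<open>The image of a field: either \<open>f 0\<close> is zero, hence the empty combination, or
  \<open>f 1\<close> is a multiple of it.\<close>

lemma (in complex_algebra) noetherian_scalars: "noetherian (range \<kappa>)"
  unfolding noetherian_def
proof (intro allI impI)
  fix f :: "nat \<Rightarrow> 'a" assume "\<forall>n. f n \<in> range \<kappa>"
  then have "\<forall>n. \<exists>c. f n = \<kappa> c" by blast
  then obtain c where c: "\<And>n. f n = \<kappa> (c n)" using choice by metis
  show "\<exists>n. f n \<in> combs (range \<kappa>) f n"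
  proof (cases "c 0 = 0")
    case True
    then show ?thesis by (intro exI[of _ 0]) (auto simp: combs_def c)
  next
    case False
    then have "f 1 = (\<Sum>j<1. \<kappa> (c 1 / c 0) * f j)" by (simp add: c flip: scalar_mult)
    then show ?thesis
      unfolding combs_def by (intro exI[of _ 1] CollectI exI[of _ "\<lambda>_. \<kappa> (c 1 / c 0)"]) auto
  qed
qed

lemma coeffs_in_imp_poly_in:
  assumes "\<And>i. coeff p i \<in> R" "\<And>a b. a \<in> R \<Longrightarrow> b \<in> R \<Longrightarrow> a + b \<in> R" "\<And>a. a \<in> R \<Longrightarrow> a * y \<in> R" "0 \<in> R"
  shows "poly p y \<in> R"
  using assms(1)
proof (induction p)
  case (pCons a p)
  have "a \<in> R" using pCons(3)[of 0] by simp
  moreover have "poly p y \<in> R" using pCons(2) pCons(3)[of "Suc _"] by simp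
  ultimately show ?case using assms(2)[OF _ assms(3), of a "poly p y"] by (simp add: mult.commute)
qed (use assms in auto)

text \<open>Hilbert's argument with leading coefficients. As \<open>y\<close> may satisfy relations
  over \<open>R\<close>, elements have no degree; the least bound over all representing polynomials
  takes its place.\<close>

theorem (in complex_algebra) hilbert_basis_step:
  assumes R: "subalg R" and noe: "noetherian R"
  shows "noetherian {poly p y | p. \<forall>i. coeff p i \<in> R}" (is "noetherian ?S")
  unfolding noetherian_def
proof (intro allI impI, rule ccontr)
  note RD = subalgD[OF R]
  have S: "subalg ?S"
  proof -
    have "poly p y + poly q y \<in> ?S" if "\<forall>i. coeff p i \<in> R" "\<forall>i. coeff q i \<in> R" for p q
      using that RD by (auto intro!: exI[of _ "p + q"])
    moreover have "poly p y * poly q y \<in> ?S" if "\<forall>i. coeff p i \<in> R" "\<forall>i. coeff q i \<in> R" for p q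
      using that RD by (auto intro!: exI[of _ "p * q"] simp: coeff_mult intro!: subalg_sum[OF R])
    moreover have "\<kappa> c \<in> ?S" for c
      using RD by (auto intro!: exI[of _ "[:\<kappa> c:]"] simp: coeff_pCons split: nat.splits)
    ultimately show ?thesis unfolding subalg_def by blast
  qed
  note SD = subalgD[OF S]
  fix g :: "nat \<Rightarrow> 'a" assume g: "\<forall>n. g n \<in> ?S" and contra: "\<nexists>n. g n \<in> combs ?S g n"
  define I where "I = (\<Union>n. combs ?S g n)"
  \<comment> \<open>The bound exceeds the degree by one, so that only zero has bound
    \<open>0\<close>.\<close>
  define rep where "rep d f \<longleftrightarrow> (\<exists>p. (\<forall>i. coeff p i \<in> R) \<and> (\<forall>i\<ge>d. coeff p i = 0) \<and> f = poly p y)" for d f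
  have IS: "I \<subseteq> ?S"
  proof -
    have "(\<Sum>j<n. r j * g j) \<in> ?S" if "\<forall>j. r j \<in> ?S" for r and n :: nat
      using that g by (intro subalg_sum[OF S] SD) auto
    then show ?thesis by (fastforce simp: I_def combs_def)
  qed
  have rep_ex: "\<exists>d. rep d f" if "f \<in> I" for f
  proof -
    from that IS obtain p where p: "f = poly p y" "\<forall>i. coeff p i \<in> R" by blast
    then have "rep (Suc (degree p)) f" unfolding rep_def by (auto intro!: exI[of _ p] coeff_eq_0)
    then show ?thesis by blast
  qed
  have Iadd: "a + b \<in> I" "r * a \<in> I" if "a \<in> I" "b \<in> I" "r \<in> ?S" for a b r
  proof -
    from that obtain m n where mn: "a \<in> combs ?S g m" "b \<in> combs ?S g n" by (auto simp: I_def)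
    have "a \<in> combs ?S g (max m n)" "b \<in> combs ?S g (max m n)"
      using mn combs_mono[OF S, of m "max m n" g] combs_mono[OF S, of n "max m n" g] by auto
    from combs_closed[OF S that(3) this] show "a + b \<in> I" "r * a \<in> I" by (auto simp: I_def)
  qed
  have I0: "0 \<in> I"
    unfolding I_def using combs_sum[OF S, of "{}" "\<lambda>_. 0" g 0] by auto
  \<comment> \<open>\<open>I\<close> is not generated by finitely many of its elements: these would
    all lie in some \<open>combs ?S g N\<close>, and so would \<open>g N\<close>.\<close>
  have new: "\<exists>x\<in>I. x \<notin> combs ?S f n" if f: "\<forall>j<n. f j \<in> I" for f and n :: nat
  proof (rule ccontr)
    assume "\<not> ?thesis"
    then have I: "I \<subseteq> combs ?S f n" by blast
    have "\<exists>N. \<forall>j<n. f j \<in> combs ?S g N" using f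
    proof (induction n)
      case (Suc n)
      then obtain N where N: "\<forall>j<n. f j \<in> combs ?S g N" by auto
      obtain M where M: "f n \<in> combs ?S g M" using Suc(2) by (auto simp: I_def)
      have "\<forall>j<Suc n. f j \<in> combs ?S g (max N M)"
        using N M combs_mono[OF S, of N "max N M" g] combs_mono[OF S, of M "max N M" g]
        by (auto simp: less_Suc_eq)
      then show ?case by blast
    qed auto
    then obtain N where N: "\<forall>j<n. f j \<in> combs ?S g N" by blast
    have "g N \<in> I" using combs_gen[OF S, of N "Suc N"] by (auto simp: I_def)
    then have "g N \<in> combs ?S f n" using I by blast
    then obtain r where r: "\<forall>j. r j \<in> ?S" "g N = (\<Sum>j<n. r j * f j)" unfolding combs_def by blast
    have "(\<Sum>j<n. r j * f j) \<in> combs ?S g N"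
      using N r(1) combs_closed(2)[OF S] by (intro combs_sum[OF S]) blast
    then show False using contra r(2) by metis
  qed
  \<comment> \<open>Every choice has the least bound among the elements outside the ideal generated
    so far; this makes \<open>d\<close> monotone and any further reduction contradictory.\<close>
  define good where "good f n x \<longleftrightarrow> x \<in> I \<and> x \<notin> combs ?S f n \<and>
    (\<forall>x'\<in>I. x' \<notin> combs ?S f n \<longrightarrow> (LEAST d. rep d x) \<le> (LEAST d. rep d x'))" for f and n :: nat and x
  have "\<exists>f. \<forall>n. good f n (f n)"
  proof (rule dependent_wf_choice[of less_than])
    show "\<exists>r. good f n r" if "\<And>m. (m, n) \<in> less_than \<Longrightarrow> good f m (f m)" for n f
    proof -
      have "\<forall>j<n. f j \<in> I" using that by (auto simp: good_def)
      from new[OF this] obtain x0 where "x0 \<in> I \<and> x0 \<notin> combs ?S f n" by blast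
      from ex_has_least_nat[of "\<lambda>x. x \<in> I \<and> x \<notin> combs ?S f n", OF this, of "\<lambda>x. LEAST d. rep d x"]
      show ?thesis unfolding good_def by blast
    qed
    show "good f x r = good f' x r" if "\<And>z. (z, x) \<in> less_than \<Longrightarrow> f z = f' z" for f f' x r
    proof -
      have "combs ?S f x = combs ?S f' x" unfolding combs_def using that by (auto intro!: sum.cong)
      then show ?thesis by (simp add: good_def)
    qed
  qed simp
  then obtain f where f: "\<And>n. good f n (f n)" by blast
  define d where "d n = (LEAST d. rep d (f n))" for n
  have dmono: "d j \<le> d n" if "j \<le> n" for j n
  proof -
    have "f n \<in> I" "f n \<notin> combs ?S f j"
      using f[of n] combs_mono[OF S that, of f] by (auto simp: good_def)
    then show ?thesis using f[of j] unfolding d_def good_def by blast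
  qed
  have "\<exists>d. rep d (f n)" for n
    using rep_ex[of "f n"] f[of n] by (auto simp: good_def)
  then have "rep (d n) (f n)" for n
    unfolding d_def by (rule LeastI_ex)
  then have "\<forall>n. \<exists>p. (\<forall>i. coeff p i \<in> R) \<and> (\<forall>i\<ge>d n. coeff p i = 0) \<and> f n = poly p y"
    unfolding rep_def by blast
  from choice[OF this] obtain p where
    "\<forall>n. (\<forall>i. coeff (p n) i \<in> R) \<and> (\<forall>i\<ge>d n. coeff (p n) i = 0) \<and> f n = poly (p n) y"
    by blast
  then have p: "\<And>n i. coeff (p n) i \<in> R" "\<And>n i. i \<ge> d n \<Longrightarrow> coeff (p n) i = 0" "\<And>n. f n = poly (p n) y"
    by auto
  have dpos: "d n > 0" for n
  proof (rule ccontr)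
    assume "\<not> ?thesis"
    then have "p n = 0" using p(2)[of n] by (intro poly_eqI) simp
    then have "f n = 0" using p by simp
    then show False using f[of n] combs_sum[OF S, of "{}" "\<lambda>_. 0" f n]
      by (simp add: good_def)
  qed
  \<comment> \<open>The coefficient at the highest place that the bound allows.\<close>
  define a where "a n = coeff (p n) (d n - 1)" for n
  have "\<forall>n. a n \<in> R" using p(1) by (simp add: a_def)
  then obtain n where "a n \<in> combs R a n" using noe unfolding noetherian_def by blast
  then obtain r where r: "\<forall>j. r j \<in> R" "a n = (\<Sum>j<n. r j * a j)" unfolding combs_def by blast
  \<comment> \<open>The shift by \<open>d n - d j\<close> aligns the top places, so subtracting
    \<open>q\<close> cancels the top coefficient of \<open>p n\<close>.\<close>
  define q where "q = (\<Sum>j<n. monom (r j) (d n - d j) * p j)"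
  define h where "h = f n - poly q y"
  have q: "poly q y = (\<Sum>j<n. (r j * y ^ (d n - d j)) * f j)"
    by (simp add: q_def poly_sum poly_monom p(3))
  have rS: "r j * y ^ (d n - d j) \<in> ?S" for j
    using r RD(4) by (auto intro!: exI[of _ "monom (r j) (d n - d j)"] simp: poly_monom)
  have qin: "poly q y \<in> combs ?S f n" unfolding q by (rule combsI) (rule rS)
  have fI: "f j \<in> I" for j using f[of j] by (simp add: good_def)
  have "ideal_of ?S I" using IS I0 Iadd unfolding ideal_of_def by blast
  moreover from this have "poly q y \<in> I"
    unfolding q by (intro ideal_of_sum[of ?S I]) (auto intro: ideal_ofD(4)[of ?S I, OF _ rS fI])
  ultimately have hI: "h \<in> I" unfolding h_def using ideal_of_minus(2)[OF S] fI by blast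
  have hn: "h \<notin> combs ?S f n"
  proof
    assume "h \<in> combs ?S f n"
    from combs_closed(1)[OF S SD(4) this qin] show False using f[of n] by (simp add: h_def good_def)
  qed
  have "rep (d n - 1) h"
    unfolding rep_def
  proof (intro exI[of _ "p n - q"] conjI allI impI)
    have cq: "coeff q i = (\<Sum>j<n. r j * (if d n - d j \<le> i then coeff (p j) (i - (d n - d j)) else 0))" for i
      unfolding q_def coeff_sum coeff_monom_mult by (intro sum.cong refl) (simp add: not_le)
    show "coeff (p n - q) i \<in> R" for i
      unfolding coeff_diff cq using r(1) p(1) RD by (intro RD subalg_sum[OF R]) auto
    show "coeff (p n - q) i = 0" if "d n - 1 \<le> i" for i
    proof (cases "i = d n - 1")
      case True
      have "coeff q i = (\<Sum>j<n. r j * a j)" unfolding cq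
      proof (intro sum.cong refl arg_cong[of _ _ "(*) _"])
        fix j assume "j \<in> {..<n}"
        then have "d j \<le> d n" "d j > 0" using dmono dpos by auto
        then have "d n - d j \<le> i" "i - (d n - d j) = d j - 1" unfolding True by auto
        then show "(if d n - d j \<le> i then coeff (p j) (i - (d n - d j)) else 0) = a j" by (simp add: a_def)
      qed
      then show ?thesis using r True by (simp add: a_def)
    next
      case False
      then have i: "i \<ge> d n" using that by auto
      have "coeff q i = (\<Sum>j<n. 0)" unfolding cq
      proof (intro sum.cong refl)
        fix j assume "j \<in> {..<n}"
        then have "d j \<le> d n" using dmono by auto
        then show "r j * (if d n - d j \<le> i then coeff (p j) (i - (d n - d j)) else 0) = 0"
          using i p(2)[of j "i - (d n - d j)"] by auto
      qed
      then show ?thesis using i p(2) by simp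
    qed
  qed (simp add: h_def p)
  then have "(LEAST d. rep d h) \<le> d n - 1" by (rule Least_le)
  moreover have "d n \<le> (LEAST d. rep d h)" using f[of n] hI hn unfolding good_def d_def by blast
  ultimately show False using dpos[of n] by simp
qed

theorem (in complex_algebra) noetherian_alg: "finite Y \<Longrightarrow> noetherian (alg Y)"
proof (induction Y rule: finite_induct)
  case empty
  have "alg {} = range \<kappa>"
  proof
    show "alg {} \<subseteq> range \<kappa>"
      by (rule alg_least) (auto simp: subalg_def simp flip: scalar_add scalar_mult)
  qed (auto intro: alg.const)
  then show ?case using noetherian_scalars by simp
next
  case (insert y Y)
  note RD = subalgD[OF subalg_alg[of Y]]
  let ?S = "{poly p y | p. \<forall>i. coeff p i \<in> alg Y}"
  \<comment> \<open>Adjoining \<open>y\<close> means evaluating at \<open>y\<close> the polynomials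
    over \<open>alg Y\<close>, which is the form that \<open>hilbert_basis_step\<close>
    treats.\<close>
  have "alg (insert y Y) = ?S"
  proof
    show "alg (insert y Y) \<subseteq> ?S"
    proof (rule alg_least)
      have "poly p y + poly q y \<in> ?S" if "\<forall>i. coeff p i \<in> alg Y" "\<forall>i. coeff q i \<in> alg Y" for p q
        using that RD by (auto intro!: exI[of _ "p + q"])
      moreover have "poly p y * poly q y \<in> ?S" if "\<forall>i. coeff p i \<in> alg Y" "\<forall>i. coeff q i \<in> alg Y" for p q
        using that RD by (auto intro!: exI[of _ "p * q"] simp: coeff_mult intro!: subalg_sum[OF subalg_alg])
      moreover have c: "x \<in> ?S" if "x \<in> alg Y" for x
        using that RD by (auto intro!: exI[of _ "[:x:]"] simp: coeff_pCons split: nat.splits)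
      ultimately show "subalg ?S" unfolding subalg_def using RD(1) by blast
      have "y \<in> ?S" using RD by (auto intro!: exI[of _ "[:0, 1:]"] simp: coeff_pCons split: nat.splits)
      then show "insert y Y \<subseteq> ?S" using c alg.gen by blast
    qed
    note AD = subalgD[OF subalg_alg[of "insert y Y"]]
    have "alg Y \<subseteq> alg (insert y Y)" by (rule alg_mono) auto
    then show "?S \<subseteq> alg (insert y Y)"
      using AD
      by (auto intro!: coeffs_in_imp_poly_in intro: alg.intros)
  qed
  then show ?case using hilbert_basis_step[OF subalg_alg insert.IH] by simp
qed

section \<open>The Artin--Rees lemma\<close>

context complex_algebra
begin

text \<open>\<open>ipow Y k\<close> is the \<open>k\<close>-th power of the ideal generated by \<open>Y\<close> in \<open>alg Y\<close>, for finite \<open>Y\<close>.\<close>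

fun ipow :: "'a set \<Rightarrow> nat \<Rightarrow> 'a set" where
  "ipow Y 0 = alg Y"
| "ipow Y (Suc k) = {(\<Sum>y\<in>Y. y * c y) | c. \<forall>y. c y \<in> ipow Y k}"

lemma ideal_of_ipow: "ideal_of (alg Y) (ipow Y k)"
proof (induction k)
  case 0
  then show ?case using subalgD[OF subalg_alg[of Y]] by (auto simp: ideal_of_def)
next
  case (Suc k)
  note ID = ideal_ofD[OF Suc]
  have "a \<in> alg Y" if "a \<in> ipow Y (Suc k)" for a
    using that ID(1) by (auto intro!: subalg_sum[OF subalg_alg] alg.mult intro: alg.gen)
  moreover have "0 \<in> ipow Y (Suc k)" using ID(2) by (auto intro!: exI[of _ "\<lambda>_. 0"])
  moreover have "a + b \<in> ipow Y (Suc k)" if ab: "a \<in> ipow Y (Suc k)" "b \<in> ipow Y (Suc k)" for a b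
  proof -
    from ab obtain c c' where "a = (\<Sum>y\<in>Y. y * c y)" "b = (\<Sum>y\<in>Y. y * c' y)" "\<forall>y. c y \<in> ipow Y k" "\<forall>y. c' y \<in> ipow Y k"
      by auto
    then show ?thesis using ID(3)
      by (auto intro!: exI[of _ "\<lambda>y. c y + c' y"] simp: sum.distrib algebra_simps)
  qed
  moreover have "r * a \<in> ipow Y (Suc k)" if "r \<in> alg Y" "a \<in> ipow Y (Suc k)" for r a
  proof -
    from that obtain c where "a = (\<Sum>y\<in>Y. y * c y)" "\<forall>y. c y \<in> ipow Y k" by auto
    then show ?thesis using that(1)
      by (auto intro!: exI[of _ "\<lambda>y. r * c y"] ID(4) simp: sum_distrib_left mult.left_commute)
  qed
  ultimately show ?case unfolding ideal_of_def by blast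
qed

lemmas ipowD = ideal_ofD[OF ideal_of_ipow]

lemma ipow_antimono:
  assumes "i \<le> j" shows "ipow Y j \<subseteq> ipow Y i"
proof -
  have "ipow Y (Suc k) \<subseteq> ipow Y k" for k
    by (auto intro!: ideal_of_sum[OF ideal_of_ipow] ipowD(4) intro: alg.gen)
  then show ?thesis using assms lift_Suc_antimono_le[of "ipow Y"] by blast
qed

lemma ipow_SucI:
  assumes "finite Y" "y \<in> Y" "a \<in> ipow Y k" shows "y * a \<in> ipow Y (Suc k)"
proof -
  have "y * a = (\<Sum>z\<in>Y. z * (if z = y then a else 0))"
    using assms by (simp add: if_distrib[of "\<lambda>x. _ * x"] cong: if_cong)
  then show ?thesis using assms ipowD(2) by (auto intro!: exI[of _ "\<lambda>z. if z = y then a else 0"])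
qed

lemma ipow_mult: "a \<in> ipow Y i \<Longrightarrow> b \<in> ipow Y j \<Longrightarrow> a * b \<in> ipow Y (i + j)"
proof (induction i arbitrary: a)
  case 0
  then show ?case using ipowD(4) by auto
next
  case (Suc i)
  then obtain c where c: "a = (\<Sum>y\<in>Y. y * c y)" "\<forall>y. c y \<in> ipow Y i" by auto
  have "a * b = (\<Sum>y\<in>Y. y * (c y * b))" by (simp add: c sum_distrib_right mult.assoc)
  then show ?case using Suc c by (auto intro!: exI[of _ "\<lambda>y. c y * b"])
qed

lemma ipow_gen: "finite Y \<Longrightarrow> y \<in> Y \<Longrightarrow> y \<in> ipow Y (Suc 0)"
  using ipow_SucI[of Y y 1 0] subalgD(5)[OF subalg_alg] by simp

text \<open>The ideal generated by \<open>Y\<close> has codimension at most one; later it is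
  recognised as the maximal ideal of the trivial character.\<close>

lemma alg_decomp:
  assumes "finite Y" "a \<in> alg Y"
  shows "\<exists>c. a - \<kappa> c \<in> ipow Y (Suc 0)"
  using assms(2)
proof (induction rule: alg.induct)
  case (const c)
  then show ?case using ipowD(2) by (intro exI[of _ c]) (simp del: ipow.simps)
next
  case (gen x)
  then show ?case using ipow_gen[OF assms(1)] by (intro exI[of _ 0]) (simp del: ipow.simps)
next
  case (add a b)
  then obtain c d where "a - \<kappa> c \<in> ipow Y (Suc 0)" "b - \<kappa> d \<in> ipow Y (Suc 0)" by blast
  then have "(a - \<kappa> c) + (b - \<kappa> d) \<in> ipow Y (Suc 0)" by (rule ipowD(3))
  then show ?case by (intro exI[of _ "c + d"]) (simp add: scalar_add algebra_simps del: ipow.simps)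
next
  case (mult a b)
  then obtain c d where cd: "a - \<kappa> c \<in> ipow Y (Suc 0)" "b - \<kappa> d \<in> ipow Y (Suc 0)" by blast
  then have "b * (a - \<kappa> c) + \<kappa> c * (b - \<kappa> d) \<in> ipow Y (Suc 0)"
    using mult by (intro ipowD(3) ipowD(4)) (auto intro: alg.const)
  then show ?case by (intro exI[of _ "c * d"]) (simp add: scalar_mult algebra_simps del: ipow.simps)
qed

text \<open>The Rees algebra \<open>\<Oplus>\<^sub>k (ipow Y k) T\<^sup>k\<close> is generated by the constants \<open>y\<close> and the
  monomials \<open>y T\<close>, so it is noetherian; this is what the Artin--Rees lemma rests on.\<close>

lemma artin_rees:
  assumes fin: "finite Y" and J: "ideal_of (alg Y) J"
  shows "\<exists>n::nat. \<exists>h d. (\<forall>j<n. h j \<in> J) \<and> (\<forall>k x. x \<in> J \<longrightarrow> x \<in> ipow Y k \<longrightarrow>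
       (\<exists>r. x = (\<Sum>j<n. r j * h j) \<and> (\<forall>j<n. r j \<in> ipow Y (k - d j))))"
proof -
  interpret P: complex_algebra "\<lambda>c. [:\<kappa> c:]"
    by unfold_locales (auto simp: scalar_add scalar_mult one_pCons)
  let ?G = "(\<lambda>y. [:y:]) ` Y \<union> (\<lambda>y. monom y 1) ` Y"
  \<comment> \<open>Together with \<open>monom_in\<close> this identifies the Rees algebra: its part
    of degree \<open>i\<close> consists of the \<open>a T^i\<close> with \<open>a\<close> in
    \<open>ipow Y i\<close>.\<close>
  have coeff_in: "coeff p i \<in> ipow Y i" if "p \<in> P.alg ?G" for p i
    using that
  proof (induction arbitrary: i rule: P.alg.induct)
    case (const c)
    then show ?case using ipowD(2)[of Y i] by (cases i) (auto simp del: ipow.simps(2) intro: alg.const)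
  next
    case (gen x)
    then show ?case using ipowD(2)[of Y i] ipow_gen[OF fin]
      by (cases i) (auto simp del: ipow.simps(2) simp: coeff_pCons coeff_monom split: nat.splits intro: alg.gen ipowD)
  next
    case (add a b)
    then show ?case by (simp add: ipowD)
  next
    case (mult a b)
    have "coeff a j * coeff b (i - j) \<in> ipow Y i" if "j \<le> i" for j
      using ipow_mult[OF mult.IH(1)[of j] mult.IH(2)[of "i - j"]] that by simp
    then show ?case by (auto simp: coeff_mult intro!: ideal_of_sum[OF ideal_of_ipow])
  qed
  have monom_in: "monom a k \<in> P.alg ?G" if "a \<in> ipow Y k" for a k
    using that
  proof (induction k arbitrary: a)
    case 0
    then have "a \<in> alg Y" by simp
    then show ?case
    proof (induction rule: alg.induct)
      case (const c) then show ?case using P.alg.const[of c] by (simp add: monom_0)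
    next
      case (gen x) then show ?case by (auto intro!: P.alg.gen simp: monom_0)
    next
      case (add a b) then show ?case by (simp add: P.alg.add flip: add_monom)
    next
      case (mult a b)
      then show ?case using P.alg.mult[OF mult.IH] by (simp add: mult_monom)
    qed
  next
    case (Suc k)
    then obtain c where c: "a = (\<Sum>y\<in>Y. y * c y)" "\<forall>y. c y \<in> ipow Y k" by auto
    have "monom a (Suc k) = (\<Sum>y\<in>Y. monom y 1 * monom (c y) k)"
      by (simp add: c monom_sum mult_monom)
    then show ?case using Suc.IH c by (auto intro!: P.subalg_sum[OF P.subalg_alg] P.alg.mult intro: P.alg.gen)
  qed
  \<comment> \<open>A pair consists of an element and its level. If no finite list of pairs
    sufficed, there would be an infinite list of bad ones, and their monomials \<open>x T^k\<close>
    would contradict noetherianity of the Rees algebra.\<close>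
  define bad where "bad f n x \<longleftrightarrow> fst x \<in> J \<and> fst x \<in> ipow Y (snd x) \<and>
     \<not> (\<exists>r. fst x = (\<Sum>j<n. r j * fst (f j)) \<and> (\<forall>j<n. r j \<in> ipow Y (snd x - snd (f j))))"
    for f :: "nat \<Rightarrow> 'a \<times> nat" and n :: nat and x
  have "\<exists>n f. (\<forall>j<n. fst (f j) \<in> J) \<and> (\<forall>x. \<not> bad f n x)"
  proof (rule ccontr)
    assume contra: "\<not> ?thesis"
    have "\<exists>f. \<forall>n. bad f n (f n)"
    proof (rule dependent_wf_choice[of less_than])
      show "\<exists>r. bad f n r" if "\<And>m. (m, n) \<in> less_than \<Longrightarrow> bad f m (f m)" for n f
      proof -
        have "\<forall>j<n. fst (f j) \<in> J" using that by (auto simp: bad_def)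
        then show ?thesis using contra by blast
      qed
      show "bad f x r = bad f' x r" if "\<And>z. (z, x) \<in> less_than \<Longrightarrow> f z = f' z" for f f' x r
      proof -
        have "(\<Sum>j<x. s j * fst (f j)) = (\<Sum>j<x. s j * fst (f' j))" for s
          using that by (intro sum.cong) auto
        moreover have "(\<forall>j<x. s j \<in> ipow Y (snd r - snd (f j))) \<longleftrightarrow> (\<forall>j<x. s j \<in> ipow Y (snd r - snd (f' j)))" for s
          using that by auto
        ultimately show ?thesis unfolding bad_def by simp
      qed
    qed simp
    then obtain f where f: "\<And>n. bad f n (f n)" by blast
    have "finite ?G" using fin by auto
    moreover have "monom (fst (f n)) (snd (f n)) \<in> P.alg ?G" for n
      using f[of n] by (intro monom_in) (simp add: bad_def)
    ultimately have
      "\<exists>n. monom (fst (f n)) (snd (f n)) \<in> combs (P.alg ?G) (\<lambda>n. monom (fst (f n)) (snd (f n))) n"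
      using P.noetherian_alg[of ?G, unfolded noetherian_def, rule_format,
          of "\<lambda>n. monom (fst (f n)) (snd (f n))"] by simp
    then obtain n r where r: "\<forall>j. r j \<in> P.alg ?G"
      "monom (fst (f n)) (snd (f n)) = (\<Sum>j<n. r j * monom (fst (f j)) (snd (f j)))"
      unfolding combs_def by blast
    \<comment> \<open>Only the coefficient of degree \<open>snd (f n)\<close> of the relation
      matters; generators of larger level contribute nothing to it.\<close>
    define s where "s j = (if snd (f n) < snd (f j) then 0 else coeff (r j) (snd (f n) - snd (f j)))" for j
    have cm: "coeff (p * monom a k) m = (if m < k then 0 else coeff p (m - k) * a)" for p and a :: 'a and k m
      by (subst mult.commute, subst coeff_monom_mult) (simp add: mult.commute)
    have "fst (f n) = coeff (monom (fst (f n)) (snd (f n))) (snd (f n))" by simp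
    also have "\<dots> = (\<Sum>j<n. s j * fst (f j))"
      unfolding r(2) coeff_sum s_def by (intro sum.cong refl) (simp add: cm)
    finally have "fst (f n) = (\<Sum>j<n. s j * fst (f j))" .
    moreover have "s j \<in> ipow Y (snd (f n) - snd (f j))" for j
      using coeff_in r(1) subalgD(4)[OF subalg_alg] by (simp add: s_def)
    ultimately show False using f[of n] unfolding bad_def by blast
  qed
  then obtain n f where f: "\<forall>j<n. fst (f j) \<in> J" "\<forall>x. \<not> bad f n x" by blast
  from f(2) have "\<forall>k x. x \<in> J \<longrightarrow> x \<in> ipow Y k \<longrightarrow>
      (\<exists>r. x = (\<Sum>j<n. r j * fst (f j)) \<and> (\<forall>j<n. r j \<in> ipow Y (k - snd (f j))))"
    by (auto simp: bad_def)
  with f(1) show ?thesis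
    by (intro exI[of _ n] exI[of _ "\<lambda>j. fst (f j)"] exI[of _ "\<lambda>j. snd (f j)"] conjI)
qed

definition sumset :: "'a set \<Rightarrow> 'a set \<Rightarrow> 'a set" where
  "sumset A B = {a + b | a b. a \<in> A \<and> b \<in> B}"

lemma sumsetI: "a \<in> A \<Longrightarrow> b \<in> B \<Longrightarrow> a + b \<in> sumset A B"
  by (auto simp: sumset_def)

lemma sumset_mono: "A \<subseteq> A' \<Longrightarrow> B \<subseteq> B' \<Longrightarrow> sumset A B \<subseteq> sumset A' B'"
  by (auto simp: sumset_def)

lemma ideal_of_sumset:
  assumes "subalg R" "ideal_of R A" "ideal_of R B" shows "ideal_of R (sumset A B)"
proof -
  note A = ideal_ofD[OF assms(2)] and B = ideal_ofD[OF assms(3)]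
  have "a + b + (a' + b') \<in> sumset A B" if "a \<in> A" "b \<in> B" "a' \<in> A" "b' \<in> B" for a b a' b'
    using sumsetI[OF A(3)[OF that(1,3)] B(3)[OF that(2,4)]] by (simp add: algebra_simps)
  moreover have "r * (a + b) \<in> sumset A B" if "a \<in> A" "b \<in> B" "r \<in> R" for a b r
    using sumsetI[OF A(4)[OF that(3,1)] B(4)[OF that(3,2)]] by (simp add: distrib_left)
  moreover have "0 \<in> sumset A B" using sumsetI[OF A(2) B(2)] by simp
  moreover have "sumset A B \<subseteq> R" using A(1) B(1) subalgD[OF assms(1)] by (auto simp: sumset_def)
  ultimately show ?thesis unfolding ideal_of_def by (auto simp: sumset_def) 
qed

text \<open>Multiplication by \<open>f\<close> is injective on the domain \<open>alg Y\<close>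
  modulo \<open>P\<close>. Artin--Rees for the ideal \<open>P + f R\<close> makes this effective:
  division by \<open>f\<close> loses at most \<open>c\<close> orders.\<close>

lemma prime_quotient_bound:
  assumes fin: "finite Y" and P: "prime_of (alg Y) P" and f: "f \<in> alg Y" "f \<notin> P"
  obtains c where "\<And>k g. g \<in> alg Y \<Longrightarrow> f * g \<in> sumset P (ipow Y k) \<Longrightarrow> g \<in> sumset P (ipow Y (k - c))"
proof -
  have PI: "ideal_of (alg Y) P" using P by (simp add: prime_of_def)
  note PD = ideal_ofD[OF PI] and RD = subalgD[OF subalg_alg[of Y]]
  define J where "J = sumset P {f * q | q. q \<in> alg Y}"
  have "ideal_of (alg Y) {f * q | q. q \<in> alg Y}"
  proof -
    have "f * a + f * b \<in> {f * q | q. q \<in> alg Y}" if "a \<in> alg Y" "b \<in> alg Y" for a b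
      using that by (auto intro!: exI[of _ "a + b"] simp: distrib_left intro: RD)
    moreover have "r * (f * a) \<in> {f * q | q. q \<in> alg Y}" if "a \<in> alg Y" "r \<in> alg Y" for a r
      using that by (auto intro!: exI[of _ "r * a"] simp: algebra_simps intro: RD)
    moreover have "0 \<in> {f * q | q. q \<in> alg Y}" using RD(4) by (auto intro!: exI[of _ 0])
    ultimately show ?thesis using f(1) unfolding ideal_of_def by (auto intro: RD)
  qed
  then have J: "ideal_of (alg Y) J" unfolding J_def by (intro ideal_of_sumset subalg_alg PI)
  from artin_rees[OF fin J] obtain n :: nat and h d where h: "\<forall>j<n. h j \<in> J"
    "\<forall>k x. x \<in> J \<longrightarrow> x \<in> ipow Y k \<longrightarrow>
       (\<exists>r. x = (\<Sum>j<n. r j * h j) \<and> (\<forall>j<n. r j \<in> ipow Y (k - d j)))"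
    by (elim exE conjE)
  have "\<forall>j. \<exists>pq. j < n \<longrightarrow> h j = fst pq + f * snd pq \<and> fst pq \<in> P \<and> snd pq \<in> alg Y"
    using h(1) unfolding J_def sumset_def by fastforce
  from choice[OF this] obtain pq where
    pq: "\<And>j. j < n \<Longrightarrow> h j = fst (pq j) + f * snd (pq j) \<and> fst (pq j) \<in> P \<and> snd (pq j) \<in> alg Y" by blast
  \<comment> \<open>The sum dominates each single shift \<open>d j\<close>.\<close>
  define c where "c = (\<Sum>j<n. d j)"
  show thesis
  proof (rule that[of c])
    fix k g assume g: "g \<in> alg Y" "f * g \<in> sumset P (ipow Y k)"
    then obtain p z where pz: "f * g = p + z" "p \<in> P" "z \<in> ipow Y k" by (auto simp: sumset_def)
    have "- p + f * g \<in> J" unfolding J_def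
      using pz(2) g(1) ideal_of_minus(1)[OF subalg_alg PI] by (intro sumsetI) auto
    then have "z \<in> J" using pz(1) by simp
    from h(2)[rule_format, OF this pz(3)] obtain r where r: "z = (\<Sum>j<n. r j * h j)" "\<And>j. j < n \<Longrightarrow> r j \<in> ipow Y (k - d j)"
      by blast
    define u where "u = (\<Sum>j<n. r j * snd (pq j))"
    define v where "v = (\<Sum>j<n. r j * fst (pq j))"
    have "z = v + f * u"
      unfolding r(1) u_def v_def sum_distrib_left sum.distrib[symmetric]
      by (intro sum.cong refl) (simp add: pq algebra_simps)
    have u: "u \<in> ipow Y (k - c)" unfolding u_def
    proof (intro ideal_of_sum[OF ideal_of_ipow] ipowD(5))
      fix j assume j: "j \<in> {..<n}"
      then have "d j \<le> c" unfolding c_def by (intro member_le_sum) auto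
      then show "r j \<in> ipow Y (k - c)" using r(2)[of j] j ipow_antimono[OF diff_le_mono2[of "d j" c k], of Y] by auto
    qed (use pq in auto)
    have v: "v \<in> P" unfolding v_def
      using pq by (intro ideal_of_sum[OF PI] PD(4)) (auto intro: ipowD(1)[OF r(2)])
    have "f * (g - u) = p + v" using \<open>z = v + f * u\<close> pz(1) by (simp add: right_diff_distrib)
    then have 1: "f * (g - u) \<in> P" using PD(3) pz(2) v by simp
    have 2: "g - u \<in> alg Y" by (rule RD(7)[OF g(1) ipowD(1)[OF u]])
    have "g - u \<in> P" by (rule prime_ofD(3)[OF P f(1) 2 1 f(2)])
    from sumsetI[OF this u] show "g \<in> sumset P (ipow Y (k - c))" by simp
  qed
qed

end

section \<open>Homogeneous linear systems with more unknowns than equations\<close>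

lemma underdetermined_system_set:
  fixes a :: "nat \<Rightarrow> 'j \<Rightarrow> complex"
  assumes "finite J" "n < card J"
  shows "\<exists>x. (\<exists>j\<in>J. x j \<noteq> 0) \<and> (\<forall>i<n. (\<Sum>j\<in>J. a i j * x j) = 0)"
  using assms
proof (induction n arbitrary: J a)
  case 0
  then obtain j where "j \<in> J" by fastforce
  then show ?case by (intro exI[of _ "\<lambda>_. 1"]) auto
next
  case (Suc n)
  show ?case
  proof (cases "\<forall>j\<in>J. a n j = 0")
    case True
    obtain x where x: "\<exists>j\<in>J. x j \<noteq> 0" "\<forall>i<n. (\<Sum>j\<in>J. a i j * x j) = 0"
      using Suc.IH[of J a] Suc.prems by auto
    with True show ?thesis by (intro exI[of _ x]) (auto simp: less_Suc_eq)
  next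
    case False
    then obtain p where p: "p \<in> J" "a n p \<noteq> 0" by blast
    define J' where "J' = J - {p}"
    have J': "finite J'" "n < card J'" using Suc.prems p by (auto simp: J'_def)
    \<comment> \<open>The pivot column \<open>p\<close> is eliminated from the other equations; the
      last equation then fixes the unknown at \<open>p\<close>.\<close>
    define a' where "a' i j = a i j - a i p * a n j / a n p" for i j
    from Suc.IH[OF J', of a'] obtain x where
      x: "\<exists>j\<in>J'. x j \<noteq> 0" "\<forall>i<n. (\<Sum>j\<in>J'. a' i j * x j) = 0" by blast
    define y where "y = x(p := - (\<Sum>j\<in>J'. a n j * x j) / a n p)"
    have s: "(\<Sum>j\<in>J. a i j * y j) = a i p * y p + (\<Sum>j\<in>J'. a i j * x j)" for i
      using Suc.prems p by (simp add: sum.remove[of J p] J'_def y_def cong: sum.cong_simp)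
    have "(\<Sum>j\<in>J. a n j * y j) = 0" unfolding s using p by (simp add: y_def)
    moreover have "(\<Sum>j\<in>J. a i j * y j) = 0" if "i < n" for i
    proof -
      have "(\<Sum>j\<in>J'. a' i j * x j) = (\<Sum>j\<in>J'. a i j * x j) - a i p * (\<Sum>j\<in>J'. a n j * x j) / a n p"
        by (simp add: a'_def algebra_simps sum_subtractf sum_distrib_left sum_divide_distrib)
      then show ?thesis using x(2) that unfolding s by (simp add: y_def algebra_simps)
    qed
    moreover have "\<exists>j\<in>J. y j \<noteq> 0" using x(1) by (auto simp: y_def J'_def)
    ultimately show ?thesis by (intro exI[of _ y]) (auto simp: less_Suc_eq)
  qed
qed

lemma underdetermined_system:
  fixes a :: "nat \<Rightarrow> nat \<Rightarrow> complex"
  assumes "n < m"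
  obtains x where "\<exists>j<m. x j \<noteq> 0" "\<And>i. i < n \<Longrightarrow> (\<Sum>j<m. a i j * x j) = 0"
  using underdetermined_system_set[of "{..<m}" n a] assms by auto

section \<open>Chains of prime ideals\<close>

context complex_algebra
begin

text \<open>The products \<open>x\<^sub>n\<^sup>a \<cdots> x\<^sub>1\<^sup>b\<close> with exponents below \<open>J\<close>, weighted by \<open>l\<close>; the index in \<open>l\<close> is the
  number with the \<open>J\<close>-adic digits \<open>a, \<dots>, b\<close>.\<close>

fun digit_sum :: "nat \<Rightarrow> (nat \<Rightarrow> 'a) \<Rightarrow> nat \<Rightarrow> (nat \<Rightarrow> complex) \<Rightarrow> 'a" where
  "digit_sum J x 0 l = \<kappa> (l 0)"
| "digit_sum J x (Suc n) l = (\<Sum>a<J. x (Suc n) ^ a * digit_sum J x n (\<lambda>e. l (a * J ^ n + e)))"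

text \<open>Linearity in \<open>l\<close> turns the vanishing of finitely many coordinates of a
  digit sum into a linear system for its coefficients.\<close>

lemma digit_sum_linear:
  assumes "subalg R" "\<And>i. x i \<in> R"
  shows "\<exists>m. (\<forall>e. m e \<in> R) \<and> (\<forall>l. digit_sum J x n l = (\<Sum>e<J ^ n. \<kappa> (l e) * m e))"
proof (induction n)
  case 0
  show ?case using subalgD(5)[OF assms(1)] by (intro exI[of _ "\<lambda>_. 1"]) (simp add: lessThan_Suc)
next
  case (Suc n)
  then obtain m where m: "\<forall>e. m e \<in> R" "\<And>l. digit_sum J x n l = (\<Sum>e<J ^ n. \<kappa> (l e) * m e)" by blast
  \<comment> \<open>The leading digit of \<open>i\<close> is the exponent of
    \<open>x (Suc n)\<close>, the remaining digits index a product of the other elements.\<close>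
  define m' where "m' i = x (Suc n) ^ (i div J ^ n) * m (i mod J ^ n)" for i
  have "digit_sum J x (Suc n) l = (\<Sum>e<J ^ Suc n. \<kappa> (l e) * m' e)" for l
  proof -
    have "digit_sum J x (Suc n) l = (\<Sum>a<J. \<Sum>e<J ^ n. \<kappa> (l (a * J ^ n + e)) * m' (a * J ^ n + e))"
      by (auto simp: m m'_def sum_distrib_left algebra_simps intro!: sum.cong)
    also have "\<dots> = (\<Sum>a<J. \<Sum>e\<in>{a * J ^ n..<a * J ^ n + J ^ n}. \<kappa> (l e) * m' e)"
      using sum.shift_bounds_nat_ivl[of "\<lambda>e. \<kappa> (l e) * m' e" 0 "_ * J ^ n" "J ^ n"]
      by (simp add: lessThan_atLeast0 add.commute)
    also have "\<dots> = (\<Sum>e<J * J ^ n. \<kappa> (l e) * m' e)" by (rule sum.nat_group)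
    finally show ?thesis by simp
  qed
  moreover have "\<forall>e. m' e \<in> R" using m(1) assms subalgD[OF assms(1)] by (auto simp: m'_def)
  ultimately show ?case by blast
qed

lemma digit_sum_zero: "(\<And>e. e < J ^ n \<Longrightarrow> l e = 0) \<Longrightarrow> digit_sum J x n l = 0"
proof (induction n arbitrary: l)
  case (Suc n)
  have "a * J ^ n + e < J ^ Suc n" if "a < J" "e < J ^ n" for a e
  proof -
    have "a * J ^ n + e < Suc a * J ^ n" using that by simp
    also have "\<dots> \<le> J * J ^ n" using that by (intro mult_right_mono) auto
    finally show ?thesis by simp
  qed
  then show ?case using Suc by (auto intro!: sum.neutral)
qed auto

text \<open>Peeling off the lowest monomial, one prime of the chain at a time.\<close>

lemma digit_sum_injective:
  assumes fin: "finite Y"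
    and Q: "\<And>i. i \<le> n \<Longrightarrow> prime_of (alg Y) (Q i)" "\<And>i. i < n \<Longrightarrow> Q (Suc i) \<subseteq> Q i"
    and x: "\<And>i. x i \<in> alg Y" "\<And>i. i < n \<Longrightarrow> x (Suc i) \<in> Q i" 
    and c: "\<And>i k g. i < n \<Longrightarrow> g \<in> alg Y \<Longrightarrow> x (Suc i) * g \<in> sumset (Q (Suc i)) (ipow Y k) \<Longrightarrow>
        g \<in> sumset (Q (Suc i)) (ipow Y (k - c))"
    and proper: "\<And>a. \<kappa> a \<in> sumset (Q 0) (ipow Y 1) \<Longrightarrow> a = 0"
    and mem: "digit_sum J x n l \<in> sumset (Q n) (ipow Y k)" and k: "n * (c * J) < k"
  shows "\<forall>e<J ^ n. l e = 0"
  using Q x c mem k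
proof (induction n arbitrary: l k)
  case 0
  then have "\<kappa> (l 0) \<in> sumset (Q 0) (ipow Y 1)"
    using sumset_mono[OF order_refl[of "Q 0"] ipow_antimono[of 1 k Y]] by auto
  then show ?case using proper by simp
next
  case (Suc n)
  define X where "X = x (Suc n)"
  define g where "g a = digit_sum J x n (\<lambda>e. l (a * J ^ n + e))" for a
  have gR: "g a \<in> alg Y" for a
    using digit_sum_linear[where x = x and J = J and n = n, OF subalg_alg[of Y] Suc.prems(3)] unfolding g_def
    by (auto intro!: subalg_sum[OF subalg_alg] alg.mult alg.const)
  have XR: "X \<in> alg Y" using Suc.prems(3) by (simp add: X_def)
  note RD = subalgD[OF subalg_alg[of Y]]
  have QI: "ideal_of (alg Y) (Q i)" if "i \<le> Suc n" for i using Suc.prems(1)[OF that] by (rule prime_ofD)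
  have SI: "ideal_of (alg Y) (sumset (Q n) (ipow Y k))" for k
    by (intro ideal_of_sumset subalg_alg QI ideal_of_ipow) auto
  have ginv: "\<forall>e<J ^ n. l (a * J ^ n + e) = 0" if "a < J" for a
    using that
  proof (induction a rule: less_induct)
    case (less a)
    \<comment> \<open>The coefficients of lower powers are already known to vanish, so a factor
      \<open>X ^ a\<close> splits off.\<close>
    have "g b = 0" if "b < a" for b
      unfolding g_def using less.IH[OF that] that less.prems by (intro digit_sum_zero) auto
    then have "digit_sum J x (Suc n) l = (\<Sum>b\<in>{a..<J}. X ^ b * g b)"
      unfolding digit_sum.simps X_def[symmetric] g_def[symmetric]
      using less.prems by (intro sum.mono_neutral_right) auto
    also have "\<dots> = X ^ a * (\<Sum>b\<in>{a..<J}. X ^ (b - a) * g b)"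
      unfolding sum_distrib_left by (intro sum.cong refl) (simp flip: power_add mult.assoc)
    finally have eq: "digit_sum J x (Suc n) l = X ^ a * (\<Sum>b\<in>{a..<J}. X ^ (b - a) * g b)" .
    define s where "s = (\<Sum>b\<in>{a..<J}. X ^ (b - a) * g b)"
    have sR: "s \<in> alg Y" unfolding s_def using gR RD(8)[OF XR] by (intro subalg_sum[OF subalg_alg] alg.mult) auto
    \<comment> \<open>Removing one factor \<open>X\<close> costs \<open>c\<close> orders, at most
      \<open>c * J\<close> in all: this is the share of one level in the bound
      \<open>n * (c * J) < k\<close>.\<close>
    have "X ^ d * s \<in> sumset (Q (Suc n)) (ipow Y (k - c * (a - d)))" if "d \<le> a" for d
      using that
    proof (induction rule: inc_induct)
      case base
      then show ?case using Suc.prems(6) eq by (simp add: s_def)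
    next
      case (step d)
      have "X ^ d * s \<in> sumset (Q (Suc n)) (ipow Y (k - c * (a - Suc d) - c))"
        using step.IH by (intro Suc.prems(5)[of n] alg.mult RD(8)[OF XR] sR) (auto simp: X_def mult.assoc)
      moreover have "k - c * (a - Suc d) - c = k - c * (a - d)"
        using step.hyps by (metis Suc_diff_Suc add.commute diff_diff_left mult_Suc_right)
      ultimately show ?case by simp
    qed
    from this[of 0] have "s \<in> sumset (Q (Suc n)) (ipow Y (k - c * a))" by simp
    \<comment> \<open>Modulo the larger prime \<open>Q n\<close> the element \<open>X\<close>
      vanishes, which leaves only \<open>g a\<close>, a digit sum in fewer elements.\<close>
    then have 1: "s \<in> sumset (Q n) (ipow Y (k - c * a))"
      using sumset_mono[OF Suc.prems(2)[of n] order_refl] by blast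
    have "s = X ^ (a - a) * g a + (\<Sum>b\<in>{Suc a..<J}. X ^ (b - a) * g b)"
      unfolding s_def using less.prems by (rule sum.atLeast_Suc_lessThan)
    moreover have "(\<Sum>b\<in>{Suc a..<J}. X ^ (b - a) * g b) \<in> sumset (Q n) (ipow Y (k - c * a))" (is "?t \<in> _")
    proof (intro ideal_of_sum[OF SI] ideal_ofD(5)[OF SI] gR)
      fix b assume "b \<in> {Suc a..<J}"
      then obtain d where d: "b - a = Suc d" by (cases "b - a") auto
      have "X ^ (b - a) \<in> Q n" unfolding d power_Suc X_def
        using Suc.prems(4)[of n] RD(8)[OF XR] by (intro ideal_ofD(5)[OF QI]) (auto simp: X_def)
      from sumsetI[OF this ipowD(2)] show "X ^ (b - a) \<in> sumset (Q n) (ipow Y (k - c * a))" by simp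
    qed
    ultimately have 2: "g a = s - ?t" "?t \<in> sumset (Q n) (ipow Y (k - c * a))" by simp_all
    have "g a \<in> sumset (Q n) (ipow Y (k - c * a))"
      unfolding 2(1) by (rule ideal_of_minus(2)[OF subalg_alg SI 1 2(2)])
    moreover have "n * (c * J) < k - c * a"
    proof -
      have "c * a \<le> c * J" using less.prems by simp
      moreover have "n * (c * J) + c * J < k" using Suc.prems(7) by simp
      ultimately show ?thesis by linarith
    qed
    ultimately show ?case unfolding g_def
      using Suc.prems by (intro Suc.IH[where k = "k - c * a"]) auto
  qed
  show ?case
  proof (intro allI impI)
    fix e assume e: "e < J ^ Suc n"
    then have "J ^ n > 0" "e div J ^ n < J" by (auto simp: less_mult_imp_div_less intro!: Nat.gr0I)
    moreover from this have "e mod J ^ n < J ^ n" by simp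
    ultimately have "l (e div J ^ n * J ^ n + e mod J ^ n) = 0" using ginv by blast
    then show "l e = 0" by (simp only: div_mult_mod_eq)
  qed
qed

text \<open>A chain of four proper inclusions would make too many monomials independent modulo a power
  of the maximal ideal.\<close>

theorem no_long_prime_chain:
  assumes fin: "finite Y"
    and Q: "\<And>i. i \<le> 4 \<Longrightarrow> prime_of (alg Y) (Q i)" "\<And>i. i < 4 \<Longrightarrow> Q (Suc i) \<subset> Q i" "K \<subseteq> Q 4"
    and proper: "\<And>a. \<kappa> a \<in> sumset (Q 0) (ipow Y 1) \<Longrightarrow> a = 0"
    and coords: "\<And>k. \<exists>t :: 'a \<Rightarrow> nat \<Rightarrow> complex.
      (\<forall>a\<in>alg Y. \<forall>b\<in>alg Y. \<forall>i. t (a + b) i = t a i + t b i) \<and>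
      (\<forall>c. \<forall>a\<in>alg Y. \<forall>i. t (\<kappa> c * a) i = c * t a i) \<and>
      (\<forall>a\<in>alg Y. (\<forall>i<k ^ 3. t a i = 0) \<longrightarrow> a \<in> sumset K (ipow Y k))"
  shows False
proof -
  note RD = subalgD[OF subalg_alg[of Y]]
  have "\<forall>i. \<exists>y. i < 4 \<longrightarrow> y \<in> Q i \<and> y \<notin> Q (Suc i)" using Q(2) by blast
  from choice[OF this] obtain y where y: "\<And>i. i < 4 \<Longrightarrow> y i \<in> Q i \<and> y i \<notin> Q (Suc i)" by blast
  \<comment> \<open>\<open>x (Suc i)\<close> witnesses that \<open>Q (Suc i)\<close> is a proper
    subset of \<open>Q i\<close>; the default \<open>0\<close> keeps all values inside
    \<open>alg Y\<close>.\<close>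
  define x where "x i = (if 0 < i \<and> i \<le> 4 then y (i - 1) else 0)" for i
  have xR: "x i \<in> alg Y" for i
  proof (cases "0 < i \<and> i \<le> 4")
    case True
    then have "y (i - 1) \<in> Q (i - 1)" using y[of "i - 1"] by auto
    with True show ?thesis using ideal_ofD(1)[OF prime_ofD(1)[OF Q(1)[of "i - 1"]]] by (auto simp: x_def)
  qed (use RD(4) in \<open>auto simp: x_def\<close>)
  have x: "x (Suc i) \<in> Q i" "x (Suc i) \<notin> Q (Suc i)" if "i < 4" for i
    using y[OF that] that by (auto simp: x_def)
  have "\<exists>c. \<forall>k g. g \<in> alg Y \<longrightarrow> x (Suc i) * g \<in> sumset (Q (Suc i)) (ipow Y k) \<longrightarrow>
      g \<in> sumset (Q (Suc i)) (ipow Y (k - c))" if "i < 4" for i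
  proof -
    have "Suc i \<le> 4" using that by simp
    from prime_quotient_bound[OF fin Q(1)[OF this] xR x(2)[OF that]] show ?thesis by metis
  qed
  then have "\<forall>i. \<exists>c. i < 4 \<longrightarrow> (\<forall>k g. g \<in> alg Y \<longrightarrow> x (Suc i) * g \<in> sumset (Q (Suc i)) (ipow Y k) \<longrightarrow>
      g \<in> sumset (Q (Suc i)) (ipow Y (k - c)))" by blast
  from choice[OF this] obtain d where d: "\<And>i k g. i < 4 \<Longrightarrow> g \<in> alg Y \<Longrightarrow>
      x (Suc i) * g \<in> sumset (Q (Suc i)) (ipow Y k) \<Longrightarrow> g \<in> sumset (Q (Suc i)) (ipow Y (k - d i))" by blast
  define c where "c = d 0 + d 1 + d 2 + d 3"
  have c: "g \<in> sumset (Q (Suc i)) (ipow Y (k - c))"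
    if "i < 4" "g \<in> alg Y" "x (Suc i) * g \<in> sumset (Q (Suc i)) (ipow Y k)" for i k g
  proof -
    have "i = 0 \<or> i = 1 \<or> i = 2 \<or> i = 3" using that(1) by arith
    then have "d i \<le> c" unfolding c_def by auto
    from ipow_antimono[OF diff_le_mono2[OF this]] sumset_mono[OF order_refl] d[OF that] show ?thesis by blast
  qed
  \<comment> \<open>\<open>k\<close> is one more than the total loss \<open>4 * (c * J)\<close>,
    hence at most \<open>(4 * c + 1) * J\<close>; this \<open>J\<close> makes \<open>k ^ 3\<close>
    smaller than \<open>J ^ 4\<close>, so there are more products than linear conditions.\<close>
  define J where "J = (4 * c + 1) ^ 3 + 1"
  define k where "k = 4 * (c * J) + 1"
  have "k ^ 3 < J ^ 4"
  proof -
    have "k \<le> (4 * c + 1) * J" by (simp add: k_def algebra_simps J_def)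
    then have "k ^ 3 \<le> ((4 * c + 1) * J) ^ 3" by (rule power_mono) simp
    also have "\<dots> = (4 * c + 1) ^ 3 * J ^ 3" by (rule power_mult_distrib)
    also have "\<dots> < J * J ^ 3" by (intro mult_strict_right_mono) (auto simp: J_def)
    also have "\<dots> = J ^ 4" by (simp add: power4_eq_xxxx power3_eq_cube)
    finally show ?thesis .
  qed
  obtain m where m: "\<forall>e. m e \<in> alg Y" "\<And>l. digit_sum J x 4 l = (\<Sum>e<J ^ 4. \<kappa> (l e) * m e)"
    using digit_sum_linear[where x = x and J = J and n = 4, OF subalg_alg xR] by blast
  obtain t where t: "\<And>a b i. a \<in> alg Y \<Longrightarrow> b \<in> alg Y \<Longrightarrow> t (a + b) i = t a i + t b i"
    "\<And>c a i. a \<in> alg Y \<Longrightarrow> t (\<kappa> c * a) i = c * t a i"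
    "\<And>a. a \<in> alg Y \<Longrightarrow> \<forall>i<k ^ 3. t a i = 0 \<Longrightarrow> a \<in> sumset K (ipow Y k)"
    using coords[of k] by blast
  obtain l where l: "\<exists>e<J ^ 4. l e \<noteq> 0" "\<And>i. i < k ^ 3 \<Longrightarrow> (\<Sum>e<J ^ 4. t (m e) i * l e) = 0"
    using underdetermined_system[OF \<open>k ^ 3 < J ^ 4\<close>, of "\<lambda>i e. t (m e) i"] by blast
  have sR: "(\<Sum>e<n. \<kappa> (l e) * m e) \<in> alg Y" for n :: nat
    using m(1) by (intro subalg_sum[OF subalg_alg] alg.mult alg.const) auto
  have tsum: "t (\<Sum>e<n. \<kappa> (l e) * m e) i = (\<Sum>e<n. t (m e) i * l e)" for n i
  proof (induction n)
    case 0
    show ?case using t(2)[OF RD(4), of 0 i] by simp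
  next
    case (Suc n)
    then show ?case using t(1)[OF sR alg.mult[OF alg.const], of "m n" n "l n" i] m(1) t(2) by simp
  qed
  have "digit_sum J x 4 l \<in> sumset K (ipow Y k)"
    unfolding m(2) using l(2) by (intro t(3) sR) (simp add: tsum)
  then have mem: "digit_sum J x 4 l \<in> sumset (Q 4) (ipow Y k)"
    using sumset_mono[OF Q(3) order_refl] by blast
  have "\<forall>e<J ^ 4. l e = 0"
    by (rule digit_sum_injective[OF fin Q(1) _ xR x(1) c proper mem]) (use Q(2) in \<open>auto simp: k_def\<close>)
  with l(1) show False by blast
qed

end

section \<open>Formal charts\<close>

text \<open>Substitution of \<open>t\<close> for the variable of a power series, cut off at
  \<open>k\<close>. Nested three times, it evaluates series in three variables by ring operations
  alone.\<close>

definition trunc_eval :: "nat \<Rightarrow> 'a::comm_ring_1 \<Rightarrow> ('b::comm_ring_1 \<Rightarrow> 'a) \<Rightarrow> 'b fps \<Rightarrow> 'a" where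
  "trunc_eval k t \<phi> F = (\<Sum>i<k. \<phi> (F $$$ i) * t ^ i)"

lemma trunc_eval_add:
  "(\<And>a b. \<phi> (a + b) = \<phi> a + \<phi> b) \<Longrightarrow> trunc_eval k t \<phi> (F + G) = trunc_eval k t \<phi> F + trunc_eval k t \<phi> G"
  by (simp add: trunc_eval_def sum.distrib distrib_right)

lemma trunc_eval_const:
  assumes "\<phi> 0 = 0" "0 < k" shows "trunc_eval k t \<phi> (fps_const c) = \<phi> c"
proof -
  have "trunc_eval k t \<phi> (fps_const c) = (\<Sum>i<k. if i = 0 then \<phi> c else 0)"
    unfolding trunc_eval_def by (intro sum.cong refl) (auto simp: assms)
  then show ?thesis using assms by simp
qed

lemma trunc_eval_fps_X:
  assumes "\<phi> 0 = 0" shows "trunc_eval k t \<phi> fps_X = (if 1 < k then \<phi> 1 * t else 0)"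
proof -
  have "trunc_eval k t \<phi> fps_X = (\<Sum>i<k. if i = 1 then \<phi> 1 * t else 0)"
    unfolding trunc_eval_def by (intro sum.cong refl) (auto simp: assms fps_X_def)
  then show ?thesis by simp
qed

text \<open>The products lost by truncation contain \<open>t ^ k\<close>. Multiplicativity of
  \<open>\<phi>\<close> is asked only modulo \<open>S\<close>, which permits nesting.\<close>

lemma (in complex_algebra) trunc_eval_mult:
  assumes R: "subalg R" and S: "ideal_of R S" and t: "t \<in> R" "t ^ k \<in> S"
    and \<phi>: "\<And>a. \<phi> a \<in> R" "\<And>a b. \<phi> (a + b) = \<phi> a + \<phi> b" "\<And>a b. \<phi> (a * b) - \<phi> a * \<phi> b \<in> S"
  shows "trunc_eval k t \<phi> (F * G) - trunc_eval k t \<phi> F * trunc_eval k t \<phi> G \<in> S"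
proof -
  note RD = subalgD[OF R] and SD = ideal_ofD[OF S]
  have \<phi>0: "\<phi> 0 = 0" using \<phi>(2)[of 0 0] by simp
  have \<phi>s: "\<phi> (sum f A) = (\<Sum>i\<in>A. \<phi> (f i))" for f :: "nat \<Rightarrow> _" and A
    by (induction A rule: infinite_finite_induct) (auto simp: \<phi>0 \<phi>)
  define P where "P = {(i, j). i + j < k}"
  define B where "B = {..<k} \<times> {..<k}"
  define m where "m = (\<lambda>(i, j). \<phi> (F $$$ i) * \<phi> (G $$$ j) * t ^ (i + j))"
  have PB: "P \<subseteq> B" "finite B" by (auto simp: P_def B_def)
  have "trunc_eval k t \<phi> (F * G) = (\<Sum>n<k. \<Sum>i\<le>n. \<phi> (F $$$ i * G $$$ (n - i)) * t ^ n)"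
    unfolding trunc_eval_def by (simp add: fps_mult_nth \<phi>s sum_distrib_right atLeast0AtMost)
  also have "\<dots> = (\<Sum>n<k. \<Sum>i\<le>n. (\<lambda>i j. \<phi> (F $$$ i * G $$$ j) * t ^ (i + j)) i (n - i))"
    by (intro sum.cong refl) auto
  also have "\<dots> = (\<Sum>(i, j)\<in>P. \<phi> (F $$$ i * G $$$ j) * t ^ (i + j))"
    unfolding P_def by (rule sum.triangle_reindex[symmetric])
  finally have 1: "trunc_eval k t \<phi> (F * G) = (\<Sum>(i, j)\<in>P. \<phi> (F $$$ i * G $$$ j) * t ^ (i + j))" .
  have 2: "trunc_eval k t \<phi> F * trunc_eval k t \<phi> G = sum m B"
    by (simp add: trunc_eval_def sum_product sum.cartesian_product m_def power_add algebra_simps B_def)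
  have "sum m B = sum m P + sum m (B - P)" using PB by (metis add.commute sum.subset_diff)
  moreover have B: "sum m (B - P) \<in> S"
  proof (intro ideal_of_sum[OF S])
    fix x assume x: "x \<in> B - P"
    obtain i j where ij: "x = (i, j)" by (cases x)
    then have "k \<le> i + j" using x by (auto simp: P_def B_def)
    then have "t ^ (i + j) = t ^ (i + j - k) * t ^ k" by (simp flip: power_add)
    moreover have "t ^ (i + j - k) * t ^ k \<in> S" using t RD(8) by (intro SD(4)) auto
    ultimately show "m x \<in> S" using \<phi>(1) RD by (auto simp: m_def ij intro!: SD(4))
  qed
  moreover have A: "trunc_eval k t \<phi> (F * G) - sum m P \<in> S"
  proof -
    have "trunc_eval k t \<phi> (F * G) - sum m P =
        (\<Sum>(i, j)\<in>P. (\<phi> (F $$$ i * G $$$ j) - \<phi> (F $$$ i) * \<phi> (G $$$ j)) * t ^ (i + j))"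
      unfolding 1 m_def sum_subtractf[symmetric] by (intro sum.cong refl) (auto simp: algebra_simps)
    also have "\<dots> \<in> S" using RD(8) t(1) \<phi>(3) by (intro ideal_of_sum[OF S]) (auto intro!: SD(5))
    finally show ?thesis .
  qed
  from ideal_of_minus(2)[OF R S A B] show ?thesis unfolding 2 \<open>sum m B = _\<close> by (simp add: algebra_simps)
qed

text \<open>The identity theorem for polynomials in one variable, applied to \<open>u\<close>,
  \<open>v\<close> and \<open>w\<close> in turn.\<close>

lemma trinomials_independent:
  fixes c :: "nat \<Rightarrow> nat \<Rightarrow> nat \<Rightarrow> complex"
  assumes "\<And>u v w. (\<Sum>i<k. \<Sum>j<k. \<Sum>l<k. c i j l * (u ^ i * v ^ j * w ^ l)) = 0" and "i < k" "j < k" "l < k"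
  shows "c i j l = 0"
proof -
  have poly0: "f i = 0" if 0: "\<And>x. (\<Sum>i<k. f i * x ^ i) = 0" and i: "i < k" for f :: "nat \<Rightarrow> complex" and i
  proof -
    obtain n where n: "k = Suc n" using i by (cases k) auto
    have "\<forall>x. (\<Sum>i\<le>n. f i * x ^ i) = 0" using 0 by (simp add: n lessThan_Suc_atMost)
    then show ?thesis using i by (simp add: polyfun_eq_0 n less_Suc_eq_le)
  qed
  have "(\<Sum>j<k. \<Sum>l<k. c i j l * (v ^ j * w ^ l)) = 0" for v w
  proof (rule poly0[OF _ assms(2)])
    show "(\<Sum>i<k. (\<Sum>j<k. \<Sum>l<k. c i j l * (v ^ j * w ^ l)) * u ^ i) = 0" for u
      using assms(1)[of u v w] by (simp add: sum_distrib_left sum_distrib_right mult_ac)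
  qed
  then have "(\<Sum>j<k. (\<Sum>l<k. c i j l * w ^ l) * v ^ j) = 0" for v w
    by (simp add: sum_distrib_left sum_distrib_right mult_ac)
  then have "(\<Sum>l<k. c i j l * w ^ l) = 0" for w
    by (rule poly0[OF _ assms(3)])
  then show ?thesis by (rule poly0[OF _ assms(4)])
qed

lemma fps_X_power_dvd_iff: "fps_X ^ n dvd f \<longleftrightarrow> (\<forall>i<n. f $$$ i = 0)" for f :: "'a::comm_ring_1 fps"
proof
  assume "\<forall>i<n. f $$$ i = 0"
  then have "f = fps_X ^ n * fps_shift n f"
    by (intro fps_ext) (simp add: fps_X_power_mult_nth)
  then show "fps_X ^ n dvd f" by (rule dvdI)
qed (auto simp: fps_X_power_mult_nth elim!: dvdE)

text \<open>The quotient of \<open>alg Y\<close> by \<open>K\<close> has at the origin the tangent directions \<open>t1, t2, t3\<close> and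
  enough arcs \<open>\<psi>\<close> through the origin; being of order two in \<open>Y\<close>, these separate the leading forms.\<close>

locale formal_chart = complex_algebra \<kappa> for \<kappa> :: "complex \<Rightarrow> 'a::comm_ring_1" +
  fixes Y K :: "'a set" and t1 t2 t3 :: 'a
  assumes fin: "finite Y" and K: "ideal_of (alg Y) K"
    and t: "t1 \<in> ipow Y 1" "t2 \<in> ipow Y 1" "t3 \<in> ipow Y 1"
    and tangent: "y \<in> Y \<Longrightarrow> \<exists>a b c. y - (\<kappa> a * t1 + \<kappa> b * t2 + \<kappa> c * t3) \<in> sumset K (ipow Y 2)"
    and arcs: "\<exists>\<psi> :: 'a \<Rightarrow> complex fps.
      (\<forall>a\<in>alg Y. \<forall>b\<in>alg Y. \<psi> (a + b) = \<psi> a + \<psi> b \<and> \<psi> (a * b) = \<psi> a * \<psi> b) \<and>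
      (\<forall>c. \<psi> (\<kappa> c) = fps_const c) \<and> (\<forall>a\<in>K. \<psi> a = 0) \<and> (\<forall>y\<in>Y. \<psi> y $$$ 0 = 0 \<and> \<psi> y $$$ 1 = 0) \<and>
      \<psi> t1 $$$ 2 = u \<and> \<psi> t2 $$$ 2 = v \<and> \<psi> t3 $$$ 2 = w"
begin

abbreviation "R \<equiv> alg Y"

text \<open>The powers of the ideal generated by \<open>Y\<close> in the quotient by
  \<open>K\<close>, pulled back to \<open>R\<close>.\<close>

definition fil :: "nat \<Rightarrow> 'a set" where "fil k = sumset K (ipow Y k)"

lemmas R = subalg_alg[of Y]
lemmas RD = subalgD[OF R]

lemma ideal_of_fil: "ideal_of R (fil k)"
  unfolding fil_def by (intro ideal_of_sumset R K ideal_of_ipow)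

lemmas filD = ideal_ofD[OF ideal_of_fil] ideal_of_minus[OF R ideal_of_fil]

lemma K_fil: "a \<in> K \<Longrightarrow> a \<in> fil k"
  using sumsetI[of a K 0 "ipow Y k"] ipowD(2) by (simp add: fil_def)

lemma ipow_fil: "a \<in> ipow Y k \<Longrightarrow> a \<in> fil k"
  using sumsetI[of 0 K a "ipow Y k"] ideal_ofD(2)[OF K] by (simp add: fil_def)

lemma fil_0: "fil 0 = R"
  using filD(1) ipow_fil[of _ 0] by auto

lemma fil_antimono: "i \<le> j \<Longrightarrow> fil j \<subseteq> fil i"
  unfolding fil_def by (intro sumset_mono order_refl ipow_antimono)

lemma fil_mult:
  assumes "a \<in> fil i" "b \<in> fil j" shows "a * b \<in> fil (i + j)"
proof -
  obtain p q p' q' where *: "a = p + q" "p \<in> K" "q \<in> ipow Y i" "b = p' + q'" "p' \<in> K" "q' \<in> ipow Y j"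
    using assms by (auto simp: fil_def sumset_def)
  have "a * b = (p * (p' + q') + q * p') + q * q'" by (simp add: * algebra_simps)
  moreover have "p * (p' + q') + q * p' \<in> K"
    using * ideal_ofD[OF K] ipowD(1) RD by (intro ideal_ofD(3)[OF K] ideal_ofD(4)[OF K] ideal_ofD(5)[OF K]) auto
  moreover have "q * q' \<in> ipow Y (i + j)" using * by (intro ipow_mult)
  ultimately show ?thesis unfolding fil_def by (auto intro: sumsetI)
qed

lemma tR: "t1 \<in> R" "t2 \<in> R" "t3 \<in> R"
  using t ipowD(1) by blast+

lemma t_fil: "t1 \<in> fil 1" "t2 \<in> fil 1" "t3 \<in> fil 1"
  using t ipow_fil by blast+

lemma fil_power: "a \<in> fil 1 \<Longrightarrow> a ^ k \<in> fil k"
  by (induction k) (use fil_0 RD(5) fil_mult[of a 1] in auto)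

definition mon :: "nat \<Rightarrow> nat \<Rightarrow> nat \<Rightarrow> 'a" where "mon i j l = t1 ^ i * t2 ^ j * t3 ^ l"

lemma mon_fil: "k \<le> i + j + l \<Longrightarrow> mon i j l \<in> fil k"
  unfolding mon_def using fil_mult[OF fil_mult[OF fil_power fil_power] fil_power, OF t_fil] fil_antimono by blast

text \<open>The outermost variable stands for \<open>t1\<close>, the innermost for
  \<open>t3\<close>.\<close>

definition ev :: "nat \<Rightarrow> complex fps fps fps \<Rightarrow> 'a" where
  "ev k F = trunc_eval k t1 (trunc_eval k t2 (trunc_eval k t3 \<kappa>)) F"

lemma ev_sum: "ev k F = (\<Sum>i<k. \<Sum>j<k. \<Sum>l<k. \<kappa> (F $$$ i $$$ j $$$ l) * mon i j l)"
  by (simp add: ev_def trunc_eval_def mon_def sum_distrib_left sum_distrib_right mult_ac)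

lemma ev_add: "ev k (F + G) = ev k F + ev k G"
  unfolding ev_def by (intro trunc_eval_add scalar_add)

lemma ev_0: "ev k 0 = 0"
  by (simp add: ev_sum)

lemma ev_diff: "ev k (F - G) = ev k F - ev k G"
  using ev_add[of k "F - G" G] by simp

lemma ev_mult: "ev k (F * G) - ev k F * ev k G \<in> fil k"
proof -
  have 1: "trunc_eval k t3 \<kappa> F \<in> R" for F
    using tR RD alg.const by (auto simp: trunc_eval_def intro!: subalg_sum[OF R])
  have 2: "trunc_eval k t2 (trunc_eval k t3 \<kappa>) F \<in> R" for F
    using tR RD 1 by (auto simp: trunc_eval_def[of _ t2] intro!: subalg_sum[OF R])
  show ?thesis unfolding ev_def
    by (intro trunc_eval_mult[OF R ideal_of_fil] trunc_eval_add scalar_add 1 2 fil_power t_fil tR alg.const)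
      (simp add: scalar_mult filD(2))
qed

lemma ev_const: "0 < k \<Longrightarrow> ev k (fps_const (fps_const (fps_const c))) = \<kappa> c"
  unfolding ev_def by (subst trunc_eval_const; simp add: trunc_eval_def[of _ _ _ 0] trunc_eval_const)+

lemma evR: "ev k F \<in> R"
  unfolding ev_sum mon_def using tR by (intro subalg_sum[OF R] alg.mult RD(8) alg.const)

lemma ev_fil:
  assumes "\<And>i j l. i + j + l < k' \<Longrightarrow> F $$$ i $$$ j $$$ l = 0"
  shows "ev k F \<in> fil k'"
proof -
  have "\<kappa> (F $$$ i $$$ j $$$ l) * mon i j l \<in> fil k'" for i j l
    using mon_fil[of k' i j l] assms[of i j l] filD(2) by (cases "i + j + l < k'") (auto intro!: filD(4) alg.const)
  then show ?thesis unfolding ev_sum by (intro ideal_of_sum[OF ideal_of_fil])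
qed

text \<open>Every additional term has some exponent at least \<open>k'\<close>.\<close>

lemma ev_ev:
  assumes "k' \<le> k" shows "ev k F - ev k' F \<in> fil k'"
proof -
  define g where "g = (\<lambda>(i, j, l). \<kappa> (F $$$ i $$$ j $$$ l) * mon i j l)"
  define B where "B k = {..<k} \<times> {..<k} \<times> {..<k::nat}" for k
  have e: "ev k F = sum g (B k)" for k
    by (simp add: ev_sum g_def B_def sum.cartesian_product)
  have "B k' \<subseteq> B k" "finite (B k)" using assms by (auto simp: B_def)
  then have "ev k F - ev k' F = sum g (B k - B k')" unfolding e by (simp add: sum_diff)
  also have "\<dots> \<in> fil k'"
    by (intro ideal_of_sum[OF ideal_of_fil]) (auto simp: B_def g_def intro!: filD(4) mon_fil alg.const)
  finally show ?thesis .
qed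

text \<open>Testing on arcs: the coefficient of order \<open>2 n\<close> on the arc is the form of degree \<open>n\<close>.\<close>

lemma ev_nondegenerate:
  assumes "ev k F \<in> fil k" "i + j + l < k"
  shows "F $$$ i $$$ j $$$ l = 0"
  using assms(2)
proof (induction "i + j + l" arbitrary: i j l rule: less_induct)
  case less
  define n where "n = i + j + l"
  have low: "F $$$ i' $$$ j' $$$ l' = 0" if "i' + j' + l' < n" for i' j' l'
    using less.hyps that less.prems by (simp add: n_def)
  \<comment> \<open>The homogeneous part of the lowest degree not yet known to vanish.\<close>
  define c where "c i j l = (if i + j + l = n then F $$$ i $$$ j $$$ l else 0)" for i j l
  have "(\<Sum>i<k. \<Sum>j<k. \<Sum>l<k. c i j l * (u ^ i * v ^ j * w ^ l)) = 0" for u v w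
  proof -
    obtain \<psi> :: "'a \<Rightarrow> complex fps" where
      \<psi>': "\<forall>a\<in>R. \<forall>b\<in>R. \<psi> (a + b) = \<psi> a + \<psi> b \<and> \<psi> (a * b) = \<psi> a * \<psi> b"
      "\<forall>c. \<psi> (\<kappa> c) = fps_const c" "\<forall>a\<in>K. \<psi> a = 0" "\<forall>y\<in>Y. \<psi> y $$$ 0 = 0 \<and> \<psi> y $$$ 1 = 0"
      and uvw: "\<psi> t1 $$$ 2 = u" "\<psi> t2 $$$ 2 = v" "\<psi> t3 $$$ 2 = w"
      using arcs[of u v w] by blast
    from \<psi>' have \<psi>: "\<And>a b. a \<in> R \<Longrightarrow> b \<in> R \<Longrightarrow> \<psi> (a + b) = \<psi> a + \<psi> b"
      "\<And>a b. a \<in> R \<Longrightarrow> b \<in> R \<Longrightarrow> \<psi> (a * b) = \<psi> a * \<psi> b"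
      "\<And>c. \<psi> (\<kappa> c) = fps_const c" "\<And>a. a \<in> K \<Longrightarrow> \<psi> a = 0" "\<And>y. y \<in> Y \<Longrightarrow> \<psi> y $$$ 0 = 0 \<and> \<psi> y $$$ 1 = 0"
      by auto
    have \<psi>0: "\<psi> 0 = 0" using \<psi>(3)[of 0] by simp
    have \<psi>s: "\<psi> (sum f A) = (\<Sum>x\<in>A. \<psi> (f x))" if "\<And>x. x \<in> A \<Longrightarrow> f x \<in> R" for f :: "'x \<Rightarrow> 'a" and A
      using that by (induction A rule: infinite_finite_induct) (auto simp: \<psi>0 \<psi>(1) subalg_sum[OF R])
    have \<psi>p: "\<psi> (a ^ m) = \<psi> a ^ m" if "a \<in> R" for a m
      using that \<psi>(3)[of 1] by (induction m) (auto simp: \<psi>(2) RD(8))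
    \<comment> \<open>Elements of \<open>Y\<close> have order at least two on the arc, which doubles
      the order of every power.\<close>
    have dvd: "fps_X ^ (2 * m) dvd \<psi> a" if "a \<in> ipow Y m" for a m
      using that
    proof (induction m arbitrary: a)
      case (Suc m)
      then obtain c where c: "a = (\<Sum>y\<in>Y. y * c y)" "\<forall>y. c y \<in> ipow Y m" by auto
      have "fps_X ^ 2 dvd \<psi> y" if "y \<in> Y" for y
        using \<psi>(5)[OF that] by (auto simp: fps_X_power_dvd_iff less_2_cases_iff)
      moreover have "fps_X ^ (2 * m) dvd \<psi> (c y)" for y using Suc.IH c by simp
      ultimately have "fps_X ^ 2 * fps_X ^ (2 * m) dvd \<psi> y * \<psi> (c y)" if "y \<in> Y" for y
        using that by (intro mult_dvd_mono)
      then have "fps_X ^ (2 * Suc m) dvd \<psi> y * \<psi> (c y)" if "y \<in> Y" for y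
        using that by (simp only: mult_Suc_right power_add)
      moreover have "\<psi> a = (\<Sum>y\<in>Y. \<psi> y * \<psi> (c y))"
        unfolding c(1) using c(2) ipowD(1) by (subst \<psi>s) (auto intro!: sum.cong \<psi>(2) alg.mult intro: alg.gen)
      ultimately show ?case by (auto intro!: dvd_sum)
    qed simp
    have "fps_X ^ (2 * k) dvd \<psi> (ev k F)"
    proof -
      obtain p q where pq: "ev k F = p + q" "p \<in> K" "q \<in> ipow Y k" using assms(1) by (auto simp: fil_def sumset_def)
      then have "\<psi> (ev k F) = \<psi> q" using \<psi>(1,4) ideal_ofD(1)[OF K] ipowD(1) by simp
      then show ?thesis using dvd pq by simp
    qed
    then have "\<psi> (ev k F) $$$ (2 * n) = 0"
      using less.prems by (simp add: fps_X_power_dvd_iff n_def)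
    moreover have "\<exists>A. \<psi> a = fps_X ^ 2 * A \<and> A $$$ 0 = \<psi> a $$$ 2" if "a \<in> ipow Y 1" for a
    proof -
      have "fps_X ^ 2 dvd \<psi> a" using dvd[of a 1] that by (simp only: mult_1_right)
      then obtain A where A: "\<psi> a = fps_X ^ 2 * A" unfolding dvd_def by blast
      then have "\<psi> a $$$ 2 = A $$$ 0" by (simp add: fps_X_power_mult_nth)
      with A show ?thesis by auto
    qed
    from this[OF t(1)] this[OF t(2)] this[OF t(3)] obtain A B C where
      ABC: "\<psi> t1 = fps_X ^ 2 * A" "A $$$ 0 = u" "\<psi> t2 = fps_X ^ 2 * B" "B $$$ 0 = v" "\<psi> t3 = fps_X ^ 2 * C" "C $$$ 0 = w"
      using uvw by auto
    \<comment> \<open>Terms of degree above \<open>n\<close> start beyond order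
      \<open>2 * n\<close>, and those of lower degree vanish by induction.\<close>
    have "\<psi> (\<kappa> (F $$$ i $$$ j $$$ l) * mon i j l) $$$ (2 * n) = c i j l * (u ^ i * v ^ j * w ^ l)" for i j l
    proof -
      have "\<psi> (\<kappa> (F $$$ i $$$ j $$$ l) * mon i j l) = fps_X ^ (2 * (i + j + l)) * (fps_const (F $$$ i $$$ j $$$ l) * (A ^ i * B ^ j * C ^ l))"
      proof -
        have p: "(fps_X ^ 2 * A) ^ i = fps_X ^ (2 * i) * A ^ i" for A :: "complex fps" and i
          by (simp add: power_mult_distrib flip: power_mult)
        have "\<psi> (\<kappa> (F $$$ i $$$ j $$$ l) * mon i j l) = fps_const (F $$$ i $$$ j $$$ l) * (\<psi> t1 ^ i * \<psi> t2 ^ j * \<psi> t3 ^ l)"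
          unfolding mon_def using tR by (simp add: \<psi>(2,3) \<psi>p RD alg.const alg.mult)
        also have "\<dots> = fps_X ^ (2 * (i + j + l)) * (fps_const (F $$$ i $$$ j $$$ l) * (A ^ i * B ^ j * C ^ l))"
          unfolding ABC p by (simp add: power_add distrib_left mult_ac)
        finally show ?thesis .
      qed
      then have "\<psi> (\<kappa> (F $$$ i $$$ j $$$ l) * mon i j l) $$$ (2 * n) =
        (if n < i + j + l then 0 else (fps_const (F $$$ i $$$ j $$$ l) * (A ^ i * B ^ j * C ^ l)) $$$ (2 * n - 2 * (i + j + l)))"
        by (simp add: fps_X_power_mult_nth del: fps_mult_left_const_nth)
      also have "\<dots> = c i j l * (u ^ i * v ^ j * w ^ l)"
        using low[of i j l] by (cases "i + j + l" n rule: linorder_cases) (auto simp: c_def ABC fps_nth_power_0)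
      finally show ?thesis .
    qed
    moreover have "\<psi> (ev k F) = (\<Sum>i<k. \<Sum>j<k. \<Sum>l<k. \<psi> (\<kappa> (F $$$ i $$$ j $$$ l) * mon i j l))"
      unfolding ev_sum using tR
      by (simp add: \<psi>s subalg_sum[OF R] alg.mult alg.const RD mon_def)
    ultimately show ?thesis by (simp add: fps_sum_nth)
  qed
  from trinomials_independent[where c = c and k = k and i = i and j = j and l = l, OF this] less.prems show ?case by (simp add: c_def n_def)
qed

text \<open>The product \<open>y * a\<close> is replaced by the linear approximation of
  \<open>y\<close> times the given approximation of \<open>a\<close>; in both error terms one factor
  contributes an extra order.\<close>

lemma tangent_ipow:
  assumes "y \<in> Y" "\<And>k' a'. k' = k \<Longrightarrow> a' \<in> ipow Y k \<Longrightarrow> \<exists>r\<in>alg {t1, t2, t3}. a' - r \<in> fil (Suc k)" "a \<in> ipow Y k"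
  shows "\<exists>r\<in>alg {t1, t2, t3}. y * a - r \<in> fil (Suc (Suc k))"
proof -
  obtain r where r: "r \<in> alg {t1, t2, t3}" "a - r \<in> fil (Suc k)" using assms by blast
  obtain b1 b2 b3 where b: "y - (\<kappa> b1 * t1 + \<kappa> b2 * t2 + \<kappa> b3 * t3) \<in> fil 2"
    using tangent[OF assms(1)] unfolding fil_def by blast
  define s where "s = \<kappa> b1 * t1 + \<kappa> b2 * t2 + \<kappa> b3 * t3"
  have "s \<in> fil 1" unfolding s_def using t_fil by (intro filD(3) filD(4) alg.const)
  then have "s * (a - r) \<in> fil (Suc (Suc k))" using fil_mult[OF _ r(2), of s 1] by simp
  moreover have "(y - s) * a \<in> fil (Suc (Suc k))"
    using fil_mult[OF b ipow_fil[OF assms(3)]] by (simp add: s_def)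
  ultimately have "s * (a - r) + (y - s) * a \<in> fil (Suc (Suc k))" by (rule filD(3))
  then have "y * a - s * r \<in> fil (Suc (Suc k))" by (simp add: algebra_simps)
  moreover have "s * r \<in> alg {t1, t2, t3}"
    unfolding s_def by (intro alg.mult alg.add alg.const r(1) alg.gen) auto
  ultimately show ?thesis by blast
qed

lemma ipow_approx: "a \<in> ipow Y k \<Longrightarrow> \<exists>r\<in>alg {t1, t2, t3}. a - r \<in> fil (Suc k)"
proof (induction k arbitrary: a)
  case 0
  then show ?case using alg_decomp[OF fin] ipow_fil[of _ 1] alg.const by fastforce
next
  case (Suc k)
  then obtain c where c: "a = (\<Sum>y\<in>Y. y * c y)" "\<forall>y. c y \<in> ipow Y k" by auto
  have "\<forall>y. \<exists>r. y \<in> Y \<longrightarrow> r \<in> alg {t1, t2, t3} \<and> y * c y - r \<in> fil (Suc (Suc k))"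
    using tangent_ipow[OF _ Suc.IH] c(2) by blast
  from choice[OF this] obtain r where
    r: "\<And>y. y \<in> Y \<Longrightarrow> r y \<in> alg {t1, t2, t3} \<and> y * c y - r y \<in> fil (Suc (Suc k))" by blast
  have "a - sum r Y \<in> fil (Suc (Suc k))"
    unfolding c(1) sum_subtractf[symmetric] using r by (intro ideal_of_sum[OF ideal_of_fil]) auto
  moreover have "sum r Y \<in> alg {t1, t2, t3}" using r by (intro subalg_sum[OF subalg_alg]) auto
  ultimately show ?case by blast
qed

lemma approx: "a \<in> R \<Longrightarrow> \<exists>r\<in>alg {t1, t2, t3}. a - r \<in> fil k"
proof (induction k)
  case 0
  then show ?case using alg.const[of 0] fil_0 by (intro bexI[of _ 0]) auto
next
  case (Suc k)
  then obtain r where r: "r \<in> alg {t1, t2, t3}" "a - r \<in> fil k" by blast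
  then obtain p q where pq: "a - r = p + q" "p \<in> K" "q \<in> ipow Y k" by (auto simp: fil_def sumset_def)
  from ipow_approx[OF pq(3)] obtain s where s: "s \<in> alg {t1, t2, t3}" "q - s \<in> fil (Suc k)" by blast
  from filD(3)[OF s(2) K_fil[OF pq(2)]] have "a - (r + s) \<in> fil (Suc k)" 
    using pq(1) by (simp add: algebra_simps)
  then show ?case using alg.add r s by blast
qed

abbreviation "X1 \<equiv> (fps_X :: complex fps fps fps)"
abbreviation "X2 \<equiv> (fps_const fps_X :: complex fps fps fps)"
abbreviation "X3 \<equiv> (fps_const (fps_const fps_X) :: complex fps fps fps)"

lemma ev_X:
  "t1 - ev k X1 \<in> fil k" "t2 - ev k X2 \<in> fil k" "t3 - ev k X3 \<in> fil k"
proof -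
  have e: "ev k X1 = (if 1 < k then t1 else 0) \<and> ev k X2 = (if 1 < k then t2 else 0) \<and> ev k X3 = (if 1 < k then t3 else 0)"
    if "0 < k"
    using that unfolding ev_def
    by (simp add: trunc_eval_fps_X trunc_eval_const trunc_eval_def[of _ _ _ 0])
      (auto simp flip: fps_const_1_eq_1 simp: trunc_eval_const trunc_eval_def[of _ _ _ 0])
  consider "k = 0" | "k = 1" | "1 < k" by linarith
  then have "t1 - ev k X1 \<in> fil k \<and> t2 - ev k X2 \<in> fil k \<and> t3 - ev k X3 \<in> fil k"
  proof cases
    case 1
    then show ?thesis using fil_0 evR tR RD by auto
  next
    case 2
    then show ?thesis using e t_fil by simp
  next
    case 3
    then show ?thesis using e filD(2) by simp
  qed
  then show "t1 - ev k X1 \<in> fil k" "t2 - ev k X2 \<in> fil k" "t3 - ev k X3 \<in> fil k" by auto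
qed

lemma mult_congruent:
  assumes "a - a' \<in> fil k" "b - b' \<in> fil k" "b \<in> R" "a' \<in> R" shows "a * b - a' * b' \<in> fil k"
proof -
  have "(a - a') * b + a' * (b - b') \<in> fil k" using assms by (intro filD(3) filD(4) filD(5))
  then show ?thesis by (simp add: algebra_simps)
qed

lemma ev_surj: "a \<in> R \<Longrightarrow> \<exists>G. a - ev k G \<in> fil k"
proof (cases "k = 0")
  case True
  then show "a \<in> R \<Longrightarrow> \<exists>G. a - ev k G \<in> fil k" using fil_0 evR RD by auto
next
  case k: False
  assume "a \<in> R"
  have tR': "alg {t1, t2, t3} \<subseteq> R" using tR by (intro alg_least R) auto
  have "\<exists>G. r - ev k G \<in> fil k" if "r \<in> alg {t1, t2, t3}" for r
    using that
  proof (induction rule: alg.induct)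
    case (const c)
    then show ?case using k filD(2) by (intro exI[of _ "fps_const (fps_const (fps_const c))"]) (simp add: ev_const)
  next
    case (gen x)
    then show ?case using ev_X by auto
  next
    case (add a b)
    then obtain F G where "a - ev k F \<in> fil k" "b - ev k G \<in> fil k" by blast
    from filD(3)[OF this] show ?case by (intro exI[of _ "F + G"]) (simp add: ev_add algebra_simps)
  next
    case (mult a b)
    then obtain F G where "a - ev k F \<in> fil k" "b - ev k G \<in> fil k" by blast
    then have "a * b - ev k F * ev k G \<in> fil k" using mult tR' evR by (intro mult_congruent) auto
    from filD(7)[OF this ev_mult[of k F G]] show ?case by (intro exI[of _ "F * G"]) (simp add: algebra_simps)
  qed
  moreover obtain r where "r \<in> alg {t1, t2, t3}" "a - r \<in> fil k" using approx[OF \<open>a \<in> R\<close>] by blast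
  ultimately obtain G where "r - ev k G \<in> fil k" "a - r \<in> fil k" by blast
  from filD(3)[OF this(2,1)] show "\<exists>G. a - ev k G \<in> fil k" by auto
qed

text \<open>A coefficient of total degree \<open>n\<close> is read off from any series that
  approximates \<open>a\<close> to order \<open>n + 1\<close>; by \<open>ev_nondegenerate\<close>
  the choice has no influence.\<close>

definition taylor :: "'a \<Rightarrow> complex fps fps fps" where
  "taylor a = Abs_fps (\<lambda>i. Abs_fps (\<lambda>j. Abs_fps (\<lambda>l.
     (SOME G. a - ev (Suc (i + j + l)) G \<in> fil (Suc (i + j + l))) $$$ i $$$ j $$$ l)))"

lemma taylor_nth:
  assumes a: "a \<in> R" and G: "a - ev k G \<in> fil k" and le: "i + j + l < k"
  shows "taylor a $$$ i $$$ j $$$ l = G $$$ i $$$ j $$$ l"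
proof -
  define k' where "k' = Suc (i + j + l)"
  define G' where "G' = (SOME G. a - ev k' G \<in> fil k')"
  have G': "a - ev k' G' \<in> fil k'" unfolding G'_def by (rule someI_ex) (rule ev_surj[OF a])
  have k': "k' \<le> k" using le by (simp add: k'_def)
  have "a - ev k' G \<in> fil k'"
    using filD(3)[OF subsetD[OF fil_antimono[OF k'] G] ev_ev[OF k', of G]] by simp
  from filD(7)[OF this G'] have "ev k' (G' - G) \<in> fil k'" by (simp add: ev_diff)
  from ev_nondegenerate[OF this, of i j l] have "G' $$$ i $$$ j $$$ l = G $$$ i $$$ j $$$ l" by (simp add: k'_def)
  then show ?thesis by (simp add: taylor_def G'_def k'_def)
qed

lemma taylor_approx: "a \<in> R \<Longrightarrow> a - ev k (taylor a) \<in> fil k"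
proof -
  assume a: "a \<in> R"
  obtain G where G: "a - ev k G \<in> fil k" using ev_surj[OF a] by blast
  have "ev k (G - taylor a) \<in> fil k" using taylor_nth[OF a G] by (intro ev_fil) simp
  from filD(3)[OF G this] show ?thesis by (simp add: ev_diff)
qed

lemma taylor_unique:
  assumes "a \<in> R" "\<And>k. 0 < k \<Longrightarrow> a - ev k G \<in> fil k" shows "taylor a = G"
  by (intro fps_ext taylor_nth[OF assms(1) assms(2)]) auto

lemma taylor_add: "a \<in> R \<Longrightarrow> b \<in> R \<Longrightarrow> taylor (a + b) = taylor a + taylor b"
proof (intro taylor_unique alg.add)
  fix k assume "a \<in> R" "b \<in> R"
  from filD(3)[OF taylor_approx[OF this(1)] taylor_approx[OF this(2)]]
  show "a + b - ev k (taylor a + taylor b) \<in> fil k" by (simp add: ev_add algebra_simps)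
qed

lemma taylor_mult: "a \<in> R \<Longrightarrow> b \<in> R \<Longrightarrow> taylor (a * b) = taylor a * taylor b"
proof (intro taylor_unique alg.mult)
  fix k assume ab: "a \<in> R" "b \<in> R"
  from mult_congruent[OF taylor_approx[OF ab(1)] taylor_approx[OF ab(2)] ab(2) evR]
  have "a * b - ev k (taylor a) * ev k (taylor b) \<in> fil k" .
  from filD(7)[OF this ev_mult[of k "taylor a" "taylor b"]]
  show "a * b - ev k (taylor a * taylor b) \<in> fil k" by (simp add: algebra_simps)
qed

lemma taylor_const: "taylor (\<kappa> c) = fps_const (fps_const (fps_const c))"
  by (intro taylor_unique alg.const) (simp add: ev_const filD(2))

lemma taylor_t: "taylor t1 = X1" "taylor t2 = X2" "taylor t3 = X3"
  by (intro taylor_unique ev_X tR)+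

lemma taylor_K: "a \<in> K \<Longrightarrow> taylor a = 0"
  using ideal_ofD(1)[OF K] K_fil by (intro taylor_unique) (auto simp: ev_0)

text \<open>The Taylor series detects the order exactly, so \<open>R\<close> modulo
  \<open>fil k\<close> is no larger than the space of truncated power series.\<close>

lemma fil_iff:
  assumes "a \<in> R" shows "a \<in> fil k \<longleftrightarrow> (\<forall>i j l. i + j + l < k \<longrightarrow> taylor a $$$ i $$$ j $$$ l = 0)"
proof
  assume "a \<in> fil k"
  from filD(7)[OF this taylor_approx[OF assms, of k]] have "ev k (taylor a) \<in> fil k" by simp
  then show "\<forall>i j l. i + j + l < k \<longrightarrow> taylor a $$$ i $$$ j $$$ l = 0" using ev_nondegenerate by blast
next
  assume "\<forall>i j l. i + j + l < k \<longrightarrow> taylor a $$$ i $$$ j $$$ l = 0"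
  then have "ev k (taylor a) \<in> fil k" by (intro ev_fil) blast
  from filD(3)[OF taylor_approx[OF assms, of k] this] show "a \<in> fil k" by simp
qed

text \<open>Applied to the maps that set some variables to zero; their targets are again
  domains.\<close>

lemma prime_of_kernel:
  fixes \<theta> :: "complex fps fps fps \<Rightarrow> 'b::idom"
  assumes "\<And>F G. \<theta> (F + G) = \<theta> F + \<theta> G" "\<And>F G. \<theta> (F * G) = \<theta> F * \<theta> G" "\<theta> 1 = 1"
  shows "prime_of R {a \<in> R. \<theta> (taylor a) = 0}"
proof -
  have 0: "\<theta> 0 = 0" using assms(1)[of 0 0] by (metis add_0 add_cancel_left_right)
  have T0: "taylor 0 = 0" "taylor 1 = 1" using taylor_const[of 0] taylor_const[of 1] by simp_all
  show ?thesis
    unfolding prime_of_def ideal_of_def using RD T0 0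
    by (auto simp: taylor_add taylor_mult assms)
qed

theorem prime_chain:
  obtains P where "\<And>i. i \<le> 3 \<Longrightarrow> prime_of R (P i)" "\<And>i. i \<le> 3 \<Longrightarrow> K \<subseteq> P i"
    "\<And>i. i \<le> 3 \<Longrightarrow> P i \<subseteq> fil 1" "\<And>i. i < (3::nat) \<Longrightarrow> P i \<subset> P (Suc i)"
proof -
  \<comment> \<open>The pullbacks of the ideals \<open>0\<close>, \<open>(X1)\<close>,
    \<open>(X1, X2)\<close> and \<open>(X1, X2, X3)\<close>: taking the coefficient at
    \<open>0\<close> sets the outermost variable to zero.\<close>
  define P :: "nat \<Rightarrow> 'a set" where "P i = (if i = 0 then {a \<in> R. taylor a = 0} else if i = 1 then {a \<in> R. taylor a $$$ 0 = 0}
    else if i = 2 then {a \<in> R. taylor a $$$ 0 $$$ 0 = 0} else {a \<in> R. taylor a $$$ 0 $$$ 0 $$$ 0 = 0})" for i :: nat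
  have i3: "i = 0 \<or> i = 1 \<or> i = 2 \<or> i = 3" if "i \<le> 3" for i :: nat using that by arith
  have "prime_of R {a \<in> R. taylor a = 0}" by (rule prime_of_kernel[of "\<lambda>F. F"]) auto
  moreover have "prime_of R {a \<in> R. taylor a $$$ 0 = 0}" by (rule prime_of_kernel[of "\<lambda>F. F $$$ 0"]) auto
  moreover have "prime_of R {a \<in> R. taylor a $$$ 0 $$$ 0 = 0}" by (rule prime_of_kernel[of "\<lambda>F. F $$$ 0 $$$ 0"]) auto
  moreover have "prime_of R {a \<in> R. taylor a $$$ 0 $$$ 0 $$$ 0 = 0}" by (rule prime_of_kernel[of "\<lambda>F. F $$$ 0 $$$ 0 $$$ 0"]) auto
  ultimately have 1: "prime_of R (P i)" if "i \<le> 3" for i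
    using i3[OF that] by (auto simp: P_def)
  have 2: "K \<subseteq> P i" for i using taylor_K ideal_ofD(1)[OF K] by (auto simp: P_def)
  have 3: "P i \<subseteq> fil 1" for i by (auto simp: P_def fil_iff)
  have w: "t3 \<in> P 3 - P 2" "t2 \<in> P 2 - P 1" "t1 \<in> P 1 - P 0"
    using tR by (auto simp: P_def taylor_t)
  have "P i \<subset> P (Suc i)" if "i < 3" for i
  proof -
    have "P 0 \<subseteq> P 1" "P 1 \<subseteq> P 2" "P 2 \<subseteq> P 3" by (auto simp: P_def)
    with w have "P 0 \<subset> P 1" "P 1 \<subset> P 2" "P 2 \<subset> P 3" by blast+
    moreover have "i = 0 \<or> i = 1 \<or> i = 2" using that by arith
    ultimately show ?thesis by (auto simp: numeral_2_eq_2 numeral_3_eq_3)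
  qed
  with 1 2 3 show thesis by (rule that)
qed

theorem prime_chain_bound:
  assumes P: "\<And>i. i \<le> n \<Longrightarrow> prime_of R (P i)" "\<And>i. i \<le> n \<Longrightarrow> K \<subseteq> P i"
    "\<And>i. i \<le> n \<Longrightarrow> P i \<subseteq> fil 1" "\<And>i. i < n \<Longrightarrow> P i \<subset> P (Suc i)"
  shows "n \<le> 3"
proof (rule ccontr)
  assume n: "\<not> n \<le> 3"
  \<comment> \<open>\<open>no_long_prime_chain\<close> counts downwards from the largest
    prime.\<close>
  define Q where "Q i = P (4 - i)" for i
  have "sumset (Q 0) (ipow Y 1) \<subseteq> fil 1"
    using P(3)[of 4] n ipow_fil[of _ 1] filD(3) by (auto simp: Q_def sumset_def simp del: ipow.simps One_nat_def)
  then have "\<And>a. \<kappa> a \<in> sumset (Q 0) (ipow Y 1) \<Longrightarrow> a = 0"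
    by (auto simp: fil_iff alg.const taylor_const dest!: subsetD)
  moreover have "Q (Suc i) \<subset> Q i" if "i < 4" for i
  proof -
    have "Suc (4 - Suc i) = 4 - i" using that by simp
    then show ?thesis using P(4)[of "4 - Suc i"] n unfolding Q_def by simp
  qed
  moreover have "\<exists>t :: 'a \<Rightarrow> nat \<Rightarrow> complex.
      (\<forall>a\<in>R. \<forall>b\<in>R. \<forall>i. t (a + b) i = t a i + t b i) \<and>
      (\<forall>c. \<forall>a\<in>R. \<forall>i. t (\<kappa> c * a) i = c * t a i) \<and>
      (\<forall>a\<in>R. (\<forall>i<k ^ 3. t a i = 0) \<longrightarrow> a \<in> sumset K (ipow Y k))" for k
  \<comment> \<open>The three base-\<open>k\<close> digits of the index are the exponents, so
    \<open>k ^ 3\<close> functionals cover all coefficients of total degree below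
    \<open>k\<close>.\<close>
  proof (intro exI[of _ "\<lambda>a i. taylor a $$$ (i div (k * k)) $$$ (i div k mod k) $$$ (i mod k)"] conjI ballI allI impI)
    fix a assume a: "a \<in> R" "\<forall>i<k ^ 3. taylor a $$$ (i div (k * k)) $$$ (i div k mod k) $$$ (i mod k) = 0"
    have "taylor a $$$ i $$$ j $$$ l = 0" if ijl: "i + j + l < k" for i j l
    proof -
      define e where "e = (i * k + j) * k + l"
      have "k > 0" using ijl by simp
      have "e mod k = l" "e div k = i * k + j" unfolding e_def using ijl by simp_all
      moreover from this have "e div k mod k = j" "e div (k * k) = i"
        using ijl by (simp_all add: div_mult2_eq)
      moreover have "e < k ^ 3"
      proof -
        have "i * k + j < Suc i * k" using ijl by simp
        also have "\<dots> \<le> k * k" using ijl by (intro mult_right_mono) auto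
        finally have "Suc (i * k + j) \<le> k * k" by simp
        then have "Suc (i * k + j) * k \<le> k * k * k" by (intro mult_right_mono) auto
        moreover have "e < Suc (i * k + j) * k" unfolding e_def using ijl by simp
        ultimately show ?thesis by (simp add: power3_eq_cube)
      qed
      ultimately show ?thesis using a(2) by metis
    qed
    then show "a \<in> sumset K (ipow Y k)" using fil_iff[OF a(1)] unfolding fil_def by blast
  qed (auto simp: taylor_add taylor_mult taylor_const alg.const)
  ultimately show False
    using no_long_prime_chain[OF fin, of Q K] P n by (auto simp: Q_def)
qed

end

section \<open>Presentations of abstract rings and vector spaces\<close>

text \<open>Presents a record ring as the image of a subset of a type class ring, so that
  computations in \<open>A\<close> become computations with representatives.\<close>

locale ring_presentation = complex_algebra \<kappa> for \<kappa> :: "complex \<Rightarrow> 'a::comm_ring_1" +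
  fixes R0 :: "'a set" and \<phi> :: "'a \<Rightarrow> 'x" and A :: "('x, 'y) ring_scheme"
  assumes R0: "subalg R0"
    and carrier_eq: "carrier A = \<phi> ` R0"
    and hom_add: "p \<in> R0 \<Longrightarrow> q \<in> R0 \<Longrightarrow> \<phi> p \<oplus>\<^bsub>A\<^esub> \<phi> q = \<phi> (p + q)"
    and hom_mult: "p \<in> R0 \<Longrightarrow> q \<in> R0 \<Longrightarrow> \<phi> p \<otimes>\<^bsub>A\<^esub> \<phi> q = \<phi> (p * q)"
    and hom_0: "\<zero>\<^bsub>A\<^esub> = \<phi> 0" and hom_1: "\<one>\<^bsub>A\<^esub> = \<phi> 1"
begin

lemmas R0D = subalgD[OF R0]

lemma cring: "cring A"
proof (rule cringI)
  show "abelian_group A"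
  proof (rule abelian_groupI)
    fix x assume "x \<in> carrier A"
    then obtain p where p: "x = \<phi> p" "p \<in> R0" by (auto simp: carrier_eq)
    then have "\<phi> (- p) \<oplus>\<^bsub>A\<^esub> x = \<zero>\<^bsub>A\<^esub>" using R0D by (simp add: hom_add hom_0)
    then show "\<exists>y\<in>carrier A. y \<oplus>\<^bsub>A\<^esub> x = \<zero>\<^bsub>A\<^esub>" using p R0D by (auto simp: carrier_eq)
  qed (use R0D in \<open>auto simp: carrier_eq hom_add hom_0 add_ac\<close>)
  show "comm_monoid A"
    by (rule comm_monoidI) (use R0D in \<open>auto simp: carrier_eq hom_mult hom_1 mult_ac\<close>)
qed (use R0D in \<open>auto simp: carrier_eq hom_add hom_mult distrib_right\<close>)

lemma hom_minus:
  assumes "p \<in> R0" shows "\<ominus>\<^bsub>A\<^esub> \<phi> p = \<phi> (- p)"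
proof -
  interpret cring A by (rule cring)
  show ?thesis using assms R0D
    by (intro minus_equality) (auto simp: carrier_eq hom_add hom_0)
qed

lemma hom_diff: "p \<in> R0 \<Longrightarrow> q \<in> R0 \<Longrightarrow> \<phi> p \<ominus>\<^bsub>A\<^esub> \<phi> q = \<phi> (p - q)"
  using R0D by (simp add: a_minus_def hom_minus hom_add)

lemma ideal_iff:
  assumes J: "J \<subseteq> carrier A"
  shows "ideal J A \<longleftrightarrow> ideal_of R0 {p \<in> R0. \<phi> p \<in> J}"
proof
  assume "ideal J A"
  then interpret ideal J A .
  have "\<phi> 0 \<in> J" using additive_subgroup.zero_closed[OF is_additive_subgroup] by (simp add: hom_0)
  moreover have "\<phi> (p + q) \<in> J" if "p \<in> R0" "q \<in> R0" "\<phi> p \<in> J" "\<phi> q \<in> J" for p q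
    using additive_subgroup.a_closed[OF is_additive_subgroup that(3,4)] that by (simp add: hom_add)
  moreover have "\<phi> (p * q) \<in> J" if "p \<in> R0" "q \<in> R0" "\<phi> q \<in> J" for p q
    using I_l_closed[OF that(3), of "\<phi> p"] that by (simp add: hom_mult carrier_eq)
  ultimately show "ideal_of R0 {p \<in> R0. \<phi> p \<in> J}" using R0D by (auto simp: ideal_of_def)
next
  assume I: "ideal_of R0 {p \<in> R0. \<phi> p \<in> J}"
  interpret cring A by (rule cring)
  have rep: "\<exists>p\<in>R0. x = \<phi> p" if "x \<in> J" for x using that J by (auto simp: carrier_eq)
  show "ideal J A"
  proof (rule idealI[OF ring_axioms])
    show "subgroup J (add_monoid A)"
    proof (rule group.subgroupI)
      show "group (add_monoid A)" by (rule a_group)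
      show "J \<noteq> {}" using ideal_ofD(2)[OF I] by auto
      fix a assume a: "a \<in> J"
      then obtain p where p: "p \<in> R0" "a = \<phi> p" using rep by blast
      have "- p \<in> {p \<in> R0. \<phi> p \<in> J}" using ideal_of_minus(1)[OF R0 I, of p] p a by auto
      then have "\<ominus>\<^bsub>A\<^esub> a \<in> J" using p by (simp add: hom_minus)
      then show "inv\<^bsub>add_monoid A\<^esub> a \<in> J" by (simp add: a_inv_def)
      fix b assume b: "b \<in> J"
      then obtain q where q: "q \<in> R0" "b = \<phi> q" using rep by blast
      have "p + q \<in> {p \<in> R0. \<phi> p \<in> J}" using ideal_ofD(3)[OF I, of p q] p q a b by auto
      then show "a \<otimes>\<^bsub>add_monoid A\<^esub> b \<in> J" using p q by (simp add: hom_add)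
    qed (use J in auto)
  next
    fix a x assume ax: "a \<in> J" "x \<in> carrier A"
    obtain p where "p \<in> R0" "a = \<phi> p" using rep[OF ax(1)] by blast
    moreover obtain q where "q \<in> R0" "x = \<phi> q" using ax(2) by (auto simp: carrier_eq)
    ultimately have p: "p \<in> R0" "a = \<phi> p" "q \<in> R0" "x = \<phi> q" by auto
    have "q * p \<in> {p \<in> R0. \<phi> p \<in> J}" using ideal_ofD(4)[OF I, of q p] p ax by auto
    then show "x \<otimes>\<^bsub>A\<^esub> a \<in> J" "a \<otimes>\<^bsub>A\<^esub> x \<in> J" using p by (auto simp: hom_mult mult.commute)
  qed
qed

lemma primeideal_iff:
  assumes J: "J \<subseteq> carrier A"
  shows "primeideal J A \<longleftrightarrow> prime_of R0 {p \<in> R0. \<phi> p \<in> J}"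
proof
  assume "primeideal J A"
  then interpret primeideal J A .
  have "\<phi> 1 \<notin> J"
    using one_imp_carrier I_notcarr by (auto simp: hom_1)
  moreover have "\<phi> p \<in> J \<or> \<phi> q \<in> J" if "p \<in> R0" "q \<in> R0" "\<phi> (p * q) \<in> J" for p q
    using I_prime[of "\<phi> p" "\<phi> q"] that by (auto simp: hom_mult carrier_eq)
  ultimately show "prime_of R0 {p \<in> R0. \<phi> p \<in> J}"
    using ideal_iff[OF J] is_ideal R0D by (auto simp: prime_of_def)
next
  assume P: "prime_of R0 {p \<in> R0. \<phi> p \<in> J}"
  show "primeideal J A"
  proof (rule primeidealI)
    show "ideal J A" using P ideal_iff[OF J] by (auto simp: prime_of_def)
    show "carrier A \<noteq> J" using P R0D by (auto simp: prime_of_def carrier_eq)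
    fix a b assume ab: "a \<in> carrier A" "b \<in> carrier A" "a \<otimes>\<^bsub>A\<^esub> b \<in> J"
    then obtain p q where "p \<in> R0" "a = \<phi> p" "q \<in> R0" "b = \<phi> q" by (auto simp: carrier_eq)
    then show "a \<in> J \<or> b \<in> J" using prime_ofD(3)[OF P, of p q] ab R0D by (auto simp: hom_mult)
  qed (rule cring)
qed

end

lemma field_complex_field: "field complex_field"
proof (rule cring.cring_fieldI2)
  show "cring complex_field"
  proof (rule cringI)
    show "abelian_group complex_field"
    proof (rule abelian_groupI)
      fix x assume "x \<in> carrier complex_field"
      then show "\<exists>y\<in>carrier complex_field. y \<oplus>\<^bsub>complex_field\<^esub> x = \<zero>\<^bsub>complex_field\<^esub>"
        by (intro bexI[of _ "- x"]) (simp_all add: complex_field_def)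
    qed (simp_all add: complex_field_def)
    show "comm_monoid complex_field" by (rule comm_monoidI) (simp_all add: complex_field_def)
  qed (simp_all add: complex_field_def distrib_right)
  show "\<zero>\<^bsub>complex_field\<^esub> \<noteq> \<one>\<^bsub>complex_field\<^esub>" by (simp add: complex_field_def)
  fix a assume "a \<in> carrier complex_field" "a \<noteq> \<zero>\<^bsub>complex_field\<^esub>"
  then show "\<exists>b\<in>carrier complex_field. a \<otimes>\<^bsub>complex_field\<^esub> b = \<one>\<^bsub>complex_field\<^esub>"
    by (intro bexI[of _ "inverse a"]) (simp_all add: complex_field_def)
qed

text \<open>The analogous device for vector spaces; \<open>sc\<close> is the scalar action on
  representatives.\<close>

locale space_presentation =
  fixes sc :: "complex \<Rightarrow> 'a::ab_group_add \<Rightarrow> 'a" and M :: "'a set" and \<phi> :: "'a \<Rightarrow> 'x" and V :: "(complex, 'x) module"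
  assumes sc_add_left: "x \<in> M \<Longrightarrow> sc (a + b) x = sc a x + sc b x"
    and sc_add_right: "x \<in> M \<Longrightarrow> y \<in> M \<Longrightarrow> sc a (x + y) = sc a x + sc a y"
    and sc_mult: "x \<in> M \<Longrightarrow> sc (a * b) x = sc a (sc b x)"
    and sc_1: "x \<in> M \<Longrightarrow> sc 1 x = x"
    and M: "0 \<in> M" "x \<in> M \<Longrightarrow> y \<in> M \<Longrightarrow> x + y \<in> M" "x \<in> M \<Longrightarrow> sc a x \<in> M"
    and space_carrier: "carrier V = \<phi> ` M"
    and space_add: "x \<in> M \<Longrightarrow> y \<in> M \<Longrightarrow> \<phi> x \<oplus>\<^bsub>V\<^esub> \<phi> y = \<phi> (x + y)"
    and space_zero: "\<zero>\<^bsub>V\<^esub> = \<phi> 0"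
    and space_smult: "x \<in> M \<Longrightarrow> a \<odot>\<^bsub>V\<^esub> \<phi> x = \<phi> (sc a x)"
begin

lemma sc_0: "x \<in> M \<Longrightarrow> sc 0 x = 0"
  using sc_add_left[of x 0 0] by simp

lemma sc_minus_1: "x \<in> M \<Longrightarrow> sc (- 1) x = - x"
  using sc_add_left[of x "- 1" 1] sc_0[of x] sc_1[of x] by (simp add: eq_neg_iff_add_eq_0)

lemma vectorspace: "vectorspace complex_field V"
proof -
  have ag: "abelian_group V"
  proof (rule abelian_groupI)
    fix x assume "x \<in> carrier V"
    then obtain p where p: "x = \<phi> p" "p \<in> M" by (auto simp: space_carrier)
    then have "\<phi> (sc (- 1) p) \<oplus>\<^bsub>V\<^esub> x = \<zero>\<^bsub>V\<^esub>" using M by (simp add: space_add space_zero sc_minus_1[symmetric]) (simp add: sc_minus_1)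
    then show "\<exists>y\<in>carrier V. y \<oplus>\<^bsub>V\<^esub> x = \<zero>\<^bsub>V\<^esub>" using p M by (auto simp: space_carrier)
  qed (use M in \<open>auto simp: space_carrier space_add space_zero add_ac\<close>)
  have "Module.module complex_field V"
  proof (rule Module.moduleI)
    show "cring complex_field" using field_complex_field by (rule fieldE)
    show "abelian_group V" by (rule ag)
  qed (use M in \<open>auto simp: space_carrier space_smult space_add complex_field_def sc_add_left sc_add_right sc_mult sc_1\<close>)
  with field_complex_field show ?thesis by (simp add: vectorspace_def)
qed

end

lemma vectorspace_dual_space: "vectorspace complex_field (dual_space V)"
proof -
  have ag: "abelian_group (dual_space V)"
  proof (rule abelian_groupI)
    fix f assume f: "f \<in> carrier (dual_space V)"
    then show "\<exists>g\<in>carrier (dual_space V). g \<oplus>\<^bsub>dual_space V\<^esub> f = \<zero>\<^bsub>dual_space V\<^esub>"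
      by (intro bexI[of _ "\<lambda>x. - f x"]) (auto simp: dual_space_def)
  qed (auto simp: dual_space_def algebra_simps)
  have "Module.module complex_field (dual_space V)"
  proof (rule Module.moduleI)
    show "cring complex_field" using field_complex_field by (rule fieldE)
    show "abelian_group (dual_space V)" by (rule ag)
  qed (auto simp: dual_space_def complex_field_def algebra_simps)
  with field_complex_field show ?thesis by (simp add: vectorspace_def)
qed

text \<open>Duality \<open>dv\<close> makes the forms distinct and independent, and
  \<open>span\<close> makes them generate.\<close>

lemma has_dimension_dual_spaceI:
  fixes d :: "nat \<Rightarrow> 'v \<Rightarrow> complex" and v :: "nat \<Rightarrow> 'v"
  assumes d: "\<And>i. i < n \<Longrightarrow> d i \<in> carrier (dual_space V)"
    and v: "\<And>i. i < n \<Longrightarrow> v i \<in> carrier V"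
    and dv: "\<And>i j. i < n \<Longrightarrow> j < n \<Longrightarrow> d i (v j) = (if i = j then 1 else 0)"
    and span: "\<And>f x. f \<in> carrier (dual_space V) \<Longrightarrow> x \<in> carrier V \<Longrightarrow> f x = (\<Sum>i<n. f (v i) * d i x)"
  shows "has_dimension (dual_space V) n"
proof -
  interpret D: vectorspace complex_field "dual_space V" by (rule vectorspace_dual_space)
  have inj: "inj_on d {..<n}"
  proof (rule inj_onI)
    fix i j assume "i \<in> {..<n}" "j \<in> {..<n}" "d i = d j"
    then show "i = j" using dv[of i j] dv[of j j] by (auto split: if_splits)
  qed
  have fs: "D.lincomb a B = (\<lambda>x. \<Sum>f\<in>B. a f * f x)" if "finite B" "B \<subseteq> carrier (dual_space V)" for a B
    using that
  proof (induction B rule: finite_induct)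
    case empty
    then show ?case by (simp add: D.lincomb_def) (simp add: dual_space_def)
  next
    case (insert f B)
    have "D.lincomb a (insert f B) = a f \<odot>\<^bsub>dual_space V\<^esub> f \<oplus>\<^bsub>dual_space V\<^esub> D.lincomb a B"
      using insert by (intro D.lincomb_insert2) (auto simp: complex_field_def)
    then show ?case using insert by (simp add: dual_space_def)
  qed
  let ?B = "d ` {..<n}"
  have B: "finite ?B" "?B \<subseteq> carrier (dual_space V)" using d by auto
  have gen: "D.gen_set ?B"
  proof -
    have "f \<in> D.span ?B" if f: "f \<in> carrier (dual_space V)" for f
    proof -
      \<comment> \<open>Linear combinations index coefficients by vectors, hence the detour through
        the index of a form.\<close>
      define a where "a g = f (v (the_inv_into {..<n} d g))" for g
      have "f = (\<lambda>x. \<Sum>g\<in>?B. a g * g x)"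
      proof
        fix x
        have "(\<Sum>g\<in>?B. a g * g x) = (\<Sum>i<n. f (v i) * d i x)"
          unfolding a_def sum.reindex[OF inj] by (intro sum.cong refl) (simp add: the_inv_into_f_f[OF inj])
        also have "\<dots> = f x"
        proof (cases "x \<in> carrier V")
          case True
          then show ?thesis using span[OF f] by simp
        next
          case False
          then have "f x = 0" "\<And>i. i < n \<Longrightarrow> d i x = 0" using f d by (auto simp: dual_space_def)
          then show ?thesis by simp
        qed
        finally show "f x = (\<Sum>g\<in>?B. a g * g x)" by simp
      qed
      then have "f = D.lincomb a ?B" using fs[OF B] by simp
      then show ?thesis unfolding D.span_def using B by (auto simp: complex_field_def)
    qed
    moreover have "D.span ?B \<subseteq> carrier (dual_space V)" by (rule D.span_is_subset2[OF B(2)])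
    ultimately show ?thesis by auto
  qed
  have "D.lin_indpt ?B"
  proof
    assume "D.lin_dep ?B"
    then obtain A a f where A: "finite A" "A \<subseteq> ?B" "D.lincomb a A = \<zero>\<^bsub>dual_space V\<^esub>" "f \<in> A" "a f \<noteq> \<zero>\<^bsub>complex_field\<^esub>"
      unfolding D.lin_dep_def by blast
    then obtain i where i: "i < n" "f = d i" by auto
    have "(\<Sum>g\<in>A. a g * g (v i)) = 0"
      using A(1,2,3) B(2) fs[of A a] by (simp add: fun_eq_iff) (simp add: dual_space_def)
    moreover have "(\<Sum>g\<in>A. a g * g (v i)) = (\<Sum>g\<in>A. if g = f then a f else 0)"
    proof (intro sum.cong refl)
      fix g assume "g \<in> A"
      then obtain j where j: "j < n" "g = d j" using A(2) by auto
      then show "a g * g (v i) = (if g = f then a f else 0)"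
        using dv[of j i] i inj by (auto simp: inj_on_def)
    qed
    ultimately show False using A by (simp add: complex_field_def)
  qed
  then have basis: "D.basis ?B" using gen B by (simp add: D.basis_def)
  have "D.dim = card ?B" using basis B by (intro D.dim_basis)
  moreover have "D.fin_dim" unfolding D.fin_dim_def using gen B by blast
  ultimately show ?thesis using inj by (simp add: has_dimension_def card_image)
qed

section \<open>First homology\<close>

text \<open>Cosets are compared through representatives; \<open>ker\<close> ensures that elements
  identified by \<open>\<phi>\<close> already agree modulo \<open>N\<close>.\<close>

lemma (in space_presentation) quot_space_presentation:
  assumes N: "N \<subseteq> M" "0 \<in> N" "\<And>x y. x \<in> N \<Longrightarrow> y \<in> N \<Longrightarrow> x + y \<in> N" "\<And>a x. x \<in> N \<Longrightarrow> sc a x \<in> N"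
    and ker: "\<And>x y. x \<in> M \<Longrightarrow> y \<in> M \<Longrightarrow> \<phi> x = \<phi> y \<Longrightarrow> x - y \<in> N"
  shows "space_presentation sc M (\<lambda>x. (\<phi> ` N) +>\<^bsub>V\<^esub> \<phi> x) (quot_space V (\<phi> ` N))"
    and "\<And>x y. x \<in> M \<Longrightarrow> y \<in> M \<Longrightarrow> (\<phi> ` N) +>\<^bsub>V\<^esub> \<phi> x = (\<phi> ` N) +>\<^bsub>V\<^esub> \<phi> y \<longleftrightarrow> x - y \<in> N"
proof -
  have neg: "- x \<in> N" if "x \<in> N" for x
    using N(4)[OF that, of "-1"] sc_minus_1[of x] N(1) that by auto
  have coset: "(\<phi> ` N) +>\<^bsub>V\<^esub> \<phi> x = {\<phi> (n + x) | n. n \<in> N}" if "x \<in> M" for x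
  proof -
    have "\<phi> n \<oplus>\<^bsub>V\<^esub> \<phi> x = \<phi> (n + x)" if "n \<in> N" for n
      using that N(1) \<open>x \<in> M\<close> by (intro space_add) auto
    then show ?thesis by (auto simp: a_r_coset_def r_coset_def)
  qed
  show eq: "(\<phi> ` N) +>\<^bsub>V\<^esub> \<phi> x = (\<phi> ` N) +>\<^bsub>V\<^esub> \<phi> y \<longleftrightarrow> x - y \<in> N" if xy: "x \<in> M" "y \<in> M" for x y
  proof
    assume "(\<phi> ` N) +>\<^bsub>V\<^esub> \<phi> x = (\<phi> ` N) +>\<^bsub>V\<^esub> \<phi> y"
    moreover have "\<phi> x \<in> (\<phi> ` N) +>\<^bsub>V\<^esub> \<phi> x" unfolding coset[OF xy(1)] using N(2) by force
    ultimately obtain n where n: "n \<in> N" "\<phi> x = \<phi> (n + y)" unfolding coset[OF xy(2)] by auto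
    have "x - (n + y) \<in> N" using ker[OF xy(1) _ n(2)] N(1) n(1) M xy by blast
    from N(3)[OF this n(1)] show "x - y \<in> N" by simp
  next
    assume d: "x - y \<in> N"
    have sub: "{\<phi> (n + x) | n. n \<in> N} \<subseteq> {\<phi> (n + y) | n. n \<in> N}" if "x - y \<in> N" for x y
    proof
      fix z assume "z \<in> {\<phi> (n + x) | n. n \<in> N}"
      then obtain n where n: "n \<in> N" "z = \<phi> (n + x)" by blast
      then have "z = \<phi> ((n + (x - y)) + y)" by simp
      with N(3)[OF n(1) that] show "z \<in> {\<phi> (n + y) | n. n \<in> N}" by blast
    qed
    have "y - x \<in> N" using neg[OF d] by simp
    from sub[OF this] sub[OF d] have "{\<phi> (n + x) | n. n \<in> N} = {\<phi> (n + y) | n. n \<in> N}" by blast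
    then show "(\<phi> ` N) +>\<^bsub>V\<^esub> \<phi> x = (\<phi> ` N) +>\<^bsub>V\<^esub> \<phi> y" using coset xy by simp
  qed
  show "space_presentation sc M (\<lambda>x. (\<phi> ` N) +>\<^bsub>V\<^esub> \<phi> x) (quot_space V (\<phi> ` N))"
  proof
    show "carrier (quot_space V (\<phi> ` N)) = (\<lambda>x. (\<phi> ` N) +>\<^bsub>V\<^esub> \<phi> x) ` M"
      by (auto simp: quot_space_def A_RCOSETS_def RCOSETS_def a_r_coset_def space_carrier)
    show "((\<phi> ` N) +>\<^bsub>V\<^esub> \<phi> x) \<oplus>\<^bsub>quot_space V (\<phi> ` N)\<^esub> ((\<phi> ` N) +>\<^bsub>V\<^esub> \<phi> y) = (\<phi> ` N) +>\<^bsub>V\<^esub> \<phi> (x + y)"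
      if xy: "x \<in> M" "y \<in> M" for x y
    proof -
      have "((\<phi> ` N) +>\<^bsub>V\<^esub> \<phi> x) \<oplus>\<^bsub>quot_space V (\<phi> ` N)\<^esub> ((\<phi> ` N) +>\<^bsub>V\<^esub> \<phi> y) =
          {\<phi> (n + x) \<oplus>\<^bsub>V\<^esub> \<phi> (n' + y) | n n'. n \<in> N \<and> n' \<in> N}"
        unfolding coset[OF xy(1)] coset[OF xy(2)] by (auto simp: quot_space_def set_add_def set_mult_def)
      also have "\<dots> = {\<phi> (n + (x + y)) | n. n \<in> N}"
      proof (rule equalityI; rule subsetI)
        fix z assume "z \<in> {\<phi> (n + x) \<oplus>\<^bsub>V\<^esub> \<phi> (n' + y) | n n'. n \<in> N \<and> n' \<in> N}"
        then obtain n n' where n: "n \<in> N" "n' \<in> N" "z = \<phi> (n + x) \<oplus>\<^bsub>V\<^esub> \<phi> (n' + y)" by blast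
        have "z = \<phi> ((n + n') + (x + y))"
          unfolding n(3) using n N(1) xy M by (subst space_add) (auto simp: add_ac subset_iff)
        then show "z \<in> {\<phi> (n + (x + y)) | n. n \<in> N}" using N(3)[OF n(1,2)] by blast
      next
        fix z assume "z \<in> {\<phi> (n + (x + y)) | n. n \<in> N}"
        then obtain n where n: "n \<in> N" "z = \<phi> (n + (x + y))" by blast
        have "z = \<phi> (n + x) \<oplus>\<^bsub>V\<^esub> \<phi> (0 + y)"
          unfolding n(2) using n N(1) xy M by (subst space_add) (auto simp: add_ac subset_iff)
        then show "z \<in> {\<phi> (n + x) \<oplus>\<^bsub>V\<^esub> \<phi> (n' + y) | n n'. n \<in> N \<and> n' \<in> N}" using n N(2) by blast
      qed
      finally show ?thesis using coset[OF M(2)[OF xy]] by simp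
    qed
    show "\<zero>\<^bsub>quot_space V (\<phi> ` N)\<^esub> = (\<phi> ` N) +>\<^bsub>V\<^esub> \<phi> 0"
      unfolding coset[OF M(1)] by (auto simp: quot_space_def)
    show "a \<odot>\<^bsub>quot_space V (\<phi> ` N)\<^esub> ((\<phi> ` N) +>\<^bsub>V\<^esub> \<phi> x) = (\<phi> ` N) +>\<^bsub>V\<^esub> \<phi> (sc a x)" if x: "x \<in> M" for a x
    proof -
      have "(\<phi> ` N) +>\<^bsub>V\<^esub> (a \<odot>\<^bsub>V\<^esub> \<phi> (n + x)) = (\<phi> ` N) +>\<^bsub>V\<^esub> \<phi> (sc a x)" if n: "n \<in> N" for n
      proof -
        have nx: "n \<in> M" "n + x \<in> M" using n N(1) x M by auto
        have "sc a (n + x) - sc a x = sc a n" using sc_add_right[OF nx(1) x] by simp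
        then show ?thesis using eq[of "sc a (n + x)" "sc a x"] space_smult[OF nx(2)] N(4)[OF n] M(3) nx x by auto
      qed
      then show ?thesis unfolding coset[OF x] using N(2) by (auto simp: quot_space_def)
    qed
  qed (fact sc_add_left sc_add_right sc_mult sc_1 M)+
qed

lemma has_dimension_2_obtain:
  assumes "vectorspace complex_field V" "has_dimension V 2"
  obtains u v where "u \<in> carrier V" "v \<in> carrier V"
    "\<And>x. x \<in> carrier V \<Longrightarrow> \<exists>s t. x = (s \<odot>\<^bsub>V\<^esub> u) \<oplus>\<^bsub>V\<^esub> (t \<odot>\<^bsub>V\<^esub> v)"
    "\<And>s t. (s \<odot>\<^bsub>V\<^esub> u) \<oplus>\<^bsub>V\<^esub> (t \<odot>\<^bsub>V\<^esub> v) = \<zero>\<^bsub>V\<^esub> \<Longrightarrow> s = 0 \<and> t = 0"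
proof -
  interpret vectorspace complex_field V by fact
  have "fin_dim" "dim = 2" using assms(2) by (auto simp: has_dimension_def)
  then obtain B where B: "finite B" "basis B" using finite_basis_exists by blast
  then have "card B = 2" using dim_basis \<open>dim = 2\<close> by auto
  then obtain u v where uv: "B = {u, v}" "u \<noteq> v" by (auto simp: card_2_iff)
  have BV: "B \<subseteq> carrier V" "span B = carrier V" "lin_indpt B" using B(2) by (auto simp: basis_def)
  have lc: "lincomb a B = (a u \<odot>\<^bsub>V\<^esub> u) \<oplus>\<^bsub>V\<^esub> (a v \<odot>\<^bsub>V\<^esub> v)" for a
  proof -
    have "lincomb a {u, v} = (a u \<odot>\<^bsub>V\<^esub> u) \<oplus>\<^bsub>V\<^esub> lincomb a {v}"
      using uv BV(1) by (intro lincomb_insert2) (auto simp: complex_field_def)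
    also have "lincomb a {v} = (a v \<odot>\<^bsub>V\<^esub> v) \<oplus>\<^bsub>V\<^esub> lincomb a {}"
      using uv BV(1) by (intro lincomb_insert2) (auto simp: complex_field_def)
    also have "\<dots> = a v \<odot>\<^bsub>V\<^esub> v"
      using uv BV(1) by (simp add: lincomb_def complex_field_def)
    finally show ?thesis by (simp add: uv(1))
  qed
  show thesis
  proof (rule that[of u v])
    show "u \<in> carrier V" "v \<in> carrier V" using uv BV by auto
    show "\<exists>s t. x = (s \<odot>\<^bsub>V\<^esub> u) \<oplus>\<^bsub>V\<^esub> (t \<odot>\<^bsub>V\<^esub> v)" if "x \<in> carrier V" for x
    proof -
      have "x \<in> span B" using that BV by simp
      then obtain a where "x = lincomb a B" using finite_in_span[OF B(1) BV(1)] by blast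
      then show ?thesis using lc by blast
    qed
    show "s = 0 \<and> t = 0" if "(s \<odot>\<^bsub>V\<^esub> u) \<oplus>\<^bsub>V\<^esub> (t \<odot>\<^bsub>V\<^esub> v) = \<zero>\<^bsub>V\<^esub>" for s t
    proof (rule ccontr)
      assume n: "\<not> (s = 0 \<and> t = 0)"
      define a where "a x = (if x = u then s else t)" for x
      have "lincomb a B = \<zero>\<^bsub>V\<^esub>" unfolding lc using that uv by (simp add: a_def)
      moreover have "\<exists>x\<in>B. a x \<noteq> \<zero>\<^bsub>complex_field\<^esub>"
        using n uv by (auto simp: a_def complex_field_def)
      ultimately have "lin_dep B" unfolding lin_dep_def
        using B(1) by (intro exI[of _ B] exI[of _ a]) (auto simp: complex_field_def)
      then show False using BV by simp
    qed
  qed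
qed

section \<open>Finitely supported chains with complex coefficients\<close>

definition pm_scale :: "complex \<Rightarrow> ('k \<Rightarrow>\<^sub>0 complex) \<Rightarrow> ('k \<Rightarrow>\<^sub>0 complex)" where
  "pm_scale a = Poly_Mapping.map (\<lambda>z. a * z)"

lemma lookup_pm_scale: "Poly_Mapping.lookup (pm_scale a c) k = a * Poly_Mapping.lookup c k"
  by (simp add: pm_scale_def Poly_Mapping.map.rep_eq when_def)

lemma pm_scale_single [simp]: "pm_scale a (Poly_Mapping.single k z) = Poly_Mapping.single k (a * z)"
  by (simp add: pm_scale_def)

lemma pm_scale_laws:
  "pm_scale (a + b) x = pm_scale a x + pm_scale b x" "pm_scale a (x + y) = pm_scale a x + pm_scale a y"
  "pm_scale (a * b) x = pm_scale a (pm_scale b x)" "pm_scale 1 x = x"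
  by (rule poly_mapping_eqI, simp only: lookup_pm_scale lookup_add, simp add: algebra_simps)+

lemma keys_pm_scale: "Poly_Mapping.keys (pm_scale a c) \<subseteq> Poly_Mapping.keys c"
  by (auto simp: in_keys_iff lookup_pm_scale)

lemma sum_single_lookup: "(\<Sum>k\<in>Poly_Mapping.keys x. Poly_Mapping.single k (Poly_Mapping.lookup x k)) = x"
  by (rule poly_mapping_eqI) (simp add: lookup_sum lookup_single when_def in_keys_iff)

text \<open>The linear extension of \<open>f\<close> to chains. On boundaries it measures how far
  \<open>f\<close> is from being additive.\<close>

definition (in complex_algebra) chain_eval :: "('k \<Rightarrow> 'a) \<Rightarrow> ('k \<Rightarrow>\<^sub>0 complex) \<Rightarrow> 'a" where
  "chain_eval f c = (\<Sum>k\<in>Poly_Mapping.keys c. \<kappa> (Poly_Mapping.lookup c k) * f k)"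

context complex_algebra
begin

lemma chain_eval_add: "chain_eval f (c + d) = chain_eval f c + chain_eval f d"
  unfolding chain_eval_def by (rule setsum_keys_plus_distrib) (auto simp: scalar_add distrib_right)

lemma chain_eval_single: "chain_eval f (Poly_Mapping.single k z) = \<kappa> z * f k"
  by (cases "z = 0") (simp_all add: chain_eval_def)

lemma chain_eval_diff: "chain_eval f (c - d) = chain_eval f c - chain_eval f d"
  using chain_eval_add[of f "c - d" d] by simp

lemma chain_eval_sum: "chain_eval f (sum g A) = (\<Sum>x\<in>A. chain_eval f (g x))"
proof (induction A rule: infinite_finite_induct)
  case (insert x F) then show ?case by (simp add: chain_eval_add)
qed (auto simp: chain_eval_def)

lemma chain_eval_boundary2:
  "chain_eval f (boundary2 G c) =
    (\<Sum>(g, h)\<in>Poly_Mapping.keys c. \<kappa> (Poly_Mapping.lookup c (g, h)) * (f h - f (g \<otimes>\<^bsub>G\<^esub> h) + f g))"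
  unfolding boundary2_def chain_eval_sum
  by (intro sum.cong refl) (auto simp: chain_eval_add chain_eval_diff chain_eval_single algebra_simps)

end

lemma boundary2_add: "boundary2 G (c + d) = boundary2 G c + boundary2 G d"
  unfolding boundary2_def case_prod_beta prod.collapse
  by (rule setsum_keys_plus_distrib) (auto simp: single_add algebra_simps)

lemma boundary2_scale: "boundary2 G (pm_scale a c) = pm_scale a (boundary2 G c)"
proof (rule poly_mapping_eqI)
  fix k
  have "boundary2 G (pm_scale a c) = (\<Sum>(g, h)\<in>Poly_Mapping.keys c.
       Poly_Mapping.single h (a * Poly_Mapping.lookup c (g, h))
     - Poly_Mapping.single (g \<otimes>\<^bsub>G\<^esub> h) (a * Poly_Mapping.lookup c (g, h))
     + Poly_Mapping.single g (a * Poly_Mapping.lookup c (g, h)))"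
    unfolding boundary2_def using keys_pm_scale[of a c]
    by (intro sum.mono_neutral_cong_left) (auto simp: lookup_pm_scale in_keys_iff)
  then show "Poly_Mapping.lookup (boundary2 G (pm_scale a c)) k = Poly_Mapping.lookup (pm_scale a (boundary2 G c)) k"
    by (simp add: lookup_pm_scale boundary2_def lookup_sum sum_distrib_left)
      (intro sum.cong refl, auto simp: lookup_add lookup_minus lookup_single when_def algebra_simps)
qed

section \<open>Bases of first homology by group elements\<close>

locale group_H1_dim_2 = group G for G :: "('g, 'b) monoid_scheme" (structure) +
  assumes H1: "has_dimension (group_H1 G) 2"
begin

abbreviation "cycles1 \<equiv> {c :: 'g \<Rightarrow>\<^sub>0 complex. Poly_Mapping.keys c \<subseteq> carrier G}"
abbreviation "boundaries \<equiv> boundary2 G ` {c. Poly_Mapping.keys c \<subseteq> carrier G \<times> carrier G}"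

lemma boundaries_subspace:
  "boundaries \<subseteq> cycles1" "0 \<in> boundaries" "x \<in> boundaries \<Longrightarrow> y \<in> boundaries \<Longrightarrow> x + y \<in> boundaries"
  "x \<in> boundaries \<Longrightarrow> pm_scale a x \<in> boundaries"
proof -
  show "boundaries \<subseteq> cycles1"
  proof clarify
    fix c k assume c: "Poly_Mapping.keys c \<subseteq> carrier G \<times> carrier G" "k \<in> Poly_Mapping.keys (boundary2 G c)"
    show "k \<in> carrier G"
    proof (rule ccontr)
      assume k: "k \<notin> carrier G"
      have "Poly_Mapping.lookup (boundary2 G c) k = 0"
        unfolding boundary2_def lookup_sum
      proof (intro sum.neutral ballI)
        fix p assume "p \<in> Poly_Mapping.keys c"
        then obtain g h where "p = (g, h)" "g \<in> carrier G" "h \<in> carrier G" using c(1) by auto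
        with k show "Poly_Mapping.lookup (case p of (g, h) \<Rightarrow> Poly_Mapping.single h (Poly_Mapping.lookup c (g, h))
           - Poly_Mapping.single (g \<otimes> h) (Poly_Mapping.lookup c (g, h))
           + Poly_Mapping.single g (Poly_Mapping.lookup c (g, h))) k = 0"
          by (auto simp: lookup_add lookup_minus lookup_single when_def)
      qed
      with c(2) show False by (simp add: in_keys_iff)
    qed
  qed
  have "boundary2 G 0 = 0" by (simp add: boundary2_def)
  then show "0 \<in> boundaries" by (intro image_eqI[of _ _ 0]) auto
  show "x + y \<in> boundaries" if xy: "x \<in> boundaries" "y \<in> boundaries"
  proof -
    obtain c d where cd: "x = boundary2 G c" "Poly_Mapping.keys c \<subseteq> carrier G \<times> carrier G" 
      "y = boundary2 G d" "Poly_Mapping.keys d \<subseteq> carrier G \<times> carrier G" using xy by blast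
    then have "Poly_Mapping.keys (c + d) \<subseteq> carrier G \<times> carrier G" using Poly_Mapping.keys_add[of c d] by blast
    then show ?thesis using cd by (auto simp flip: boundary2_add)
  qed
  show "pm_scale a x \<in> boundaries" if x: "x \<in> boundaries"
  proof -
    obtain c where c: "x = boundary2 G c" "Poly_Mapping.keys c \<subseteq> carrier G \<times> carrier G" using x by blast
    then have "Poly_Mapping.keys (pm_scale a c) \<subseteq> carrier G \<times> carrier G" using keys_pm_scale[of a c] by blast
    then show ?thesis using c by (auto simp flip: boundary2_scale)
  qed
qed

lemma H1_coordinates:
  "\<exists>u\<in>cycles1. \<exists>v\<in>cycles1. (\<forall>x\<in>cycles1. \<exists>s t. x - (pm_scale s u + pm_scale t v) \<in> boundaries) \<and>
    (\<forall>s t. pm_scale s u + pm_scale t v \<in> boundaries \<longrightarrow> s = 0 \<and> t = 0)"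
proof -
  have ch: "carrier (chains1 G) = cycles1" "\<zero>\<^bsub>chains1 G\<^esub> = 0"
    "\<And>x y. x \<oplus>\<^bsub>chains1 G\<^esub> y = x + y" "\<And>a x. a \<odot>\<^bsub>chains1 G\<^esub> x = pm_scale a x"
    by (simp_all add: chains1_def pm_scale_def)
  interpret C: space_presentation pm_scale cycles1 "\<lambda>x. x" "chains1 G"
  proof
    show "x + y \<in> cycles1" if "x \<in> cycles1" "y \<in> cycles1" for x y using that Poly_Mapping.keys_add[of x y] by auto
    show "pm_scale a x \<in> cycles1" if "x \<in> cycles1" for a x using that keys_pm_scale[of a x] by auto
  qed (auto simp: pm_scale_laws ch)
  interpret Q: space_presentation pm_scale cycles1 "\<lambda>x. boundaries +>\<^bsub>chains1 G\<^esub> x" "group_H1 G"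
    unfolding group_H1_def using C.quot_space_presentation(1)[OF boundaries_subspace] boundaries_subspace(2) by simp
  have eq: "(boundaries +>\<^bsub>chains1 G\<^esub> x = boundaries +>\<^bsub>chains1 G\<^esub> y) = (x - y \<in> boundaries)"
    if "x \<in> cycles1" "y \<in> cycles1" for x y
    using C.quot_space_presentation(2)[OF boundaries_subspace _ that] boundaries_subspace(2) by simp
  obtain u' v' where uv': "u' \<in> carrier (group_H1 G)" "v' \<in> carrier (group_H1 G)"
    "\<And>x. x \<in> carrier (group_H1 G) \<Longrightarrow> \<exists>s t. x = (s \<odot>\<^bsub>group_H1 G\<^esub> u') \<oplus>\<^bsub>group_H1 G\<^esub> (t \<odot>\<^bsub>group_H1 G\<^esub> v')"
    "\<And>s t. (s \<odot>\<^bsub>group_H1 G\<^esub> u') \<oplus>\<^bsub>group_H1 G\<^esub> (t \<odot>\<^bsub>group_H1 G\<^esub> v') = \<zero>\<^bsub>group_H1 G\<^esub> \<Longrightarrow> s = 0 \<and> t = 0"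
    using has_dimension_2_obtain[OF Q.vectorspace H1] by blast
  then obtain u v where uv: "u \<in> cycles1" "v \<in> cycles1" "u' = boundaries +>\<^bsub>chains1 G\<^esub> u" "v' = boundaries +>\<^bsub>chains1 G\<^esub> v"
    by (auto simp: Q.space_carrier)
  have comb: "(s \<odot>\<^bsub>group_H1 G\<^esub> u') \<oplus>\<^bsub>group_H1 G\<^esub> (t \<odot>\<^bsub>group_H1 G\<^esub> v') = boundaries +>\<^bsub>chains1 G\<^esub> (pm_scale s u + pm_scale t v)" for s t
    unfolding uv(3,4) Q.space_smult[OF uv(1)] Q.space_smult[OF uv(2)] using uv Q.M(3) by (intro Q.space_add)
  have cc: "pm_scale s u + pm_scale t v \<in> cycles1" for s t using uv Q.M(2,3) by blast
  have "\<exists>s t. x - (pm_scale s u + pm_scale t v) \<in> boundaries" if "x \<in> cycles1" for x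
    using uv'(3)[of "boundaries +>\<^bsub>chains1 G\<^esub> x"] that unfolding comb by (auto simp: Q.space_carrier eq[OF that cc])
  moreover have "s = 0 \<and> t = 0" if "pm_scale s u + pm_scale t v \<in> boundaries" for s t
    using that uv'(4)[of s t] eq[OF cc Q.M(1), of s t] unfolding comb Q.space_zero by simp
  ultimately show ?thesis using uv(1,2) by blast
qed

text \<open>A basis of \<open>H_1\<close> given by group elements, with the dual homomorphisms. The
  last clause stays at the level of chains so that functions additive only modulo an ideal can be
  expanded as well.\<close>

definition hom_basis :: "'g \<Rightarrow> 'g \<Rightarrow> ('g \<Rightarrow> complex) \<Rightarrow> ('g \<Rightarrow> complex) \<Rightarrow> bool" where
  "hom_basis a b \<alpha> \<beta> \<longleftrightarrow> a \<in> carrier G \<and> b \<in> carrier G \<and>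
    (\<forall>g\<in>carrier G. \<forall>h\<in>carrier G. \<alpha> (g \<otimes> h) = \<alpha> g + \<alpha> h \<and> \<beta> (g \<otimes> h) = \<beta> g + \<beta> h) \<and>
    \<alpha> a = 1 \<and> \<alpha> b = 0 \<and> \<beta> a = 0 \<and> \<beta> b = 1 \<and>
    (\<forall>g\<in>carrier G. Poly_Mapping.single g 1 - (Poly_Mapping.single a (\<alpha> g) + Poly_Mapping.single b (\<beta> g)) \<in> boundaries)"

text \<open>The classes of group elements span \<open>H_1\<close>, so two of them form a basis, and
  \<open>\<alpha>\<close>, \<open>\<beta>\<close> are the coordinates in it.\<close>

theorem hom_basis_exists: "\<exists>a b \<alpha> \<beta>. hom_basis a b \<alpha> \<beta>"
proof -
  obtain u v where uv: "u \<in> cycles1" "v \<in> cycles1"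
    "\<And>x. x \<in> cycles1 \<Longrightarrow> \<exists>s t. x - (pm_scale s u + pm_scale t v) \<in> boundaries"
    "\<And>s t. pm_scale s u + pm_scale t v \<in> boundaries \<Longrightarrow> s = 0 \<and> t = 0"
    using H1_coordinates by blast
  have sub: "x - y \<in> boundaries" if "x \<in> boundaries" "y \<in> boundaries" for x y
  proof -
    have e: "x - y = x + pm_scale (-1) y" by (rule poly_mapping_eqI) (simp add: lookup_add lookup_minus lookup_pm_scale lookup_single when_def)
    show ?thesis unfolding e by (rule boundaries_subspace(3)[OF that(1) boundaries_subspace(4)[OF that(2)]])
  qed
  have "\<forall>x. \<exists>st. x \<in> cycles1 \<longrightarrow> x - (pm_scale (fst st) u + pm_scale (snd st) v) \<in> boundaries"
    using uv(3) by simp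
  from choice[OF this] obtain st where st: "\<And>x. x \<in> cycles1 \<Longrightarrow> x - (pm_scale (fst (st x)) u + pm_scale (snd (st x)) v) \<in> boundaries"
    by blast
  define S where "S x = fst (st x)" for x
  define T where "T x = snd (st x)" for x
  have uniq: "S x = s \<and> T x = t" if "x \<in> cycles1" "x - (pm_scale s u + pm_scale t v) \<in> boundaries" for x s t
  proof -
    have "pm_scale (S x - s) u + pm_scale (T x - t) v =
      (x - (pm_scale s u + pm_scale t v)) - (x - (pm_scale (S x) u + pm_scale (T x) v))"
      by (rule poly_mapping_eqI) (simp add: lookup_add lookup_minus lookup_pm_scale algebra_simps)
    then have "pm_scale (S x - s) u + pm_scale (T x - t) v \<in> boundaries"
      using sub[OF that(2) st[OF that(1)]] by (simp add: S_def T_def)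
    from uv(4)[OF this] show ?thesis by simp
  qed
  have ST: "x - (pm_scale (S x) u + pm_scale (T x) v) \<in> boundaries" if "x \<in> cycles1" for x
    using st[OF that] by (simp add: S_def T_def)
  have add: "S (x + y) = S x + S y \<and> T (x + y) = T x + T y" if "x \<in> cycles1" "y \<in> cycles1" for x y
  proof (rule uniq)
    show "x + y \<in> cycles1" using that Poly_Mapping.keys_add[of x y] by auto
    have e: "x + y - (pm_scale (S x + S y) u + pm_scale (T x + T y) v) =
      (x - (pm_scale (S x) u + pm_scale (T x) v)) + (y - (pm_scale (S y) u + pm_scale (T y) v))"
      by (rule poly_mapping_eqI) (simp add: lookup_add lookup_minus lookup_pm_scale algebra_simps)
    show "x + y - (pm_scale (S x + S y) u + pm_scale (T x + T y) v) \<in> boundaries"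
      unfolding e by (rule boundaries_subspace(3)[OF ST[OF that(1)] ST[OF that(2)]])
  qed
  have scale: "S (pm_scale a x) = a * S x \<and> T (pm_scale a x) = a * T x" if "x \<in> cycles1" for a x
  proof (rule uniq)
    show "pm_scale a x \<in> cycles1" using that keys_pm_scale[of a x] by auto
    have e: "pm_scale a x - (pm_scale (a * S x) u + pm_scale (a * T x) v) =
      pm_scale a (x - (pm_scale (S x) u + pm_scale (T x) v))"
      by (rule poly_mapping_eqI) (simp add: lookup_add lookup_minus lookup_pm_scale algebra_simps)
    show "pm_scale a x - (pm_scale (a * S x) u + pm_scale (a * T x) v) \<in> boundaries"
      unfolding e by (rule boundaries_subspace(4)[OF ST[OF that]])
  qed
  have zero: "S x = 0 \<and> T x = 0" if "x \<in> boundaries" for x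
  proof (rule uniq)
    have "x - (pm_scale 0 u + pm_scale 0 v) = x"
      by (rule poly_mapping_eqI) (simp add: lookup_add lookup_minus lookup_pm_scale)
    then show "x - (pm_scale 0 u + pm_scale 0 v) \<in> boundaries" using that by (simp only:)
  qed (use that boundaries_subspace(1) in blast)
  have zeroD: "x \<in> boundaries" if "x \<in> cycles1" "S x = 0" "T x = 0" for x
  proof -
    have e: "x - (pm_scale (S x) u + pm_scale (T x) v) = x"
      unfolding that by (intro poly_mapping_eqI) (simp add: lookup_add lookup_minus lookup_pm_scale lookup_single when_def)
    show ?thesis using ST[OF that(1)] by (simp only: e)
  qed
  define p where "p g = S (Poly_Mapping.single g 1)" for g
  define q where "q g = T (Poly_Mapping.single g 1)" for g
  have sgl: "Poly_Mapping.single g z \<in> cycles1" if "g \<in> carrier G" for g and z :: complex using that by simp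
  have hom: "p (g \<otimes> h) = p g + p h \<and> q (g \<otimes> h) = q g + q h" if gh: "g \<in> carrier G" "h \<in> carrier G" for g h
  proof -
    define x where "x = Poly_Mapping.single h (1::complex)"
    define y where "y = Poly_Mapping.single (g \<otimes> h) (- 1 :: complex)"
    define z where "z = Poly_Mapping.single g (1::complex)"
    have c: "x \<in> cycles1" "y \<in> cycles1" "z \<in> cycles1" using gh by (auto simp: x_def y_def z_def)
    then have c': "x + y \<in> cycles1" using Poly_Mapping.keys_add[of x y] by auto
    have "boundary2 G (Poly_Mapping.single (g, h) 1) = (x + y) + z"
      by (rule poly_mapping_eqI) (simp add: boundary2_def x_def y_def z_def lookup_add lookup_minus lookup_single when_def)
    moreover have "boundary2 G (Poly_Mapping.single (g, h) 1) \<in> boundaries"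
      using gh by (intro imageI) simp
    ultimately have "S ((x + y) + z) = 0" "T ((x + y) + z) = 0" using zero by auto
    moreover have "S y = - p (g \<otimes> h)" "T y = - q (g \<otimes> h)"
      using scale[OF sgl, of "g \<otimes> h" "-1" 1] gh by (simp_all add: y_def p_def q_def)
    ultimately show ?thesis
      using add[OF c' c(3)] add[OF c(1,2)] by (simp add: x_def z_def p_def q_def add_eq_0_iff algebra_simps)
  qed
  \<comment> \<open>Otherwise all pairs \<open>(p g, q g)\<close> are proportional, and a nonzero
    combination of \<open>S\<close> and \<open>T\<close> kills every chain, in particular
    \<open>u\<close> and \<open>v\<close>, whose coordinates are the unit vectors.\<close>
  have "\<exists>a\<in>carrier G. \<exists>b\<in>carrier G. p a * q b - p b * q a \<noteq> 0"
  proof (rule ccontr)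
    assume "\<not> ?thesis"
    then have dep: "p a * q b = p b * q a" if "a \<in> carrier G" "b \<in> carrier G" for a b using that by simp
    obtain s t where st0: "s \<noteq> 0 \<or> t \<noteq> 0" "\<And>g. g \<in> carrier G \<Longrightarrow> s * p g + t * q g = 0"
    proof (cases "\<exists>a\<in>carrier G. p a \<noteq> 0 \<or> q a \<noteq> 0")
      case True
      then obtain a where a: "a \<in> carrier G" "p a \<noteq> 0 \<or> q a \<noteq> 0" by blast
      show ?thesis by (rule that[of "q a" "- p a"]) (use a dep[OF a(1)] in \<open>auto simp: mult.commute\<close>)
    next
      case False
      then show ?thesis by (intro that[of 1 1]) auto
    qed
    have all: "s * S x + t * T x = 0" if x: "x \<in> cycles1" for x
    proof -
      have "s * S (\<Sum>k\<in>K. Poly_Mapping.single k (Poly_Mapping.lookup x k)) +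
          t * T (\<Sum>k\<in>K. Poly_Mapping.single k (Poly_Mapping.lookup x k)) = 0 \<and>
          (\<Sum>k\<in>K. Poly_Mapping.single k (Poly_Mapping.lookup x k)) \<in> cycles1" if "finite K" "K \<subseteq> carrier G" for K
        using that
      proof (induction K rule: finite_induct)
        case empty
        then show ?case using zero[OF boundaries_subspace(2)] by simp
      next
        case (insert k K)
        let ?x = "Poly_Mapping.single k (Poly_Mapping.lookup x k)" and ?r = "\<Sum>k\<in>K. Poly_Mapping.single k (Poly_Mapping.lookup x k)"
        have k: "k \<in> carrier G" using insert by simp
        have "?x = pm_scale (Poly_Mapping.lookup x k) (Poly_Mapping.single k 1)" by simp
        then have "S ?x = Poly_Mapping.lookup x k * p k" "T ?x = Poly_Mapping.lookup x k * q k"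
          using scale[OF sgl[OF k], of "Poly_Mapping.lookup x k" 1] by (simp_all add: p_def q_def)
        moreover have "?r \<in> cycles1" "s * S ?r + t * T ?r = 0" using insert by auto
        moreover have "?x + ?r \<in> cycles1" using \<open>?r \<in> cycles1\<close> sgl[OF k, of "Poly_Mapping.lookup x k"] Poly_Mapping.keys_add[of ?x ?r] by auto
        moreover have "s * (Poly_Mapping.lookup x k * p k) + t * (Poly_Mapping.lookup x k * q k) =
           Poly_Mapping.lookup x k * (s * p k + t * q k)" by (simp add: algebra_simps)
        ultimately show ?case using insert(1,2) add[OF sgl[OF k] \<open>?r \<in> cycles1\<close>, of "Poly_Mapping.lookup x k"] st0(2)[OF k]
          by (simp add: algebra_simps)
      qed
      from this[of "Poly_Mapping.keys x"] x show ?thesis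
        by (simp add: sum_single_lookup)
    qed
    have "S u = 1 \<and> T u = 0" "S v = 0 \<and> T v = 1"
    proof -
      have "u - (pm_scale 1 u + pm_scale 0 v) = 0" "v - (pm_scale 0 u + pm_scale 1 v) = 0"
        by (rule poly_mapping_eqI, simp add: lookup_add lookup_minus lookup_pm_scale)+
      then show "S u = 1 \<and> T u = 0" "S v = 0 \<and> T v = 1"
        using boundaries_subspace(2) by (intro uniq[OF uv(1)] uniq[OF uv(2)]; simp only:)+
    qed
    then show False using all[OF uv(1)] all[OF uv(2)] st0(1) by simp
  qed
  then obtain a b where ab: "a \<in> carrier G" "b \<in> carrier G" "p a * q b - p b * q a \<noteq> 0" by blast
  \<comment> \<open>Cramer's rule for the change from \<open>u\<close>, \<open>v\<close> to the
    classes of \<open>a\<close>, \<open>b\<close>.\<close>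
  define D where "D = p a * q b - p b * q a"
  define \<alpha> where "\<alpha> g = (p g * q b - p b * q g) / D" for g
  define \<beta> where "\<beta> g = (p a * q g - p g * q a) / D" for g
  have D: "D \<noteq> 0" using ab by (simp add: D_def)
  have pq: "p g = \<alpha> g * p a + \<beta> g * p b" "q g = \<alpha> g * q a + \<beta> g * q b" for g
    using D unfolding \<alpha>_def \<beta>_def by (simp_all add: field_simps) (simp_all add: D_def algebra_simps)
  have 1: "\<alpha> (g \<otimes> h) = \<alpha> g + \<alpha> h \<and> \<beta> (g \<otimes> h) = \<beta> g + \<beta> h" if "g \<in> carrier G" "h \<in> carrier G" for g h
    using hom[OF that] by (simp add: \<alpha>_def \<beta>_def algebra_simps flip: add_divide_distrib diff_divide_distrib)
  have 2: "\<alpha> a = 1" "\<alpha> b = 0" "\<beta> a = 0" "\<beta> b = 1"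
    using D by (auto simp: \<alpha>_def \<beta>_def D_def)
  have 3: "Poly_Mapping.single g 1 - (Poly_Mapping.single a (\<alpha> g) + Poly_Mapping.single b (\<beta> g)) \<in> boundaries"
    if g: "g \<in> carrier G" for g
  proof -
    define x where "x = Poly_Mapping.single g (1::complex)"
    define y where "y = Poly_Mapping.single a (- \<alpha> g)"
    define z where "z = Poly_Mapping.single b (- \<beta> g)"
    have e: "Poly_Mapping.single g 1 - (Poly_Mapping.single a (\<alpha> g) + Poly_Mapping.single b (\<beta> g)) = (x + y) + z"
      by (rule poly_mapping_eqI) (simp add: x_def y_def z_def lookup_add lookup_minus lookup_single when_def)
    have c1: "x \<in> cycles1" "y \<in> cycles1" "z \<in> cycles1" using g ab by (auto simp: x_def y_def z_def)
    have c2: "x + y \<in> cycles1" using Poly_Mapping.keys_add[of x y] c1 by auto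
    have c3: "(x + y) + z \<in> cycles1" using Poly_Mapping.keys_add[of "x + y" z] c1 c2 by auto
    have "S y = - \<alpha> g * p a" "T y = - \<alpha> g * q a"
      using scale[OF sgl[OF ab(1)], of "- \<alpha> g" 1] by (simp_all add: y_def p_def q_def)
    moreover have "S z = - \<beta> g * p b" "T z = - \<beta> g * q b"
      using scale[OF sgl[OF ab(2)], of "- \<beta> g" 1] by (simp_all add: z_def p_def q_def)
    ultimately have "S ((x + y) + z) = 0" "T ((x + y) + z) = 0"
      using add[OF c2 c1(3)] add[OF c1(1,2)] pq[of g] by (simp_all add: x_def p_def q_def)
    from zeroD[OF c3 this] show ?thesis by (simp only: e)
  qed
  show ?thesis
    unfolding hom_basis_def using ab(1,2) 1 2 3
    by (intro exI[of _ a] exI[of _ b] exI[of _ \<alpha>] exI[of _ \<beta>]) simp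
qed

text \<open>\<open>chain_eval f\<close> is applied to the homology relation for \<open>g\<close>; it
  sends boundaries to combinations of additivity defects, which lie in \<open>S\<close>. With
  \<open>S = {0}\<close>, a homomorphism is determined by its values at \<open>a\<close> and
  \<open>b\<close>.\<close>

lemma hom_basis_expand:
  fixes \<kappa> :: "complex \<Rightarrow> 'c::comm_ring_1" and f :: "'g \<Rightarrow> 'c"
  assumes "complex_algebra \<kappa>" "hom_basis a b \<alpha> \<beta>"
    and S: "0 \<in> S" "\<And>x y. x \<in> S \<Longrightarrow> y \<in> S \<Longrightarrow> x + y \<in> S" "\<And>c x. x \<in> S \<Longrightarrow> \<kappa> c * x \<in> S"
    and f: "\<And>g h. g \<in> carrier G \<Longrightarrow> h \<in> carrier G \<Longrightarrow> f h - f (g \<otimes> h) + f g \<in> S"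
    and g: "g \<in> carrier G"
  shows "f g - (\<kappa> (\<alpha> g) * f a + \<kappa> (\<beta> g) * f b) \<in> S"
proof -
  interpret complex_algebra \<kappa> by fact
  obtain c where c: "Poly_Mapping.keys c \<subseteq> carrier G \<times> carrier G"
    "Poly_Mapping.single g 1 - (Poly_Mapping.single a (\<alpha> g) + Poly_Mapping.single b (\<beta> g)) = boundary2 G c"
    using assms(2) g unfolding hom_basis_def by blast
  have "f g - (\<kappa> (\<alpha> g) * f a + \<kappa> (\<beta> g) * f b) = chain_eval f (boundary2 G c)"
    by (simp flip: c(2) add: chain_eval_diff chain_eval_add chain_eval_single)
  also have "\<dots> \<in> S"
  proof -
    have "(\<Sum>p\<in>A. u p) \<in> S" if "\<And>p. p \<in> A \<Longrightarrow> u p \<in> S" for A :: "('g \<times> 'g) set" and u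
      using that by (induction A rule: infinite_finite_induct) (auto intro: S)
    moreover have "(case p of (g, h) \<Rightarrow> \<kappa> (Poly_Mapping.lookup c (g, h)) * (f h - f (g \<otimes> h) + f g)) \<in> S"
      if p: "p \<in> Poly_Mapping.keys c" for p
    proof -
      obtain g h where "p = (g, h)" "g \<in> carrier G" "h \<in> carrier G" using p c(1) by auto
      then show ?thesis using S(3)[OF f] by simp
    qed
    ultimately show ?thesis unfolding chain_eval_boundary2 by blast
  qed
  finally show ?thesis .
qed

end

section \<open>Polynomial functions of representations\<close>

text \<open>Substitution into an arbitrary complex algebra, serving evaluation at a representation,
  conjugation and arcs alike.\<close>

definition peval :: "(complex \<Rightarrow> 'b::comm_ring_1) \<Rightarrow> (rep_var \<Rightarrow> 'b) \<Rightarrow> rep_poly \<Rightarrow> 'b" where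
  "peval \<kappa> s p = (\<Sum>m\<in>Poly_Mapping.keys p. \<kappa> (Poly_Mapping.lookup p m) *
     (\<Prod>v\<in>Poly_Mapping.keys m. s v ^ Poly_Mapping.lookup m v))"

lemma poly_subst_eq_peval: "poly_subst = peval poly_const"
  by (intro ext) (simp add: poly_subst_def peval_def)

context complex_algebra
begin

lemma peval_superset:
  assumes "finite A" "Poly_Mapping.keys p \<subseteq> A"
  shows "peval \<kappa> s p = (\<Sum>m\<in>A. \<kappa> (Poly_Mapping.lookup p m) *
     (\<Prod>v\<in>Poly_Mapping.keys m. s v ^ Poly_Mapping.lookup m v))"
  unfolding peval_def using assms by (intro sum.mono_neutral_left) (auto simp: in_keys_iff)

lemma peval_add: "peval \<kappa> s (p + q) = peval \<kappa> s p + peval \<kappa> s q"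
proof -
  let ?A = "Poly_Mapping.keys p \<union> Poly_Mapping.keys q"
  have "Poly_Mapping.keys (p + q) \<subseteq> ?A" by (rule Poly_Mapping.keys_add)
  then show ?thesis
    by (simp add: peval_superset[of ?A] lookup_add scalar_add distrib_right sum.distrib)
qed

lemma peval_sum: "peval \<kappa> s (sum f A) = (\<Sum>i\<in>A. peval \<kappa> s (f i))"
proof (induction A rule: infinite_finite_induct)
  case (insert x A)
  then show ?case by (simp add: peval_add)
qed (auto simp: peval_def)

lemma peval_single: "peval \<kappa> s (Poly_Mapping.single m c) =
  \<kappa> c * (\<Prod>v\<in>Poly_Mapping.keys m. s v ^ Poly_Mapping.lookup m v)"
  by (cases "c = 0") (simp_all add: peval_def)

lemma monomial_add:
  "(\<Prod>v\<in>Poly_Mapping.keys (m + n). s v ^ Poly_Mapping.lookup (m + n) v) =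
   (\<Prod>v\<in>Poly_Mapping.keys m. s v ^ Poly_Mapping.lookup m v) *
   (\<Prod>v\<in>Poly_Mapping.keys n. s v ^ Poly_Mapping.lookup n v)" for m n :: "rep_var \<Rightarrow>\<^sub>0 nat" and s :: "rep_var \<Rightarrow> 'a"
proof -
  let ?A = "Poly_Mapping.keys m \<union> Poly_Mapping.keys n"
  have e: "(\<Prod>v\<in>Poly_Mapping.keys k. s v ^ Poly_Mapping.lookup k v) = (\<Prod>v\<in>?A. s v ^ Poly_Mapping.lookup k v)"
    if "Poly_Mapping.keys k \<subseteq> ?A" for k
    using that by (intro prod.mono_neutral_left) (auto simp: in_keys_iff)
  have "Poly_Mapping.keys (m + n) \<subseteq> ?A" by (rule Poly_Mapping.keys_add)
  from e[OF this] e[of m] e[of n] show ?thesis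
    by (simp add: lookup_add power_add prod.distrib)
qed

lemma poly_mapping_eq_sum_single:
  "p = (\<Sum>m\<in>Poly_Mapping.keys p. Poly_Mapping.single m (Poly_Mapping.lookup p m))" for p :: rep_poly
proof (rule poly_mapping_eqI)
  fix k
  show "Poly_Mapping.lookup p k = Poly_Mapping.lookup (\<Sum>m\<in>Poly_Mapping.keys p. Poly_Mapping.single m (Poly_Mapping.lookup p m)) k"
    by (simp add: lookup_sum lookup_single when_def in_keys_iff)
qed

lemma peval_mult: "peval \<kappa> s (p * q) = peval \<kappa> s p * peval \<kappa> s q"
proof -
  let ?g = "\<lambda>p m. Poly_Mapping.single m (Poly_Mapping.lookup p m) :: rep_poly"
  have "peval \<kappa> s (p * q) =
    peval \<kappa> s ((\<Sum>m\<in>Poly_Mapping.keys p. ?g p m) * (\<Sum>m\<in>Poly_Mapping.keys q. ?g q m))"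
    using poly_mapping_eq_sum_single by metis
  also have "\<dots> = (\<Sum>m\<in>Poly_Mapping.keys p. \<Sum>n\<in>Poly_Mapping.keys q. peval \<kappa> s (?g p m) * peval \<kappa> s (?g q n))"
    by (simp add: sum_product peval_sum mult_single peval_single scalar_mult monomial_add mult_ac)
  also have "\<dots> = peval \<kappa> s p * peval \<kappa> s q"
    by (simp add: peval_def[of _ _ p] peval_def[of _ _ q] sum_product peval_single)
  finally show ?thesis .
qed

lemma peval_const: "peval \<kappa> s (poly_const c) = \<kappa> c"
  by (simp add: poly_const_def peval_single)

lemma peval_var: "peval \<kappa> s (poly_var v) = s v"
  by (simp add: poly_var_def peval_single)

lemma peval_1: "peval \<kappa> s 1 = 1"
  using peval_const[of s 1] by (simp add: poly_const_def)

lemma peval_0: "peval \<kappa> s 0 = 0"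
  by (simp add: peval_def)

lemma peval_minus: "peval \<kappa> s (- p) = - peval \<kappa> s p"
  using peval_add[of s p "- p"] by (simp add: peval_0 eq_neg_iff_add_eq_0 add.commute)

lemma peval_diff: "peval \<kappa> s (p - q) = peval \<kappa> s p - peval \<kappa> s q"
  using peval_add[of s p "- q"] by (simp add: peval_minus)

end

interpretation rep: complex_algebra poly_const
  by unfold_locales (auto simp: poly_const_def single_add mult_single)

definition vars :: "nat \<Rightarrow> rep_poly set" where
  "vars r = {poly_var (l, i, j) | l i j. l < r}"

definition polys :: "nat \<Rightarrow> rep_poly set" where
  "polys r = rep.alg (vars r)"

lemma peval_id: "peval poly_const poly_var p = p"
proof -
  have "(\<Prod>v\<in>Poly_Mapping.keys m. poly_var v ^ Poly_Mapping.lookup m v) = Poly_Mapping.single m 1" for m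
  proof -
    have "poly_var v ^ n = Poly_Mapping.single (Poly_Mapping.single v n) 1" for v n
      by (induction n) (auto simp: poly_var_def mult_single simp flip: single_add)
    moreover have "(\<Prod>v\<in>A. Poly_Mapping.single (Poly_Mapping.single v (Poly_Mapping.lookup m v)) (1::complex)) =
        Poly_Mapping.single (\<Sum>v\<in>A. Poly_Mapping.single v (Poly_Mapping.lookup m v)) 1" for A :: "rep_var set"
      by (induction A rule: infinite_finite_induct) (auto simp: mult_single)
    moreover have "(\<Sum>v\<in>Poly_Mapping.keys m. Poly_Mapping.single v (Poly_Mapping.lookup m v)) = m"
      by (rule poly_mapping_eqI) (simp add: lookup_sum lookup_single when_def in_keys_iff)
    ultimately show ?thesis by simp
  qed
  then have "peval poly_const poly_var p = (\<Sum>m\<in>Poly_Mapping.keys p. Poly_Mapping.single m (Poly_Mapping.lookup p m))"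
    by (simp add: peval_def poly_const_def mult_single)
  then show ?thesis using rep.poly_mapping_eq_sum_single[of p] by simp
qed

lemma carrier_rep_poly_ring: "carrier (rep_poly_ring r) = polys r"
proof
  show "carrier (rep_poly_ring r) \<subseteq> polys r"
  proof
    fix p assume p: "p \<in> carrier (rep_poly_ring r)"
    have "peval poly_const poly_var p \<in> polys r"
      unfolding peval_def polys_def using p
      by (intro rep.subalg_sum[OF rep.subalg_alg] rep.alg.mult rep.alg.const rep.subalg_prod[OF rep.subalg_alg]
          rep.subalgD(8)[OF rep.subalg_alg] rep.alg.gen) (force simp: rep_poly_ring_def vars_def)
    then show "p \<in> polys r" by (simp add: peval_id)
  qed
  show "polys r \<subseteq> carrier (rep_poly_ring r)"
    unfolding polys_def
  proof (rule rep.alg_least)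
    have "p + q \<in> carrier (rep_poly_ring r)" if "p \<in> carrier (rep_poly_ring r)" "q \<in> carrier (rep_poly_ring r)" for p q
      using that subsetD[OF Poly_Mapping.keys_add[of p q]] by (fastforce simp: rep_poly_ring_def case_prod_beta)
    moreover have "p * q \<in> carrier (rep_poly_ring r)" if "p \<in> carrier (rep_poly_ring r)" "q \<in> carrier (rep_poly_ring r)" for p q
    proof -
      have "\<forall>v\<in>Poly_Mapping.keys m. fst v < r" if "m \<in> Poly_Mapping.keys (p * q)" for m
      proof -
        have "m \<in> {a + b | a b. a \<in> Poly_Mapping.keys p \<and> b \<in> Poly_Mapping.keys q}"
          using that keys_mult by blast
        then obtain a b where "m = a + b" "a \<in> Poly_Mapping.keys p" "b \<in> Poly_Mapping.keys q" by blast
        with \<open>p \<in> _\<close> \<open>q \<in> _\<close> subsetD[OF Poly_Mapping.keys_add[of a b]] show ?thesis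
          by (fastforce simp: rep_poly_ring_def case_prod_beta)
      qed
      then show ?thesis by (simp add: rep_poly_ring_def case_prod_beta)
    qed
    moreover have "poly_const c \<in> carrier (rep_poly_ring r)" for c
      by (simp add: rep_poly_ring_def poly_const_def)
    ultimately show "rep.subalg (carrier (rep_poly_ring r))" by (auto simp: rep.subalg_def)
    show "vars r \<subseteq> carrier (rep_poly_ring r)"
      by (auto simp: vars_def rep_poly_ring_def poly_var_def)
  qed
qed

lemma subalg_polys: "rep.subalg (polys r)"
  unfolding polys_def by (rule rep.subalg_alg)

lemmas polysD = rep.subalgD[OF subalg_polys]

lemma hom_eqI:
  fixes f g :: "rep_poly \<Rightarrow> 'b::comm_ring_1"
  assumes "\<And>c. f (poly_const c) = g (poly_const c)" "\<And>v. f (poly_var v) = g (poly_var v)"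
    "\<And>p q. f (p + q) = f p + f q" "\<And>p q. f (p * q) = f p * f q"
    "\<And>p q. g (p + q) = g p + g q" "\<And>p q. g (p * q) = g p * g q"
  shows "f p = g p"
proof -
  have "p \<in> rep.alg (range poly_var)"
  proof -
    have "peval poly_const poly_var p \<in> rep.alg (range poly_var)"
      unfolding peval_def
      by (intro rep.subalg_sum[OF rep.subalg_alg] rep.alg.mult rep.alg.const rep.subalg_prod[OF rep.subalg_alg]
          rep.subalgD(8)[OF rep.subalg_alg] rep.alg.gen) auto
    then show ?thesis by (simp add: peval_id)
  qed
  then show ?thesis by (induction rule: rep.alg.induct) (auto simp: assms)
qed

lemmas matrix2_simps = matrix_matrix_mult_def sum_2 vec_eq_iff forall_2 adjugate2_def det_2 trace_def mat_def vector_2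

lemma adjugate2_mult: "adjugate2 (A ** B) = adjugate2 B ** adjugate2 (A :: 'a::comm_ring_1^2^2)"
  by (simp add: matrix2_simps algebra_simps)

lemma adjugate2_adjugate2 [simp]: "adjugate2 (adjugate2 A) = A"
  by (simp add: matrix2_simps)

lemma adjugate2_mat_1 [simp]: "adjugate2 (mat 1) = mat 1"
  by (simp add: matrix2_simps)

lemma adjugate2_inverse: "det A = 1 \<Longrightarrow> A ** adjugate2 A = mat 1" "det A = 1 \<Longrightarrow> adjugate2 A ** A = mat 1"
  for A :: "'a::comm_ring_1^2^2"
  by (simp_all add: matrix2_simps algebra_simps)

lemma det_adjugate2: "det (adjugate2 A) = det A" for A :: "'a::comm_ring_1^2^2"
  by (simp add: matrix2_simps algebra_simps)

text \<open>Adjugates are polynomial and reverse products, so \<open>word_eval_inv_word\<close>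
  holds even where determinants differ from \<open>1\<close>.\<close>

definition letter_value :: "(nat \<Rightarrow> 'a::comm_ring_1^2^2) \<Rightarrow> nat \<times> bool \<Rightarrow> 'a^2^2" where
  "letter_value M a = (if snd a then M (fst a) else adjugate2 (M (fst a)))"

definition word_eval :: "(nat \<Rightarrow> 'a::comm_ring_1^2^2) \<Rightarrow> nat word \<Rightarrow> 'a^2^2" where
  "word_eval M w = foldr (\<lambda>a B. letter_value M a ** B) w (mat 1)"

lemma word_matrix_eq: "word_matrix = word_eval gen_matrix"
  by (intro ext) (simp add: word_matrix_def word_eval_def letter_value_def case_prod_unfold if_distrib)

lemma word_eval_simps [simp]:
  "word_eval M [] = mat 1" "word_eval M (a # w) = letter_value M a ** word_eval M w"
  by (simp_all add: word_eval_def)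

lemma word_eval_append: "word_eval M (u @ v) = word_eval M u ** word_eval M v"
  by (induction u) (auto simp: matrix_mul_assoc)

definition inv_word :: "'x word \<Rightarrow> 'x word" where
  "inv_word w = rev (map inv_letter w)"

lemma word_eval_inv_word: "word_eval M (inv_word w) = adjugate2 (word_eval M w)"
  by (induction w) (auto simp: inv_word_def word_eval_append letter_value_def inv_letter_def adjugate2_mult)

lemma words_over_simps [simp]:
  "[] \<in> words_over X" "a # w \<in> words_over X \<longleftrightarrow> fst a \<in> X \<and> w \<in> words_over X"
  "u @ v \<in> words_over X \<longleftrightarrow> u \<in> words_over X \<and> v \<in> words_over X"
  "inv_word w \<in> words_over X \<longleftrightarrow> w \<in> words_over X"
  by (auto simp: words_over_def inv_word_def inv_letter_def image_image)

lemma peval_word_matrix: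
  assumes "complex_algebra \<kappa>"
  shows "peval \<kappa> s (word_matrix w $ i $ j) = word_eval (\<lambda>l. \<chi> i j. s (l, i, j)) w $ i $ j"
proof -
  interpret complex_algebra \<kappa> by fact
  have gen: "peval \<kappa> s (letter_value gen_matrix a $ i $ j) = letter_value (\<lambda>l. \<chi> i j. s (l, i, j)) a $ i $ j" for a i j
    using exhaust_2[of i] exhaust_2[of j]
    by (auto simp: letter_value_def gen_matrix_def peval_var peval_minus adjugate2_def vector_2)
  show ?thesis unfolding word_matrix_eq
  proof (induction w arbitrary: i j)
    case Nil
    then show ?case by (simp add: mat_def peval_1 peval_0)
  next
    case (Cons a w)
    then show ?case by (simp add: matrix_matrix_mult_def peval_sum peval_mult gen)
  qed
qed

lemma gen_matrix_in: "l < r \<Longrightarrow> gen_matrix l $ i $ j \<in> polys r"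
  by (auto simp: gen_matrix_def polys_def vars_def intro!: rep.alg.gen)

lemma word_matrix_in: "w \<in> words_over {..<r} \<Longrightarrow> word_matrix w $ i $ j \<in> polys r"
  unfolding word_matrix_eq
proof (induction w arbitrary: i j)
  case Nil
  then show ?case using polysD by (simp add: mat_def)
next
  case (Cons a w)
  have "\<forall>i j. letter_value gen_matrix a $ i $ j \<in> polys r"
    using Cons.prems gen_matrix_in polysD(6) unfolding letter_value_def
    by (auto simp: forall_2 adjugate2_def vector_2)
  with Cons show ?case by (auto simp: matrix_matrix_mult_def intro!: polysD rep.subalg_sum[OF subalg_polys])
qed

text \<open>All words are taken as generators; finitely many of them suffice by
  \<open>alg_trace_coords\<close>.\<close>

definition traces :: "nat \<Rightarrow> rep_poly set" where
  "traces r = rep.alg {trace (word_matrix w) | w. w \<in> words_over {..<r}}"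

lemma subalg_traces: "rep.subalg (traces r)"
  unfolding traces_def by (rule rep.subalg_alg)

lemmas tracesD = rep.subalgD[OF subalg_traces]

lemma trace_in: "w \<in> words_over {..<r} \<Longrightarrow> trace (word_matrix w) \<in> traces r"
  unfolding traces_def by (intro rep.alg.gen) auto

lemma traces_subset_polys: "traces r \<subseteq> polys r"
  unfolding traces_def
  by (intro rep.alg_least subalg_polys) (auto simp: trace_def intro!: rep.subalg_sum[OF subalg_polys] word_matrix_in)

section \<open>Deformations of the trivial representation\<close>

text \<open>Vanishing of second cohomology in unpacked form, with curried cochains and no
  normalisation outside the carrier.\<close>

definition H2_trivial :: "('g, 'b) monoid_scheme \<Rightarrow> bool" where
  "H2_trivial G \<longleftrightarrow> (\<forall>f :: 'g \<Rightarrow> 'g \<Rightarrow> complex.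
     (\<forall>g\<in>carrier G. \<forall>h\<in>carrier G. \<forall>k\<in>carrier G.
        f h k - f (g \<otimes>\<^bsub>G\<^esub> h) k + f g (h \<otimes>\<^bsub>G\<^esub> k) - f g h = 0) \<longrightarrow>
     (\<exists>u. \<forall>g\<in>carrier G. \<forall>h\<in>carrier G. f g h = u h - u (g \<otimes>\<^bsub>G\<^esub> h) + u g))"

lemma (in group) H2_trivialI:
  assumes "carrier (group_H2 G) = {\<zero>\<^bsub>group_H2 G\<^esub>}"
  shows "H2_trivial G"
  unfolding H2_trivial_def
proof (intro allI impI)
  fix f :: "'a \<Rightarrow> 'a \<Rightarrow> complex"
  assume f: "\<forall>g\<in>carrier G. \<forall>h\<in>carrier G. \<forall>k\<in>carrier G.
        f h k - f (g \<otimes> h) k + f g (h \<otimes> k) - f g h = 0"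
  let ?V = "cocycles2 G" and ?W = "range (coboundary1 G)"
  define F where "F = (\<lambda>(g, h). if g \<in> carrier G \<and> h \<in> carrier G then f g h else 0)"
  have "F \<in> carrier ?V" using f by (auto simp: cocycles2_def F_def)
  then have "?W +>\<^bsub>?V\<^esub> F \<in> carrier (group_H2 G)"
    by (auto simp: group_H2_def quot_space_def A_RCOSETS_def RCOSETS_def a_r_coset_def)
  then have "?W +>\<^bsub>?V\<^esub> F = ?W" using assms by (simp add: group_H2_def quot_space_def)
  moreover have "coboundary1 G (\<lambda>_. 0) = (\<lambda>_. 0)" by (auto simp: coboundary1_def)
  then have "F \<in> ?W +>\<^bsub>?V\<^esub> F"
    by (auto simp: a_r_coset_def r_coset_def cocycles2_def intro!: exI[of _ "\<lambda>_. 0"])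
  ultimately obtain u where "F = coboundary1 G u" by auto
  then have u: "F (g, h) = coboundary1 G u (g, h)" for g h by simp
  have "f g h = u h - u (g \<otimes> h) + u g" if "g \<in> carrier G" "h \<in> carrier G" for g h
    using u[of g h] that by (simp add: F_def coboundary1_def)
  then show "\<exists>u. \<forall>g\<in>carrier G. \<forall>h\<in>carrier G. f g h = u h - u (g \<otimes> h) + u g" by blast
qed

text \<open>First order deformations of the trivial representation are homomorphisms to traceless
  matrices, here \<open>\<alpha> X + \<beta> Y\<close>; each of them has to integrate to a formal
  curve in \<open>SL_2\<close>.\<close>

definition deformable :: "('g, 'b) monoid_scheme \<Rightarrow> ('g \<Rightarrow> complex) \<Rightarrow> ('g \<Rightarrow> complex) \<Rightarrow> bool" where
  "deformable G \<alpha> \<beta> \<longleftrightarrow> (\<forall>X Y :: complex^2^2. trace X = 0 \<longrightarrow> trace Y = 0 \<longrightarrow>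
     (\<exists>\<rho> :: 'g \<Rightarrow> complex fps^2^2.
       (\<forall>g\<in>carrier G. \<forall>h\<in>carrier G. \<rho> (g \<otimes>\<^bsub>G\<^esub> h) = \<rho> g ** \<rho> h) \<and>
       (\<forall>g\<in>carrier G. det (\<rho> g) = 1) \<and>
       (\<forall>g\<in>carrier G. \<forall>i j. fps_nth (\<rho> g $ i $ j) 0 = mat 1 $ i $ j \<and>
          fps_nth (\<rho> g $ i $ j) 1 = \<alpha> g * X $ i $ j + \<beta> g * Y $ i $ j)))"

definition xp :: "nat \<Rightarrow> complex fps^2^2 \<Rightarrow> complex fps^2^2" where
  "xp n A = (\<chi> i j. fps_X ^ n * A $ i $ j)"

definition const_term :: "complex fps^2^2 \<Rightarrow> complex^2^2" where
  "const_term A = (\<chi> i j. fps_nth (A $ i $ j) 0)"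

definition lift_const :: "complex^2^2 \<Rightarrow> complex fps^2^2" where
  "lift_const V = (\<chi> i j. fps_const (V $ i $ j))"

lemma xp_simps:
  "xp n A ** B = xp n (A ** B)" "A ** xp n B = xp n (A ** B)" "xp n A + xp n B = xp n (A + B)"
  "xp n A - xp n B = xp n (A - B)" "xp m (xp n A) = xp (m + n) A" "xp n A = xp n B \<longleftrightarrow> A = B"
  by (auto simp: xp_def matrix_matrix_mult_def sum_2 vec_eq_iff algebra_simps power_add)

lemma const_term_simps:
  "const_term (A ** B) = const_term A ** const_term B" "const_term (A + B) = const_term A + const_term B"
  "const_term (A - B) = const_term A - const_term B" "const_term (lift_const V) = V" "const_term (mat 1) = mat 1"
  "0 < n \<Longrightarrow> const_term (xp n A) = 0"
  by (auto simp: const_term_def lift_const_def xp_def matrix_matrix_mult_def sum_2 vec_eq_iff mat_def fps_X_power_mult_nth)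

lemma const_term_0D:
  assumes "const_term A = 0" obtains B where "A = xp 1 B"
proof (rule that[of "\<chi> i j. fps_shift 1 (A $ i $ j)"])
  have "fps_nth (A $ i $ j) 0 = 0" for i j
    using assms by (auto simp: const_term_def vec_eq_iff)
  then have "A $ i $ j = fps_X * fps_shift 1 (A $ i $ j)" for i j
    by (intro fps_ext) auto
  then show "A = xp 1 (\<chi> i j. fps_shift 1 (A $ i $ j))"
    by (auto simp: xp_def vec_eq_iff)
qed

lemma matrix2_add_rdistrib: "(A + B) ** C = A ** C + B ** C" for A B C :: "'a::comm_ring_1^2^2"
  by (simp add: matrix_matrix_mult_def sum_2 vec_eq_iff algebra_simps)

text \<open>The polar form of the determinant, that is, the bilinear term in
  \<open>det (A + B)\<close>.\<close>

definition mixed_det :: "'a::comm_ring_1^2^2 \<Rightarrow> 'a^2^2 \<Rightarrow> 'a" where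
  "mixed_det A B = A $ 1 $ 1 * B $ 2 $ 2 + A $ 2 $ 2 * B $ 1 $ 1 - A $ 1 $ 2 * B $ 2 $ 1 - A $ 2 $ 1 * B $ 1 $ 2"

lemma det_add_xp: "det (A + xp n B) = det A + fps_X ^ n * (mixed_det A B + fps_X ^ n * det B)"
  by (simp add: det_2 mixed_det_def xp_def algebra_simps)

text \<open>Representations modulo \<open>\<epsilon>\<^sup>n\<close>, reducing to the trivial one modulo \<open>\<epsilon>\<close>.\<close>

definition approx_rep :: "('g, 'b) monoid_scheme \<Rightarrow> nat \<Rightarrow> ('g \<Rightarrow> complex fps^2^2) \<Rightarrow> bool" where
  "approx_rep G n \<rho> \<longleftrightarrow> (\<forall>g\<in>carrier G. \<forall>h\<in>carrier G. \<exists>Z. \<rho> g ** \<rho> h = \<rho> (g \<otimes>\<^bsub>G\<^esub> h) + xp n Z) \<and>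
     (\<forall>g\<in>carrier G. (\<exists>d. det (\<rho> g) = 1 + fps_X ^ n * d) \<and> const_term (\<rho> g) = mat 1)"

text \<open>The obstruction to extending to order \<open>n + 1\<close> is a matrix of 2-cocycles.\<close>

lemma (in group) approx_rep_step:
  assumes H2: "H2_trivial G" and n: "0 < n" and \<rho>: "approx_rep G n \<rho>"
  shows "\<exists>V. approx_rep G (Suc n) (\<lambda>g. \<rho> g + xp n (lift_const (V g)))"
proof -
  have mult: "\<exists>Z. \<rho> g ** \<rho> h = \<rho> (g \<otimes> h) + xp n Z" if "g \<in> carrier G" "h \<in> carrier G" for g h
    using \<rho> that by (simp add: approx_rep_def)
  then have "\<forall>g h. \<exists>Z. g \<in> carrier G \<longrightarrow> h \<in> carrier G \<longrightarrow> \<rho> g ** \<rho> h = \<rho> (g \<otimes> h) + xp n Z" by blast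
  then obtain Z where Z: "\<And>g h. g \<in> carrier G \<Longrightarrow> h \<in> carrier G \<Longrightarrow> \<rho> g ** \<rho> h = \<rho> (g \<otimes> h) + xp n (Z g h)"
    by metis
  have c1: "const_term (\<rho> g) = mat 1" if "g \<in> carrier G" for g using \<rho> that by (simp add: approx_rep_def)
  \<comment> \<open>Associativity of the triple product, with the factor
    \<open>\<epsilon> ^ n\<close> cancelled.\<close>
  have cocycle: "Z (g \<otimes> h) k + Z g h ** \<rho> k = Z g (h \<otimes> k) + \<rho> g ** Z h k"
    if ghk: "g \<in> carrier G" "h \<in> carrier G" "k \<in> carrier G" for g h k
  proof -
    have "(\<rho> g ** \<rho> h) ** \<rho> k = \<rho> (g \<otimes> h \<otimes> k) + xp n (Z (g \<otimes> h) k + Z g h ** \<rho> k)"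
      using ghk by (simp add: Z matrix2_add_rdistrib xp_simps add.assoc flip: xp_simps(3))
    moreover have "\<rho> g ** (\<rho> h ** \<rho> k) = \<rho> (g \<otimes> h \<otimes> k) + xp n (Z g (h \<otimes> k) + \<rho> g ** Z h k)"
      using ghk by (simp add: Z matrix_add_ldistrib xp_simps add.assoc m_assoc flip: xp_simps(3))
    ultimately show ?thesis by (simp add: matrix_mul_assoc xp_simps)
  qed
  \<comment> \<open>The matrices \<open>\<rho> g\<close> and \<open>\<rho> k\<close> are the
    identity modulo \<open>\<epsilon>\<close>, so the constant terms satisfy the cocycle identity
    with trivial coefficients, entry by entry.\<close>
  define z where "z g h = const_term (Z g h)" for g h
  have cocycle0: "z h k - z (g \<otimes> h) k + z g (h \<otimes> k) - z g h = 0"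
    if ghk: "g \<in> carrier G" "h \<in> carrier G" "k \<in> carrier G" for g h k
    using arg_cong[OF cocycle[OF ghk], of const_term] ghk
    by (simp add: const_term_simps c1 z_def matrix_mul_lid matrix_mul_rid algebra_simps)
  have "\<exists>u. \<forall>g\<in>carrier G. \<forall>h\<in>carrier G. z g h $ i $ j = u h - u (g \<otimes> h) + u g" for i j
  proof -
    have "z h k $ i $ j - z (g \<otimes> h) k $ i $ j + z g (h \<otimes> k) $ i $ j - z g h $ i $ j = 0"
      if "g \<in> carrier G" "h \<in> carrier G" "k \<in> carrier G" for g h k
      using arg_cong[OF cocycle0[OF that], of "\<lambda>A. A $ i $ j"] by simp
    then show ?thesis using H2[unfolded H2_trivial_def, rule_format, of "\<lambda>g h. z g h $ i $ j"] by simp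
  qed
  then obtain u where u: "\<And>i j g h. g \<in> carrier G \<Longrightarrow> h \<in> carrier G \<Longrightarrow> z g h $ i $ j = u i j h - u i j (g \<otimes> h) + u i j g"
    by metis
  define U where "U g = (\<chi> i j. - u i j g)" for g
  have U: "z g h + U g + U h - U (g \<otimes> h) = 0" if "g \<in> carrier G" "h \<in> carrier G" for g h
    using u[OF that] by (simp add: vec_eq_iff U_def)
  \<comment> \<open>Any solution \<open>V\<close> of the coboundary equation improves the order;
    this is applied to \<open>U\<close> and again after correcting the determinant.\<close>
  have adjust: "\<exists>W. (\<rho> g + xp n (lift_const (V g))) ** (\<rho> h + xp n (lift_const (V h))) =
       (\<rho> (g \<otimes> h) + xp n (lift_const (V (g \<otimes> h)))) + xp (Suc n) W"
    if gh: "g \<in> carrier G" "h \<in> carrier G" and V: "z g h + V g + V h - V (g \<otimes> h) = 0" for V g h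
  proof -
    define D where "D = Z g h + lift_const (V g) ** \<rho> h + \<rho> g ** lift_const (V h) +
      xp n (lift_const (V g) ** lift_const (V h)) - lift_const (V (g \<otimes> h))"
    have "const_term D = 0"
      using V gh n by (simp add: D_def const_term_simps c1 z_def matrix_mul_lid matrix_mul_rid)
    then obtain W where W: "D = xp 1 W" by (rule const_term_0D)
    have "(\<rho> g + xp n (lift_const (V g))) ** (\<rho> h + xp n (lift_const (V h))) =
       (\<rho> (g \<otimes> h) + xp n (lift_const (V (g \<otimes> h)))) + xp n D"
      by (simp add: matrix_add_ldistrib matrix2_add_rdistrib Z[OF gh] xp_simps D_def flip: xp_simps(3,4))
    then show ?thesis using W by (auto simp: xp_simps)
  qed
  define \<rho>1 where "\<rho>1 g = \<rho> g + xp n (lift_const (U g))" for g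
  have "\<exists>W. \<rho>1 g ** \<rho>1 h = \<rho>1 (g \<otimes> h) + xp (Suc n) W" if "g \<in> carrier G" "h \<in> carrier G" for g h
    unfolding \<rho>1_def by (rule adjust[OF that U[OF that]])
  then have \<rho>1: "\<exists>W. \<rho>1 g ** \<rho>1 h = \<rho>1 (g \<otimes> h) + xp (Suc n) W" if "g \<in> carrier G" "h \<in> carrier G" for g h
    using that by blast
  have "\<exists>d. det (\<rho>1 g) = 1 + fps_X ^ n * d" if g: "g \<in> carrier G" for g
  proof -
    obtain d where "det (\<rho> g) = 1 + fps_X ^ n * d" using \<rho> g by (auto simp: approx_rep_def)
    then have "det (\<rho>1 g) = 1 + fps_X ^ n * (d + (mixed_det (\<rho> g) (lift_const (U g)) + fps_X ^ n * det (lift_const (U g))))"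
      unfolding \<rho>1_def det_add_xp by (simp add: algebra_simps)
    then show ?thesis by blast
  qed
  then obtain d where d: "\<And>g. g \<in> carrier G \<Longrightarrow> det (\<rho>1 g) = 1 + fps_X ^ n * d g" by metis
  \<comment> \<open>Determinants are multiplicative, so their leading error is a homomorphism to the
    additive group.\<close>
  define \<delta> where "\<delta> g = fps_nth (d g) 0" for g
  have \<delta>: "\<delta> (g \<otimes> h) = \<delta> g + \<delta> h" if gh: "g \<in> carrier G" "h \<in> carrier G" for g h
  proof -
    obtain W where W: "\<rho>1 g ** \<rho>1 h = \<rho>1 (g \<otimes> h) + xp (Suc n) W" using \<rho>1[OF gh] by blast
    have "det (\<rho>1 g ** \<rho>1 h) = (1 + fps_X ^ n * d g) * (1 + fps_X ^ n * d h)"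
      by (simp add: det_mul d gh)
    moreover have "det (\<rho>1 g ** \<rho>1 h) = 1 + fps_X ^ n * d (g \<otimes> h) + fps_X ^ Suc n * (mixed_det (\<rho>1 (g \<otimes> h)) W + fps_X ^ Suc n * det W)"
      unfolding W det_add_xp using gh by (simp add: d)
    ultimately have "fps_X ^ n * (d g + d h + fps_X ^ n * d g * d h) =
      fps_X ^ n * (d (g \<otimes> h) + fps_X * (mixed_det (\<rho>1 (g \<otimes> h)) W + fps_X ^ Suc n * det W))"
      by (simp add: algebra_simps)
    then have "d g + d h + fps_X ^ n * d g * d h = d (g \<otimes> h) + fps_X * (mixed_det (\<rho>1 (g \<otimes> h)) W + fps_X ^ Suc n * det W)"
      by simp
    from arg_cong[OF this, of "\<lambda>f. fps_nth f 0"] show ?thesis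
      using n by (simp add: \<delta>_def fps_X_power_mult_nth mult.assoc)
  qed
  \<comment> \<open>Subtracting a scalar matrix of trace \<open>\<delta> g\<close> removes the
    determinant error, and as \<open>\<delta>\<close> is additive the coboundary equation
    survives.\<close>
  define V where "V g = U g - (\<chi> i j. if i = j then \<delta> g / 2 else 0)" for g
  have V: "z g h + V g + V h - V (g \<otimes> h) = 0" if gh: "g \<in> carrier G" "h \<in> carrier G" for g h
    using U[OF gh] \<delta>[OF gh] by (auto simp: V_def vec_eq_iff algebra_simps add_divide_distrib)
  have "approx_rep G (Suc n) (\<lambda>g. \<rho> g + xp n (lift_const (V g)))"
    unfolding approx_rep_def
  proof (intro conjI ballI)
    fix g h assume gh: "g \<in> carrier G" "h \<in> carrier G"
    show "\<exists>Z. (\<rho> g + xp n (lift_const (V g))) ** (\<rho> h + xp n (lift_const (V h))) =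
       (\<rho> (g \<otimes> h) + xp n (lift_const (V (g \<otimes> h)))) + xp (Suc n) Z"
      by (rule adjust[OF gh V[OF gh]])
  next
    fix g assume g: "g \<in> carrier G"
    show "const_term (\<rho> g + xp n (lift_const (V g))) = mat 1"
      using n g by (simp add: const_term_simps c1)
    define S where "S = - lift_const (\<chi> i j. if i = j then \<delta> g / 2 else 0)"
    have eq: "\<rho> g + xp n (lift_const (V g)) = \<rho>1 g + xp n S"
      by (simp add: \<rho>1_def V_def S_def xp_def lift_const_def vec_eq_iff algebra_simps fps_const_sub[symmetric] del: fps_const_sub)
    define e where "e = d g + (mixed_det (\<rho>1 g) S + fps_X ^ n * det S)"
    have "const_term (\<rho>1 g) = mat 1" using n g by (simp add: \<rho>1_def const_term_simps c1)
    then have "fps_nth (\<rho>1 g $ i $ j) 0 = (if i = j then 1 else 0)" for i j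
      by (simp add: const_term_def mat_def vec_eq_iff)
    then have "fps_nth e 0 = 0"
      using n by (simp add: e_def mixed_det_def S_def lift_const_def fps_X_power_mult_nth \<delta>_def)
    then have "e = fps_X * fps_shift 1 e" by (intro fps_ext) auto
    moreover have "det (\<rho>1 g + xp n S) = 1 + fps_X ^ n * e"
      unfolding det_add_xp e_def using g by (simp add: d algebra_simps)
    ultimately show "\<exists>d. det (\<rho> g + xp n (lift_const (V g))) = 1 + fps_X ^ Suc n * d"
      unfolding eq by (intro exI[of _ "fps_shift 1 e"]) (metis mult.assoc power_Suc2)
  qed
  then show ?thesis by blast
qed

text \<open>The lifting starts modulo \<open>\<epsilon> ^ 2\<close>, where additivity and
  tracelessness of the linear term suffice; all later corrections leave that term alone.\<close>

theorem (in group) deformable_if_H2_trivial: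
  assumes H2: "H2_trivial G"
    and \<alpha>: "\<And>g h. g \<in> carrier G \<Longrightarrow> h \<in> carrier G \<Longrightarrow> \<alpha> (g \<otimes> h) = \<alpha> g + \<alpha> h"
    and \<beta>: "\<And>g h. g \<in> carrier G \<Longrightarrow> h \<in> carrier G \<Longrightarrow> \<beta> (g \<otimes> h) = \<beta> g + \<beta> h"
  shows "deformable G \<alpha> \<beta>"
  unfolding deformable_def
proof (intro allI impI)
  fix X Y :: "complex^2^2" assume XY: "trace X = 0" "trace Y = 0"
  define A where "A g = (\<chi> i j. \<alpha> g * X $ i $ j + \<beta> g * Y $ i $ j)" for g
  define \<rho>0 where "\<rho>0 g = mat 1 + xp 1 (lift_const (A g))" for g
  have A: "A (g \<otimes> h) = A g + A h" if "g \<in> carrier G" "h \<in> carrier G" for g h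
    using that by (simp add: A_def vec_eq_iff \<alpha> \<beta> algebra_simps)
  have lc: "lift_const (P + Q) = lift_const P + lift_const Q" for P Q
    by (simp add: lift_const_def vec_eq_iff)
  have init: "approx_rep G 2 \<rho>0"
    unfolding approx_rep_def
  proof (intro conjI ballI)
    fix g h assume gh: "g \<in> carrier G" "h \<in> carrier G"
    have "\<rho>0 g ** \<rho>0 h = \<rho>0 (g \<otimes> h) + xp 2 (lift_const (A g) ** lift_const (A h))"
      by (simp add: \<rho>0_def A[OF gh] lc matrix_add_ldistrib matrix2_add_rdistrib matrix_mul_lid matrix_mul_rid xp_simps flip: xp_simps(3))
        (simp add: algebra_simps numeral_2_eq_2)
    then show "\<exists>Z. \<rho>0 g ** \<rho>0 h = \<rho>0 (g \<otimes> h) + xp 2 Z" by blast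
  next
    fix g assume "g \<in> carrier G"
    show "const_term (\<rho>0 g) = mat 1" by (simp add: \<rho>0_def const_term_simps)
    have "A g $ 1 $ 1 + A g $ 2 $ 2 = \<alpha> g * trace X + \<beta> g * trace Y"
      by (simp add: A_def trace_def sum_2 algebra_simps)
    then have "A g $ 2 $ 2 = - A g $ 1 $ 1" using XY by (simp add: add_eq_0_iff)
    then have "mixed_det (mat 1) (lift_const (A g)) = 0"
      by (simp add: mixed_det_def mat_def lift_const_def flip: fps_const_neg)
    then have "det (\<rho>0 g) = 1 + fps_X ^ 2 * det (lift_const (A g))"
      unfolding \<rho>0_def det_add_xp by (simp add: power2_eq_square mult.assoc)
    then show "\<exists>d. det (\<rho>0 g) = 1 + fps_X ^ 2 * d" by blast
  qed
  have "\<exists>f. \<forall>k. (approx_rep G (k + 2) (f k) \<and> (k = 0 \<longrightarrow> f k = \<rho>0)) \<and> (\<exists>V. \<forall>g. f (Suc k) g = f k g + xp (k + 2) (V g))"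
  proof (rule dependent_nat_choice)
    show "\<exists>f. approx_rep G (0 + 2) f \<and> (0 = 0 \<longrightarrow> f = \<rho>0)" using init by (simp add: numeral_2_eq_2)
    fix f k assume f: "approx_rep G (k + 2) f \<and> (k = 0 \<longrightarrow> f = \<rho>0)"
    obtain V where "approx_rep G (Suc (k + 2)) (\<lambda>g. f g + xp (k + 2) (lift_const (V g)))"
      using approx_rep_step[OF H2, of "k + 2" f] f by auto
    then show "\<exists>f'. (approx_rep G (Suc k + 2) f' \<and> (Suc k = 0 \<longrightarrow> f' = \<rho>0)) \<and> (\<exists>V. \<forall>g. f' g = f g + xp (k + 2) (V g))"
      by (intro exI[of _ "\<lambda>g. f g + xp (k + 2) (lift_const (V g))"]) auto
  qed
  then obtain f where f: "\<And>k. approx_rep G (k + 2) (f k)" "f 0 = \<rho>0"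
    "\<And>k. \<exists>V. \<forall>g. f (Suc k) g = f k g + xp (k + 2) (V g)" by auto
  have stable1: "fps_nth (f (Suc k) g $ i $ j) m = fps_nth (f k g $ i $ j) m" if "m < k + 2" for k g i j m
  proof -
    obtain V where "\<forall>g. f (Suc k) g = f k g + xp (k + 2) (V g)" using f(3) by blast
    then show ?thesis using that by (simp add: xp_def fps_X_power_mult_nth del: power_Suc)
  qed
  have stable: "fps_nth (f k' g $ i $ j) m = fps_nth (f k g $ i $ j) m" if "k \<le> k'" "m < k + 2" for k k' g i j m
    using that by (induction k' rule: dec_induct) (auto simp: stable1)
  \<comment> \<open>The diagonal limit: corrections to stage \<open>m\<close> start at order
    \<open>m + 2\<close>, so its coefficient of order \<open>m\<close> is final.\<close>
  define \<rho> :: "'a \<Rightarrow> complex fps^2^2" where "\<rho> g = (\<chi> i j. Abs_fps (\<lambda>m. fps_nth (f m g $ i $ j) m))" for g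
  have \<rho>: "fps_nth (\<rho> g $ i $ j) m = fps_nth (f k g $ i $ j) m" if "m < k + 2" for g i j m k
    using stable[of k m m g i j] stable[of m k m g i j] that by (cases "k \<le> m") (auto simp: \<rho>_def)
  have prod: "fps_nth (\<rho> g $ i $ j * \<rho> h $ i' $ j') m = fps_nth (f m g $ i $ j * f m h $ i' $ j') m" for g h i j i' j' m
    unfolding fps_mult_nth by (intro sum.cong refl) (simp add: \<rho>[of _ m])
  show "\<exists>\<rho> :: 'a \<Rightarrow> complex fps^2^2.
       (\<forall>g\<in>carrier G. \<forall>h\<in>carrier G. \<rho> (g \<otimes> h) = \<rho> g ** \<rho> h) \<and>
       (\<forall>g\<in>carrier G. det (\<rho> g) = 1) \<and>
       (\<forall>g\<in>carrier G. \<forall>i j. fps_nth (\<rho> g $ i $ j) 0 = mat 1 $ i $ j \<and>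
          fps_nth (\<rho> g $ i $ j) 1 = \<alpha> g * X $ i $ j + \<beta> g * Y $ i $ j)"
  proof (intro exI[of _ \<rho>] conjI ballI allI)
    fix g h assume gh: "g \<in> carrier G" "h \<in> carrier G"
    have "fps_nth ((\<rho> g ** \<rho> h) $ i $ j) m = fps_nth (\<rho> (g \<otimes> h) $ i $ j) m" for i j m
    proof -
      have "fps_nth ((\<rho> g ** \<rho> h) $ i $ j) m = fps_nth ((f m g ** f m h) $ i $ j) m"
        by (simp add: matrix_matrix_mult_def sum_2 prod)
      moreover from f(1)[of m] gh obtain Z where "f m g ** f m h = f m (g \<otimes> h) + xp (m + 2) Z"
        unfolding approx_rep_def by blast
      ultimately show ?thesis using \<rho>[of m m "g \<otimes> h" i j] by (simp add: xp_def fps_X_power_mult_nth del: power_Suc)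
    qed
    then show "\<rho> (g \<otimes> h) = \<rho> g ** \<rho> h" by (simp add: vec_eq_iff fps_eq_iff)
  next
    fix g assume g: "g \<in> carrier G"
    have "fps_nth (det (\<rho> g)) m = fps_nth 1 m" for m
    proof -
      have "fps_nth (det (\<rho> g)) m = fps_nth (det (f m g)) m" by (simp add: det_2 prod)
      moreover from f(1)[of m] g obtain d where "det (f m g) = 1 + fps_X ^ (m + 2) * d"
        unfolding approx_rep_def by blast
      ultimately show ?thesis by (simp add: fps_X_power_mult_nth del: power_Suc)
    qed
    then show "det (\<rho> g) = 1" by (simp add: fps_eq_iff)
    fix i j
    show "fps_nth (\<rho> g $ i $ j) 0 = mat 1 $ i $ j"
      using \<rho>[of 0 0 g i j] by (simp add: f(2) \<rho>0_def xp_def mat_def)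
    show "fps_nth (\<rho> g $ i $ j) 1 = \<alpha> g * X $ i $ j + \<beta> g * Y $ i $ j"
      using \<rho>[of 1 0 g i j] by (simp add: f(2) \<rho>0_def xp_def mat_def lift_const_def A_def)
  qed
qed

section \<open>Deficiency two and free quotients\<close>

lemma inv_letter_inv_letter [simp]: "inv_letter (inv_letter a) = a"
  by (simp add: inv_letter_def)

lemma inv_letter_neq [simp]: "inv_letter a \<noteq> a" "a \<noteq> inv_letter a"
  by (auto simp: inv_letter_def prod_eq_iff)

lemma reduced_simps [simp]:
  "reduced []" "reduced [a]" "reduced (a # b # w) \<longleftrightarrow> b \<noteq> inv_letter a \<and> reduced (b # w)"
  by (auto simp: reduced_def)

lemma reduced_ConsD: "reduced (a # w) \<Longrightarrow> reduced w"
  by (cases w) auto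

lemma reduced_push_letter: "reduced w \<Longrightarrow> reduced (push_letter a w)"
  by (cases w) (auto dest: reduced_ConsD)

lemma push_letter_inv: "reduced w \<Longrightarrow> push_letter a (push_letter (inv_letter a) w) = w"
  by (cases w; cases "tl w") auto

lemma push_letter_words_over: "fst a \<in> X \<Longrightarrow> w \<in> words_over X \<Longrightarrow> push_letter a w \<in> words_over X"
  by (cases w) auto

abbreviation word_mult :: "'x word \<Rightarrow> 'x word \<Rightarrow> 'x word" where
  "word_mult u v \<equiv> foldr push_letter u v"

lemma reduced_word_mult: "reduced v \<Longrightarrow> reduced (word_mult u v)"
  by (induction u) (auto intro: reduced_push_letter)

lemma word_mult_words_over: "u \<in> words_over X \<Longrightarrow> v \<in> words_over X \<Longrightarrow> word_mult u v \<in> words_over X"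
  by (induction u) (auto intro: push_letter_words_over)

lemma word_mult_push_letter: "reduced w \<Longrightarrow> word_mult (push_letter a v) w = push_letter a (word_mult v w)"
  by (cases v) (auto simp: push_letter_inv reduced_word_mult)

lemma word_mult_assoc: "reduced w \<Longrightarrow> word_mult (word_mult u v) w = word_mult u (word_mult v w)"
  by (induction u) (auto simp: word_mult_push_letter)

lemma word_mult_Nil: "reduced w \<Longrightarrow> word_mult w [] = w"
proof (induction w)
  case (Cons a w)
  then have "word_mult w [] = w" by (auto dest: reduced_ConsD)
  with Cons.prems show ?case by (cases w) auto
qed simp

lemma word_mult_inv_word: "reduced w \<Longrightarrow> word_mult (inv_word u) (word_mult u w) = w"
proof (induction u arbitrary: w)
  case (Cons a u)
  have "push_letter (inv_letter a) (push_letter (inv_letter (inv_letter a)) (word_mult u w)) = word_mult u w"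
    by (intro push_letter_inv reduced_word_mult Cons.prems)
  then show ?case using Cons by (simp add: inv_word_def)
qed (simp add: inv_word_def)

lemma reduced_inv_word: "reduced w \<Longrightarrow> reduced (inv_word w)"
  unfolding reduced_def inv_word_def successively_rev successively_map
  by (erule successively_mono) (auto simp: inv_letter_def prod_eq_iff)

lemma group_free_group: "group (free_group X)"
proof (rule groupI)
  fix x assume x: "x \<in> carrier (free_group X)"
  have "word_mult (inv_word x) x = []"
    using word_mult_inv_word[of "[]" x] word_mult_Nil[of x] x by (simp add: free_group_def)
  then show "\<exists>y\<in>carrier (free_group X). y \<otimes>\<^bsub>free_group X\<^esub> x = \<one>\<^bsub>free_group X\<^esub>"
    using x by (intro bexI[of _ "inv_word x"]) (auto simp: free_group_def reduced_inv_word)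
qed (auto simp: free_group_def word_mult_words_over reduced_word_mult word_mult_assoc)

text \<open>A letter and its inverse cancel under evaluation, so the reductions in a product are not
  seen. The target is a monoid so as to cover twisted products and all square matrices.\<close>

lemma free_group_hom:
  assumes "monoid M" "\<And>a. fst a \<in> X \<Longrightarrow> L a \<in> carrier M"
    "\<And>a. fst a \<in> X \<Longrightarrow> L a \<otimes>\<^bsub>M\<^esub> L (inv_letter a) = \<one>\<^bsub>M\<^esub>"
  shows "(\<lambda>w. foldr (\<lambda>a y. L a \<otimes>\<^bsub>M\<^esub> y) w \<one>\<^bsub>M\<^esub>) \<in> hom (free_group X) M"
proof -
  interpret monoid M by fact
  define ev where "ev w = foldr (\<lambda>a y. L a \<otimes>\<^bsub>M\<^esub> y) w \<one>\<^bsub>M\<^esub>" for w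
  have ev [simp]: "ev [] = \<one>\<^bsub>M\<^esub>" "ev (a # w) = L a \<otimes>\<^bsub>M\<^esub> ev w" for a w by (simp_all add: ev_def)
  have c: "ev w \<in> carrier M" if "w \<in> words_over X" for w
    using that by (induction w) (auto intro: assms)
  have push: "ev (push_letter a w) = L a \<otimes>\<^bsub>M\<^esub> ev w" if "fst a \<in> X" "w \<in> words_over X" for a w
  proof (cases w)
    case (Cons b v)
    show ?thesis
    proof (cases "b = inv_letter a")
      case True
      have "L a \<otimes>\<^bsub>M\<^esub> (L (inv_letter a) \<otimes>\<^bsub>M\<^esub> ev v) = ev v"
        using that Cons True c[of v] by (subst m_assoc[symmetric]) (auto simp: assms)
      then show ?thesis using Cons True by simp
    qed (use Cons in auto)
  qed simp
  have "ev (word_mult u v) = ev u \<otimes>\<^bsub>M\<^esub> ev v" if "u \<in> words_over X" "v \<in> words_over X" for u v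
    using that
  proof (induction u)
    case (Cons a u)
    then show ?case using c assms(2)[of a] by (simp add: push word_mult_words_over m_assoc)
  qed (use c in auto)
  then show ?thesis unfolding ev_def[symmetric] using c by (auto simp: hom_def free_group_def)
qed

text \<open>The homomorphism from the free group to the additive complex numbers with prescribed
  values on the generators.\<close>

definition linear_form :: "(nat \<Rightarrow> complex) \<Rightarrow> nat word \<Rightarrow> complex" where
  "linear_form c w = (\<Sum>a\<leftarrow>w. if snd a then c (fst a) else - c (fst a))"

lemma linear_form_push_letter: "linear_form c (push_letter a w) = linear_form c [a] + linear_form c w"
  by (cases w) (auto simp: linear_form_def inv_letter_def)

lemma linear_form_word_mult: "linear_form c (word_mult u v) = linear_form c u + linear_form c v"
proof (induction u)
  case (Cons a u)
  have "linear_form c (a # u) = linear_form c [a] + linear_form c u" by (simp add: linear_form_def)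
  with Cons show ?case by (simp add: linear_form_push_letter)
qed (simp add: linear_form_def)

lemma linear_form_eq_sum:
  assumes "w \<in> words_over {..<n}"
  shows "linear_form c w = (\<Sum>i<n. linear_form (\<lambda>k. if k = i then 1 else 0) w * c i)"
  using assms
proof (induction w)
  case (Cons a w)
  have "linear_form c [a] = (\<Sum>i<n. linear_form (\<lambda>k. if k = i then 1 else 0) [a] * c i)"
  proof -
    have "(\<Sum>i<n. linear_form (\<lambda>k. if k = i then 1 else 0) [a] * c i) =
      (\<Sum>i<n. if i = fst a then (if snd a then c (fst a) else - c (fst a)) else 0)"
      by (intro sum.cong refl) (auto simp: linear_form_def)
    then show ?thesis using Cons.prems by (simp add: linear_form_def)
  qed
  moreover have "linear_form c (a # w) = linear_form c [a] + linear_form c w" for c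
    by (simp add: linear_form_def)
  ultimately show ?case using Cons by (simp add: distrib_right sum.distrib)
qed (simp add: linear_form_def)

text \<open>A square system whose homogeneous version has only the trivial solution is solvable: add the
  right-hand side as one more column.\<close>

lemma square_system_solvable:
  fixes a :: "'r \<Rightarrow> nat \<Rightarrow> complex"
  assumes "finite R" "card R = n"
    and inj: "\<And>x. (\<And>r. r \<in> R \<Longrightarrow> (\<Sum>i<n. a r i * x i) = 0) \<Longrightarrow> \<forall>i<n. x i = 0"
  shows "\<exists>x. \<forall>r\<in>R. (\<Sum>i<n. a r i * x i) = b r"
proof -
  obtain e where e: "bij_betw e {..<n} R"
    using assms(1,2) by (metis ex_bij_betw_nat_finite lessThan_atLeast0)
  obtain y where y: "\<exists>j<Suc n. y j \<noteq> 0" 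
    "\<And>k. k < n \<Longrightarrow> (\<Sum>j<Suc n. (if j < n then a (e k) j else - b (e k)) * y j) = 0"
    using underdetermined_system[of n "Suc n" "\<lambda>k j. if j < n then a (e k) j else - b (e k)"] by auto
  have y': "(\<Sum>i<n. a r i * y i) = b r * y n" if r: "r \<in> R" for r
  proof -
    obtain k where "k < n" "r = e k" using e r by (auto simp: bij_betw_def)
    then show ?thesis using y(2)[of k] by (simp add: algebra_simps)
  qed
  have "y n \<noteq> 0"
  proof
    assume "y n = 0"
    then have "\<forall>i<n. y i = 0" by (intro inj) (simp add: y')
    with y(1) \<open>y n = 0\<close> show False by (auto simp: less_Suc_eq)
  qed
  then show ?thesis
    using y' by (intro exI[of _ "\<lambda>i. y i / y n"]) (simp flip: sum_divide_distrib)
qed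

text \<open>The set underlying a central extension of \<open>G\<close> by the complex numbers; the
  normalisation \<open>f \<one> \<one> = 0\<close> in its use makes \<open>(0, \<one>)\<close>
  neutral.\<close>

definition twisted_product :: "('g, 'b) monoid_scheme \<Rightarrow> ('g \<Rightarrow> 'g \<Rightarrow> complex) \<Rightarrow> (complex \<times> 'g) monoid" where
  "twisted_product G f = \<lparr>carrier = UNIV \<times> carrier G,
     mult = (\<lambda>x y. (fst x + fst y + f (snd x) (snd y), snd x \<otimes>\<^bsub>G\<^esub> snd y)), one = (0, \<one>\<^bsub>G\<^esub>)\<rparr>"

text \<open>Free groups have no second cohomology: the central extension of \<open>G\<close> by a cocycle \<open>f\<close> splits
  over the free group.\<close>

lemma (in group) cocycle_over_free_group:
  fixes f :: "'a \<Rightarrow> 'a \<Rightarrow> complex" and p :: "'x word \<Rightarrow> 'a"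
  assumes f: "\<And>g h k. g \<in> carrier G \<Longrightarrow> h \<in> carrier G \<Longrightarrow> k \<in> carrier G \<Longrightarrow>
      f h k - f (g \<otimes> h) k + f g (h \<otimes> k) - f g h = 0"
    and f1: "f \<one> \<one> = 0"
    and p: "p \<in> hom (free_group X) G"
  obtains u where "\<And>x y. x \<in> carrier (free_group X) \<Longrightarrow> y \<in> carrier (free_group X) \<Longrightarrow>
    u (x \<otimes>\<^bsub>free_group X\<^esub> y) = u x + u y + f (p x) (p y)"
proof -
  let ?F = "free_group X" and ?T = "twisted_product G f"
  interpret F: group ?F by (rule group_free_group)
  interpret p: group_hom ?F G p by unfold_locales (rule p)
  have f1l: "f \<one> g = 0" if "g \<in> carrier G" for g using f[of \<one> \<one> g] that f1 by simp
  have f1r: "f g \<one> = 0" if "g \<in> carrier G" for g using f[of g \<one> \<one>] that f1 by simp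
  have mon: "monoid ?T"
  proof (rule monoidI)
    fix x y z assume "x \<in> carrier ?T" "y \<in> carrier ?T" "z \<in> carrier ?T"
    then show "x \<otimes>\<^bsub>?T\<^esub> y \<otimes>\<^bsub>?T\<^esub> z = x \<otimes>\<^bsub>?T\<^esub> (y \<otimes>\<^bsub>?T\<^esub> z)"
      using f[of "snd x" "snd y" "snd z"] by (auto simp: twisted_product_def m_assoc algebra_simps)
  qed (auto simp: twisted_product_def f1l f1r)
  have let_c: "[a] \<in> carrier ?F" if "fst a \<in> X" for a using that by (simp add: free_group_def)
  define g where "g a = p [a]" for a
  have gc: "g a \<in> carrier G" if "fst a \<in> X" for a unfolding g_def using let_c[OF that] by (rule p.hom_closed)
  have ginv: "g a \<otimes> g (inv_letter a) = \<one>" if "fst a \<in> X" for a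
  proof -
    have "[a] \<otimes>\<^bsub>?F\<^esub> [inv_letter a] = \<one>\<^bsub>?F\<^esub>" by (simp add: free_group_def)
    then show ?thesis unfolding g_def
      using p.hom_mult[of "[a]" "[inv_letter a]"] let_c that p.hom_one by (simp add: inv_letter_def)
  qed
  \<comment> \<open>A generator is lifted with first coordinate \<open>0\<close>; the lift of its
    inverse is then forced, since the two have to cancel.\<close>
  define L where "L a = ((if snd a then 0 else - f (g (inv_letter a)) (g a)), g a)" for a
  have Linv: "L a \<otimes>\<^bsub>?T\<^esub> L (inv_letter a) = \<one>\<^bsub>?T\<^esub>" if a: "fst a \<in> X" for a
  proof -
    have a': "fst (inv_letter a) \<in> X" using a by (simp add: inv_letter_def)
    \<comment> \<open>The cocycle identity for \<open>g a\<close>, its inverse and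
      \<open>g a\<close> shows that a right inverse is also a left inverse.\<close>
    have "f (g (inv_letter a)) (g a) = f (g a) (g (inv_letter a))"
      using f[of "g a" "g (inv_letter a)" "g a"] gc[OF a] gc[OF a'] ginv[OF a] ginv[OF a'] f1l f1r by simp
    then show ?thesis using ginv[OF a]
      by (cases a; cases "snd a") (auto simp: L_def twisted_product_def inv_letter_def)
  qed
  define s where "s w = foldr (\<lambda>a y. L a \<otimes>\<^bsub>?T\<^esub> y) w \<one>\<^bsub>?T\<^esub>" for w
  have s: "s \<in> hom ?F ?T" unfolding s_def
  proof (rule free_group_hom[where L = L and X = X, OF mon])
    show "L a \<in> carrier ?T" if "fst a \<in> X" for a using gc[OF that] by (simp add: L_def twisted_product_def)
  qed (rule Linv)
  have snd_s: "snd (s w) = p w" if "w \<in> carrier ?F" for w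
  proof -
    have "w \<in> words_over X \<Longrightarrow> reduced w \<Longrightarrow> snd (s w) = p w"
    proof (induction w)
      case Nil
      then show ?case using p.hom_one by (simp add: s_def twisted_product_def free_group_def)
    next
      case (Cons a w)
      have w: "w \<in> carrier ?F" using Cons.prems by (auto simp: free_group_def dest: reduced_ConsD)
      have a: "fst a \<in> X" using Cons.prems by simp
      have "[a] \<otimes>\<^bsub>?F\<^esub> w = a # w" using Cons.prems by (cases w) (auto simp: free_group_def)
      then have "p (a # w) = g a \<otimes> p w" using p.hom_mult[OF let_c[OF a] w] by (simp add: g_def)
      moreover have "snd (s (a # w)) = g a \<otimes> snd (s w)" by (simp add: s_def L_def twisted_product_def)
      ultimately show ?case using Cons by (auto dest: reduced_ConsD)
    qed
    with that show ?thesis by (simp add: free_group_def)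
  qed
  show thesis
  proof (rule that[of "\<lambda>w. fst (s w)"])
    fix x y assume "x \<in> carrier ?F" "y \<in> carrier ?F"
    then show "fst (s (x \<otimes>\<^bsub>?F\<^esub> y)) = fst (s x) + fst (s y) + f (p x) (p y)"
      using s snd_s by (simp add: hom_def twisted_product_def)
  qed
qed

text \<open>Allows testing on relators only: a normal zero set that contains the relators contains
  their normal closure.\<close>

lemma (in group) normal_zero_set:
  fixes v :: "'a \<Rightarrow> complex"
  assumes N: "N \<lhd> G" and add: "\<And>x y. x \<in> N \<Longrightarrow> y \<in> N \<Longrightarrow> v (x \<otimes> y) = v x + v y"
    and conj: "\<And>x y. x \<in> carrier G \<Longrightarrow> y \<in> N \<Longrightarrow> v (x \<otimes> y \<otimes> inv x) = v y"
  shows "{w \<in> N. v w = 0} \<lhd> G"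
proof -
  interpret N: normal N G by (rule N)
  have v1: "v \<one> = 0" using add[of \<one> \<one>] N.one_closed by simp
  have "subgroup {w \<in> N. v w = 0} G"
  proof (rule subgroupI)
    show "{w \<in> N. v w = 0} \<noteq> {}" using v1 N.one_closed by blast
    fix x assume x: "x \<in> {w \<in> N. v w = 0}"
    then have "v (x \<otimes> inv x) = v x + v (inv x)" by (intro add) auto
    then show "inv x \<in> {w \<in> N. v w = 0}" using x v1 N.subset by (auto simp: subset_iff)
    fix y assume y: "y \<in> {w \<in> N. v w = 0}"
    show "x \<otimes> y \<in> {w \<in> N. v w = 0}" using x y add by auto
  qed (use N.subset in auto)
  moreover have "x \<otimes> y \<otimes> inv x \<in> N" if "x \<in> carrier G" "y \<in> N" for x y
    using N that normal_inv_iff by blast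
  ultimately show ?thesis unfolding normal_inv_iff using conj by auto
qed

text \<open>There are two relators fewer than generators. Lifts of a basis of \<open>H_1\<close>
  supply two more equations, and the square system has no kernel; hence linear forms take any
  prescribed values on the relators. A cocycle is a coboundary over the free group, and a linear
  form removes the obstruction to descending to \<open>G\<close>.\<close>

theorem (in group_H1_dim_2) deficiency_2_imp_H2_trivial:
  assumes "has_finite_presentation_of_deficiency_2 G"
  shows "H2_trivial G"
  unfolding H2_trivial_def
proof (intro allI impI)
  obtain n R where R: "R \<subseteq> carrier (free_group {..<n})" "finite R" "n = card R + 2"
    and iso: "G \<cong> free_group {..<n::nat} Mod normal_closure (free_group {..<n}) R"
    using assms by (auto simp: has_finite_presentation_of_deficiency_2_def)
  let ?F = "free_group {..<n}"
  define N where "N = normal_closure ?F R"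
  interpret F: group ?F by (rule group_free_group)
  have Nsub: "N \<lhd> ?F"
  proof -
    have c: "carrier ?F \<lhd> ?F" unfolding F.normal_inv_iff using F.subgroup_self by auto
    have "subgroup N ?F" unfolding N_def normal_closure_def
      by (rule F.subgroups_Inter) (use c R(1) in \<open>auto simp: normal_imp_subgroup\<close>)
    moreover have "x \<otimes>\<^bsub>?F\<^esub> y \<otimes>\<^bsub>?F\<^esub> inv\<^bsub>?F\<^esub> x \<in> N" if "x \<in> carrier ?F" "y \<in> N" for x y
      using that F.normal_inv_iff unfolding N_def normal_closure_def by blast
    ultimately show ?thesis unfolding F.normal_inv_iff by blast
  qed
  interpret N: normal N ?F by (rule Nsub)
  have RN: "R \<subseteq> N" by (auto simp: N_def normal_closure_def)
  have Nmin: "N \<subseteq> M" if "M \<lhd> ?F" "R \<subseteq> M" for M using that by (auto simp: N_def normal_closure_def)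
  interpret Q: group "?F Mod N" by (rule N.factorgroup_is_group)
  obtain \<psi> where \<psi>: "\<psi> \<in> Group.iso (?F Mod N) G"
    using iso group.iso_sym[OF is_group] unfolding N_def[symmetric] is_iso_def by blast
  define p where "p w = \<psi> (N #>\<^bsub>?F\<^esub> w)" for w
  have p: "p \<in> hom ?F G"
  proof (rule homI)
    have \<psi>h: "\<psi> \<in> hom (?F Mod N) G" using \<psi> by (simp add: iso_def)
    note q = N.r_coset_hom_Mod
    show "p w \<in> carrier G" if "w \<in> carrier ?F" for w
      using hom_in_carrier[OF \<psi>h hom_in_carrier[OF q that]] by (simp add: p_def)
    show "p (v \<otimes>\<^bsub>?F\<^esub> w) = p v \<otimes> p w" if "v \<in> carrier ?F" "w \<in> carrier ?F" for v w
      using hom_mult[OF q that] hom_mult[OF \<psi>h hom_in_carrier[OF q that(1)] hom_in_carrier[OF q that(2)]]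
      by (simp add: p_def)
  qed
  interpret p: group_hom ?F G p by unfold_locales (rule p)
  have psurj: "\<exists>w\<in>carrier ?F. p w = g" if "g \<in> carrier G" for g
  proof -
    have "g \<in> \<psi> ` carrier (?F Mod N)" using \<psi> that by (auto simp: iso_def bij_betw_def)
    then obtain C where "C \<in> carrier (?F Mod N)" "g = \<psi> C" by blast
    moreover from this obtain w where "w \<in> carrier ?F" "C = N #>\<^bsub>?F\<^esub> w" by (auto simp: FactGroup_def RCOSETS_def)
    ultimately show ?thesis by (auto simp: p_def)
  qed
  have pker: "w \<in> N" if "w \<in> carrier ?F" "p w = \<one>" for w
  proof -
    have "\<psi> (N #>\<^bsub>?F\<^esub> w) = \<psi> \<one>\<^bsub>?F Mod N\<^esub>"
      using that \<psi> Q.is_group hom_one[of \<psi> "?F Mod N" G] by (simp add: p_def iso_def)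
    moreover have "N #>\<^bsub>?F\<^esub> w \<in> carrier (?F Mod N)" using that by (auto simp: FactGroup_def RCOSETS_def)
    ultimately have "N #>\<^bsub>?F\<^esub> w = \<one>\<^bsub>?F Mod N\<^esub>"
      using \<psi> Q.one_closed by (auto simp: iso_def bij_betw_def inj_on_def)
    then show ?thesis using F.rcos_self[OF that(1) N.is_subgroup] by (simp add: FactGroup_def)
  qed
  have pN: "p w = \<one>" if "w \<in> N" for w
  proof -
    have "w \<in> carrier ?F" using that N.subset by blast
    then have "N #>\<^bsub>?F\<^esub> w = N" using that N.is_subgroup by (simp add: F.coset_join2)
    then show ?thesis using hom_one[of \<psi> "?F Mod N" G] \<psi> Q.is_group is_group by (simp add: p_def iso_def FactGroup_def)
  qed
  obtain a b \<alpha> \<beta> where basis: "hom_basis a b \<alpha> \<beta>" using hom_basis_exists by blast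
  obtain a' b' where ab': "a' \<in> carrier ?F" "p a' = a" "b' \<in> carrier ?F" "p b' = b"
    using psurj basis unfolding hom_basis_def by metis
  \<comment> \<open>This makes the number of equations exactly \<open>n\<close>: relators map to
    \<open>\<one>\<close>, while \<open>a\<close> and \<open>b\<close> are distinct and
    nontrivial.\<close>
  have "a' \<notin> R \<and> b' \<notin> R \<and> a' \<noteq> b'"
  proof -
    have "a \<noteq> b" using basis by (auto simp: hom_basis_def)
    moreover have "\<alpha> \<one> = 0" "\<beta> \<one> = 0"
      using basis one_closed r_one[OF one_closed] unfolding hom_basis_def by (metis add_cancel_right_left)+
    then have "a \<noteq> \<one>" "b \<noteq> \<one>" using basis by (auto simp: hom_basis_def)
    ultimately show ?thesis using ab' pN RN by blast
  qed
  then have card: "card (insert a' (insert b' R)) = n" "finite (insert a' (insert b' R))" using R by auto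
  have solvable: "\<exists>c. \<forall>r\<in>R. linear_form c r = v r" for v
  proof -
    define A where "A r i = linear_form (\<lambda>k. if k = i then 1 else 0) r" for r :: "nat word" and i :: nat
    have lf: "linear_form c w = (\<Sum>i<n. A w i * c i)" if "w \<in> carrier ?F" for c w
      using linear_form_eq_sum[of w n c] that by (simp add: A_def free_group_def)
    have "\<exists>x. \<forall>r\<in>insert a' (insert b' R). (\<Sum>i<n. A r i * x i) = v r"
    proof (rule square_system_solvable[OF card(2,1)])
      fix c assume "\<And>r. r \<in> insert a' (insert b' R) \<Longrightarrow> (\<Sum>i<n. A r i * c i) = 0"
      then have c0: "linear_form c r = 0" if "r \<in> insert a' (insert b' R)" for r
        using lf that ab' R(1) by auto
      have lm: "linear_form c (x \<otimes>\<^bsub>?F\<^esub> y) = linear_form c x + linear_form c y" for x y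
        by (simp add: free_group_def linear_form_word_mult)
      have l1: "linear_form c \<one>\<^bsub>?F\<^esub> = 0" by (simp add: linear_form_def free_group_def)
      have linv: "linear_form c (inv\<^bsub>?F\<^esub> x) = - linear_form c x" if "x \<in> carrier ?F" for x
        using lm[of "inv\<^bsub>?F\<^esub> x" x] l1 that by (simp add: add_eq_0_iff2)
      have "carrier ?F \<lhd> ?F" unfolding F.normal_inv_iff using F.subgroup_self by auto
      then have "{w \<in> carrier ?F. linear_form c w = 0} \<lhd> ?F"
        by (rule F.normal_zero_set) (simp_all add: lm linv)
      from Nmin[OF this] have lN: "linear_form c w = 0" if "w \<in> N" for w
        using that c0 R(1) by auto
      have wd: "linear_form c w = linear_form c w'" if "w \<in> carrier ?F" "w' \<in> carrier ?F" "p w = p w'" for w w'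
      proof -
        have "p (w \<otimes>\<^bsub>?F\<^esub> inv\<^bsub>?F\<^esub> w') = \<one>" using that by simp
        then have "linear_form c (w \<otimes>\<^bsub>?F\<^esub> inv\<^bsub>?F\<^esub> w') = 0" using that by (intro lN pker) auto
        then show ?thesis using lm linv that by simp
      qed
      \<comment> \<open>A linear form that kills the relators descends to \<open>G\<close>, where it
        is determined by its values at \<open>a\<close> and \<open>b\<close>.\<close>
      define l where "l g = linear_form c (SOME w. w \<in> carrier ?F \<and> p w = g)" for g
      have l: "l (p w) = linear_form c w" if "w \<in> carrier ?F" for w
        unfolding l_def using someI[of "\<lambda>w'. w' \<in> carrier ?F \<and> p w' = p w" w] that by (intro wd) auto
      have "l g - (\<alpha> g * l a + \<beta> g * l b) \<in> {0}" if "g \<in> carrier G" for g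
      proof (rule hom_basis_expand[OF _ basis, of "\<lambda>z. z" "{0}" l])
        show "complex_algebra (\<lambda>z::complex. z)" by unfold_locales auto
        show "l h - l (g \<otimes> h) + l g \<in> {0}" if gh: "g \<in> carrier G" "h \<in> carrier G" for g h
        proof -
          obtain x y where xy: "x \<in> carrier ?F" "p x = g" "y \<in> carrier ?F" "p y = h" using psurj gh by metis
          then show ?thesis using l[of x] l[of y] l[of "x \<otimes>\<^bsub>?F\<^esub> y"] lm[of x y] by simp
        qed
      qed (use that in auto)
      moreover have "l a = 0" "l b = 0" using l[OF ab'(1)] l[OF ab'(3)] c0 ab' by auto
      ultimately have l0: "l g = 0" if "g \<in> carrier G" for g using that by simp
      show "\<forall>i<n. c i = 0"
      proof (intro allI impI)
        fix i assume "i < n"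
        then have "[(i, True)] \<in> carrier ?F" by (simp add: free_group_def)
        with l[OF this] l0[OF p.hom_closed[OF this]] show "c i = 0" by (simp add: linear_form_def)
      qed
    qed
    then show ?thesis using lf R(1) by (metis insertCI subsetD)
  qed
  fix f :: "'g \<Rightarrow> 'g \<Rightarrow> complex"
  assume "\<forall>g\<in>carrier G. \<forall>h\<in>carrier G. \<forall>k\<in>carrier G. f h k - f (g \<otimes> h) k + f g (h \<otimes> k) - f g h = 0"
  then have f: "f h k - f (g \<otimes> h) k + f g (h \<otimes> k) - f g h = 0"
    if "g \<in> carrier G" "h \<in> carrier G" "k \<in> carrier G" for g h k using that by blast
  \<comment> \<open>The subtracted constant is the coboundary of a constant function, which is added
    back at the end.\<close>
  define f' where "f' g h = f g h - f \<one> \<one>" for g h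
  have f': "f' h k - f' (g \<otimes> h) k + f' g (h \<otimes> k) - f' g h = 0"
    if "g \<in> carrier G" "h \<in> carrier G" "k \<in> carrier G" for g h k using f[OF that] by (simp add: f'_def algebra_simps)
  have f'1: "f' \<one> g = 0" "f' g \<one> = 0" if "g \<in> carrier G" for g
    using f'[of \<one> \<one> g] f'[of g \<one> \<one>] that by (auto simp: f'_def)
  obtain u where u: "\<And>x y. x \<in> carrier ?F \<Longrightarrow> y \<in> carrier ?F \<Longrightarrow> u (x \<otimes>\<^bsub>?F\<^esub> y) = u x + u y + f' (p x) (p y)"
    using cocycle_over_free_group[OF f' _ p] f'1 by blast
  obtain c where c: "\<And>r. r \<in> R \<Longrightarrow> linear_form c r = u r" using solvable[of u] by blast
  \<comment> \<open>\<open>v\<close> has the same additivity defect as \<open>u\<close> but vanishes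
    on the relators. The defect disappears on \<open>N\<close>, so \<open>v\<close> is additive and
    conjugation invariant there, hence zero, and \<open>v\<close> descends to
    \<open>G\<close>.\<close>
  define v where "v w = u w - linear_form c w" for w
  have v: "v (x \<otimes>\<^bsub>?F\<^esub> y) = v x + v y + f' (p x) (p y)" if "x \<in> carrier ?F" "y \<in> carrier ?F" for x y
    using u[OF that] by (simp add: v_def free_group_def linear_form_word_mult)
  have v1: "v \<one>\<^bsub>?F\<^esub> = 0" using v[of "\<one>\<^bsub>?F\<^esub>" "\<one>\<^bsub>?F\<^esub>"] f'1[of \<one>] by simp
  have "{w \<in> N. v w = 0} \<lhd> ?F"
  proof (rule F.normal_zero_set[OF Nsub])
    fix x y assume "x \<in> N" "y \<in> N"
    then show "v (x \<otimes>\<^bsub>?F\<^esub> y) = v x + v y" using v N.subset pN f'1[of \<one>] by (simp add: subset_iff)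
  next
    fix x y assume x: "x \<in> carrier ?F" and y: "y \<in> N"
    let ?z = "x \<otimes>\<^bsub>?F\<^esub> y \<otimes>\<^bsub>?F\<^esub> inv\<^bsub>?F\<^esub> x"
    have yF: "y \<in> carrier ?F" and z: "?z \<in> N" using x y N.subset Nsub F.normal_inv_iff by blast+
    have "?z \<otimes>\<^bsub>?F\<^esub> x = x \<otimes>\<^bsub>?F\<^esub> y" using x yF by (simp add: F.m_assoc)
    moreover have "v (?z \<otimes>\<^bsub>?F\<^esub> x) = v ?z + v x"
      using v[of ?z x] x z N.subset pN[OF z] f'1 by (simp add: subset_iff)
    moreover have "v (x \<otimes>\<^bsub>?F\<^esub> y) = v x + v y" using v[OF x yF] pN[OF y] f'1 x by simp
    ultimately show "v ?z = v y" by simp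
  qed
  moreover have "R \<subseteq> {w \<in> N. v w = 0}" using RN c by (auto simp: v_def)
  ultimately have vN: "v w = 0" if "w \<in> N" for w using Nmin that by blast
  have wd: "v w = v w'" if w: "w \<in> carrier ?F" "w' \<in> carrier ?F" "p w = p w'" for w w'
  proof -
    let ?z = "w \<otimes>\<^bsub>?F\<^esub> inv\<^bsub>?F\<^esub> w'"
    have z: "?z \<in> N" using w by (intro pker) auto
    have "?z \<otimes>\<^bsub>?F\<^esub> w' = w" using w by (simp add: F.m_assoc)
    then show ?thesis using v[of ?z w'] w pN[OF z] vN[OF z] f'1 by simp
  qed
  define V where "V g = v (SOME w. w \<in> carrier ?F \<and> p w = g)" for g
  have V: "V (p w) = v w" if "w \<in> carrier ?F" for w
    unfolding V_def using someI[of "\<lambda>w'. w' \<in> carrier ?F \<and> p w' = p w" w] that by (intro wd) auto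
  show "\<exists>u. \<forall>g\<in>carrier G. \<forall>h\<in>carrier G. f g h = u h - u (g \<otimes> h) + u g"
  proof (intro exI[of _ "\<lambda>g. f \<one> \<one> - V g"] ballI)
    fix g h assume "g \<in> carrier G" "h \<in> carrier G"
    then obtain x y where xy: "x \<in> carrier ?F" "p x = g" "y \<in> carrier ?F" "p y = h" using psurj by metis
    then show "f g h = f \<one> \<one> - V h - (f \<one> \<one> - V (g \<otimes> h)) + (f \<one> \<one> - V g)"
      using v[of x y] V[of x] V[of y] V[of "x \<otimes>\<^bsub>?F\<^esub> y"] by (simp add: f'_def)
  qed
qed

text \<open>Three entries are linear and the fourth is solved from determinant one; \<open>p\<close>
  is invertible because its constant term is \<open>1\<close>.\<close>

definition sl2_curve :: "complex^2^2 \<Rightarrow> complex fps^2^2" where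
  "sl2_curve X = (let p = 1 + fps_const (X $ 1 $ 1) * fps_X; q = fps_const (X $ 1 $ 2) * fps_X;
     r = fps_const (X $ 2 $ 1) * fps_X in
     vector [vector [p, q], vector [r, (1 + q * r) * inverse p]])"

lemma sl2_curve:
  assumes "trace X = 0"
  shows "det (sl2_curve X) = 1" "const_term (sl2_curve X) = mat 1" "fps_nth (sl2_curve X $ i $ j) 1 = X $ i $ j"
proof -
  define p :: "complex fps" where "p = 1 + fps_const (X $ 1 $ 1) * fps_X"
  have p: "fps_nth p 0 = 1" "fps_nth p 1 = X $ 1 $ 1" by (simp_all add: p_def)
  have entries: "sl2_curve X $ 1 $ 1 = p" "sl2_curve X $ 1 $ 2 = fps_const (X $ 1 $ 2) * fps_X"
    "sl2_curve X $ 2 $ 1 = fps_const (X $ 2 $ 1) * fps_X"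
    "sl2_curve X $ 2 $ 2 = (1 + fps_const (X $ 1 $ 2) * fps_X * (fps_const (X $ 2 $ 1) * fps_X)) * inverse p"
    by (simp_all add: sl2_curve_def Let_def vector_2 p_def)
  have inv: "p * inverse p = 1" using inverse_mult_eq_1[of p] p by (simp add: mult.commute)
  have "det (sl2_curve X) = (p * inverse p) * (1 + fps_const (X $ 1 $ 2) * fps_X * (fps_const (X $ 2 $ 1) * fps_X)) -
      fps_const (X $ 1 $ 2) * fps_X * (fps_const (X $ 2 $ 1) * fps_X)"
    unfolding det_2 entries by (simp add: algebra_simps)
  then show "det (sl2_curve X) = 1" by (simp add: inv)
  have 0: "fps_nth (inverse p) 0 = 1" using p by simp
  have 1: "fps_nth (inverse p) 1 = - X $ 1 $ 1"
    using arg_cong[OF inv, of "\<lambda>f. fps_nth f 1"] 0 p by (simp add: fps_mult_nth_1 add_eq_0_iff2)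
  show "const_term (sl2_curve X) = mat 1"
    using 0 p by (simp add: const_term_def vec_eq_iff forall_2 entries mat_def)
  have X22: "X $ 2 $ 2 = - X $ 1 $ 1" using assms by (simp add: trace_def sum_2 add_eq_0_iff2 add.commute)
  show "fps_nth (sl2_curve X $ i $ j) 1 = X $ i $ j"
    using 0 1 p X22 exhaust_2[of i] exhaust_2[of j]
    by (auto simp: entries fps_mult_nth_1)
qed

lemma linear_term_mult:
  assumes "const_term A = mat 1" "const_term B = mat 1"
  shows "fps_nth ((A ** B) $ i $ j) 1 = fps_nth (A $ i $ j) 1 + fps_nth (B $ i $ j) 1"
proof -
  have "fps_nth (A $ i $ j) 0 = (if i = j then 1 else 0)" "fps_nth (B $ i $ j) 0 = (if i = j then 1 else 0)" for i j
    using assms by (auto simp: const_term_def mat_def vec_eq_iff)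
  then show ?thesis using exhaust_2[of i] exhaust_2[of j]
    by (auto simp: matrix_matrix_mult_def sum_2 fps_mult_nth)
qed

text \<open>Generators of a free group may be sent to any two curves in \<open>SL_2\<close>; they
  are chosen so that the pullback has the prescribed linear term.\<close>

theorem (in group_H1_dim_2) deformable_if_onto_free:
  assumes basis: "hom_basis a b \<alpha> \<beta>" and f: "f \<in> epi G (free_group {..<2::nat})"
  shows "deformable G \<alpha> \<beta>"
  unfolding deformable_def
proof (intro allI impI)
  let ?F = "free_group {..<2::nat}"
  fix X Y :: "complex^2^2" assume XY: "trace X = 0" "trace Y = 0"
  have hom: "f \<in> hom G ?F" and surj: "f ` carrier G = carrier ?F" using f by (auto simp: epi_def)
  define e where "e k i = (if i = k then 1 else 0 :: complex)" for k i :: nat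
  \<comment> \<open>The exponent sums of the two generators, pulled back to \<open>G\<close>:
    another basis of the homomorphisms to the complex numbers.\<close>
  define A where "A k g = linear_form (e k) (f g)" for k :: nat and g
  have A_mult: "A k (g \<otimes> h) = A k g + A k h" if "g \<in> carrier G" "h \<in> carrier G" for k g h
    using hom_mult[OF hom that] by (simp add: A_def free_group_def linear_form_word_mult)
  have A_expand: "A k g = \<alpha> g * A k a + \<beta> g * A k b" if "g \<in> carrier G" for k g
  proof -
    have "A k g - (\<alpha> g * A k a + \<beta> g * A k b) \<in> {0}"
      by (rule hom_basis_expand[OF _ basis, of "\<lambda>z. z" "{0}" "A k"])
        (use that in \<open>auto simp: A_mult complex_algebra_def\<close>)
    then show ?thesis by simp
  qed
  have "[(0, True)] \<in> f ` carrier G" "[(1, True)] \<in> f ` carrier G" unfolding surj by (auto simp: free_group_def)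
  then obtain a' b' where ab': "a' \<in> carrier G" "f a' = [(0, True)]" "b' \<in> carrier G" "f b' = [(1, True)]" by force
  have A0: "A 0 a' = 1" "A 0 b' = 0" "A 1 a' = 0" "A 1 b' = 1"
    by (simp_all add: A_def ab' linear_form_def e_def)
  define M :: "complex^2^2" where "M = vector [vector [A 0 a, A 0 b], vector [A 1 a, A 1 b]]"
  define N :: "complex^2^2" where "N = vector [vector [\<alpha> a', \<alpha> b'], vector [\<beta> a', \<beta> b']]"
  \<comment> \<open>Surjectivity provides \<open>a'\<close> and \<open>b'\<close> dual to the
    exponent sums, which makes the base change invertible.\<close>
  have "M ** N = mat 1"
    using A0 A_expand[OF ab'(1)] A_expand[OF ab'(3)]
    by (simp add: M_def N_def matrix2_simps mult.commute)
  then have "N ** M = mat 1" by (simp add: matrix_left_right_inverse)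
  then have NM: "\<alpha> a' * A 0 a + \<alpha> b' * A 1 a = 1" "\<alpha> a' * A 0 b + \<alpha> b' * A 1 b = 0"
    "\<beta> a' * A 0 a + \<beta> b' * A 1 a = 0" "\<beta> a' * A 0 b + \<beta> b' * A 1 b = 1"
    by (simp_all add: M_def N_def matrix2_simps)
  have ab: "\<alpha> g = \<alpha> a' * A 0 g + \<alpha> b' * A 1 g" "\<beta> g = \<beta> a' * A 0 g + \<beta> b' * A 1 g" if "g \<in> carrier G" for g
  proof -
    have "\<alpha> a' * A 0 g + \<alpha> b' * A 1 g = \<alpha> g * (\<alpha> a' * A 0 a + \<alpha> b' * A 1 a) + \<beta> g * (\<alpha> a' * A 0 b + \<alpha> b' * A 1 b)"
      using A_expand[OF that, of 0] A_expand[OF that, of 1] by (simp add: algebra_simps)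
    then show "\<alpha> g = \<alpha> a' * A 0 g + \<alpha> b' * A 1 g" unfolding NM by simp
    have "\<beta> a' * A 0 g + \<beta> b' * A 1 g = \<alpha> g * (\<beta> a' * A 0 a + \<beta> b' * A 1 a) + \<beta> g * (\<beta> a' * A 0 b + \<beta> b' * A 1 b)"
      using A_expand[OF that, of 0] A_expand[OF that, of 1] by (simp add: algebra_simps)
    then show "\<beta> g = \<beta> a' * A 0 g + \<beta> b' * A 1 g" unfolding NM by simp
  qed
  \<comment> \<open>By this base change \<open>A 0 g\<close> times \<open>X'\<close> plus
    \<open>A 1 g\<close> times \<open>Y'\<close> is the wanted linear term.\<close>
  define X' where "X' = (\<chi> i j. \<alpha> a' * X $ i $ j + \<beta> a' * Y $ i $ j)"
  define Y' where "Y' = (\<chi> i j. \<alpha> b' * X $ i $ j + \<beta> b' * Y $ i $ j)"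
  have tr: "trace X' = 0" "trace Y' = 0"
  proof -
    have "trace X' = \<alpha> a' * trace X + \<beta> a' * trace Y" "trace Y' = \<alpha> b' * trace X + \<beta> b' * trace Y"
      by (simp_all add: X'_def Y'_def trace_def sum_2 algebra_simps)
    then show "trace X' = 0" "trace Y' = 0" using XY by simp_all
  qed
  define C where "C l = sl2_curve (if l = 0 then X' else Y')" for l :: nat
  have C: "det (C l) = 1" "const_term (C l) = mat 1" "fps_nth (C l $ i $ j) 1 = (if l = 0 then X' else Y') $ i $ j" for l i j
    using sl2_curve tr by (simp_all add: C_def)
  define ev where "ev = word_eval C"
  let ?M = "\<lparr>carrier = UNIV, mult = (**), one = mat 1\<rparr> :: (complex fps^2^2) monoid"
  have "monoid ?M" by (rule monoidI) (auto simp: matrix_mul_assoc matrix_mul_lid matrix_mul_rid)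
  from free_group_hom[OF this, of "{..<2}" "letter_value C"] have "ev \<in> hom ?F ?M"
    unfolding ev_def word_eval_def by (simp add: letter_value_def inv_letter_def adjugate2_inverse C)
  then have ev_mult: "ev (x \<otimes>\<^bsub>?F\<^esub> y) = ev x ** ev y" if "x \<in> carrier ?F" "y \<in> carrier ?F" for x y
    using hom_mult[of ev ?F ?M x y] that by simp
  have L: "det (letter_value C x) = 1" "const_term (letter_value C x) = mat 1"
    "fps_nth (letter_value C x $ i $ j) 1 = (if snd x then 1 else - 1) * (if fst x = 0 then X' else Y') $ i $ j" for x i j
  proof -
    show "det (letter_value C x) = 1" by (simp add: letter_value_def det_adjugate2 C)
    have "const_term (adjugate2 A) = adjugate2 (const_term A)" for A
      by (simp add: const_term_def adjugate2_def vec_eq_iff forall_2 vector_2)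
    then show "const_term (letter_value C x) = mat 1" by (simp add: letter_value_def C)
    have "X' $ 2 $ 2 = - X' $ 1 $ 1" "Y' $ 2 $ 2 = - Y' $ 1 $ 1"
      using tr by (simp_all add: trace_def sum_2 add_eq_0_iff2 add.commute)
    then show "fps_nth (letter_value C x $ i $ j) 1 = (if snd x then 1 else - 1) * (if fst x = 0 then X' else Y') $ i $ j"
      using exhaust_2[of i] exhaust_2[of j] C(3)[of "fst x"]
      by (auto simp: letter_value_def adjugate2_def vector_2)
  qed
  have ev: "det (ev w) = 1" "const_term (ev w) = mat 1" for w
    by (induction w) (simp_all add: ev_def det_mul L const_term_simps matrix_mul_lid matrix_mul_rid det_I)
  have ev1: "fps_nth (ev w $ i $ j) 1 = linear_form (e 0) w * X' $ i $ j + linear_form (e 1) w * Y' $ i $ j"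
    if "w \<in> words_over {..<2}" for w i j
    using that
  proof (induction w)
    case Nil
    then show ?case by (simp add: ev_def linear_form_def mat_def)
  next
    case (Cons x w)
    have "ev (x # w) = letter_value C x ** ev w" by (simp add: ev_def)
    then have "fps_nth (ev (x # w) $ i $ j) 1 = fps_nth (letter_value C x $ i $ j) 1 + fps_nth (ev w $ i $ j) 1"
      by (simp only: linear_term_mult[OF L(2) ev(2)])
    moreover have "linear_form (e k) (x # w) = (if fst x = k then if snd x then 1 else - 1 else 0) + linear_form (e k) w" for k
      by (simp add: linear_form_def e_def)
    moreover have "fst x = 0 \<or> fst x = 1" using Cons.prems by auto
    ultimately show ?case
      using Cons L(3)[of x i j] by (auto simp: algebra_simps)
  qed
  show "\<exists>\<rho> :: 'g \<Rightarrow> complex fps^2^2.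
       (\<forall>g\<in>carrier G. \<forall>h\<in>carrier G. \<rho> (g \<otimes> h) = \<rho> g ** \<rho> h) \<and>
       (\<forall>g\<in>carrier G. det (\<rho> g) = 1) \<and>
       (\<forall>g\<in>carrier G. \<forall>i j. fps_nth (\<rho> g $ i $ j) 0 = mat 1 $ i $ j \<and>
          fps_nth (\<rho> g $ i $ j) 1 = \<alpha> g * X $ i $ j + \<beta> g * Y $ i $ j)"
  proof (intro exI[of _ "\<lambda>g. ev (f g)"] conjI ballI allI)
    fix g h assume gh: "g \<in> carrier G" "h \<in> carrier G"
    then have "f g \<in> carrier ?F" "f h \<in> carrier ?F" using surj by blast+
    then show "ev (f (g \<otimes> h)) = ev (f g) ** ev (f h)" using hom_mult[OF hom gh] ev_mult by simp
  next
    fix g i j assume g: "g \<in> carrier G"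
    show "det (ev (f g)) = 1" by (rule ev)
    show "fps_nth (ev (f g) $ i $ j) 0 = mat 1 $ i $ j"
      using ev(2)[of "f g"] by (auto simp: const_term_def vec_eq_iff)
    have "f g \<in> carrier ?F" using surj g by blast
    then have "f g \<in> words_over {..<2}" by (simp add: free_group_def)
    then show "fps_nth (ev (f g) $ i $ j) 1 = \<alpha> g * X $ i $ j + \<beta> g * Y $ i $ j"
      using ab[OF g] ev1[of "f g" i j] by (simp add: A_def[symmetric] X'_def Y'_def algebra_simps)
  qed
qed

section \<open>Invariants modulo an ideal\<close>

interpretation repp: complex_algebra "\<lambda>c. [:poly_const c:]"
  by unfold_locales (auto simp: rep.scalar_add rep.scalar_mult one_pCons)

definition const_matrix :: "complex^2^2 \<Rightarrow> rep_poly^2^2" where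
  "const_matrix h = (\<chi> a b. poly_const (h $ a $ b))"

text \<open>The entries of \<open>(1 - T X) M (1 + T X)\<close> as polynomials in \<open>T\<close>. The coefficient of \<open>T\<close> is the
  derivation \<open>M \<mapsto> [M, X]\<close>.\<close>

definition conj_poly :: "complex^2^2 \<Rightarrow> rep_var \<Rightarrow> rep_poly poly" where
  "conj_poly X = (\<lambda>(l, i, j). [: gen_matrix l $ i $ j,
     (gen_matrix l ** const_matrix X - const_matrix X ** gen_matrix l) $ i $ j,
     - (const_matrix X ** gen_matrix l ** const_matrix X) $ i $ j :])"

definition deriv_along :: "complex^2^2 \<Rightarrow> rep_poly \<Rightarrow> rep_poly" where
  "deriv_along X p = coeff (peval (\<lambda>c. [:poly_const c:]) (conj_poly X) p) 1"

lemma coeff_0_conj_poly: "coeff (peval (\<lambda>c. [:poly_const c:]) (conj_poly X) p) 0 = p"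
  by (rule hom_eqI) (auto simp: repp.peval_const repp.peval_var repp.peval_add repp.peval_mult coeff_mult conj_poly_def gen_matrix_def)

lemma deriv_along_simps:
  "deriv_along X (p + q) = deriv_along X p + deriv_along X q"
  "deriv_along X (p * q) = deriv_along X p * q + p * deriv_along X q"
  "deriv_along X (poly_const c) = 0"
  "deriv_along X (poly_var (l, i, j)) =
    (gen_matrix l ** const_matrix X - const_matrix X ** gen_matrix l) $ i $ j"
  using coeff_0_conj_poly
  by (auto simp: deriv_along_def repp.peval_add repp.peval_mult repp.peval_const repp.peval_var coeff_mult conj_poly_def)

text \<open>In place of a Vandermonde determinant: substituting \<open>2 T\<close> for
  \<open>T\<close> and subtracting \<open>2 ^ n\<close> times the original removes the coefficient
  of index \<open>n\<close> and rescales the others by nonzero scalars.\<close>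

lemma coeffs_in_subspace:
  fixes q :: "rep_poly poly"
  assumes "\<And>a b. a \<in> I \<Longrightarrow> b \<in> I \<Longrightarrow> a + b \<in> I" "\<And>c a. a \<in> I \<Longrightarrow> poly_const c * a \<in> I" "0 \<in> I"
    and "\<And>k. k \<ge> n \<Longrightarrow> coeff q k = 0" "\<And>t. poly q (poly_const t) \<in> I"
  shows "coeff q k \<in> I"
  using assms(4,5)
proof (induction n arbitrary: q k)
  case 0
  then show ?case using assms(3) by simp
next
  case (Suc n)
  have sub: "a - b \<in> I" if "a \<in> I" "b \<in> I" for a b
    using assms(1)[OF that(1) assms(2)[OF that(2), of "-1"]] by (simp add: rep.scalar_minus)
  define q' where "q' = pcompose q [:0, poly_const 2:] - smult (poly_const (2 ^ n)) q"
  have pw: "poly_const c ^ m = poly_const (c ^ m)" for c m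
    by (induction m) (auto simp: rep.scalar_mult)
  have cq: "coeff q' k = poly_const (2 ^ k - 2 ^ n) * coeff q k" for k
    by (simp add: q'_def coeff_pcompose_linear rep.scalar_diff left_diff_distrib pw)
  have "coeff q' k \<in> I" for k
  proof (rule Suc.IH)
    show "coeff q' k = 0" if "n \<le> k" for k
      using that Suc.prems(1)[of k] unfolding cq by (cases "k = n") auto
    show "poly q' (poly_const t) \<in> I" for t
      using Suc.prems(2)[of "2 * t"] Suc.prems(2)[of t] assms(2) sub
      by (simp add: q'_def poly_pcompose mult.commute flip: rep.scalar_mult)
  qed
  then have q': "coeff q' k \<in> I" for k .
  have low: "coeff q k \<in> I" if "k \<noteq> n" for k
  proof -
    have "(2::complex) ^ k \<noteq> 2 ^ n"
    proof
      assume "(2::complex) ^ k = 2 ^ n"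
      then have "of_nat (2 ^ k) = (of_nat (2 ^ n) :: complex)" by simp
      then show False using that by (simp only: of_nat_eq_iff) simp
    qed
    then show ?thesis using assms(2)[OF q'[of k], of "1 / (2 ^ k - 2 ^ n)"]
      by (simp add: cq flip: mult.assoc rep.scalar_mult)
  qed
  \<comment> \<open>The remaining coefficient is the value at \<open>1\<close> minus all the
    others.\<close>
  have "poly q (poly_const 1) = (\<Sum>k\<le>degree q. coeff q k)" by (simp add: poly_altdef)
  also have "\<dots> = (\<Sum>k\<le>n. coeff q k)"
  proof (intro sum.mono_neutral_left)
    have "degree q \<le> n" using Suc.prems(1) by (intro degree_le) auto
    then show "{..degree q} \<subseteq> {..n}" by auto
  qed (auto intro: coeff_eq_0)
  finally have "poly q (poly_const 1) = (\<Sum>k\<le>n. coeff q k)" .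
  then have "poly q (poly_const 1) = coeff q n + (\<Sum>k<n. coeff q k)"
    by (simp add: lessThan_Suc_atMost[symmetric] add.commute)
  moreover have "(\<Sum>k\<in>A. coeff q k) \<in> I" if "n \<notin> A" for A
    using that by (induction A rule: infinite_finite_induct) (auto simp: assms(1,3) low)
  ultimately have "coeff q n \<in> I"
    using sub[OF Suc.prems(2)[of 1], of "\<Sum>k<n. coeff q k"] by simp
  with low show ?case by (cases "k = n") auto
qed

text \<open>Together with \<open>e21\<close> this generates \<open>sl_2\<close>. Both are nilpotent,
  so \<open>1 + t X\<close> has determinant one and the polynomial inverse
  \<open>1 - t X\<close>.\<close>

definition e12 :: "complex^2^2" where "e12 = vector [vector [0, 1], vector [0, 0]]"
definition e21 :: "complex^2^2" where "e21 = vector [vector [0, 0], vector [1, 0]]"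

definition unipotent :: "complex^2^2 \<Rightarrow> complex \<Rightarrow> complex^2^2" where
  "unipotent X t = (\<chi> i j. (if i = j then 1 else 0) + t * X $ i $ j)"

lemma matrix_inv_eqI:
  fixes A B :: "complex^2^2"
  assumes "A ** B = mat 1" "B ** A = mat 1" shows "matrix_inv A = B"
proof -
  have "A ** matrix_inv A = mat 1 \<and> matrix_inv A ** A = mat 1"
    unfolding matrix_inv_def by (rule someI[of _ B]) (use assms in blast)
  moreover have "matrix_inv A ** (A ** B) = (matrix_inv A ** A) ** B" by (rule matrix_mul_assoc)
  ultimately show ?thesis using assms by (simp add: matrix_mul_lid matrix_mul_rid)
qed

lemma const_matrix_e:
  "const_matrix e12 $ 1 $ 1 = 0" "const_matrix e12 $ 1 $ 2 = 1" "const_matrix e12 $ 2 $ 1 = 0" "const_matrix e12 $ 2 $ 2 = 0"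
  "const_matrix e21 $ 1 $ 1 = 0" "const_matrix e21 $ 1 $ 2 = 0" "const_matrix e21 $ 2 $ 1 = 1" "const_matrix e21 $ 2 $ 2 = 0"
  by (simp_all add: const_matrix_def e12_def e21_def vector_2)

lemma poly_conj_poly:
  assumes "X \<in> {e12, e21}"
  shows "poly (peval (\<lambda>c. [:poly_const c:]) (conj_poly X) p) (poly_const t) =
    poly_subst (conj_subst (unipotent X t)) p"
proof -
  have "(unipotent X t) ** (unipotent X (- t)) = mat 1" "(unipotent X (- t)) ** (unipotent X t) = mat 1"
    using assms by (auto simp: matrix2_simps e12_def e21_def unipotent_def)
  then have inv: "matrix_inv (unipotent X t) = unipotent X (- t)"
    by (rule matrix_inv_eqI)
  show ?thesis unfolding poly_subst_eq_peval
  proof (rule hom_eqI[of "\<lambda>p. poly (peval (\<lambda>c. [:poly_const c:]) (conj_poly X) p) (poly_const t)"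
        "peval poly_const (conj_subst (unipotent X t))"])
    fix v :: rep_var
    obtain l i j where v: "v = (l, i, j)" by (cases v)
    have c: "conj_subst (unipotent X t) (l, i, j) =
      (const_matrix (unipotent X (- t)) ** gen_matrix l ** const_matrix (unipotent X t)) $ i $ j"
      by (simp add: conj_subst_def inv const_matrix_def)
    show "poly (peval (\<lambda>c. [:poly_const c:]) (conj_poly X) (poly_var v)) (poly_const t) =
      peval poly_const (conj_subst (unipotent X t)) (poly_var v)"
      unfolding repp.peval_var rep.peval_var v c
      using assms exhaust_2[of i] exhaust_2[of j]
      by (auto simp: conj_poly_def matrix2_simps e12_def e21_def
          const_matrix_def unipotent_def rep.scalar_minus algebra_simps)
  qed (auto simp: repp.peval_const rep.peval_const repp.peval_add rep.peval_add repp.peval_mult rep.peval_mult)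
qed

text \<open>Along a unipotent one-parameter group the change of \<open>p\<close> is a polynomial in
  \<open>t\<close> with all values in \<open>I\<close>, hence with all coefficients in
  \<open>I\<close>.\<close>

lemma deriv_along_invariant:
  assumes X: "X \<in> {e12, e21}"
    and I: "\<And>a b. a \<in> I \<Longrightarrow> b \<in> I \<Longrightarrow> a + b \<in> I" "\<And>c a. a \<in> I \<Longrightarrow> poly_const c * a \<in> I" "0 \<in> I"
    and inv: "\<And>h. det h = 1 \<Longrightarrow> poly_subst (conj_subst h) p - p \<in> I"
  shows "deriv_along X p \<in> I"
proof -
  define q where "q = peval (\<lambda>c. [:poly_const c:]) (conj_poly X) p - [:p:]"
  have "coeff q 1 \<in> I"
  proof (rule coeffs_in_subspace[OF I])
    show "coeff q k = 0" if "Suc (degree q) \<le> k" for k using that by (intro coeff_eq_0) simp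
    have "det (unipotent X t) = 1" for t
      using X by (auto simp: matrix2_simps e12_def e21_def unipotent_def)
    from inv[OF this] show "poly q (poly_const t) \<in> I" for t
      unfolding q_def using X by (simp add: poly_conj_poly)
  qed
  then show ?thesis by (simp add: q_def deriv_along_def)
qed

section \<open>The operators of \<open>sl_2\<close> on polynomials\<close>

abbreviation "E \<equiv> deriv_along e12"
abbreviation "F \<equiv> deriv_along e21"

lemma deriv_along_0 [simp]: "deriv_along X 0 = 0" and deriv_along_1 [simp]: "deriv_along X 1 = 0"
  using deriv_along_simps(3)[of X 0] deriv_along_simps(3)[of X 1] by simp_all

lemma deriv_along_minus: "deriv_along X (- p) = - deriv_along X p"
  using deriv_along_simps(1)[of X p "- p"] by (simp add: eq_neg_iff_add_eq_0 add.commute)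

lemma deriv_along_diff: "deriv_along X (p - q) = deriv_along X p - deriv_along X q"
  using deriv_along_simps(1)[of X p "- q"] by (simp add: deriv_along_minus)

lemma deriv_along_sum: "deriv_along X (sum f A) = (\<Sum>i\<in>A. deriv_along X (f i))"
  by (induction A rule: infinite_finite_induct) (auto simp: deriv_along_simps)

text \<open>The commutator with a constant matrix obeys the product rule, so letters suffice;
  adjugates of generic matrices follow the same rule because conjugation respects adjugates.\<close>

lemma deriv_along_word:
  assumes X: "X \<in> {e12, e21}"
  shows "deriv_along X (word_matrix w $ i $ j) =
    (word_matrix w ** const_matrix X - const_matrix X ** word_matrix w) $ i $ j"
  unfolding word_matrix_eq
proof (induction w arbitrary: i j)
  case Nil
  then show ?case by (simp add: matrix_mul_lid matrix_mul_rid) (simp add: mat_def)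
next
  case (Cons a w)
  let ?L = "letter_value gen_matrix a" and ?W = "word_eval gen_matrix w" and ?X = "const_matrix X"
  have L: "deriv_along X (?L $ i $ j) = (?L ** ?X - ?X ** ?L) $ i $ j" for i j
  proof -
    have g: "deriv_along X (gen_matrix l $ i $ j) = (gen_matrix l ** ?X - ?X ** gen_matrix l) $ i $ j" for l i j
      using deriv_along_simps(4)[of X l i j] by (simp add: gen_matrix_def)
    consider "X = e12" | "X = e21" using X by blast
    then show ?thesis
    proof cases
      case X: 1
      show ?thesis using exhaust_2[of i] exhaust_2[of j] g[unfolded X]
        by (auto simp: X letter_value_def adjugate2_def vector_2 deriv_along_minus matrix_matrix_mult_def sum_2 const_matrix_e)
    next
      case X: 2
      show ?thesis using exhaust_2[of i] exhaust_2[of j] g[unfolded X]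
        by (auto simp: X letter_value_def adjugate2_def vector_2 deriv_along_minus matrix_matrix_mult_def sum_2 const_matrix_e)
    qed
  qed
  have "deriv_along X ((?L ** ?W) $ i $ j) = ((?L ** ?X - ?X ** ?L) ** ?W + ?L ** (?W ** ?X - ?X ** ?W)) $ i $ j"
    by (simp add: matrix_matrix_mult_def[of ?L ?W] deriv_along_sum deriv_along_simps(2) L Cons sum.distrib)
      (simp add: matrix_matrix_mult_def)
  also have "(?L ** ?X - ?X ** ?L) ** ?W + ?L ** (?W ** ?X - ?X ** ?W) = (?L ** ?W) ** ?X - ?X ** (?L ** ?W)"
    by (simp add: matrix2_simps algebra_simps)
  finally show ?case by simp
qed

lemma EF_word:
  "E (word_matrix w $ 1 $ 1) = - word_matrix w $ 2 $ 1" "E (word_matrix w $ 1 $ 2) = word_matrix w $ 1 $ 1 - word_matrix w $ 2 $ 2"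
  "E (word_matrix w $ 2 $ 1) = 0" "E (word_matrix w $ 2 $ 2) = word_matrix w $ 2 $ 1"
  "F (word_matrix w $ 1 $ 1) = word_matrix w $ 1 $ 2" "F (word_matrix w $ 2 $ 1) = word_matrix w $ 2 $ 2 - word_matrix w $ 1 $ 1"
  "F (word_matrix w $ 1 $ 2) = 0" "F (word_matrix w $ 2 $ 2) = - word_matrix w $ 1 $ 2"
  by (simp_all add: deriv_along_word matrix_matrix_mult_def sum_2 const_matrix_def e12_def e21_def vector_2)

lemma deriv_along_traces:
  assumes "X \<in> {e12, e21}" "q \<in> traces r" shows "deriv_along X q = 0"
  using assms(2) unfolding traces_def
  by (induction rule: rep.alg.induct) (use assms(1) in \<open>auto simp: deriv_along_simps trace_def sum_2 EF_word\<close>)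

lemma of_nat_poly_const: "of_nat n = poly_const (of_nat n)"
  by (induction n) (auto simp: rep.scalar_add)

lemma numeral_poly_const: "numeral n = poly_const (numeral n)"
  using of_nat_poly_const[of "numeral n"] by simp

lemma deriv_along_numeral [simp]: "deriv_along X (numeral n) = 0"
  by (simp only: numeral_poly_const deriv_along_simps)

definition H :: "rep_poly \<Rightarrow> rep_poly" where "H p = E (F p) - F (E p)"

lemma H_word:
  "H (word_matrix w $ 1 $ 1) = 0" "H (word_matrix w $ 1 $ 2) = - 2 * word_matrix w $ 1 $ 2"
  "H (word_matrix w $ 2 $ 1) = 2 * word_matrix w $ 2 $ 1" "H (word_matrix w $ 2 $ 2) = 0"
  by (simp_all add: H_def EF_word deriv_along_diff deriv_along_minus)

text \<open>Twice the Casimir operator of \<open>sl\<^sub>2\<close>.\<close>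

definition casimir :: "rep_poly \<Rightarrow> rep_poly" where
  "casimir p = 2 * E (F p) + 2 * F (E p) + H (H p)"

text \<open>The mixed term in the product rule of the second order operator \<open>casimir\<close>,
  as in \<open>casimir_mult\<close>.\<close>

definition cross :: "rep_poly \<Rightarrow> rep_poly \<Rightarrow> rep_poly" where
  "cross p q = 4 * (E p * F q + F p * E q) + 2 * (H p * H q)"

lemma H_mult: "H (p * q) = H p * q + p * H q"
  by (simp add: H_def deriv_along_simps algebra_simps)

lemma H_add: "H (p + q) = H p + H q"
  by (simp add: H_def deriv_along_simps)

lemma H_minus: "H (- p) = - H p"
  by (simp add: H_def deriv_along_minus)

lemma H_0 [simp]: "H 0 = 0" and H_numeral [simp]: "H (numeral n) = 0"
  by (simp_all add: H_def)

lemma casimir_add: "casimir (p + q) = casimir p + casimir q"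
  by (simp add: casimir_def H_add deriv_along_simps algebra_simps)

lemma casimir_mult: "casimir (p * q) = casimir p * q + p * casimir q + cross p q"
  by (simp add: casimir_def cross_def H_add H_mult deriv_along_simps algebra_simps)

lemma cross_mult_left: "cross (p * p') q = p * cross p' q + p' * cross p q"
  by (simp add: cross_def H_mult deriv_along_simps algebra_simps)

lemma cross_add_left: "cross (p + p') q = cross p q + cross p' q"
  by (simp add: cross_def H_add deriv_along_simps algebra_simps)

lemma traces_killed:
  assumes "q \<in> traces r" shows "E q = 0" "F q = 0" "H q = 0" "casimir q = 0" "cross q p = 0"
  using deriv_along_traces[OF _ assms] by (auto simp: H_def casimir_def cross_def)

inductive tensor :: "nat \<Rightarrow> nat \<Rightarrow> rep_poly \<Rightarrow> bool" for r where
  zero: "q \<in> traces r \<Longrightarrow> tensor r 0 q"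
| mult: "tensor r d f \<Longrightarrow> w \<in> words_over {..<r} \<Longrightarrow> tensor r (Suc d) (f * word_matrix w $ i $ j)"
| add: "tensor r d f \<Longrightarrow> tensor r d g \<Longrightarrow> tensor r d (f + g)"

lemma tensor_traces_mult: "tensor r d f \<Longrightarrow> q \<in> traces r \<Longrightarrow> tensor r d (q * f)"
proof (induction rule: tensor.induct)
  case (mult d f w i j)
  then have "tensor r (Suc d) (q * f * word_matrix w $ i $ j)" by (intro tensor.mult)
  then show ?case by (simp add: mult.assoc)
qed (auto intro: tensor.intros tracesD simp: distrib_left)

lemma tensor_const: "tensor r d f \<Longrightarrow> tensor r d (poly_const c * f)"
  by (intro tensor_traces_mult tracesD)

lemma tensor_minus: "tensor r d f \<Longrightarrow> tensor r d (- f)"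
  using tensor_const[of r d f "-1"] by (simp add: rep.scalar_minus)

lemma tensor_diff: "tensor r d f \<Longrightarrow> tensor r d g \<Longrightarrow> tensor r d (f - g)"
  using tensor.add[OF _ tensor_minus] by fastforce

lemma tensor_numeral: "tensor r d f \<Longrightarrow> tensor r d (numeral n * f)"
  unfolding numeral_poly_const by (rule tensor_const)

lemma tensor_0: "tensor r d 0"
proof (induction d)
  case 0
  show ?case by (intro tensor.zero tracesD)
next
  case (Suc d)
  from tensor.mult[OF this, of "[]" 1 1] show ?case by simp
qed

text \<open>Antisymmetrizing two slots of a tensor amounts to contracting them: this produces an
  entry of \<open>adj W Z\<close> or \<open>W adj Z\<close>.\<close>

lemma cross_word:
  assumes u: "u \<in> words_over {..<r}" and v: "v \<in> words_over {..<r}" and f: "tensor r d f"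
  shows "tensor r (Suc d) (f * (cross (word_matrix u $ i $ j) (word_matrix v $ k $ l)
    - 8 * (word_matrix u $ i $ j * word_matrix v $ k $ l)))"
proof -
  let ?U = "word_matrix u" and ?V = "word_matrix v"
  have ent: "tensor r (Suc d) (f * (?U ** ?V) $ a $ b)" "tensor r (Suc d) (f * (?V ** ?U) $ a $ b)"
    "tensor r (Suc d) (f * (adjugate2 ?U ** ?V) $ a $ b)" "tensor r (Suc d) (f * (?U ** adjugate2 ?V) $ a $ b)" for a b
    using tensor.mult[OF f, of "u @ v" a b] tensor.mult[OF f, of "v @ u" a b]
      tensor.mult[OF f, of "inv_word u @ v" a b] tensor.mult[OF f, of "u @ inv_word v" a b] u v
    by (auto simp: word_matrix_eq word_eval_append word_eval_inv_word)
  \<comment> \<open>\<open>a1\<close> and \<open>a2\<close> are the contractions of differing row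
    and column indices; \<open>a3\<close> and \<open>a4\<close> collect the products
    \<open>V U\<close> and \<open>U V\<close>.\<close>
  define a1 where "a1 = (if i = k then 0 else if i = 1 then (if j = 2 then (adjugate2 ?U ** ?V) $ 1 $ l else - (adjugate2 ?U ** ?V) $ 2 $ l)
      else (if j = 1 then (adjugate2 ?U ** ?V) $ 2 $ l else - (adjugate2 ?U ** ?V) $ 1 $ l))"
  define a2 where "a2 = (if j = l then 0 else if j = 1 then (if k = 1 then (?U ** adjugate2 ?V) $ i $ 2 else - (?U ** adjugate2 ?V) $ i $ 1)
      else (if k = 1 then - (?U ** adjugate2 ?V) $ i $ 2 else (?U ** adjugate2 ?V) $ i $ 1))"
  define a3 where "a3 = (if i = l then (?V ** ?U) $ k $ j else 0)"
  define a4 where "a4 = (if j = k then (?U ** ?V) $ i $ l else 0)"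
  have "cross (?U $ i $ j) (?V $ k $ l) - 8 * (?U $ i $ j * ?V $ k $ l) = 4 * (a1 + a2 - a3 - a4)"
    using exhaust_2[of i] exhaust_2[of j] exhaust_2[of k] exhaust_2[of l]
    by (elim disjE; simp add: cross_def H_word EF_word a1_def a2_def a3_def a4_def
        matrix_matrix_mult_def sum_2 adjugate2_def vector_2 algebra_simps)
  then have "f * (cross (?U $ i $ j) (?V $ k $ l) - 8 * (?U $ i $ j * ?V $ k $ l)) =
      4 * (f * a1 + f * a2 - f * a3 - f * a4)" by (simp only:) (simp add: algebra_simps)
  moreover have "tensor r (Suc d) (f * a1)" "tensor r (Suc d) (f * a2)" "tensor r (Suc d) (f * a3)" "tensor r (Suc d) (f * a4)"
    using ent tensor_minus[OF ent(3)] tensor_minus[OF ent(4)] tensor_0 by (auto simp: a1_def a2_def a3_def a4_def)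
  ultimately show ?thesis using tensor_numeral[OF tensor_diff[OF tensor_diff[OF tensor.add]]] by metis
qed

text \<open>Each of the \<open>d\<close> factors contributes \<open>8\<close>, by
  \<open>cross_word\<close> and the product rule for \<open>cross\<close>.\<close>

lemma cross_tensor:
  assumes "tensor r d f" "w \<in> words_over {..<r}"
  shows "tensor r d (cross f (word_matrix w $ k $ l) - of_nat (8 * d) * (f * word_matrix w $ k $ l))"
  using assms(1)
proof (induction rule: tensor.induct)
  case (zero q)
  then show ?case using tensor_0 by (simp add: traces_killed)
next
  case (mult d f u i j)
  let ?u = "word_matrix u $ i $ j" and ?w = "word_matrix w $ k $ l"
  have "tensor r (Suc d) ((cross f ?w - of_nat (8 * d) * (f * ?w)) * ?u + f * (cross ?u ?w - 8 * (?u * ?w)))"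
    using mult by (intro tensor.add tensor.mult cross_word assms(2))
  moreover have "(cross f ?w - of_nat (8 * d) * (f * ?w)) * ?u + f * (cross ?u ?w - 8 * (?u * ?w)) =
     cross (f * ?u) ?w - of_nat (8 * Suc d) * (f * ?u * ?w)"
    by (simp add: cross_mult_left algebra_simps)
  ultimately show ?case by simp
next
  case (add d f g)
  from tensor.add[OF add.IH] show ?case by (simp add: cross_add_left algebra_simps)
qed

text \<open>Matrices split into scalar and traceless ones, with eigenvalues \<open>0\<close> and
  \<open>8\<close>.\<close>

lemma casimir_word:
  "casimir (word_matrix w $ i $ j) = 8 * word_matrix w $ i $ j - (if i = j then 4 * trace (word_matrix w) else 0)"
  using exhaust_2[of i] exhaust_2[of j]
  by (auto simp: casimir_def H_word H_minus H_mult EF_word deriv_along_simps deriv_along_diff deriv_along_minus trace_def sum_2 algebra_simps)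

text \<open>\<open>4 * d * (d + 1)\<close> is the eigenvalue on the irreducible representation of
  dimension \<open>2 * d + 1\<close>, realised on the part of a tensor that no contraction reaches.
  The induction adds \<open>8\<close> for the new factor and \<open>8 * d\<close> for its cross
  terms.\<close>

lemma casimir_tensor:
  assumes "tensor r d f"
  shows "if d = 0 then casimir f = 0 else tensor r (d - 1) (casimir f - of_nat (4 * d * (d + 1)) * f)"
  using assms
proof (induction rule: tensor.induct)
  case (zero q)
  then show ?case by (simp add: traces_killed)
next
  case (mult d f w i j)
  let ?w = "word_matrix w $ i $ j"
  have 1: "tensor r d ((casimir f - of_nat (4 * d * (d + 1)) * f) * ?w)"
  proof (cases d)
    case 0
    then show ?thesis using mult.IH tensor_0 by simp
  next
    case (Suc d')
    then show ?thesis using tensor.mult[OF _ mult.hyps(2), of d' "casimir f - of_nat (4 * d * (d + 1)) * f" i j] mult.IH by simp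
  qed
  have "tensor r d (4 * (trace (word_matrix w) * f))"
    by (intro tensor_numeral tensor_traces_mult mult.hyps trace_in)
  then have 2: "tensor r d (f * (if i = j then 4 * trace (word_matrix w) else 0))"
    using tensor_0 by (auto simp: mult_ac)
  have "tensor r d ((casimir f - of_nat (4 * d * (d + 1)) * f) * ?w +
    (cross f ?w - of_nat (8 * d) * (f * ?w)) - f * (if i = j then 4 * trace (word_matrix w) else 0))"
    by (intro tensor_diff tensor.add 1 2 cross_tensor mult.hyps)
  moreover have "(casimir f - of_nat (4 * d * (d + 1)) * f) * ?w +
    (cross f ?w - of_nat (8 * d) * (f * ?w)) - f * (if i = j then 4 * trace (word_matrix w) else 0) =
    casimir (f * ?w) - of_nat (4 * Suc d * (Suc d + 1)) * (f * ?w)"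
    by (simp add: casimir_mult casimir_word algebra_simps)
  ultimately show ?case by simp
next
  case (add d f g)
  then show ?case
  proof (cases "d = 0")
    case False
    with add have "tensor r (d - 1) ((casimir f - of_nat (4 * d * (d + 1)) * f) + (casimir g - of_nat (4 * d * (d + 1)) * g))"
      by (intro tensor.add) auto
    with False show ?thesis by (simp add: casimir_add algebra_simps)
  qed (simp add: casimir_add)
qed

inductive tensors_upto :: "nat \<Rightarrow> nat \<Rightarrow> rep_poly \<Rightarrow> bool" for r D where
  gen: "tensor r d f \<Longrightarrow> d \<le> D \<Longrightarrow> tensors_upto r D f"
| add: "tensors_upto r D f \<Longrightarrow> tensors_upto r D g \<Longrightarrow> tensors_upto r D (f + g)"

lemma tensors_upto_mono: "tensors_upto r D f \<Longrightarrow> D \<le> D' \<Longrightarrow> tensors_upto r D' f"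
  by (induction rule: tensors_upto.induct) (auto intro: tensors_upto.intros)

lemma tensors_upto_0: "tensors_upto r 0 f \<Longrightarrow> f \<in> traces r"
proof (induction rule: tensors_upto.induct)
  case (gen d f)
  have "tensor r d f \<Longrightarrow> d = 0 \<Longrightarrow> f \<in> traces r"
    by (induction rule: tensor.induct) (auto intro: tracesD)
  with gen show ?case by simp
qed (auto intro: tracesD)

lemma tensors_upto_exists:
  assumes "p \<in> polys r" shows "\<exists>D. tensors_upto r D p"
  using assms unfolding polys_def
proof (induction rule: rep.alg.induct)
  case (const c)
  have "tensor r 0 (poly_const c)" by (intro tensor.zero tracesD)
  then show ?case by (auto intro: tensors_upto.gen)
next
  case (gen x)
  then obtain l i j where x: "x = poly_var (l, i, j)" "l < r" by (auto simp: vars_def)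
  have "tensor r (Suc 0) (1 * word_matrix [(l, True)] $ i $ j)"
    using x by (intro tensor.mult tensor.zero tracesD) auto
  then have "tensor r (Suc 0) x"
    by (simp add: x word_matrix_eq letter_value_def gen_matrix_def)
  then show ?case by (auto intro: tensors_upto.gen)
next
  case (add a b)
  then obtain D D' where "tensors_upto r D a" "tensors_upto r D' b" by blast
  then have "tensors_upto r (max D D') (a + b)"
    by (intro tensors_upto.add) (auto elim: tensors_upto_mono)
  then show ?case by blast
next
  case (mult a b)
  have t: "tensor r (d' + d) (f * g)" if "tensor r d' g" "tensor r d f" for d d' f g
    using that
  proof (induction rule: tensor.induct)
    case (zero q)
    then show ?case using tensor_traces_mult[of r d f q] by (simp add: mult.commute)
  next
    case (mult d' g w i j)
    from tensor.mult[OF mult.IH[OF mult.prems] mult.hyps(2)] show ?case by (simp add: mult.assoc)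
  next
    case (add d' g h)
    then show ?case by (auto simp: distrib_left intro: tensor.add)
  qed
  have g: "tensors_upto r (D + D') (f * g)" if "tensors_upto r D f" "tensor r d g" "d \<le> D'" for D D' d f g
    using that(1)
  proof (induction rule: tensors_upto.induct)
    case (gen d' f)
    then show ?case using t[OF that(2) gen(1)] that(3) by (auto intro: tensors_upto.gen)
  qed (auto simp: distrib_right intro: tensors_upto.add)
  obtain D D' where D: "tensors_upto r D a" "tensors_upto r D' b" using mult by blast
  from D(2) have "tensors_upto r (D + D') (a * b)"
  proof (induction rule: tensors_upto.induct)
    case (gen d g)
    then show ?case using g[OF D(1)] by blast
  qed (auto simp: distrib_left intro: tensors_upto.add)
  then show ?case by blast
qed

text \<open>The operator kills the top eigenvalue \<open>4 * Suc D * (Suc D + 1)\<close>, and does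
  not raise the number of factors in the lower parts.\<close>

lemma casimir_lowers:
  assumes "tensors_upto r (Suc D) f"
  shows "tensors_upto r D (f - poly_const (1 / of_nat (4 * Suc D * (Suc D + 1))) * casimir f)"
  using assms
proof (induction rule: tensors_upto.induct)
  case (gen d f)
  let ?c = "1 / of_nat (4 * Suc D * (Suc D + 1)) :: complex"
  have low: "tensor r (d - 1) (casimir f - of_nat (4 * d * (d + 1)) * f)" if "d \<noteq> 0"
    using casimir_tensor[OF gen(1)] that by simp
  show ?case
  proof (cases "d = Suc D")
    case True
    have "tensor r D (poly_const (- ?c) * (casimir f - of_nat (4 * d * (d + 1)) * f))"
      using low True by (intro tensor_const) simp
    moreover have "poly_const (- ?c) * of_nat (4 * d * (d + 1)) = - 1"
      unfolding of_nat_poly_const rep.scalar_mult[symmetric] True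
      by (simp add: rep.scalar_minus del: of_nat_Suc of_nat_add of_nat_mult)
    then have "poly_const (- ?c) * (casimir f - of_nat (4 * d * (d + 1)) * f) = f - poly_const ?c * casimir f"
      by (simp add: right_diff_distrib rep.scalar_minus flip: mult.assoc del: of_nat_Suc of_nat_add of_nat_mult)
    ultimately show ?thesis by (auto intro: tensors_upto.gen)
  next
    case False
    then have d: "d \<le> D" using gen by simp
    show ?thesis
    proof (cases "d = 0")
      case True
      then show ?thesis using casimir_tensor[OF gen(1)] gen(1) d by (auto intro: tensors_upto.gen)
    next
      case d0: False
      define c' where "c' = 1 - ?c * of_nat (4 * d * (d + 1))"
      have "tensors_upto r D (poly_const c' * f + poly_const (- ?c) * (casimir f - of_nat (4 * d * (d + 1)) * f))"
        using low[OF d0] gen(1) d by (intro tensors_upto.add) (auto intro!: tensors_upto.gen tensor_const)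
      moreover have "poly_const c' * f + poly_const (- ?c) * (casimir f - of_nat (4 * d * (d + 1)) * f) =
          f - poly_const ?c * casimir f"
        unfolding c'_def of_nat_poly_const
        by (simp only: rep.scalar_diff rep.scalar_mult rep.scalar_minus rep.scalar_1) (simp add: algebra_simps)
      ultimately show ?thesis by simp
    qed
  qed
next
  case (add f g)
  from tensors_upto.add[OF add.IH] show ?case by (simp add: casimir_add algebra_simps)
qed

text \<open>The Casimir operator acts on \<open>tensors_upto r D\<close> with the eigenvalues \<open>4 d (d + 1)\<close>, \<open>d \<le> D\<close>; killing
  the nonzero ones projects to \<open>traces r\<close>, and does not change an element which is invariant modulo \<open>I\<close>.\<close>

theorem infinitesimal_invariants:
  assumes I: "ideal_of (polys r) I"
    and EI: "\<And>p. p \<in> I \<Longrightarrow> E p \<in> I" "\<And>p. p \<in> I \<Longrightarrow> F p \<in> I"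
    and p: "p \<in> polys r" "E p \<in> I" "F p \<in> I"
  shows "\<exists>q\<in>traces r. p - q \<in> I"
proof -
  note ID = ideal_ofD[OF I] rep.ideal_of_minus[OF subalg_polys I]
  have C: "poly_const c * a \<in> I" "2 * a \<in> I" if "a \<in> I" for c a
    using ID(4)[OF polysD(1) that] by (auto simp: numeral_poly_const)
  \<comment> \<open>\<open>casimir\<close> is a polynomial in \<open>E\<close> and \<open>F\<close>
    without constant term, so it sends infinitesimal invariants modulo \<open>I\<close> into
    \<open>I\<close>.\<close>
  have cas: "casimir p \<in> I" if "E p \<in> I" "F p \<in> I" for p
  proof -
    have EF: "E (F a) \<in> I" "F (E a) \<in> I" "H a \<in> I" if "E a \<in> I" "F a \<in> I" for a
      unfolding H_def using EI(1)[OF that(2)] EI(2)[OF that(1)] ID(7) by auto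
    have "H p \<in> I" using EF that by blast
    from EF(3)[OF EI(1)[OF this] EI(2)[OF this]] EF(1,2)[OF that] show ?thesis
      unfolding casimir_def by (intro ID(3) C(2))
  qed
  have "\<exists>q\<in>traces r. p - q \<in> I" if "tensors_upto r D p" "E p \<in> I" "F p \<in> I" for p D
    using that
  proof (induction D arbitrary: p)
    case 0
    then show ?case using tensors_upto_0 ID(2) by (intro bexI[of _ p]) auto
  next
    case (Suc D)
    define s where "s = poly_const (1 / of_nat (4 * Suc D * (Suc D + 1))) * casimir p"
    have s: "s \<in> I" unfolding s_def using cas Suc.prems by (intro C)
    have "\<exists>q\<in>traces r. p - s - q \<in> I"
    proof (rule Suc.IH)
      show "tensors_upto r D (p - s)" unfolding s_def by (intro casimir_lowers Suc.prems)
      show "E (p - s) \<in> I" "F (p - s) \<in> I"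
        unfolding deriv_along_diff using Suc.prems EI s by (auto intro: ID(7))
    qed
    then obtain q where q: "q \<in> traces r" "p - s - q \<in> I" by blast
    from ID(3)[OF q(2) s] have "p - q \<in> I" by (simp add: algebra_simps)
    with q(1) show ?case by blast
  qed
  with tensors_upto_exists[OF p(1)] p show ?thesis by blast
qed

section \<open>The character ring\<close>

lemma word_value_simps [simp]:
  "word_value G gs [] = \<one>\<^bsub>G\<^esub>"
  "word_value G gs (a # w) = (if snd a then gs ! fst a else inv\<^bsub>G\<^esub> (gs ! fst a)) \<otimes>\<^bsub>G\<^esub> word_value G gs w"
  by (simp_all add: word_value_def case_prod_unfold)

lemma const_matrix_adjugate2: "const_matrix (adjugate2 h) = adjugate2 (const_matrix h)"
  by (simp add: const_matrix_def matrix2_simps rep.scalar_minus)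

lemma det_const_matrix: "det (const_matrix h) = poly_const (det h)"
  by (simp add: const_matrix_def det_2 rep.scalar_diff rep.scalar_mult)

lemma word_eval_conj:
  assumes P: "det P = 1"
  shows "word_eval (\<lambda>l. adjugate2 P ** M l ** P) w = adjugate2 P ** word_eval M w ** P"
proof (induction w)
  case Nil
  then show ?case by (simp add: matrix_mul_rid adjugate2_inverse P)
next
  case (Cons a w)
  have "letter_value (\<lambda>l. adjugate2 P ** M l ** P) a = adjugate2 P ** letter_value M a ** P"
    by (simp add: letter_value_def adjugate2_mult matrix_mul_assoc)
  moreover have "(adjugate2 P ** L ** P) ** (adjugate2 P ** W ** P) = adjugate2 P ** L ** (P ** adjugate2 P) ** W ** P" for L W
    by (simp only: matrix_mul_assoc)
  ultimately show ?case using Cons by (simp add: adjugate2_inverse P matrix_mul_rid matrix_mul_assoc)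
qed

lemma conj_subst_eq:
  assumes "det h = 1"
  shows "conj_subst h (l, i, j) = (adjugate2 (const_matrix h) ** gen_matrix l ** const_matrix h) $ i $ j"
proof -
  have "matrix_inv h = adjugate2 h" using assms by (intro matrix_inv_eqI adjugate2_inverse)
  then show ?thesis by (simp add: conj_subst_def flip: const_matrix_def const_matrix_adjugate2)
qed

lemma poly_subst_conj_word:
  assumes "det h = 1"
  shows "poly_subst (conj_subst h) (word_matrix w $ i $ j) =
    (adjugate2 (const_matrix h) ** word_matrix w ** const_matrix h) $ i $ j"
proof -
  have "(\<lambda>l. \<chi> i j. conj_subst h (l, i, j)) =
      (\<lambda>l. adjugate2 (const_matrix h) ** gen_matrix l ** const_matrix h)"
    using assms by (intro ext) (simp add: conj_subst_eq vec_eq_iff)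
  moreover have "det (const_matrix h) = 1" using det_const_matrix[of h] assms by (simp add: poly_const_def)
  ultimately show ?thesis
    by (simp only: poly_subst_eq_peval peval_word_matrix[OF rep.complex_algebra_axioms]) (simp add: word_eval_conj word_matrix_eq)
qed

lemma poly_subst_conj_traces:
  assumes h: "det h = 1" and q: "q \<in> traces r" shows "poly_subst (conj_subst h) q = q"
  using q unfolding traces_def
proof (induction rule: rep.alg.induct)
  case (gen q)
  then obtain w where q: "q = trace (word_matrix w)" by blast
  let ?P = "const_matrix h"
  have "poly_subst (conj_subst h) q = trace (adjugate2 ?P ** word_matrix w ** ?P)"
    using poly_subst_conj_word[OF h] by (simp add: q trace_def poly_subst_eq_peval rep.peval_sum)
  also have "\<dots> = trace (?P ** (adjugate2 ?P ** word_matrix w))" by (rule trace_mul_sym)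
  also have "\<dots> = q"
    using det_const_matrix[of h] h
    by (simp add: matrix_mul_assoc adjugate2_inverse poly_const_def matrix_mul_lid q)
  finally show ?case .
qed (simp_all add: poly_subst_eq_peval rep.peval_add rep.peval_mult rep.peval_const)

text \<open>Since \<open>conj_act\<close> takes images of residue classes, equality of classes needs
  a preimage for every element.\<close>

lemma poly_subst_conj_inverse:
  assumes h: "det h = 1"
  shows "poly_subst (conj_subst h) (poly_subst (conj_subst (adjugate2 h)) p) = p"
proof (rule hom_eqI)
  fix v :: rep_var
  obtain l i j where v: "v = (l, i, j)" by (metis prod.exhaust)
  have h': "det (adjugate2 h) = 1" using h by (simp add: det_adjugate2)
  have P: "det (const_matrix h) = 1" using det_const_matrix[of h] h by (simp add: poly_const_def)
  let ?P = "const_matrix h"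
  have g: "poly_subst (conj_subst h) (gen_matrix l $ i $ j) = (adjugate2 ?P ** gen_matrix l ** ?P) $ i $ j" for i j
    by (simp add: gen_matrix_def poly_subst_eq_peval rep.peval_var conj_subst_eq[OF h])
  have c: "poly_subst (conj_subst h) (?P $ i $ j) = ?P $ i $ j"
    "poly_subst (conj_subst h) (adjugate2 ?P $ i $ j) = adjugate2 ?P $ i $ j" for i j
    by (simp_all add: poly_subst_eq_peval flip: const_matrix_adjugate2)
      (simp_all add: const_matrix_def rep.peval_const)
  have "poly_subst (conj_subst h) ((?P ** gen_matrix l ** adjugate2 ?P) $ i $ j) =
     (?P ** (adjugate2 ?P ** gen_matrix l ** ?P) ** adjugate2 ?P) $ i $ j"
    using g c unfolding poly_subst_eq_peval
    by (simp add: matrix_matrix_mult_def[of _ "adjugate2 ?P"] matrix_matrix_mult_def[of ?P] rep.peval_sum rep.peval_mult)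
  also have "?P ** (adjugate2 ?P ** gen_matrix l ** ?P) ** adjugate2 ?P =
     (?P ** adjugate2 ?P) ** gen_matrix l ** (?P ** adjugate2 ?P)"
    by (simp only: matrix_mul_assoc)
  finally show "poly_subst (conj_subst h) (poly_subst (conj_subst (adjugate2 h)) (poly_var v)) = poly_var v"
    using h by (simp add: v poly_subst_eq_peval rep.peval_var conj_subst_eq[OF h'] const_matrix_adjugate2
        adjugate2_inverse P matrix_mul_lid matrix_mul_rid) (simp add: gen_matrix_def)
qed (simp_all add: poly_subst_eq_peval rep.peval_add rep.peval_mult rep.peval_const)

locale generated_group = group G for G :: "('g, 'b) monoid_scheme" (structure) +
  fixes gs :: "'g list"
  assumes gs: "set gs \<subseteq> carrier G" and generate: "generate G (set gs) = carrier G"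
begin

abbreviation "r \<equiv> length gs"
abbreviation "words \<equiv> words_over {..<r}"
abbreviation "val \<equiv> word_value G gs"
abbreviation "I \<equiv> rep_ideal G gs"

lemma gs_closed: "l < r \<Longrightarrow> gs ! l \<in> carrier G"
  using gs by auto

lemma val_closed [simp]: "w \<in> words \<Longrightarrow> val w \<in> carrier G"
  by (induction w) (auto simp: gs_closed)

lemma val_append: "u \<in> words \<Longrightarrow> v \<in> words \<Longrightarrow> val (u @ v) = val u \<otimes> val v"
proof (induction u)
  case (Cons a u)
  moreover from Cons.prems gs have "gs ! fst a \<in> carrier G" by auto
  ultimately show ?case by (auto simp: m_assoc)
qed simp

lemma val_inv_word: "w \<in> words \<Longrightarrow> val (inv_word w) = inv (val w)"
proof (induction w)
  case (Cons a w)
  moreover from Cons.prems gs have "gs ! fst a \<in> carrier G" by auto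
  moreover have "val (inv_word (a # w)) = val (inv_word w @ [inv_letter a])"
    by (simp add: inv_word_def)
  moreover have "val (inv_word w @ [inv_letter a]) = val (inv_word w) \<otimes> val [inv_letter a]"
    using Cons.prems by (intro val_append) (auto simp: inv_letter_def)
  ultimately show ?case by (auto simp: inv_mult_group inv_letter_def)
qed (simp add: inv_word_def)

lemma word_exists: "g \<in> carrier G \<Longrightarrow> \<exists>w\<in>words. val w = g"
  unfolding generate[symmetric]
proof (induction rule: generate.induct)
  case one
  then show ?case by (intro bexI[of _ "[]"]) auto
next
  case (incl h)
  then obtain l where "l < r" "h = gs ! l" by (auto simp: in_set_conv_nth)
  then show ?case using gs_closed[of l] by (intro bexI[of _ "[(l, True)]"]) auto
next
  case (inv h)
  then obtain l where "l < r" "h = gs ! l" by (auto simp: in_set_conv_nth)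
  then show ?case using gs_closed[of l] by (intro bexI[of _ "[(l, False)]"]) auto
next
  case (eng h1 h2)
  then obtain u v where "u \<in> words" "v \<in> words" "val u = h1" "val v = h2" by blast
  then show ?case by (intro bexI[of _ "u @ v"]) (auto simp: val_append)
qed

text \<open>Determinant one turns adjugates into inverses, so a homomorphism can be evaluated along
  words.\<close>

lemma word_eval_eq_hom:
  assumes hom: "\<And>g h. g \<in> carrier G \<Longrightarrow> h \<in> carrier G \<Longrightarrow> \<rho> (g \<otimes> h) = \<rho> g ** \<rho> h"
    and det: "\<And>g. g \<in> carrier G \<Longrightarrow> det (\<rho> g) = 1"
    and w: "w \<in> words"
  shows "word_eval (\<lambda>l. \<rho> (gs ! l)) w = \<rho> (val w)"
proof -
  have 1: "\<rho> \<one> = mat 1"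
  proof -
    have "\<rho> \<one> ** \<rho> \<one> = \<rho> \<one>" using hom[of \<one> \<one>] by simp
    then have "adjugate2 (\<rho> \<one>) ** (\<rho> \<one> ** \<rho> \<one>) = adjugate2 (\<rho> \<one>) ** \<rho> \<one>" by simp
    then show ?thesis
      by (simp only: matrix_mul_assoc) (simp add: adjugate2_inverse(2)[OF det[OF one_closed]] matrix_mul_lid)
  qed
  have inv: "\<rho> (inv g) = adjugate2 (\<rho> g)" if g: "g \<in> carrier G" for g
  proof -
    have "adjugate2 (\<rho> g) ** (\<rho> g ** \<rho> (inv g)) = adjugate2 (\<rho> g)"
      by (simp add: 1 matrix_mul_rid g r_inv flip: hom[OF g inv_closed[OF g]])
    then show ?thesis
      by (simp only: matrix_mul_assoc) (simp add: adjugate2_inverse(2)[OF det[OF g]] matrix_mul_lid)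
  qed
  show ?thesis using w
  proof (induction w)
    case Nil
    then show ?case by (simp add: 1)
  next
    case (Cons a w)
    from Cons.prems gs have "gs ! fst a \<in> carrier G" by auto
    with Cons show ?case by (auto simp: letter_value_def hom inv)
  qed
qed

sublocale polys: ring_presentation poly_const "polys r" "\<lambda>p. p" "rep_poly_ring r"
  by unfold_locales (simp_all add: subalg_polys carrier_rep_poly_ring, simp_all add: rep_poly_ring_def)

definition relators :: "rep_poly set" where
  "relators = {det (gen_matrix l) - 1 | l. l < r} \<union>
      {(word_matrix w - mat 1) $ i $ j | w i j. w \<in> words \<and> val w = \<one>}"

lemma relators_in: "relators \<subseteq> polys r"
proof -
  have m1: "mat 1 $ i $ j \<in> polys r" for i j :: 2 using polysD by (simp add: mat_def)
  moreover have "det (gen_matrix l) - 1 \<in> polys r" if "l < r" for l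
    unfolding det_2 using that by (intro polysD gen_matrix_in)
  moreover have "(word_matrix w - mat 1) $ i $ j \<in> polys r" if "w \<in> words" for w i j
    using that by (auto intro!: polysD(7) word_matrix_in m1)
  ultimately show ?thesis unfolding relators_def by blast
qed

lemma I_eq: "I = Idl\<^bsub>rep_poly_ring r\<^esub> relators"
  by (simp add: rep_ideal_def relators_def)

lemma relators_I: "relators \<subseteq> I"
  unfolding I_eq using relators_in
  by (intro ring.genideal_self[OF cring.axioms(1)[OF polys.cring]]) (simp add: carrier_rep_poly_ring)

lemma ideal_I: "ideal I (rep_poly_ring r)"
  unfolding I_eq using relators_in
  by (intro ring.genideal_ideal[OF cring.axioms(1)[OF polys.cring]]) (simp add: carrier_rep_poly_ring)

lemma I_subset: "I \<subseteq> polys r"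
  using ideal.Icarr[OF ideal_I] by (auto simp: carrier_rep_poly_ring)

lemma ideal_of_I: "ideal_of (polys r) I"
proof -
  have "ideal_of (polys r) {p \<in> polys r. p \<in> I}"
    using polys.ideal_iff[of I] ideal_I I_subset by (simp add: carrier_rep_poly_ring)
  moreover have "{p \<in> polys r. p \<in> I} = I" using I_subset by auto
  ultimately show ?thesis by simp
qed

lemmas ID = ideal_ofD[OF ideal_of_I] rep.ideal_of_minus[OF subalg_polys ideal_of_I]

lemma I_least:
  assumes "ideal_of (polys r) J" "relators \<subseteq> J" shows "I \<subseteq> J"
proof -
  have "J \<subseteq> polys r" using ideal_ofD(1)[OF assms(1)] by auto
  moreover from this have "{p \<in> polys r. p \<in> J} = J" by auto
  ultimately have "ideal J (rep_poly_ring r)"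
    using polys.ideal_iff[of J] assms(1) by (simp add: carrier_rep_poly_ring)
  then show ?thesis unfolding I_eq
    by (intro ring.genideal_minimal[OF cring.axioms(1)[OF polys.cring]] assms(2))
qed

lemma I_induct [consumes 1, case_names relator zero add mult]:
  assumes "p \<in> I" and "\<And>p. p \<in> relators \<Longrightarrow> Q p" "Q 0" "\<And>p q. p \<in> I \<Longrightarrow> q \<in> I \<Longrightarrow> Q p \<Longrightarrow> Q q \<Longrightarrow> Q (p + q)"
    "\<And>p q. p \<in> I \<Longrightarrow> q \<in> polys r \<Longrightarrow> Q p \<Longrightarrow> Q (q * p)"
  shows "Q p"
proof -
  have "I \<subseteq> {p \<in> I. Q p}"
  proof (rule I_least)
    show "ideal_of (polys r) {p \<in> I. Q p}" unfolding ideal_of_def using ID assms(2-5) by auto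
  qed (use relators_I assms(2) in auto)
  then show ?thesis using assms(1) by auto
qed

lemma word_matrix_1: "w \<in> words \<Longrightarrow> val w = \<one> \<Longrightarrow> (word_matrix w - mat 1) $ i $ j \<in> I"
  using relators_I unfolding relators_def by blast

text \<open>Equality of matrices over \<open>rep_ring\<close>.\<close>

definition mcong :: "rep_poly^2^2 \<Rightarrow> rep_poly^2^2 \<Rightarrow> bool" where
  "mcong A B \<longleftrightarrow> (\<forall>i j. (A - B) $ i $ j \<in> I)"

lemma mcong_mult:
  assumes "mcong A B" and C: "\<And>i j. C $ i $ j \<in> polys r" shows "mcong (C ** A) (C ** B)" "mcong (A ** C) (B ** C)"
proof -
  have "(C ** A - C ** B) $ i $ j = (\<Sum>k\<in>UNIV. C $ i $ k * (A - B) $ k $ j)"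
    "(A ** C - B ** C) $ i $ j = (\<Sum>k\<in>UNIV. (A - B) $ i $ k * C $ k $ j)" for i j
    by (simp_all add: matrix_matrix_mult_def sum_subtractf algebra_simps)
  then show "mcong (C ** A) (C ** B)" "mcong (A ** C) (B ** C)"
    using ID(4)[OF C] ID(5)[OF C] assms(1)[unfolded mcong_def] unfolding mcong_def
    by (auto intro!: ideal_of_sum[OF ideal_of_I] simp del: vector_minus_component)
qed

lemma mcong_trans: "mcong A B \<Longrightarrow> mcong B C \<Longrightarrow> mcong A C"
proof (unfold mcong_def, intro allI)
  fix i j :: 2
  assume "\<forall>i j. (A - B) $ i $ j \<in> I" "\<forall>i j. (B - C) $ i $ j \<in> I"
  then have "(A - B) $ i $ j + (B - C) $ i $ j \<in> I" by (intro ID(3)) auto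
  then show "(A - C) $ i $ j \<in> I" by simp
qed

lemma mcong_sym: "mcong A B \<Longrightarrow> mcong B A"
proof (unfold mcong_def, intro allI)
  fix i j :: 2
  assume "\<forall>i j. (A - B) $ i $ j \<in> I"
  then have "- ((A - B) $ i $ j) \<in> I" by (intro ID(6)) auto
  then show "(B - A) $ i $ j \<in> I" by simp
qed

text \<open>The word \<open>u @ inv_word v @ v\<close> is congruent to both sides, since its tail
  and its head have trivial value.\<close>

lemma mcong_words:
  assumes u: "u \<in> words" and v: "v \<in> words" and uv: "val u = val v"
  shows "mcong (word_matrix u) (word_matrix v)"
proof -
  have 1: "mcong (word_matrix (inv_word v @ v)) (mat 1)" "mcong (word_matrix (u @ inv_word v)) (mat 1)"
    using u v uv word_matrix_1[of "inv_word v @ v"] word_matrix_1[of "u @ inv_word v"]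
    by (auto simp: mcong_def val_append val_inv_word)
  have "mcong (word_matrix (u @ inv_word v @ v)) (word_matrix u)"
    using mcong_mult(1)[OF 1(1), of "word_matrix u"] u
    by (simp add: word_matrix_in) (simp add: word_matrix_eq word_eval_append matrix_mul_rid)
  moreover have "mcong (word_matrix (u @ inv_word v @ v)) (word_matrix v)"
    using mcong_mult(2)[OF 1(2), of "word_matrix v"] v
    by (simp add: word_matrix_in) (simp add: word_matrix_eq word_eval_append matrix_mul_lid matrix_mul_assoc)
  ultimately show ?thesis using mcong_sym mcong_trans by blast
qed

lemma trace_cong_I:
  assumes "u \<in> words" "v \<in> words" "val u = val v"
  shows "trace (word_matrix u) - trace (word_matrix v) \<in> I"
proof -
  have "trace (word_matrix u) - trace (word_matrix v) = (\<Sum>i\<in>UNIV. (word_matrix u - word_matrix v) $ i $ i)"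
    by (simp add: trace_def sum_subtractf)
  then show ?thesis using mcong_words[OF assms]
    by (auto simp: mcong_def intro!: ideal_of_sum[OF ideal_of_I])
qed

lemma det_relator: "l < r \<Longrightarrow> det (gen_matrix l) - 1 = (word_matrix [(l, True), (l, False)] - mat 1) $ 1 $ 1"
  by (simp add: word_matrix_eq letter_value_def) (simp add: matrix2_simps algebra_simps)

text \<open>A matrix times its adjugate is the determinant times the identity, so a determinant
  relation is an entry of the relation for a letter followed by its inverse. Inductions over
  \<open>I\<close> then treat one kind of generator.\<close>

lemma relators_eq: "relators = {(word_matrix w - mat 1) $ i $ j | w i j. w \<in> words \<and> val w = \<one>}"
proof -
  have "\<exists>w i j. det (gen_matrix l) - 1 = (word_matrix w - mat 1) $ i $ j \<and> w \<in> words \<and> val w = \<one>"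
    if "l < r" for l
  proof (intro exI conjI)
    show "det (gen_matrix l) - 1 = (word_matrix [(l, True), (l, False)] - mat 1) $ 1 $ 1"
      using that by (rule det_relator)
    from that gs have "gs ! l \<in> carrier G" by auto
    then show "val [(l, True), (l, False)] = \<one>" by simp
  qed (use that in simp)
  then show ?thesis unfolding relators_def by auto
qed

lemma deriv_along_polys:
  assumes "X \<in> {e12, e21}" "p \<in> polys r" shows "deriv_along X p \<in> polys r"
  using assms(2) unfolding polys_def
proof (induction rule: rep.alg.induct)
  case (gen x)
  then obtain l i j where x: "x = poly_var (l, i, j)" "l < r" by (auto simp: vars_def)
  have "const_matrix X $ i $ j \<in> polys r" for i j by (simp add: const_matrix_def polysD)
  then have "deriv_along X x \<in> polys r" unfolding x deriv_along_simps
    using x(2) gen_matrix_in by (auto simp: matrix_matrix_mult_def intro!: polysD rep.subalg_sum[OF subalg_polys])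
  then show ?case by (simp add: polys_def)
qed (auto simp: deriv_along_simps intro!: rep.subalgD[OF rep.subalg_alg])

text \<open>A word matrix congruent to the identity has a commutator with a constant matrix that is
  congruent to zero.\<close>

lemma deriv_along_I:
  assumes X: "X \<in> {e12, e21}" and p: "p \<in> I" shows "deriv_along X p \<in> I"
  using p
proof (induction p rule: I_induct)
  case (relator p)
  then obtain w i j where w: "p = (word_matrix w - mat 1) $ i $ j" "w \<in> words" "val w = \<one>"
    unfolding relators_eq by blast
  let ?W = "word_matrix w" and ?X = "const_matrix X"
  have "deriv_along X p = (?W ** ?X - ?X ** ?W) $ i $ j"
    using deriv_along_word[OF X, of w i j] by (simp add: w(1) deriv_along_diff mat_def)
  moreover have "mcong (?W ** ?X) ?X" "mcong (?X ** ?W) ?X"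
    using mcong_mult[of ?W "mat 1" ?X] word_matrix_1[OF w(2,3)] polysD(1)
    by (auto simp: mcong_def const_matrix_def matrix_mul_lid matrix_mul_rid)
  then have "mcong (?W ** ?X) (?X ** ?W)" using mcong_sym mcong_trans by blast
  ultimately show ?case by (simp add: mcong_def)
next
  case (mult p q)
  then show ?case using deriv_along_polys[OF X mult(2)] by (auto simp: deriv_along_simps intro!: ID(3,4))
qed (auto simp: deriv_along_simps intro!: ID)

lemma rep_fun_eq: "rep_fun G gs p = (\<lambda>i. i + p) ` I"
  by (auto simp: rep_fun_def a_r_coset_def' rep_poly_ring_def)

lemma rep_fun_eq_iff: "rep_fun G gs p = rep_fun G gs q \<longleftrightarrow> p - q \<in> I"
proof
  assume "rep_fun G gs p = rep_fun G gs q"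
  moreover have "p \<in> rep_fun G gs p" using ID(2) by (force simp: rep_fun_eq)
  ultimately show "p - q \<in> I" by (auto simp: rep_fun_eq)
next
  have *: "rep_fun G gs p \<subseteq> rep_fun G gs q" if "p - q \<in> I" for p q
  proof (unfold rep_fun_eq, clarify)
    fix i assume "i \<in> I"
    then show "i + p \<in> (\<lambda>i. i + q) ` I"
      using ID(3)[OF _ that, of i] by (intro image_eqI[of _ _ "i + (p - q)"]) auto
  qed
  assume "p - q \<in> I"
  moreover from this have "q - p \<in> I" using ID(6)[of "p - q"] by simp
  ultimately show "rep_fun G gs p = rep_fun G gs q" using * by blast
qed

lemma poly_subst_conj_polys:
  assumes "p \<in> polys r" shows "poly_subst (conj_subst h) p \<in> polys r"
  using assms unfolding polys_def poly_subst_eq_peval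
proof (induction rule: rep.alg.induct)
  case (gen x)
  then obtain l i j where x: "x = poly_var (l, i, j)" "l < r" by (auto simp: vars_def)
  have "peval poly_const (conj_subst h) x \<in> polys r" unfolding x rep.peval_var conj_subst_def
    using x(2) gen_matrix_in polysD(1)
    by (auto simp: matrix_matrix_mult_def intro!: polysD(3) rep.subalg_sum[OF subalg_polys])
  then show ?case by (simp add: polys_def)
qed (auto simp: rep.peval_add rep.peval_mult rep.peval_const intro!: rep.subalgD[OF rep.subalg_alg])

lemma poly_subst_conj_I:
  assumes h: "det h = 1" and p: "p \<in> I" shows "poly_subst (conj_subst h) p \<in> I"
  using p
proof (induction p rule: I_induct)
  case (relator p)
  then obtain w i j where w: "p = (word_matrix w - mat 1) $ i $ j" "w \<in> words" "val w = \<one>"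
    unfolding relators_eq by blast
  let ?W = "word_matrix w" and ?P = "const_matrix h"
  have P: "?P $ i $ j \<in> polys r" "adjugate2 ?P $ i $ j \<in> polys r" for i j
    by (simp_all add: polysD(1) flip: const_matrix_adjugate2) (simp_all add: const_matrix_def polysD(1))
  have "mcong (adjugate2 ?P ** ?W ** ?P) (adjugate2 ?P ** mat 1 ** ?P)"
    using word_matrix_1[OF w(2,3)] by (intro mcong_mult P) (auto simp: mcong_def)
  moreover have "det ?P = 1" using det_const_matrix[of h] h by (simp add: poly_const_def)
  ultimately have "mcong (adjugate2 ?P ** ?W ** ?P) (mat 1)"
    by (simp add: matrix_mul_rid adjugate2_inverse)
  moreover have "poly_subst (conj_subst h) p = (adjugate2 ?P ** ?W ** ?P - mat 1) $ i $ j"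
    using poly_subst_conj_word[OF h, of w i j]
    by (simp add: w(1) poly_subst_eq_peval rep.peval_diff mat_def rep.peval_0 rep.peval_1)
  ultimately show ?case by (simp add: mcong_def)
next
  case (mult p q)
  then show ?case using poly_subst_conj_polys[OF mult(2)]
    by (auto simp: poly_subst_eq_peval rep.peval_mult intro!: ID(4))
qed (auto simp: poly_subst_eq_peval rep.peval_add rep.peval_0 intro!: ID(2,3))

lemma conj_act_traces:
  assumes h: "det h = 1" and q: "q \<in> traces r"
  shows "conj_act h (rep_fun G gs q) = rep_fun G gs q"
proof (rule equalityI)
  let ?s = "\<lambda>h. poly_subst (conj_subst h)"
  have s: "?s h (p + q) = ?s h p + q" if "det h = 1" for h p
    using poly_subst_conj_traces[OF that q] by (simp add: poly_subst_eq_peval rep.peval_add)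
  show "conj_act h (rep_fun G gs q) \<subseteq> rep_fun G gs q"
    using poly_subst_conj_I[OF h] by (auto simp: conj_act_def rep_fun_eq s h)
  show "rep_fun G gs q \<subseteq> conj_act h (rep_fun G gs q)"
  proof (unfold rep_fun_eq conj_act_def, clarify)
    fix i assume i: "i \<in> I"
    have h': "det (adjugate2 h) = 1" using h by (simp add: det_adjugate2)
    have "i + q = ?s h (?s (adjugate2 h) i + q)" using poly_subst_conj_inverse[OF h] by (simp add: s h)
    then show "i + q \<in> ?s h ` (\<lambda>i. i + q) ` I" using poly_subst_conj_I[OF h' i] by blast
  qed
qed

text \<open>Invariance of a residue class under the group gives invariance under \<open>E\<close>
  and \<open>F\<close> modulo \<open>I\<close>; \<open>infinitesimal_invariants\<close> then
  replaces the representative by a trace polynomial.\<close>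

lemma carrier_char_ring: "carrier (char_ring G gs) = rep_fun G gs ` traces r"
proof -
  have car: "carrier (rep_ring G gs) = rep_fun G gs ` polys r"
    by (auto simp: rep_ring_def FactRing_def A_RCOSETS_def' rep_fun_def carrier_rep_poly_ring)
  show ?thesis
  proof (rule equalityI; rule subsetI)
    fix a assume a: "a \<in> carrier (char_ring G gs)"
    then obtain p where p: "a = rep_fun G gs p" "p \<in> polys r" by (auto simp: char_ring_def car)
    have "poly_subst (conj_subst h) p - p \<in> I" if "det h = 1" for h
    proof -
      have "conj_act h (rep_fun G gs p) = rep_fun G gs p" using a that by (simp add: char_ring_def p)
      moreover have "p \<in> rep_fun G gs p" using ID(2) by (force simp: rep_fun_eq)
      ultimately have "poly_subst (conj_subst h) p \<in> rep_fun G gs p" by (force simp: conj_act_def)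
      then show ?thesis by (auto simp: rep_fun_eq)
    qed
    then have "deriv_along X p \<in> I" if "X \<in> {e12, e21}" for X
      using that ID(4)[OF polysD(1)] by (intro deriv_along_invariant ID(2,3)) auto
    then obtain q where "q \<in> traces r" "p - q \<in> I"
      using infinitesimal_invariants[OF ideal_of_I _ _ p(2)] deriv_along_I by blast
    then show "a \<in> rep_fun G gs ` traces r" by (auto simp: p rep_fun_eq_iff)
  next
    fix a assume "a \<in> rep_fun G gs ` traces r"
    then show "a \<in> carrier (char_ring G gs)"
      using traces_subset_polys conj_act_traces by (auto simp: char_ring_def car)
  qed
qed

sublocale char: ring_presentation poly_const "traces r" "rep_fun G gs" "char_ring G gs"
proof
  show "rep.subalg (traces r)" by (rule subalg_traces)
  show "carrier (char_ring G gs) = rep_fun G gs ` traces r" by (rule carrier_char_ring)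
  interpret J: ideal I "rep_poly_ring r" by (rule ideal_I)
  fix p q assume "p \<in> traces r" "q \<in> traces r"
  then have pq: "p \<in> carrier (rep_poly_ring r)" "q \<in> carrier (rep_poly_ring r)"
    using traces_subset_polys by (auto simp: carrier_rep_poly_ring)
  show "rep_fun G gs p \<oplus>\<^bsub>char_ring G gs\<^esub> rep_fun G gs q = rep_fun G gs (p + q)"
    using J.a_rcos_sum[OF pq]
    by (simp add: char_ring_def rep_ring_def FactRing_def rep_fun_def) (simp add: rep_poly_ring_def)
  show "rep_fun G gs p \<otimes>\<^bsub>char_ring G gs\<^esub> rep_fun G gs q = rep_fun G gs (p * q)"
    using J.rcoset_mult_add[OF pq]
    by (simp add: char_ring_def rep_ring_def FactRing_def rep_fun_def) (simp add: rep_poly_ring_def)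
next
  show "\<zero>\<^bsub>char_ring G gs\<^esub> = rep_fun G gs 0"
    by (simp add: char_ring_def rep_ring_def FactRing_def rep_fun_eq)
  show "\<one>\<^bsub>char_ring G gs\<^esub> = rep_fun G gs 1"
    by (simp add: char_ring_def rep_ring_def FactRing_def rep_fun_def) (simp add: rep_poly_ring_def)
qed

end

section \<open>Fricke's trace identities\<close>

definition fricke3 :: "'a::comm_ring_1^2^2 \<Rightarrow> 'a^2^2 \<Rightarrow> 'a^2^2 \<Rightarrow> 'a" where
  "fricke3 A B C = trace A * trace (B ** C) + trace B * trace (A ** C) + trace C * trace (A ** B)
     - trace A * trace B * trace C"

lemma trace_triple: "trace (A ** B ** C) + trace (A ** C ** B) = fricke3 A B C"
  by (simp add: fricke3_def matrix2_simps algebra_simps)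

text \<open>The sum relation for three groupings of the cyclic word; the unwanted traces cancel in
  pairs.\<close>

lemma trace_quadruple:
  "2 * trace (A ** B ** C ** D) = fricke3 A B (C ** D) - fricke3 (A ** C) D B + fricke3 (D ** A) C B"
proof -
  have "trace (D ** A ** C ** B) = trace (A ** C ** B ** D)" "trace (D ** A ** B ** C) = trace (A ** B ** C ** D)"
    using trace_mul_sym[of D "A ** C ** B"] trace_mul_sym[of D "A ** B ** C"] by (simp_all add: matrix_mul_assoc)
  then show ?thesis by (simp add: matrix_mul_assoc flip: trace_triple)
qed

text \<open>Inverse letters count as letters of their own. Subtracting \<open>2\<close> makes the
  coordinates vanish at the trivial representation.\<close>

definition trace_coords :: "nat \<Rightarrow> rep_poly set" where
  "trace_coords r = {trace (word_matrix w) - 2 | w. w \<in> words_over {..<r} \<and> length w \<le> 3}"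

lemma finite_trace_coords: "finite (trace_coords r)"
proof -
  have "finite {w. set w \<subseteq> {..<r} \<times> (UNIV :: bool set) \<and> length w \<le> 3}"
    by (intro finite_lists_length_le) auto
  moreover have "trace_coords r \<subseteq> (\<lambda>w. trace (word_matrix w) - 2) ` {w. set w \<subseteq> {..<r} \<times> (UNIV :: bool set) \<and> length w \<le> 3}"
    unfolding trace_coords_def words_over_def by (fastforce intro: imageI)
  ultimately show ?thesis by (rule finite_subset[rotated, OF finite_imageI])
qed

text \<open>A word of length at least four is split into four nonempty factors; all traces on the
  right of \<open>trace_quadruple\<close> belong to shorter words.\<close>

lemma trace_in_alg: "w \<in> words_over {..<r} \<Longrightarrow> trace (word_matrix w) \<in> rep.alg (trace_coords r)"
proof (induction "length w" arbitrary: w rule: less_induct)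
  case less
  let ?A = "rep.alg (trace_coords r)"
  note AD = rep.subalgD[OF rep.subalg_alg[of "trace_coords r"]]
  show ?case
  proof (cases "length w \<le> 3")
    case True
    then have "trace (word_matrix w) - 2 \<in> ?A" using less.prems by (intro rep.alg.gen) (auto simp: trace_coords_def)
    from AD(2)[OF this AD(1)[of 2]] show ?thesis by (simp flip: numeral_poly_const)
  next
    case False
    then have "Suc (Suc (Suc (Suc 0))) \<le> length w" by simp
    then obtain x y z u v where "w = x # y # z # u # v" by (auto simp: Suc_le_length_iff)
    then obtain v where w: "w = x # y # z # v" "v \<noteq> []" by blast
    define M where "M = word_matrix"
    have M: "M u ** M u' = M (u @ u')" for u u' by (simp add: M_def word_matrix_eq word_eval_append)
    have shorter: "trace (M u) \<in> ?A" if "length u < length w" "set u \<subseteq> set w" for u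
      using less.hyps[OF that(1)] less.prems that(2) by (auto simp: words_over_def M_def)
    have S: "fricke3 (M a) (M b) (M c) \<in> ?A"
      if "length a + length b + length c = length w" "set a \<union> set b \<union> set c \<subseteq> set w" "a \<noteq> []" "b \<noteq> []" "c \<noteq> []" for a b c
      unfolding fricke3_def M using that by (intro AD(2,3,7) shorter) (auto simp: neq_Nil_conv)
    have "2 * trace (M [x] ** M [y] ** M [z] ** M v) \<in> ?A"
      unfolding trace_quadruple unfolding M by (intro AD(2,7) S) (use w in auto)
    from AD(3)[OF AD(1)[of "1/2"] this] show ?thesis
      by (simp only: M) (simp add: w M_def numeral_poly_const flip: mult.assoc rep.scalar_mult)
  qed
qed

lemma alg_trace_coords: "rep.alg (trace_coords r) = traces r"
proof
  show "rep.alg (trace_coords r) \<subseteq> traces r"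
  proof (rule rep.alg_least[OF subalg_traces])
    show "trace_coords r \<subseteq> traces r"
      using tracesD(1)[of 2 r] trace_in by (auto simp: trace_coords_def numeral_poly_const intro!: tracesD(7))
  qed
  show "traces r \<subseteq> rep.alg (trace_coords r)"
    unfolding traces_def by (rule rep.alg_least[OF rep.subalg_alg]) (auto intro: trace_in_alg)
qed

lemma complex_algebra_id: "complex_algebra (\<lambda>z::complex. z)"
  by unfold_locales auto

text \<open>Evaluation at the trivial representation.\<close>

definition eval1 :: "rep_poly \<Rightarrow> complex" where
  "eval1 = peval (\<lambda>z. z) (\<lambda>(l, i, j). if i = j then 1 else 0)"

lemma eval1_simps:
  "eval1 (p + q) = eval1 p + eval1 q" "eval1 (p * q) = eval1 p * eval1 q" "eval1 (poly_const c) = c"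
  "eval1 (p - q) = eval1 p - eval1 q" "eval1 (sum f A) = (\<Sum>x\<in>A. eval1 (f x))"
  using complex_algebra.peval_add[OF complex_algebra_id] complex_algebra.peval_mult[OF complex_algebra_id]
    complex_algebra.peval_const[OF complex_algebra_id] complex_algebra.peval_diff[OF complex_algebra_id]
    complex_algebra.peval_sum[OF complex_algebra_id]
  by (simp_all add: eval1_def)

lemma eval1_word: "eval1 (word_matrix w $ i $ j) = mat 1 $ i $ j"
proof -
  have g: "(\<lambda>l::nat. \<chi> i j. if i = j then 1 else 0) = (\<lambda>l. mat 1 :: complex^2^2)"
    by (simp add: mat_def)
  have "word_eval (\<lambda>l. mat 1 :: complex^2^2) w = mat 1"
    by (induction w) (auto simp: letter_value_def matrix_mul_lid)
  then show ?thesis unfolding eval1_def peval_word_matrix[OF complex_algebra_id] by (simp add: g)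
qed

lemma eval1_trace: "eval1 (trace (word_matrix w)) = 2"
  by (simp add: trace_def eval1_simps eval1_word) (simp add: mat_def)

text \<open>The trivial representation is a common zero of \<open>Y\<close>, and by
  \<open>alg_decomp\<close> only constants have to be excluded.\<close>

lemma ipow_1_trace_coords: "rep.ipow (trace_coords r) 1 = {q \<in> traces r. eval1 q = 0}"
proof -
  have two: "eval1 2 = 2" using eval1_simps(3)[of 2] by (simp add: numeral_poly_const)
  have Y: "eval1 y = 0" if "y \<in> trace_coords r" for y
    using that by (auto simp: trace_coords_def eval1_simps eval1_trace two)
  then have 0: "eval1 q = 0" if "q \<in> rep.ipow (trace_coords r) 1" for q
    using that by (auto simp: eval1_simps)
  moreover have "q \<in> rep.ipow (trace_coords r) 1" if q: "q \<in> traces r" "eval1 q = 0" for q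
  proof -
    obtain c where c: "q - poly_const c \<in> rep.ipow (trace_coords r) 1"
      using rep.alg_decomp[OF finite_trace_coords, of q r] q(1) unfolding alg_trace_coords One_nat_def by blast
    from 0[OF this] q(2) have "c = 0" by (simp add: eval1_simps)
    with c show ?thesis by simp
  qed
  moreover have "q \<in> traces r" if "q \<in> rep.ipow (trace_coords r) 1" for q
    using rep.ipowD(1)[OF that] by (simp add: alg_trace_coords)
  ultimately show ?thesis by blast
qed

section \<open>Trace coordinates\<close>

context generated_group
begin

abbreviation "Y \<equiv> trace_coords r"
text \<open>The relations among trace polynomials, that is, the kernel of the presentation of
  \<open>char_ring\<close>. Congruence modulo \<open>S\<close> is congruence modulo the square of
  its maximal ideal.\<close>

definition "K = I \<inter> traces r"
abbreviation "S \<equiv> rep.sumset K (rep.ipow Y 2)"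

lemma ideal_of_K: "ideal_of (traces r) K"
  unfolding ideal_of_def K_def using ID(2,3) ID(4)[OF subsetD[OF traces_subset_polys]] tracesD(2,3,4) by auto

lemma ideal_of_S: "ideal_of (traces r) S"
  using rep.ideal_of_sumset[OF subalg_traces ideal_of_K, of "rep.ipow Y 2"] rep.ideal_of_ipow[of Y 2]
  by (simp add: alg_trace_coords)

lemmas SD = ideal_ofD[OF ideal_of_S] rep.ideal_of_minus[OF subalg_traces ideal_of_S]

lemma S_scale: "p \<in> S \<Longrightarrow> poly_const c * p \<in> S"
  by (rule SD(4)[OF tracesD(1)])

lemma S_double: "p \<in> S \<Longrightarrow> 2 * p \<in> S"
  using S_scale[of p 2] by (simp add: numeral_poly_const)

lemma S_halve: "2 * p \<in> S \<Longrightarrow> p \<in> S"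
  using S_scale[of "2 * p" "1/2"] by (simp add: numeral_poly_const flip: mult.assoc rep.scalar_mult)

lemma K_S: "p \<in> K \<Longrightarrow> p \<in> S"
  using rep.sumsetI[of p K 0 "rep.ipow Y 2"] rep.ipowD(2) by simp

lemma ipow_S: "p \<in> rep.ipow Y 2 \<Longrightarrow> p \<in> S"
  using rep.sumsetI[of 0 K p "rep.ipow Y 2"] ideal_ofD(2)[OF ideal_of_K] by simp

definition trace_coord :: "nat word \<Rightarrow> rep_poly" where "trace_coord w = trace (word_matrix w) - 2"

lemma trace_coord_in: "w \<in> words \<Longrightarrow> trace_coord w \<in> rep.ipow Y 1"
  unfolding ipow_1_trace_coords trace_coord_def
  using eval1_simps(3)[of 2] tracesD(1)[of 2 r]
  by (auto simp: eval1_simps eval1_trace trace_in numeral_poly_const intro!: tracesD(7))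

lemma trace_coord_mult_S: "u \<in> words \<Longrightarrow> v \<in> words \<Longrightarrow> trace_coord u * trace_coord v \<in> S"
  using rep.ipow_mult[OF trace_coord_in trace_coord_in, of u v] by (intro ipow_S) (simp only: one_add_one)

lemma trace_coord_cong:
  assumes "u \<in> words" "v \<in> words" "val u = val v" shows "trace_coord u - trace_coord v \<in> S"
proof -
  have "trace_coord u - trace_coord v = trace (word_matrix u) - trace (word_matrix v)" by (simp add: trace_coord_def)
  then show ?thesis using trace_cong_I[OF assms] tracesD(7)[OF trace_in trace_in] assms
    by (intro K_S) (simp add: K_def)
qed

lemma trace_coord_commute: "trace_coord (u @ v) = trace_coord (v @ u)"
  unfolding trace_coord_def word_matrix_eq word_eval_append by (simp only: trace_mul_sym[of "word_eval gen_matrix u"])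

lemma trace_coord_Nil: "trace_coord [] = 0"
  by (simp add: trace_coord_def word_matrix_eq trace_def sum_2) (simp add: mat_def)

text \<open>From \<open>tr (U U) + tr (U adj U) = (tr U)^2\<close>, where the second word has
  trivial value: the scaling law of a quadratic form.\<close>

lemma trace_coord_square:
  assumes "u \<in> words" shows "trace_coord (u @ u) - 4 * trace_coord u \<in> S"
proof -
  have "trace_coord (u @ u) + trace_coord (u @ inv_word u) = trace_coord u * trace_coord u + 4 * trace_coord u"
    by (simp add: trace_coord_def word_matrix_eq word_eval_append word_eval_inv_word) (simp add: matrix2_simps algebra_simps)
  then have "trace_coord (u @ u) - 4 * trace_coord u = trace_coord u * trace_coord u - (trace_coord (u @ inv_word u) - trace_coord [])"
    by (simp add: trace_coord_Nil algebra_simps)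
  moreover have "trace_coord (u @ inv_word u) - trace_coord [] \<in> S"
    using assms by (intro trace_coord_cong) (auto simp: val_append val_inv_word)
  ultimately show ?thesis using SD(7)[OF trace_coord_mult_S[OF assms assms]] by simp
qed

text \<open>The part of \<open>fricke3\<close> minus its value \<open>4\<close> at the trivial
  representation that is linear in trace coordinates.\<close>

definition fricke :: "nat word \<Rightarrow> nat word \<Rightarrow> nat word \<Rightarrow> rep_poly" where
  "fricke u v w = 2 * (trace_coord (u @ v) + trace_coord (u @ w) + trace_coord (v @ w)) - 2 * (trace_coord u + trace_coord v + trace_coord w)"

lemma fricke3_S:
  assumes "u \<in> words" "v \<in> words" "w \<in> words"
  shows "fricke3 (word_matrix u) (word_matrix v) (word_matrix w) - 4 - fricke u v w \<in> S"
proof -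
  have "fricke3 (word_matrix u) (word_matrix v) (word_matrix w) - 4 - fricke u v w =
     trace_coord u * trace_coord (v @ w) + trace_coord v * trace_coord (u @ w) + trace_coord w * trace_coord (u @ v)
     - (trace_coord u * trace_coord v * trace_coord w + 2 * (trace_coord u * trace_coord v) + 2 * (trace_coord u * trace_coord w) + 2 * (trace_coord v * trace_coord w))"
    by (simp add: fricke3_def fricke_def trace_coord_def word_matrix_eq word_eval_append algebra_simps)
  moreover have "trace_coord u * trace_coord v * trace_coord w \<in> S"
    using assms rep.ipowD(1)[OF trace_coord_in[of w]] by (intro SD(5) trace_coord_mult_S) (auto simp: alg_trace_coords)
  ultimately show ?thesis
    using assms by (auto intro!: SD(3,7) S_double trace_coord_mult_S)
qed

lemma trace_coord_triple:
  assumes "u \<in> words" "v \<in> words" "w \<in> words"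
  shows "trace_coord (u @ v @ w) + trace_coord (u @ w @ v) - fricke u v w \<in> S"
  using fricke3_S[OF assms] trace_triple[of "word_matrix u" "word_matrix v" "word_matrix w"]
  by (simp add: trace_coord_def word_matrix_eq word_eval_append matrix_mul_assoc algebra_simps)

lemma trace_coord_quadruple:
  assumes "u \<in> words" "v \<in> words" "w \<in> words" "x \<in> words"
  shows "2 * trace_coord (u @ v @ w @ x) - (fricke u v (w @ x) - fricke (u @ w) x v + fricke (x @ u) w v) \<in> S"
proof -
  define d where "d u v w = fricke3 (word_matrix u) (word_matrix v) (word_matrix w) - 4 - fricke u v w" for u v w
  have d: "d u v w \<in> S" if "u \<in> words" "v \<in> words" "w \<in> words" for u v w
    unfolding d_def using that by (rule fricke3_S)
  have M: "word_matrix y ** word_matrix z = word_matrix (y @ z)" for y z by (simp add: word_matrix_eq word_eval_append)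
  have "2 * trace_coord (u @ v @ w @ x) = 2 * trace (word_matrix u ** word_matrix v ** word_matrix w ** word_matrix x) - 4"
    by (simp add: trace_coord_def M)
  also have "\<dots> = d u v (w @ x) - d (u @ w) x v + d (x @ u) w v + (fricke u v (w @ x) - fricke (u @ w) x v + fricke (x @ u) w v)"
    unfolding trace_quadruple unfolding M d_def by (simp add: algebra_simps)
  finally have "2 * trace_coord (u @ v @ w @ x) - (fricke u v (w @ x) - fricke (u @ w) x v + fricke (x @ u) w v) =
    d u v (w @ x) - d (u @ w) x v + d (x @ u) w v" by simp
  moreover have "d u v (w @ x) - d (u @ w) x v + d (x @ u) w v \<in> S"
    using assms by (intro SD(3,7) d) auto
  ultimately show ?thesis by simp
qed

text \<open>The third difference of \<open>trace_coord\<close>, whose vanishing makes it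
  quadratic.\<close>

definition T :: "nat word \<Rightarrow> nat word \<Rightarrow> nat word \<Rightarrow> rep_poly" where
  "T u v w = trace_coord (u @ v @ w) - trace_coord (u @ v) - trace_coord (v @ w) - trace_coord (u @ w) + trace_coord u + trace_coord v + trace_coord w"

lemma T_rotate: "T u v w = T w u v"
proof -
  have "trace_coord (u @ v @ w) = trace_coord (w @ u @ v)" using trace_coord_commute[of "u @ v" w] by (simp only: append_assoc)
  then show ?thesis unfolding T_def trace_coord_commute[of v w] trace_coord_commute[of u w] by (simp only: diff_conv_add_uminus add_ac)
qed

lemma T_swap:
  assumes "u \<in> words" "v \<in> words" "w \<in> words" shows "T u v w + T u w v \<in> S"
proof -
  have "T u v w + T u w v = trace_coord (u @ v @ w) + trace_coord (u @ w @ v) - fricke u v w"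
    using trace_coord_commute[of v w] by (simp add: T_def fricke_def algebra_simps)
  then show ?thesis using trace_coord_triple[OF assms] by simp
qed

lemma T_alternating:
  assumes "u \<in> words" "v \<in> words" shows "T v u u \<in> S" "T u v u \<in> S" "T u u v \<in> S"
proof -
  show 1: "T v u u \<in> S" by (rule S_halve) (use T_swap[of v u u] assms in simp)
  then show "T u v u \<in> S" by (subst T_rotate[of u v u]) (subst T_rotate, assumption)
  from 1 show "T u u v \<in> S" by (subst T_rotate)
qed

text \<open>Twice the defect is the relation for four words minus twice the one for
  \<open>u\<close>, \<open>v\<close>, \<open>w\<close>.\<close>

lemma T_additive:
  assumes "u \<in> words" "v \<in> words" "w \<in> words" "x \<in> words"
  shows "T u v (w @ x) - (T u v w + T u v x) \<in> S"
proof -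
  let ?q = "2 * trace_coord (u @ v @ w @ x) - (fricke u v (w @ x) - fricke (u @ w) x v + fricke (x @ u) w v)"
  let ?t = "trace_coord (u @ v @ w) + trace_coord (u @ w @ v) - fricke u v w"
  have "2 * (T u v (w @ x) - (T u v w + T u v x)) = ?q - 2 * ?t"
    using trace_coord_commute[of w v] trace_coord_commute[of x v] trace_coord_commute[of x u] trace_coord_commute[of x "u @ w"] trace_coord_commute[of x "u @ v"]
    by (simp add: T_def fricke_def algebra_simps)
  moreover have "?q - 2 * ?t \<in> S" using assms by (intro SD(7) S_double trace_coord_triple trace_coord_quadruple)
  ultimately have "2 * (T u v (w @ x) - (T u v w + T u v x)) \<in> S" by simp
  then show ?thesis by (rule S_halve)
qed

end

locale deformable_group = generated_group G gs + group_H1_dim_2 G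
  for G :: "('g, 'b) monoid_scheme" (structure) and gs +
  fixes a b :: 'g and \<alpha> \<beta> :: "'g \<Rightarrow> complex" and wa wb :: "nat word"
  assumes basis: "hom_basis a b \<alpha> \<beta>" and deform: "deformable G \<alpha> \<beta>"
    and wa: "wa \<in> words" "val wa = a" and wb: "wb \<in> words" "val wb = b"
begin

text \<open>\<open>hom_basis_expand\<close> for the function obtained by choosing one word per group
  element; by \<open>cong\<close> the choice is immaterial modulo \<open>S\<close>.\<close>

lemma expand_words:
  assumes cong: "\<And>u v. u \<in> words \<Longrightarrow> v \<in> words \<Longrightarrow> val u = val v \<Longrightarrow> \<phi> u - \<phi> v \<in> S"
    and add: "\<And>u v. u \<in> words \<Longrightarrow> v \<in> words \<Longrightarrow> \<phi> (u @ v) - (\<phi> u + \<phi> v) \<in> S"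
    and w: "w \<in> words"
  shows "\<phi> w - (poly_const (\<alpha> (val w)) * \<phi> wa + poly_const (\<beta> (val w)) * \<phi> wb) \<in> S"
proof -
  define word where "word g = (SOME w. w \<in> words \<and> val w = g)" for g
  have word: "word g \<in> words" "val (word g) = g" if "g \<in> carrier G" for g
    using someI_ex[of "\<lambda>w. w \<in> words \<and> val w = g"] word_exists[OF that] by (auto simp: word_def)
  define F where "F g = \<phi> (word g)" for g
  have F: "F (val u) - \<phi> u \<in> S" if "u \<in> words" for u
    unfolding F_def using that word[of "val u"] by (intro cong) auto
  have "F (val w) - (poly_const (\<alpha> (val w)) * F a + poly_const (\<beta> (val w)) * F b) \<in> S"
  proof (rule hom_basis_expand[OF rep.complex_algebra_axioms basis SD(2)])
    fix g h assume g: "g \<in> carrier G" and h: "h \<in> carrier G"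
    have "F (val (word g @ word h)) - \<phi> (word g @ word h) \<in> S" "\<phi> (word g @ word h) - (F g + F h) \<in> S"
      unfolding F_def[of g] F_def[of h] using word[OF g] word[OF h] by (auto intro!: add F)
    from SD(3)[OF this] have "F (g \<otimes> h) - (F g + F h) \<in> S"
      using word[OF g] word[OF h] by (simp add: val_append algebra_simps)
    from SD(6)[OF this] show "F h - F (g \<otimes> h) + F g \<in> S" by (simp add: algebra_simps)
  qed (use SD(3) S_scale w in auto)
  moreover have "F (val w) - \<phi> w - (poly_const (\<alpha> (val w)) * (F (val wa) - \<phi> wa) + poly_const (\<beta> (val w)) * (F (val wb) - \<phi> wb)) \<in> S"
    using w wa(1) wb(1) by (intro SD(3,7) S_scale F)
  ultimately have "F (val w) - (poly_const (\<alpha> (val w)) * F a + poly_const (\<beta> (val w)) * F b) -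
     (F (val w) - \<phi> w - (poly_const (\<alpha> (val w)) * (F (val wa) - \<phi> wa) + poly_const (\<beta> (val w)) * (F (val wb) - \<phi> wb))) \<in> S"
    by (rule SD(7))
  then show ?thesis by (simp add: wa(2) wb(2) algebra_simps)
qed

lemma expand_zero:
  assumes "\<And>u v. u \<in> words \<Longrightarrow> v \<in> words \<Longrightarrow> val u = val v \<Longrightarrow> \<phi> u - \<phi> v \<in> S"
    and "\<And>u v. u \<in> words \<Longrightarrow> v \<in> words \<Longrightarrow> \<phi> (u @ v) - (\<phi> u + \<phi> v) \<in> S"
    and "w \<in> words" "\<phi> wa \<in> S" "\<phi> wb \<in> S"
  shows "\<phi> w \<in> S"
proof -
  have "\<phi> w - (poly_const (\<alpha> (val w)) * \<phi> wa + poly_const (\<beta> (val w)) * \<phi> wb) \<in> S"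
    using assms(1,2,3) by (rule expand_words)
  moreover have "poly_const (\<alpha> (val w)) * \<phi> wa + poly_const (\<beta> (val w)) * \<phi> wb \<in> S"
    using assms(4,5) by (intro SD(3) S_scale)
  ultimately have "\<phi> w - (poly_const (\<alpha> (val w)) * \<phi> wa + poly_const (\<beta> (val w)) * \<phi> wb) +
    (poly_const (\<alpha> (val w)) * \<phi> wa + poly_const (\<beta> (val w)) * \<phi> wb) \<in> S" by (rule SD(3))
  then show ?thesis by simp
qed

text \<open>An alternating trilinear form in dimension two: among three arguments from
  \<open>wa\<close> and \<open>wb\<close> two coincide. Expansion and rotation then free the
  arguments one at a time.\<close>

lemma T_zero: "u \<in> words \<Longrightarrow> v \<in> words \<Longrightarrow> w \<in> words \<Longrightarrow> T u v w \<in> S"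
proof -
  have cong: "T u v w - T u v x \<in> S" if "u \<in> words" "v \<in> words" "w \<in> words" "x \<in> words" "val w = val x" for u v w x
  proof -
    have "trace_coord (u @ v @ w) - trace_coord (u @ v @ x) - (trace_coord (v @ w) - trace_coord (v @ x)) - (trace_coord (u @ w) - trace_coord (u @ x)) + (trace_coord w - trace_coord x) \<in> S"
      using that by (intro SD(3,7) trace_coord_cong) (auto simp: val_append)
    then show ?thesis by (simp add: T_def algebra_simps)
  qed
  have step: "T u v w \<in> S" if "u \<in> words" "v \<in> words" "T u v wa \<in> S" "T u v wb \<in> S" "w \<in> words" for u v w
    by (rule expand_zero[of "T u v"]) (use that in \<open>auto intro: cong T_additive\<close>)
  note w = wa(1) wb(1)
  have 1: "T u v w \<in> S" if "u \<in> {wa, wb}" "v \<in> {wa, wb}" "w \<in> words" for u v w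
    by (rule step) (use that w in \<open>auto intro: T_alternating\<close>)
  have 2: "T u v w \<in> S" if "u \<in> {wa, wb}" "v \<in> words" "w \<in> words" for u v w
    by (rule step) (use that w 1 T_rotate[of u v wa] T_rotate[of u v wb] in auto)
  show "T u v w \<in> S" if "u \<in> words" "v \<in> words" "w \<in> words"
    by (rule step) (use that w 2 T_rotate[of u v wa] T_rotate[of u v wb] in auto)
qed

text \<open>The polar form of \<open>trace_coord\<close>, bilinear modulo \<open>S\<close> because
  \<open>T\<close> vanishes there.\<close>

definition B :: "nat word \<Rightarrow> nat word \<Rightarrow> rep_poly" where "B u v = trace_coord (u @ v) - trace_coord u - trace_coord v"

lemma B_commute: "B u v = B v u"
  using trace_coord_commute[of u v] by (simp add: B_def)

lemma B_expand:
  assumes "u \<in> words" "v \<in> words"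
  shows "B u v - (poly_const (\<alpha> (val v)) * B u wa + poly_const (\<beta> (val v)) * B u wb) \<in> S"
proof (rule expand_words)
  fix w x assume wx: "w \<in> words" "x \<in> words"
  have "B u (w @ x) - (B u w + B u x) = T u w x" by (simp add: B_def T_def)
  then show "B u (w @ x) - (B u w + B u x) \<in> S" using assms(1) wx T_zero by simp
  assume v: "val w = val x"
  have "trace_coord (u @ w) - trace_coord (u @ x) - (trace_coord w - trace_coord x) \<in> S" using assms(1) wx v by (intro SD(7) trace_coord_cong) (auto simp: val_append)
  then show "B u w - B u x \<in> S" by (simp add: B_def algebra_simps)
qed (use assms in auto)

text \<open>By the square rule \<open>B w w\<close> is twice \<open>trace_coord w\<close>; it is
  expanded in both arguments. As \<open>B wa wb\<close> contains the coordinates of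
  \<open>wa\<close> and \<open>wb\<close> negatively, their coefficients are lowered by the product
  of \<open>\<alpha>\<close> and \<open>\<beta>\<close>.\<close>

lemma trace_coord_expand:
  assumes w: "w \<in> words"
  shows "\<exists>x y z. trace_coord w - (poly_const x * trace_coord wa + poly_const y * trace_coord wb + poly_const z * trace_coord (wa @ wb)) \<in> S"
proof -
  define A C where "A = poly_const (\<alpha> (val w))" and "C = poly_const (\<beta> (val w))"
  let ?e = "B w w - (A * B w wa + C * B w wb)"
  let ?ea = "B wa w - (A * B wa wa + C * B wa wb)" and ?eb = "B wb w - (A * B wb wa + C * B wb wb)"
  let ?s = "trace_coord (w @ w) - 4 * trace_coord w" and ?sa = "trace_coord (wa @ wa) - 4 * trace_coord wa" and ?sb = "trace_coord (wb @ wb) - 4 * trace_coord wb"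
  let ?l = "poly_const ((\<alpha> (val w))\<^sup>2 - \<alpha> (val w) * \<beta> (val w)) * trace_coord wa + poly_const ((\<beta> (val w))\<^sup>2 - \<alpha> (val w) * \<beta> (val w)) * trace_coord wb
     + poly_const (\<alpha> (val w) * \<beta> (val w)) * trace_coord (wa @ wb)"
  have "?e + A * ?ea + C * ?eb - ?s + A * (A * ?sa) + C * (C * ?sb) \<in> S"
    unfolding A_def C_def using w wa(1) wb(1) by (intro SD(3,7) S_scale B_expand trace_coord_square)
  moreover have "?e + A * ?ea + C * ?eb - ?s + A * (A * ?sa) + C * (C * ?sb) = 2 * (trace_coord w - ?l)"
    unfolding rep.scalar_diff rep.scalar_mult power2_eq_square A_def[symmetric] C_def[symmetric]
      B_commute[of wa w] B_commute[of wb w]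
    using trace_coord_commute[of wb wa] by (simp add: B_def algebra_simps)
  ultimately have "2 * (trace_coord w - ?l) \<in> S" by simp
  then have "trace_coord w - ?l \<in> S" by (rule S_halve)
  then show ?thesis by blast
qed

lemma complex_algebra_fps_const: "complex_algebra (fps_const :: complex \<Rightarrow> complex fps)"
  by unfold_locales auto

lemma arc:
  "\<exists>\<psi> :: rep_poly \<Rightarrow> complex fps. (\<forall>p q. \<psi> (p + q) = \<psi> p + \<psi> q \<and> \<psi> (p * q) = \<psi> p * \<psi> q) \<and>
      (\<forall>c. \<psi> (poly_const c) = fps_const c) \<and> (\<forall>p\<in>I. \<psi> p = 0) \<and>
      (\<forall>w\<in>words. \<psi> (trace_coord w) $$$ 0 = 0 \<and> \<psi> (trace_coord w) $$$ 1 = 0) \<and>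
      \<psi> (trace_coord wa) $$$ 2 = u \<and> \<psi> (trace_coord wb) $$$ 2 = v \<and> \<psi> (trace_coord (wa @ wb)) $$$ 2 = t"
proof -
  \<comment> \<open>Traceless matrices with \<open>- det X = u\<close>, \<open>- det Z = v\<close>
    and \<open>- det (X + Z) = t\<close>.\<close>
  define X Z :: "complex^2^2" where
    "X = vector [vector [0, 1], vector [u, 0]]" and "Z = vector [vector [csqrt v, 0], vector [t - u - v, - csqrt v]]"
  have "trace X = 0" "trace Z = 0" by (simp_all add: X_def Z_def trace_def sum_2 vector_2)
  from deform[unfolded deformable_def, rule_format, OF this] obtain \<rho> :: "'g \<Rightarrow> complex fps^2^2" where
    \<rho>: "\<forall>g\<in>carrier G. \<forall>h\<in>carrier G. \<rho> (g \<otimes> h) = \<rho> g ** \<rho> h" "\<forall>g\<in>carrier G. det (\<rho> g) = 1"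
      "\<forall>g\<in>carrier G. \<forall>i j. (\<rho> g $ i $ j) $$$ 0 = mat 1 $ i $ j \<and>
         (\<rho> g $ i $ j) $$$ 1 = \<alpha> g * X $ i $ j + \<beta> g * Z $ i $ j"
    by (elim exE conjE)
  have hom: "\<rho> (g \<otimes> h) = \<rho> g ** \<rho> h" if "g \<in> carrier G" "h \<in> carrier G" for g h
    using \<rho>(1) that by blast
  have det: "det (\<rho> g) = 1" if "g \<in> carrier G" for g
    using \<rho>(2) that by blast
  have coeff: "(\<rho> g $ i $ j) $$$ 0 = mat 1 $ i $ j"
      "(\<rho> g $ i $ j) $$$ 1 = \<alpha> g * X $ i $ j + \<beta> g * Z $ i $ j" if "g \<in> carrier G" for g i j
    using \<rho>(3) that by blast+
  interpret C: complex_algebra "fps_const :: complex \<Rightarrow> complex fps" by (rule complex_algebra_fps_const)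
  define \<psi> where "\<psi> = peval fps_const (\<lambda>(l, i, j). \<rho> (gs ! l) $ i $ j)"
  have \<psi>: "\<psi> (p + q) = \<psi> p + \<psi> q" "\<psi> (p * q) = \<psi> p * \<psi> q" "\<psi> (p - q) = \<psi> p - \<psi> q" "\<psi> 0 = 0" "\<psi> 1 = 1"
    "\<psi> (poly_const c) = fps_const c" for p q c
    by (simp_all add: \<psi>_def C.peval_add C.peval_mult C.peval_diff C.peval_0 C.peval_1 C.peval_const)
  have word: "\<psi> (word_matrix w $ i $ j) = \<rho> (val w) $ i $ j" if "w \<in> words" for w i j
  proof -
    have "\<psi> (word_matrix w $ i $ j) = word_eval (\<lambda>l. \<chi> i j. \<rho> (gs ! l) $ i $ j) w $ i $ j"
      unfolding \<psi>_def peval_word_matrix[OF complex_algebra_fps_const] by simp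
    also have "\<dots> = word_eval (\<lambda>l. \<rho> (gs ! l)) w $ i $ j" by (simp only: vec_nth_inverse)
    finally show ?thesis by (simp only: word_eval_eq_hom[where \<rho> = \<rho>, OF hom det that])
  qed
  have m: "\<psi> (mat 1 $ i $ j) = mat 1 $ i $ j" for i j :: 2 by (simp add: mat_def \<psi>)
  have one: "\<rho> \<one> $ i $ j = mat 1 $ i $ j" for i j
    using word[of "[]" i j] m[of i j] by (simp add: word_matrix_eq)
  have kill: "\<psi> p = 0" if "p \<in> I" for p
    using that
  proof (induction p rule: I_induct)
    case (relator p)
    then obtain w i j where w: "p = (word_matrix w - mat 1) $ i $ j" "w \<in> words" "val w = \<one>"
      unfolding relators_eq by blast
    then show ?case by (simp add: \<psi> word one m)
  qed (simp_all add: \<psi>)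
  have two: "\<psi> 2 = fps_const 2" using \<psi>(6)[of 2] by (simp add: numeral_poly_const)
  have tc: "\<psi> (trace_coord w) = \<rho> (val w) $ 1 $ 1 + \<rho> (val w) $ 2 $ 2 - fps_const 2" if "w \<in> words" for w
    using that by (simp add: trace_coord_def trace_def sum_2 \<psi> word two)
  have tr: "X $ 1 $ 1 + X $ 2 $ 2 = 0" "Z $ 1 $ 1 + Z $ 2 $ 2 = 0" by (simp_all add: X_def Z_def vector_2)
  have "\<psi> (trace_coord w) $$$ 0 = 0 \<and> \<psi> (trace_coord w) $$$ 1 = 0" if "w \<in> words" for w
  proof -
    have "\<alpha> (val w) * X $ 1 $ 1 + \<beta> (val w) * Z $ 1 $ 1 + (\<alpha> (val w) * X $ 2 $ 2 + \<beta> (val w) * Z $ 2 $ 2)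
       = \<alpha> (val w) * (X $ 1 $ 1 + X $ 2 $ 2) + \<beta> (val w) * (Z $ 1 $ 1 + Z $ 2 $ 2)"
      by (simp add: algebra_simps)
    then show ?thesis using that by (simp add: tc coeff tr del: One_nat_def) (simp add: mat_def)
  qed
  \<comment> \<open>Determinant one at second order expresses this coefficient of the trace by the
    linear terms.\<close>
  moreover have second: "\<psi> (trace_coord w) $$$ 2 = - det (\<chi> i j. \<alpha> (val w) * X $ i $ j + \<beta> (val w) * Z $ i $ j)" if "w \<in> words" for w
  proof -
    have c: "val w \<in> carrier G" using that by simp
    have "(\<rho> (val w) $ 1 $ 1 * \<rho> (val w) $ 2 $ 2 - \<rho> (val w) $ 1 $ 2 * \<rho> (val w) $ 2 $ 1) $$$ 2 = 0"
      using det[OF c] by (simp add: det_2)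
    moreover have "(x * y) $$$ 2 = x $$$ 0 * y $$$ 2 + x $$$ 1 * y $$$ 1 + x $$$ 2 * y $$$ 0" for x y :: "complex fps"
      by (simp add: fps_mult_nth numeral_2_eq_2)
    moreover have "(mat 1 :: complex^2^2) $ 1 $ 1 = 1" "(mat 1 :: complex^2^2) $ 2 $ 2 = 1" "(mat 1 :: complex^2^2) $ 1 $ 2 = 0" "(mat 1 :: complex^2^2) $ 2 $ 1 = 0"
      by (simp_all add: mat_def)
    ultimately show ?thesis
      using that c by (simp add: tc coeff det_2 del: One_nat_def) (simp add: algebra_simps)
  qed
  have ab: "\<alpha> a = 1" "\<alpha> b = 0" "\<beta> a = 0" "\<beta> b = 1" "\<alpha> (a \<otimes> b) = 1" "\<beta> (a \<otimes> b) = 1"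
    using basis unfolding hom_basis_def by auto
  have "\<psi> (trace_coord wa) $$$ 2 = u" "\<psi> (trace_coord wb) $$$ 2 = v" "\<psi> (trace_coord (wa @ wb)) $$$ 2 = t"
    using wa wb by (simp_all add: second val_append ab det_2 X_def Z_def vector_2 flip: power2_eq_square)
  ultimately show ?thesis using \<psi> kill by blast
qed

sublocale chart: formal_chart poly_const Y K "trace_coord wa" "trace_coord wb" "trace_coord (wa @ wb)"
proof
  show "finite Y" by (rule finite_trace_coords)
  show "ideal_of (rep.alg Y) K" using ideal_of_K by (simp add: alg_trace_coords)
  show "trace_coord wa \<in> rep.ipow Y 1" "trace_coord wb \<in> rep.ipow Y 1" "trace_coord (wa @ wb) \<in> rep.ipow Y 1"
    using wa wb by (auto intro!: trace_coord_in simp del: One_nat_def)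
  show "\<exists>x y z. q - (poly_const x * trace_coord wa + poly_const y * trace_coord wb + poly_const z * trace_coord (wa @ wb)) \<in> S" if "q \<in> Y" for q
    using that trace_coord_expand by (auto simp: trace_coords_def trace_coord_def)
  fix u v t
  obtain \<psi> :: "rep_poly \<Rightarrow> complex fps" where \<psi>: "\<And>p q. \<psi> (p + q) = \<psi> p + \<psi> q \<and> \<psi> (p * q) = \<psi> p * \<psi> q"
    "\<And>c. \<psi> (poly_const c) = fps_const c" "\<And>p. p \<in> I \<Longrightarrow> \<psi> p = 0"
    "\<And>w. w \<in> words \<Longrightarrow> \<psi> (trace_coord w) $$$ 0 = 0 \<and> \<psi> (trace_coord w) $$$ 1 = 0"
    "\<psi> (trace_coord wa) $$$ 2 = u" "\<psi> (trace_coord wb) $$$ 2 = v" "\<psi> (trace_coord (wa @ wb)) $$$ 2 = t"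
    using arc[of u v t] by blast
  then show "\<exists>\<psi> :: rep_poly \<Rightarrow> complex fps.
      (\<forall>a\<in>rep.alg Y. \<forall>b\<in>rep.alg Y. \<psi> (a + b) = \<psi> a + \<psi> b \<and> \<psi> (a * b) = \<psi> a * \<psi> b) \<and>
      (\<forall>c. \<psi> (poly_const c) = fps_const c) \<and> (\<forall>a\<in>K. \<psi> a = 0) \<and> (\<forall>y\<in>Y. \<psi> y $$$ 0 = 0 \<and> \<psi> y $$$ 1 = 0) \<and>
      \<psi> (trace_coord wa) $$$ 2 = u \<and> \<psi> (trace_coord wb) $$$ 2 = v \<and> \<psi> (trace_coord (wa @ wb)) $$$ 2 = t"
    by (intro exI[of _ \<psi>]) (auto simp: K_def trace_coords_def trace_coord_def)
qed

end

section \<open>Smoothness\<close>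

context deformable_group
begin

abbreviation "A \<equiv> char_ring G gs"
abbreviation "\<phi> \<equiv> rep_fun G gs"
abbreviation "fil \<equiv> chart.fil"

lemma fil_traces: "ideal_of (traces r) (fil k)"
  using chart.ideal_of_fil by (simp add: alg_trace_coords)

lemma K_fil: "K \<subseteq> fil k"
  using chart.K_fil by auto

lemma rep_fun_eq_K: "p \<in> traces r \<Longrightarrow> q \<in> traces r \<Longrightarrow> \<phi> p = \<phi> q \<longleftrightarrow> p - q \<in> K"
  by (auto simp: rep_fun_eq_iff K_def intro: tracesD(7))

lemma preimage_image:
  assumes J: "ideal_of (traces r) J" "K \<subseteq> J"
  shows "{p \<in> traces r. \<phi> p \<in> \<phi> ` J} = J"
proof (intro equalityI subsetI)
  fix p assume "p \<in> {p \<in> traces r. \<phi> p \<in> \<phi> ` J}"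
  then obtain q where q: "p \<in> traces r" "q \<in> J" "\<phi> p = \<phi> q" by auto
  then have "p - q \<in> J" using J(2) rep_fun_eq_K[of p q] ideal_ofD(1)[OF J(1)] by auto
  from ideal_ofD(3)[OF J(1) this q(2)] show "p \<in> J" by simp
qed (use ideal_ofD(1)[OF J(1)] in auto)

lemma ideal_image:
  assumes J: "ideal_of (traces r) J" "K \<subseteq> J" shows "ideal (\<phi> ` J) A"
proof -
  have "\<phi> ` J \<subseteq> carrier A" using ideal_ofD(1)[OF J(1)] by (auto simp: carrier_char_ring)
  from char.ideal_iff[OF this] show ?thesis using J by (simp add: preimage_image)
qed

lemma K_preimage:
  assumes J: "ideal J A" shows "K \<subseteq> {p \<in> traces r. \<phi> p \<in> J}"
proof
  fix k assume k: "k \<in> K"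
  then have "k \<in> traces r" by (simp add: K_def)
  moreover have "\<phi> k = \<phi> 0" using k by (simp add: rep_fun_eq_iff K_def)
  moreover have "\<phi> 0 \<in> J"
    using additive_subgroup.zero_closed[OF ideal.axioms(1)[OF J]] by (simp add: char.hom_0)
  ultimately show "k \<in> {p \<in> traces r. \<phi> p \<in> J}" by simp
qed

lemma preimage_ideal:
  assumes J: "ideal J A" shows "ideal_of (traces r) {p \<in> traces r. \<phi> p \<in> J}" "J = \<phi> ` {p \<in> traces r. \<phi> p \<in> J}"
proof -
  have "J \<subseteq> carrier A" using ideal.Icarr[OF J] by auto
  then show "ideal_of (traces r) {p \<in> traces r. \<phi> p \<in> J}" "J = \<phi> ` {p \<in> traces r. \<phi> p \<in> J}"
    using char.ideal_iff J by (auto simp: carrier_char_ring)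
qed

lemma trace_fun_diff:
  assumes g: "g \<in> carrier G"
  shows "\<exists>w\<in>words. val w = g \<and> trace_fun G gs g \<ominus>\<^bsub>A\<^esub> \<phi> 2 = \<phi> (trace_coord w)"
proof -
  define w where "w = (SOME w. w \<in> words \<and> val w = g)"
  have w: "w \<in> words" "val w = g"
    using someI_ex[of "\<lambda>w. w \<in> words \<and> val w = g"] word_exists[OF g] by (auto simp: w_def)
  have "trace_fun G gs g = \<phi> (trace (word_matrix w))" by (simp add: trace_fun_def w_def)
  then show ?thesis
    using w char.hom_diff[OF trace_in[OF w(1)], of 2] tracesD(1)[of 2 r] by (auto simp: trace_coord_def numeral_poly_const)
qed

text \<open>The traces of all group elements generate the same ideal as the finitely many
  coordinates \<open>Y\<close>: each generator lies in \<open>fil 1\<close>, and each coordinate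
  agrees modulo \<open>I\<close> with a generator.\<close>

lemma trivial_char_eq: "trivial_char G gs = \<phi> ` fil 1"
proof
  interpret A: cring A by (rule char.cring)
  let ?gens = "{trace_fun G gs \<gamma> \<ominus>\<^bsub>A\<^esub> \<phi> 2 | \<gamma>. \<gamma> \<in> carrier G}"
  have "trace_coord w \<in> fil 1" if "w \<in> words" for w using trace_coord_in[OF that] by (rule chart.ipow_fil)
  then have gens: "?gens \<subseteq> \<phi> ` fil 1" using trace_fun_diff by blast
  then show "trivial_char G gs \<subseteq> \<phi> ` fil 1" unfolding trivial_char_def
    by (intro A.genideal_minimal ideal_image fil_traces K_fil)
  have "?gens \<subseteq> carrier A"
    using gens ideal.Icarr[OF ideal_image[OF fil_traces K_fil]] by blast
  then have J: "ideal (trivial_char G gs) A" and gJ: "?gens \<subseteq> trivial_char G gs"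
    unfolding trivial_char_def by (rule A.genideal_ideal, rule A.genideal_self)
  let ?J = "{p \<in> traces r. \<phi> p \<in> trivial_char G gs}"
  note JD = ideal_ofD[OF preimage_ideal(1)[OF J]]
  have fJ: "trace_coord u \<in> ?J" if u: "u \<in> words" for u
  proof -
    obtain w where w: "w \<in> words" "val w = val u" "trace_fun G gs (val u) \<ominus>\<^bsub>A\<^esub> \<phi> 2 = \<phi> (trace_coord w)"
      using trace_fun_diff[of "val u"] u by auto
    have "\<phi> (trace_coord w) \<in> trivial_char G gs" using gJ w(3) u by (metis (mono_tags, lifting) mem_Collect_eq subsetD val_closed)
    moreover have "\<phi> (trace_coord w) = \<phi> (trace_coord u)"
      using trace_cong_I[OF w(1) u w(2)] by (simp add: rep_fun_eq_iff trace_coord_def)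
    moreover have "trace_coord u \<in> traces r" using rep.ipowD(1)[OF trace_coord_in[OF u]] by (simp add: alg_trace_coords)
    ultimately show ?thesis by simp
  qed
  have "(\<Sum>y\<in>Y. y * c y) \<in> ?J" if "\<forall>y. c y \<in> rep.alg Y" for c
    using that fJ by (intro ideal_of_sum[OF preimage_ideal(1)[OF J]] JD(5))
      (auto simp: alg_trace_coords, auto simp: trace_coords_def trace_coord_def)
  then have "rep.ipow Y 1 \<subseteq> ?J" by auto
  then have "k + q \<in> ?J" if "k \<in> K" "q \<in> rep.ipow Y 1" for k q
    using that K_preimage[OF J] by (intro JD(3)) blast+
  then have "fil 1 \<subseteq> ?J" unfolding chart.fil_def rep.sumset_def by blast
  then show "\<phi> ` fil 1 \<subseteq> trivial_char G gs" by blast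
qed

text \<open>Products of two elements of \<open>fil 1\<close> lie in \<open>fil 2\<close>;
  conversely, elements of \<open>ipow Y 2\<close> are sums of such products.\<close>

lemma square_trivial_char: "\<phi> ` fil 1 \<cdot>\<^bsub>A\<^esub> (\<phi> ` fil 1) = \<phi> ` fil 2"
proof
  interpret A: cring A by (rule char.cring)
  have i1: "ideal (\<phi> ` fil 1) A" by (intro ideal_image fil_traces K_fil)
  have tr: "p \<in> traces r" if "p \<in> fil k" for p k using ideal_ofD(1)[OF fil_traces that] .
  show "\<phi> ` fil 1 \<cdot>\<^bsub>A\<^esub> (\<phi> ` fil 1) \<subseteq> \<phi> ` fil 2"
  proof
    fix x assume "x \<in> \<phi> ` fil 1 \<cdot>\<^bsub>A\<^esub> (\<phi> ` fil 1)"
    then show "x \<in> \<phi> ` fil 2"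
    proof (induction rule: ideal_prod.induct)
      case (prod i j)
      then obtain p q where "i = \<phi> p" "j = \<phi> q" "p \<in> fil 1" "q \<in> fil 1" by blast
      then show ?case using chart.fil_mult[of p 1 q 1] tr by (auto simp: char.hom_mult numeral_2_eq_2)
    next
      case (sum s1 s2)
      then obtain p q where "s1 = \<phi> p" "s2 = \<phi> q" "p \<in> fil 2" "q \<in> fil 2" by blast
      then show ?case using ideal_ofD(3)[OF fil_traces, of p 2 q] tr by (auto simp: char.hom_add)
    qed
  qed
  have J: "ideal (\<phi> ` fil 1 \<cdot>\<^bsub>A\<^esub> (\<phi> ` fil 1)) A" by (intro A.ideal_prod_is_ideal i1)
  let ?J = "{p \<in> traces r. \<phi> p \<in> \<phi> ` fil 1 \<cdot>\<^bsub>A\<^esub> (\<phi> ` fil 1)}"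
  have prod: "p * q \<in> ?J" if "p \<in> fil 1" "q \<in> fil 1" for p q
    using ideal_prod.prod[of "\<phi> p" "\<phi> ` fil 1" "\<phi> q" "\<phi> ` fil 1" A] that tr[OF that(1)] tr[OF that(2)]
    by (auto simp: char.hom_mult intro: tracesD(3))
  have "(\<Sum>y\<in>Y. y * c y) \<in> ?J" if "\<forall>y. c y \<in> rep.ipow Y 1" for c
  proof (intro ideal_of_sum[OF preimage_ideal(1)[OF J]] prod)
    fix y assume "y \<in> Y"
    then show "y \<in> fil 1" using rep.ipow_gen[OF finite_trace_coords] by (intro chart.ipow_fil) simp
    show "c y \<in> fil 1" using that by (intro chart.ipow_fil) auto
  qed
  then have "rep.ipow Y 2 \<subseteq> ?J" unfolding numeral_2_eq_2 by auto
  then have "k + q \<in> ?J" if "k \<in> K" "q \<in> rep.ipow Y 2" for k q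
    using that K_preimage[OF J] by (intro ideal_ofD(3)[OF preimage_ideal(1)[OF J]]) blast+
  then have "fil 2 \<subseteq> ?J" unfolding chart.fil_def rep.sumset_def by blast
  then show "\<phi> ` fil 2 \<subseteq> \<phi> ` fil 1 \<cdot>\<^bsub>A\<^esub> (\<phi> ` fil 1)" by blast
qed

text \<open>Primes of \<open>char_ring\<close> correspond to primes of \<open>traces r\<close> that
  contain \<open>K\<close>, so both bounds of the chart carry over.\<close>

lemma local_dimension_trivial_char: "local_dimension A (trivial_char G gs) = enat 3"
proof -
  let ?C = "\<lambda>n P. (\<forall>i\<le>n. primeideal (P i) A \<and> P i \<subseteq> trivial_char G gs) \<and> (\<forall>i<n. P i \<subset> P (Suc i))"
  have "\<exists>P. ?C 3 P"
  proof -
    obtain P where P: "\<And>i. i \<le> 3 \<Longrightarrow> prime_of (traces r) (P i)" "\<And>i. i \<le> 3 \<Longrightarrow> K \<subseteq> P i"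
      "\<And>i. i \<le> 3 \<Longrightarrow> P i \<subseteq> fil 1" "\<And>i. i < (3::nat) \<Longrightarrow> P i \<subset> P (Suc i)"
      using chart.prime_chain unfolding alg_trace_coords by metis
    have pre: "{p \<in> traces r. \<phi> p \<in> \<phi> ` P i} = P i" if "i \<le> 3" for i
      using prime_ofD(1)[OF P(1)[OF that]] P(2)[OF that] by (rule preimage_image)
    have m1: "primeideal (\<phi> ` P i) A" if "i \<le> 3" for i
      using char.primeideal_iff[of "\<phi> ` P i"] pre[OF that] P(1)[OF that] ideal_ofD(1)[OF prime_ofD(1)[OF P(1)[OF that]]]
      by (auto simp: carrier_char_ring)
    have m2: "\<phi> ` P i \<subset> \<phi> ` P (Suc i)" if "i < 3" for i
    proof
      show "\<phi> ` P i \<subseteq> \<phi> ` P (Suc i)" using P(4)[OF that] by (intro image_mono) auto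
      show "\<phi> ` P i \<noteq> \<phi> ` P (Suc i)"
      proof
        assume "\<phi> ` P i = \<phi> ` P (Suc i)"
        then have "{p \<in> traces r. \<phi> p \<in> \<phi> ` P i} = {p \<in> traces r. \<phi> p \<in> \<phi> ` P (Suc i)}" by (rule arg_cong)
        then have "P i = P (Suc i)" unfolding pre[OF less_imp_le[OF that]] pre[OF Suc_leI[OF that]] .
        then show False using P(4)[OF that] by blast
      qed
    qed
    have m3: "\<phi> ` P i \<subseteq> trivial_char G gs" if "i \<le> 3" for i
      unfolding trivial_char_eq using P(3)[OF that] by (rule image_mono)
    show ?thesis by (intro exI[of _ "\<lambda>i. \<phi> ` P i"] conjI allI impI m1 m2 m3)
  qed
  moreover have "n \<le> 3" if "?C n Q" for n Q
  proof -
    define P where "P i = {p \<in> traces r. \<phi> p \<in> Q i}" for i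
    have Q: "primeideal (Q i) A" "ideal (Q i) A" "Q i \<subseteq> \<phi> ` fil 1" if "i \<le> n" for i
      using \<open>?C n Q\<close> that by (auto simp: trivial_char_eq primeideal_def)
    have QP: "Q i = \<phi> ` P i" if "i \<le> n" for i
      unfolding P_def using preimage_ideal(2)[OF Q(2)[OF that]] .
    have "Q i \<subseteq> carrier A" if "i \<le> n" for i using ideal.Icarr[OF Q(2)[OF that]] by auto
    then have "prime_of (traces r) (P i)" if "i \<le> n" for i
      unfolding P_def using char.primeideal_iff[of "Q i"] Q(1)[OF that] that by auto
    moreover have "K \<subseteq> P i" if "i \<le> n" for i unfolding P_def by (rule K_preimage[OF Q(2)[OF that]])
    moreover have "P i \<subseteq> fil 1" if "i \<le> n" for i
      using Q(3)[OF that] preimage_image[OF fil_traces[of 1] K_fil] by (auto simp: P_def)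
    moreover have "P i \<subset> P (Suc i)" if "i < n" for i
    proof -
      have "Q i \<subset> Q (Suc i)" using \<open>?C n Q\<close> that by blast
      moreover from this have "P i \<subseteq> P (Suc i)" by (auto simp: P_def)
      ultimately show ?thesis using QP[of i] QP[of "Suc i"] that by auto
    qed
    ultimately show "n \<le> 3" by (intro chart.prime_chain_bound[of n P]) (simp_all add: alg_trace_coords)
  qed
  ultimately show ?thesis unfolding local_dimension_def
    by (intro antisym Sup_least Sup_upper) auto
qed

text \<open>The three linear Taylor coefficients are dual to the trace coordinates of
  \<open>wa\<close>, \<open>wb\<close> and \<open>wa @ wb\<close>.\<close>

lemma zariski_dimension: "has_dimension (zariski_tangent_space G gs (trivial_char G gs)) 3"
proof -
  let ?sc = "\<lambda>c p. poly_const c * p" and ?V = "ideal_space G gs (\<phi> ` fil 1)"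
  note F = ideal_ofD[OF fil_traces] rep.ideal_of_minus[OF subalg_traces fil_traces]
  interpret V: space_presentation ?sc "fil 1" \<phi> ?V
    by unfold_locales (use F tracesD(1) in \<open>auto simp: ideal_space_def char.hom_add char.hom_mult char.hom_0
        rep.scalar_add rep.scalar_mult poly_const_def[of 1] distrib_left distrib_right mult.assoc\<close>)
  have sub: "fil 2 \<subseteq> fil 1" by (rule chart.fil_antimono) simp
  have N: "0 \<in> fil 2" "\<And>x y. x \<in> fil 2 \<Longrightarrow> y \<in> fil 2 \<Longrightarrow> x + y \<in> fil 2" "\<And>a x. x \<in> fil 2 \<Longrightarrow> ?sc a x \<in> fil 2"
    using F(2,3) F(4)[OF tracesD(1)] by auto
  have ker: "x - y \<in> fil 2" if "x \<in> fil 1" "y \<in> fil 1" "\<phi> x = \<phi> y" for x y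
    using that F(1) rep_fun_eq_K[of x y] K_fil[of 2] by auto
  define q where "q x = \<phi> ` fil 2 +>\<^bsub>?V\<^esub> \<phi> x" for x
  define U where "U = quot_space ?V (\<phi> ` fil 2)"
  interpret U: space_presentation ?sc "fil 1" q U
    unfolding q_def[abs_def] U_def by (rule V.quot_space_presentation(1)[OF sub N ker])
  have qeq: "q x = q y \<longleftrightarrow> x - y \<in> fil 2" if "x \<in> fil 1" "y \<in> fil 1" for x y
    unfolding q_def by (rule V.quot_space_presentation(2)[OF sub N ker that])
  define t where "t n = (if n = 0 then trace_coord wa else if n = 1 then trace_coord wb else trace_coord (wa @ wb))" for n :: nat
  define e where "e n x = (if n = 0 then chart.taylor x $$$ 1 $$$ 0 $$$ 0 else if n = 1 then chart.taylor x $$$ 0 $$$ 1 $$$ 0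
     else chart.taylor x $$$ 0 $$$ 0 $$$ 1)" for n :: nat and x
  have n3: "n = 0 \<or> n = 1 \<or> n = 2" if "n < 3" for n :: nat using that by arith
  have tf: "t n \<in> fil 1" for n using chart.t_fil by (simp add: t_def)
  have R: "x \<in> rep.alg Y" if "x \<in> fil k" for x k using that by (rule chart.filD(1))
  have e_add: "e n (x + y) = e n x + e n y" if "x \<in> fil 1" "y \<in> fil 1" for n x y
    using R[OF that(1)] R[OF that(2)] by (simp add: e_def chart.taylor_add)
  have e_sc: "e n (?sc c x) = c * e n x" if "x \<in> fil 1" for n x c
    using R[OF that] chart.RD(1)[of c] by (simp add: e_def chart.taylor_mult chart.taylor_const)
  have e_diff: "e n (x - y) = e n x - e n y" if "x \<in> fil 1" "y \<in> fil 1" for n x y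
    using e_add[OF that(1), of "?sc (-1) y" n] e_sc[OF that(2), of n "-1"] F(4)[OF tracesD(1) that(2), of "-1"]
    by (simp add: rep.scalar_minus poly_const_def[of 1])
  have e_t: "e m (t n) = (if m = n then 1 else 0)" if "m < 3" "n < 3" for m n
    using n3[OF that(1)] n3[OF that(2)] by (auto simp: e_def t_def chart.taylor_t)
  \<comment> \<open>Elements of \<open>fil 1\<close> have no constant term, so order two means that
    the three linear coefficients vanish.\<close>
  have e_fil: "x \<in> fil 2 \<longleftrightarrow> (\<forall>n<3. e n x = 0)" if "x \<in> fil 1" for x
  proof -
    have "(\<forall>i j l. i + j + l < 2 \<longrightarrow> chart.taylor x $$$ i $$$ j $$$ l = 0) \<longleftrightarrow>
      (\<forall>i j l. i + j + l < 1 \<longrightarrow> chart.taylor x $$$ i $$$ j $$$ l = 0) \<and> (\<forall>n<3. e n x = 0)" (is "?l \<longleftrightarrow> ?z \<and> ?r")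
    proof
      assume l: ?l
      then have ?z by auto
      moreover have ?r using l by (auto simp: e_def)
      ultimately show "?z \<and> ?r" ..
    next
      assume zr: "?z \<and> ?r"
      show ?l
      proof (intro allI impI)
        fix i j l :: nat assume "i + j + l < 2"
        then consider "i + j + l < 1" | "i = 1" "j = 0" "l = 0" | "i = 0" "j = 1" "l = 0" | "i = 0" "j = 0" "l = 1" by linarith
        then show "chart.taylor x $$$ i $$$ j $$$ l = 0"
        proof cases
          case 1 then show ?thesis using zr by blast
        next
          case 2 then show ?thesis using conjunct2[OF zr, rule_format, of 0] by (simp add: e_def)
        next
          case 3 then show ?thesis using conjunct2[OF zr, rule_format, of 1] by (simp add: e_def)
        next
          case 4 then show ?thesis using conjunct2[OF zr, rule_format, of 2] by (simp add: e_def)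
        qed
      qed
    qed
    then show ?thesis using that R[OF that] by (simp only: chart.fil_iff) blast
  qed
  \<comment> \<open>The value \<open>0\<close> outside the carrier is the normalisation of
    \<open>dual_space\<close>.\<close>
  define d where "d n X = (if X \<in> carrier U then e n (SOME x. x \<in> fil 1 \<and> q x = X) else 0)" for n X
  have d: "d n (q x) = e n x" if "n < 3" "x \<in> fil 1" for n x
  proof -
    define y where "y = (SOME y. y \<in> fil 1 \<and> q y = q x)"
    have y: "y \<in> fil 1" "q y = q x" using someI[of "\<lambda>y. y \<in> fil 1 \<and> q y = q x" x] that by (auto simp: y_def)
    have "y - x \<in> fil 2" using y that qeq by blast
    then have "e n (y - x) = 0" using that y e_fil[OF F(7)] by blast
    then show ?thesis using that y by (simp add: d_def U.space_carrier e_diff del: One_nat_def flip: y_def)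
  qed
  have qt: "q (t n) \<in> carrier U" for n using tf by (auto simp: U.space_carrier)
  have "has_dimension (dual_space U) 3"
  proof (rule has_dimension_dual_spaceI[where d = d and v = "\<lambda>n. q (t n)"])
    fix n :: nat assume n: "n < 3"
    have "d n (x \<oplus>\<^bsub>U\<^esub> y) = d n x + d n y" if "x \<in> carrier U" "y \<in> carrier U" for x y
      using that n U.M(2) by (auto simp: U.space_carrier U.space_add d e_add simp del: One_nat_def)
    moreover have "d n (c \<odot>\<^bsub>U\<^esub> x) = c * d n x" if "x \<in> carrier U" for x c
      using that n U.M(3) by (auto simp: U.space_carrier U.space_smult d e_sc simp del: One_nat_def)
    ultimately show "d n \<in> carrier (dual_space U)" by (simp add: dual_space_def d_def)
    show "q (t n) \<in> carrier U" by (rule qt)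
    show "d n (q (t m)) = (if n = m then 1 else 0)" if "m < 3" for m using n that tf by (simp add: d e_t)
  next
    fix h X assume h: "h \<in> carrier (dual_space U)" and X: "X \<in> carrier U"
    then obtain x where x: "x \<in> fil 1" "X = q x" by (auto simp: U.space_carrier)
    define y where "y = ?sc (e 0 x) (t 0) + (?sc (e 1 x) (t 1) + ?sc (e 2 x) (t 2))"
    have sct: "?sc c (t n) \<in> fil 1" for c n using tf by (rule U.M(3))
    have y: "y \<in> fil 1" unfolding y_def by (intro U.M(2) sct)
    have "e n (x - y) = 0" if "n < 3" for n
      using n3[OF that] x(1) y unfolding e_diff[OF x(1) y]
      by (auto simp: y_def e_add e_sc sct tf U.M(2) e_t simp del: One_nat_def)
    then have "q x = q y" using qeq[OF x(1) y] e_fil[OF F(7)[OF x(1) y]] by blast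
    moreover have hadd: "h (q (a + b)) = h (q a) + h (q b)" if "a \<in> fil 1" "b \<in> fil 1" for a b
      using h that by (auto simp: dual_space_def U.space_carrier simp flip: U.space_add)
    moreover have hsc: "h (q (?sc c a)) = c * h (q a)" if "a \<in> fil 1" for a c
      using h that by (auto simp: dual_space_def U.space_carrier simp flip: U.space_smult)
    ultimately have "h X = e 0 x * h (q (t 0)) + (e 1 x * h (q (t 1)) + e 2 x * h (q (t 2)))"
      unfolding x(2) y_def by (simp add: hadd hsc sct tf U.M(2) del: One_nat_def)
    then show "h X = (\<Sum>n<3. h (q (t n)) * d n X)"
      using x by (simp add: d eval_nat_numeral algebra_simps)
  qed
  then show ?thesis
    unfolding zariski_tangent_space_def trivial_char_eq square_trivial_char U_def .
qed

end

theorem proposition3p10: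
  fixes G :: "('g, 'b) monoid_scheme" and gs :: "'g list"
  assumes "group G"
    and "set gs \<subseteq> carrier G" and "generate G (set gs) = carrier G"
    and "has_dimension (group_H1 G) 2"
    and "carrier (group_H2 G) = {\<zero>\<^bsub>group_H2 G\<^esub>}
       \<or> has_finite_presentation_of_deficiency_2 G
       \<or> (\<exists>f. f \<in> epi G (free_group {..<2::nat}))"
  shows "char_scheme_smooth_at G gs (trivial_char G gs)"
proof -
  interpret G: group G by fact
  interpret G: group_H1_dim_2 G by unfold_locales fact
  interpret G: generated_group G gs by unfold_locales fact+
  obtain a b \<alpha> \<beta> where basis: "G.hom_basis a b \<alpha> \<beta>" using G.hom_basis_exists by blast
  \<comment> \<open>The first two conditions pass through \<open>H2_trivial\<close>, the third gives
    deformations directly.\<close>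
  have "deformable G \<alpha> \<beta>"
    using assms(5) G.H2_trivialI G.deficiency_2_imp_H2_trivial G.deformable_if_H2_trivial[of \<alpha> \<beta>]
      G.deformable_if_onto_free[OF basis] basis unfolding G.hom_basis_def by metis
  moreover obtain wa wb where "wa \<in> words_over {..<length gs}" "word_value G gs wa = a"
    "wb \<in> words_over {..<length gs}" "word_value G gs wb = b"
    using basis G.word_exists unfolding G.hom_basis_def by metis
  ultimately interpret G: deformable_group G gs a b \<alpha> \<beta> wa wb
    by unfold_locales (use basis in auto)
  show ?thesis unfolding char_scheme_smooth_at_def
    using G.zariski_dimension G.local_dimension_trivial_char by blast
qed

end
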